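(* Let $\mathfrak{o}$ be a compact discrete valuation ring of characteristic $0$, with residue field of cardinality $q$ and characteristic $p$. Then for all $m\in\mathbb{N}$ which are permissible for the Lie lattice $\mathfrak{sl}_2(\mathfrak{o})$, the representation zeta function of the principal congruence subgroup $\mathrm{SL}_2^m(\mathfrak{o})$ is $$\zeta_{\mathrm{SL}_2^m(\mathfrak{o})}(s)=\begin{cases} q^{3m}\,\dfrac{1-q^{-2-s}}{1-q^{1-s}} & \text{if } p>2,\\[2mm] q^{3m}\,\dfrac{q^2-q^{-s}}{1-q^{1-s}} & \text{if } p=2 \text{ and } e(\mathfrak{o},\mathbb{Z}_2)=1.\end{cases}$$
   Context: Let $\mathfrak{p}$ be the maximal ideal of $\mathfrak{o}$. $e(\mathfrak{o},\mathbb{Z}_p)$ is the absolute ramification index of $\mathfrak{o}$. $\mathrm{SL}_2^m(\mathfrak{o})$ is the kernel of the reduction map $\mathrm{SL}_2(\mathfrak{o})\to\mathrm{SL}_2(\mathfrak{o}/\mathfrak{p}^m)$. For a profinite group $G$, $r_n(G)$ is the number of isomorphism classes of $n$-dimensional irreducible continuous complex representations, and $\zeta_G(s)=\sum_{n\ge1}r_n(G)n^{-s}$ for a complex variable $s$ (the identity holds where the series converges). An $\mathfrak{o}$-Lie lattice is a free $\mathfrak{o}$-module of finite rank with an $\mathfrak{o}$-bilinear Lie bracket. With $\gamma_1(\mathfrak{h})=\mathfrak{h}$, $\gamma_{i+1}(\mathfrak{h})=[\gamma_i(\mathfrak{h}),\mathfrak{h}]$, an $\mathfrak{o}$-Lie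 lattice $\mathfrak{h}$ is potent if $\gamma_{p-1}(\mathfrak{h})\subseteq p\mathfrak{h}$ when $p>2$, and $\gamma_2(\mathfrak{h})\subseteq4\mathfrak{h}$ when $p=2$. It is saturable if, as a $\mathbb{Z}_p$-Lie lattice, it admits a potent filtration, i.e. a descending chain of Lie ideals $\mathfrak{h}=\mathfrak{h}_1\supseteq\mathfrak{h}_2\supseteq\cdots$ with $\bigcap_i\mathfrak{h}_i=0$, $[\mathfrak{h}_i,\mathfrak{h}]\subseteq\mathfrak{h}_{i+1}$ and $[\mathfrak{h}_i,\underbrace{\mathfrak{h},\ldots,\mathfrak{h}}_{p-1}]\subseteq p\,\mathfrak{h}_{i+1}$ for all $i$ (left-normed brackets). A non-negative integer $m$ is permissible for $\mathfrak{g}$ if $\mathfrak{p}^m\mathfrak{g}$ is potent and saturable. *)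

theory Defs
  imports
    "HOL-Analysis.Analysis"
    "HOL-Algebra.Ring_Divisibility"
    "HOL-Algebra.Ideal_Product"
    "HOL-Algebra.QuotRing"
    "Jordan_Normal_Form.VS_Connect"
begin

no_notation Matrix.vec_index (infixl \<open>$\<close> 100)

section \<open>Compact discrete valuation rings\<close>

text \<open>
  The ring is a type \<open>'o\<close> (characteristic \<open>0\<close> is imposed by its type class in the
  theorem).  The record \<open>class_ring\<close> views the type as a ring of HOL-Algebra.
\<close>

definition max_ideal :: "'o::comm_ring_1 set" where
  "max_ideal = (THE M. maximalideal M (class_ring :: 'o ring))"

primrec max_ideal_pow :: "nat \<Rightarrow> 'o::comm_ring_1 set" where
  "max_ideal_pow 0 = UNIV"
| "max_ideal_pow (Suc k) = ideal_prod (class_ring :: 'o ring) (max_ideal_pow k) max_ideal"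

definition discrete_valuation_ring :: "'o::comm_ring_1 itself \<Rightarrow> bool" where
  "discrete_valuation_ring _ \<longleftrightarrow>
     principal_domain (class_ring :: 'o ring) \<and>
     (\<exists>!M. maximalideal M (class_ring :: 'o ring)) \<and>
     \<not> field (class_ring :: 'o ring)"

text \<open>
  The type carries a topology; the second conjunct says that it is the valuation topology, so that
  continuity on matrices over \<open>'o\<close> refers to the usual profinite topology.
\<close>

definition compact_dvr :: "'o::{comm_ring_1, topological_space} itself \<Rightarrow> bool" where
  "compact_dvr T \<longleftrightarrow>
     discrete_valuation_ring T \<and>
     (\<forall>U :: 'o set. open U \<longleftrightarrow> (\<forall>x\<in>U. \<exists>k. \<forall>y. y - x \<in> max_ideal_pow k \<longrightarrow> y \<in> U)) \<and>
     compact (UNIV :: 'o set)"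

definition residue_field :: "'o::comm_ring_1 itself \<Rightarrow> 'o set ring" where
  "residue_field _ = (class_ring :: 'o ring) Quot max_ideal"

definition residue_card :: "'o::comm_ring_1 itself \<Rightarrow> nat" where
  "residue_card T = card (carrier (residue_field T))"

definition residue_char :: "'o::comm_ring_1 itself \<Rightarrow> nat" where
  "residue_char T =
     (LEAST k::nat. 0 < k \<and>
        add_pow (residue_field T) k (\<one>\<^bsub>residue_field T\<^esub>) = \<zero>\<^bsub>residue_field T\<^esub>)"

definition abs_ramification_index :: "'o::comm_ring_1 itself \<Rightarrow> nat" where
  "abs_ramification_index T =
     (THE e. cgenideal (class_ring :: 'o ring) (of_nat (residue_char T)) = max_ideal_pow e)"

text \<open>The canonical copy of the \<open>p\<close>-adic integers inside \<open>'o\<close>.\<close>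

definition padic_subring :: "'o::{comm_ring_1, topological_space} set" where
  "padic_subring = closure (range of_int)"


section \<open>Lie lattices\<close>

text \<open>
  Lie lattices are subsets \<open>L\<close> of an ambient additive group with scalar multiplication \<open>sc\<close> and
  bracket \<open>br\<close>.  The parameter \<open>R\<close> is the set of scalars over which submodules and spans are formed:
  \<open>UNIV\<close> for Lie lattices over \<open>'o\<close>, and \<open>padic_subring\<close> after restriction of scalars.
\<close>

definition submodule_over :: "'r set \<Rightarrow> ('r \<Rightarrow> 'v \<Rightarrow> 'v) \<Rightarrow> 'v::ab_group_add set \<Rightarrow> bool" where
  "submodule_over R sc N \<longleftrightarrow>
     0 \<in> N \<and> (\<forall>x\<in>N. \<forall>y\<in>N. x + y \<in> N) \<and> (\<forall>r\<in>R. \<forall>x\<in>N. sc r x \<in> N)"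

definition span_over :: "'r set \<Rightarrow> ('r \<Rightarrow> 'v \<Rightarrow> 'v) \<Rightarrow> 'v::ab_group_add set \<Rightarrow> 'v set" where
  "span_over R sc X = \<Inter> {N. submodule_over R sc N \<and> X \<subseteq> N}"

definition lie_product ::
  "'r set \<Rightarrow> ('r \<Rightarrow> 'v \<Rightarrow> 'v) \<Rightarrow> ('v \<Rightarrow> 'v \<Rightarrow> 'v) \<Rightarrow> 'v::ab_group_add set \<Rightarrow> 'v set \<Rightarrow> 'v set" where
  "lie_product R sc br A B = span_over R sc {br a b |a b. a \<in> A \<and> b \<in> B}"

text \<open>The left-normed product \<open>[A, L, \<dots>, L]\<close> with \<open>k\<close> factors \<open>L\<close>.\<close>

definition lie_product_iter ::
  "'r set \<Rightarrow> ('r \<Rightarrow> 'v \<Rightarrow> 'v) \<Rightarrow> ('v \<Rightarrow> 'v \<Rightarrow> 'v) \<Rightarrow> 'v::ab_group_add set \<Rightarrow> 'v set \<Rightarrow> nat \<Rightarrow> 'v set" where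
  "lie_product_iter R sc br A L k = ((\<lambda>X. lie_product R sc br X L) ^^ k) A"

text \<open>Indexed from \<open>1\<close>, so that \<open>lower_central R sc br L 1 = L\<close>.\<close>

definition lower_central ::
  "'r set \<Rightarrow> ('r \<Rightarrow> 'v \<Rightarrow> 'v) \<Rightarrow> ('v \<Rightarrow> 'v \<Rightarrow> 'v) \<Rightarrow> 'v::ab_group_add set \<Rightarrow> nat \<Rightarrow> 'v set" where
  "lower_central R sc br L i = lie_product_iter R sc br L L (i - 1)"

definition potent ::
  "('o::comm_ring_1 \<Rightarrow> 'v \<Rightarrow> 'v) \<Rightarrow> ('v \<Rightarrow> 'v \<Rightarrow> 'v) \<Rightarrow> 'v::ab_group_add set \<Rightarrow> bool" where
  "potent sc br L \<longleftrightarrow>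
     (let p = residue_char TYPE('o) in
       (p > 2 \<longrightarrow> lower_central UNIV sc br L (p - 1) \<subseteq> sc (of_nat p) ` L) \<and>
       (p = 2 \<longrightarrow> lower_central UNIV sc br L 2 \<subseteq> sc 4 ` L))"

definition lie_ideal ::
  "'r set \<Rightarrow> ('r \<Rightarrow> 'v \<Rightarrow> 'v) \<Rightarrow> ('v \<Rightarrow> 'v \<Rightarrow> 'v) \<Rightarrow> 'v::ab_group_add set \<Rightarrow> 'v set \<Rightarrow> bool" where
  "lie_ideal R sc br L I \<longleftrightarrow>
     submodule_over R sc I \<and> I \<subseteq> L \<and> (\<forall>x\<in>I. \<forall>y\<in>L. br x y \<in> I)"

text \<open>\<open>F i\<close> is the \<open>(i+1)\<close>-st term of the filtration.\<close>

definition potent_filtration ::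
  "('o::{comm_ring_1, topological_space} \<Rightarrow> 'v \<Rightarrow> 'v) \<Rightarrow> ('v \<Rightarrow> 'v \<Rightarrow> 'v) \<Rightarrow>
     'v::ab_group_add set \<Rightarrow> (nat \<Rightarrow> 'v set) \<Rightarrow> bool" where
  "potent_filtration sc br L F \<longleftrightarrow>
     (let p = residue_char TYPE('o); Z = padic_subring in
       F 0 = L \<and>
       (\<forall>i. lie_ideal Z sc br L (F i)) \<and>
       (\<forall>i. F (Suc i) \<subseteq> F i) \<and>
       (\<Inter>i. F i) = {0} \<and>
       (\<forall>i. lie_product Z sc br (F i) L \<subseteq> F (Suc i)) \<and>
       (\<forall>i. lie_product_iter Z sc br (F i) L (p - 1) \<subseteq> sc (of_nat p) ` F (Suc i)))"

definition saturable ::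
  "('o::{comm_ring_1, topological_space} \<Rightarrow> 'v \<Rightarrow> 'v) \<Rightarrow> ('v \<Rightarrow> 'v \<Rightarrow> 'v) \<Rightarrow>
     'v::ab_group_add set \<Rightarrow> bool" where
  "saturable sc br L \<longleftrightarrow> (\<exists>F. potent_filtration sc br L F)"

text \<open>The multiple of \<open>L\<close> by the \<open>m\<close>-th power of the maximal ideal.\<close>

definition congruence_sublattice ::
  "('o::comm_ring_1 \<Rightarrow> 'v \<Rightarrow> 'v) \<Rightarrow> nat \<Rightarrow> 'v::ab_group_add set \<Rightarrow> 'v set" where
  "congruence_sublattice sc m L = span_over UNIV sc {sc a x |a x. a \<in> max_ideal_pow m \<and> x \<in> L}"

definition permissible ::
  "('o::{comm_ring_1, topological_space} \<Rightarrow> 'v \<Rightarrow> 'v) \<Rightarrow> ('v \<Rightarrow> 'v \<Rightarrow> 'v) \<Rightarrow>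
     'v::ab_group_add set \<Rightarrow> nat \<Rightarrow> bool" where
  "permissible sc br L m \<longleftrightarrow>
     potent sc br (congruence_sublattice sc m L) \<and> saturable sc br (congruence_sublattice sc m L)"

text \<open>
  \<open>*s\<close> of HOL-Analysis scales vectors by their entry type, and so does not apply to matrices.
\<close>

definition mat_scale :: "'o::comm_ring_1 \<Rightarrow> 'o^'n^'n \<Rightarrow> 'o^'n^'n" where
  "mat_scale c A = (\<chi> i j. c * A $ i $ j)"

definition mat_bracket :: "'o::comm_ring_1^'n^'n \<Rightarrow> 'o^'n^'n \<Rightarrow> 'o^'n^'n" where
  "mat_bracket A B = A ** B - B ** A"

definition sl2 :: "('o::comm_ring_1^2^2) set" where
  "sl2 = {A. trace A = 0}"

text \<open>The kernel of reduction modulo the \<open>m\<close>-th power of the maximal ideal.\<close>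

definition SL2_congruence :: "nat \<Rightarrow> ('o::comm_ring_1^2^2) monoid" where
  "SL2_congruence m =
     \<lparr>carrier = {A. Determinants.det A = 1 \<and>
                   (\<forall>i j. A $ i $ j - Finite_Cartesian_Product.mat 1 $ i $ j \<in> max_ideal_pow m)},
      monoid.mult = (**),
      one = Finite_Cartesian_Product.mat 1\<rparr>"


section \<open>Representation zeta functions\<close>

text \<open>
  A topological group is given by a group record whose carrier has the subspace topology of its
  type.  A representation of dimension \<open>n\<close> is a homomorphism into the group of invertible complex
  \<open>n\<close>-by-\<open>n\<close> matrices.  Only its values on the carrier matter: two functions that agree there are
  isomorphic in the sense below.
\<close>

definition continuous_reps :: "('g::topological_space, 'x) monoid_scheme \<Rightarrow> nat \<Rightarrow> ('g \<Rightarrow> complex mat) set" where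
  "continuous_reps G n =
     {\<rho> \<in> hom G (units_of (ring_mat TYPE(complex) n ())).
        \<forall>i<n. \<forall>j<n. continuous_on (carrier G) (\<lambda>g. \<rho> g $$ (i, j))}"

definition irreducible_rep :: "('g, 'x) monoid_scheme \<Rightarrow> nat \<Rightarrow> ('g \<Rightarrow> complex mat) \<Rightarrow> bool" where
  "irreducible_rep G n \<rho> \<longleftrightarrow>
     0 < n \<and>
     (\<forall>W. VectorSpace.subspace class_ring W (module_vec TYPE(complex) n) \<longrightarrow>
          (\<forall>g\<in>carrier G. \<forall>w\<in>W. \<rho> g *\<^sub>v w \<in> W) \<longrightarrow>
          W = {0\<^sub>v n} \<or> W = carrier_vec n)"

definition irr_reps :: "('g::topological_space, 'x) monoid_scheme \<Rightarrow> nat \<Rightarrow> ('g \<Rightarrow> complex mat) set" where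
  "irr_reps G n = {\<rho> \<in> continuous_reps G n. irreducible_rep G n \<rho>}"

definition rep_iso ::
  "('g, 'x) monoid_scheme \<Rightarrow> nat \<Rightarrow> ('g \<Rightarrow> complex mat) \<Rightarrow> ('g \<Rightarrow> complex mat) \<Rightarrow> bool" where
  "rep_iso G n \<rho> \<sigma> \<longleftrightarrow>
     (\<exists>P\<in>carrier_mat n n. invertible_mat P \<and> (\<forall>g\<in>carrier G. P * \<rho> g = \<sigma> g * P))"

definition irr_classes ::
  "('g::topological_space, 'x) monoid_scheme \<Rightarrow> nat \<Rightarrow> ('g \<Rightarrow> complex mat) set set" where
  "irr_classes G n =
     irr_reps G n // {(\<rho>, \<sigma>). \<rho> \<in> irr_reps G n \<and> \<sigma> \<in> irr_reps G n \<and> rep_iso G n \<rho> \<sigma>}"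

definition rep_count :: "('g::topological_space, 'x) monoid_scheme \<Rightarrow> nat \<Rightarrow> nat" where
  "rep_count G n = card (irr_classes G n)"

text \<open>Term \<open>k\<close> of the Dirichlet series is the one of dimension \<open>n = k + 1\<close>.\<close>

definition rep_zeta_term :: "('g::topological_space, 'x) monoid_scheme \<Rightarrow> complex \<Rightarrow> nat \<Rightarrow> complex" where
  "rep_zeta_term G s k = of_nat (rep_count G (Suc k)) * of_nat (Suc k) powr (- s)"

definition rep_zeta :: "('g::topological_space, 'x) monoid_scheme \<Rightarrow> complex \<Rightarrow> complex" where
  "rep_zeta G s = (\<Sum>k. rep_zeta_term G s k)"

text \<open>
  The function \<open>f\<close> gives the representation zeta function of \<open>G\<close> wherever its series converges.  The
  first two conjuncts make this meaningful: \<open>rep_count\<close> is a genuine cardinality (\<open>card\<close> of an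
  infinite set would be \<open>0\<close>), and the series converges on some right half-plane.
\<close>

definition has_rep_zeta :: "('g::topological_space, 'x) monoid_scheme \<Rightarrow> (complex \<Rightarrow> complex) \<Rightarrow> bool" where
  "has_rep_zeta G f \<longleftrightarrow>
     (\<forall>n\<ge>1. finite (irr_classes G n)) \<and>
     (\<exists>\<sigma>::real. \<forall>s. Re s > \<sigma> \<longrightarrow> summable (rep_zeta_term G s)) \<and>
     (\<forall>s. summable (rep_zeta_term G s) \<longrightarrow> rep_zeta G s = f s)"

end

theory Submission
  imports
    Defs
    "Jordan_Normal_Form.Char_Poly"
    "HOL-Computational_Algebra.Fundamental_Theorem_Algebra"
begin

text \<open>
  Let \<open>\<pi>\<close> be a uniformizer, write \<open>2 = \<epsilon> \<pi>\<^sup>v\<close> with a unit \<open>\<epsilon>\<close>, and let \<open>Ker N\<close> be the group of those elements of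
  the congruence subgroup of level \<open>m\<close> that are scalar modulo \<open>\<pi>\<^sup>N\<close>.  Permissibility of \<open>m\<close> is needed only in the
  form \<open>v < m\<close>.  A continuous irreducible representation is trivial on some \<open>Ker N\<close>, as the general linear
  group has no small subgroups.  If it is trivial on \<open>Ker (2m + v)\<close>, its image is abelian and it has dimension \<open>1\<close>.
  If it is trivial on \<open>Ker N\<close> but not on \<open>Ker (N - 1)\<close>, where \<open>N = 2m + v + k\<close> and \<open>k > 0\<close>, it has dimension \<open>q\<^sup>k\<close>.
  Indeed, there are \<open>q\<close> to the power \<open>2k\<close> group elements whose quotients, acted on by conjugation with suitably deep
  elements, become scalar multiples of themselves with a factor other than \<open>1\<close>; their images are linearly independent, which
  bounds the dimension from below.  From above, \<open>Ker \<lceil>N/2\<rceil>\<close> has abelian image and therefore an eigenvector, whose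
  character is given by pairing with a fixed matrix; the dimension is bounded by the indices of the
  centralizers of this matrix modulo two powers of \<open>\<pi>\<close> that multiply roughly to \<open>\<pi>\<^sup>N\<close>.  The squares of the dimensions
  of the representations trivial on \<open>Ker N\<close> add up to the index of \<open>Ker N\<close>, which is \<open>q\<close> to the power
  \<open>3(N - m) - v\<close>.  This determines the number of representations of each dimension, and the zeta function is
  a geometric series.
\<close>

text \<open>A commutator depends only on the classes of its arguments modulo scalars, which is why
  the filtration \<open>Ker\<close> is taken modulo scalars. In the coordinates of a matrix modulo
  scalars (the diagonal difference and the two off-diagonal entries) the bracket of trace-zero
  matrices carries a factor 2; this is the origin of the shift by \<open>v\<close> in
  \<open>2 * m + v\<close>. The determinant condition makes the diagonal coordinate of the quotient
  by \<open>Ker N\<close> run \<open>v\<close> digits shorter than the others, whence the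
  \<open>- v\<close> in the index. Numbers of representations are obtained by subtracting the sums
  of squares at consecutive levels, so these sums are needed as equations: the matrix coefficients
  must be shown to be complete as well as orthogonal. Both dimension bounds concern the square of
  the dimension, that is, a number of matrix entries; the upper one rests on Burnside's theorem that
  the operators of an irreducible representation span all matrices. The ramification condition
  enters the upper bound, where the matrix of a character may have to be divided by
  \<open>\<pi> ^ v\<close> before its centralizers have the right index.\<close>

no_notation Matrix.vec_index (infixl \<open>$\<close> 100)
notation Matrix.vec_index (infixl \<open>$v\<close> 100)

text \<open>Gaussian elimination: an equation with a nonzero coefficient at \<open>i0\<close>
  expresses the unknown \<open>i0\<close> by the others, and \<open>?a\<close> holds the
  coefficients after substitution. The index sets are arbitrary because matrix entries, group
  elements and cosets all occur as indices; this is the dimension argument used throughout.\<close>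

lemma underdetermined:
  fixes a :: "'i \<Rightarrow> 'j \<Rightarrow> 'f::field"
  assumes "finite J" "finite I" "card J < card I"
  shows "\<exists>c. (\<exists>i\<in>I. c i \<noteq> 0) \<and> (\<forall>j\<in>J. (\<Sum>i\<in>I. c i * a i j) = 0)"
  using assms
proof (induction J arbitrary: I a rule: finite_induct)
  case empty
  then have "I \<noteq> {}" by auto
  then show ?case by (intro exI[of _ "\<lambda>_. 1"]) auto
next
  case (insert j0 J)
  show ?case
  proof (cases "\<forall>i\<in>I. a i j0 = 0")
    case True
    from insert have "card J < card I" by simp
    from insert.IH[OF insert.prems(1) this, of a] obtain c where
      "\<exists>i\<in>I. c i \<noteq> 0" "\<forall>j\<in>J. (\<Sum>i\<in>I. c i * a i j) = 0" by blast
    with True show ?thesis by (intro exI[of _ c]) auto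
  next
    case False
    then obtain i0 where i0: "i0 \<in> I" "a i0 j0 \<noteq> 0" by blast
    let ?I = "I - {i0}" and ?a = "\<lambda>i j. a i j - a i j0 / a i0 j0 * a i0 j"
    have "card J < card ?I" using insert i0 by simp
    from insert.IH[OF _ this, of ?a] insert.prems obtain c where
      c: "\<exists>i\<in>?I. c i \<noteq> 0" "\<And>j. j \<in> J \<Longrightarrow> (\<Sum>i\<in>?I. c i * ?a i j) = 0" by auto
    define d where "d i = (if i = i0 then - (\<Sum>i\<in>?I. c i * a i j0) / a i0 j0 else c i)" for i
    have sum: "(\<Sum>i\<in>I. d i * a i j) = (\<Sum>i\<in>?I. c i * ?a i j)" for j
    proof -
      have "(\<Sum>i\<in>I. d i * a i j) = d i0 * a i0 j + (\<Sum>i\<in>?I. d i * a i j)"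
        using i0 insert.prems by (intro sum.remove) auto
      also have "(\<Sum>i\<in>?I. d i * a i j) = (\<Sum>i\<in>?I. c i * a i j)"
        by (intro sum.cong) (auto simp: d_def)
      also have "d i0 * a i0 j = (\<Sum>i\<in>?I. - (c i * (a i j0 / a i0 j0 * a i0 j)))"
        by (simp add: d_def sum_negf sum_divide_distrib sum_distrib_left sum_distrib_right mult_ac)
      finally show ?thesis
        by (simp add: sum.distrib[symmetric] algebra_simps)
    qed
    have "\<exists>i\<in>I. d i \<noteq> 0" using c(1) by (auto simp: d_def)
    moreover have "(\<Sum>i\<in>I. d i * a i j) = 0" if "j \<in> insert j0 J" for j
    proof (cases "j = j0")
      case True
      then show ?thesis unfolding sum using i0 by (simp)
    next
      case False
      then show ?thesis unfolding sum using c(2) that by auto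
    qed
    ultimately show ?thesis by blast
  qed
qed

section \<open>Representations\<close>

definition lin_closed :: "nat \<Rightarrow> complex Matrix.vec set \<Rightarrow> bool" where
  "lin_closed n W \<longleftrightarrow> W \<subseteq> carrier_vec n \<and> 0\<^sub>v n \<in> W \<and> (\<forall>v\<in>W. \<forall>w\<in>W. v + w \<in> W) \<and>
     (\<forall>c. \<forall>v\<in>W. c \<cdot>\<^sub>v v \<in> W)"

lemma lin_closed_iff_subspace:
  "lin_closed n W \<longleftrightarrow> VectorSpace.subspace class_ring W (module_vec TYPE(complex) n)"
proof -
  interpret vs: vec_space "TYPE(complex)" n .
  show ?thesis
    unfolding lin_closed_def VectorSpace.subspace_def submodule_def
    using vs.vectorspace_axioms vs.module_axioms
    by (auto simp: module_vec_simps)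
qed

lemma carrier_mat_mult_unit_vec:
  fixes A :: "complex mat"
  assumes "A \<in> carrier_mat n m" "i < n" "j < m"
  shows "(A *\<^sub>v unit_vec m j) $v i = A $$ (i,j)"
  using assms scalar_prod_right_unit[of j m "Matrix.row A i"] by simp

lemma mat_eq_if_vecs:
  fixes A :: "complex mat"
  assumes "A \<in> carrier_mat n m" "B \<in> carrier_mat n m" "\<And>v. v \<in> carrier_vec m \<Longrightarrow> A *\<^sub>v v = B *\<^sub>v v"
  shows "A = B"
proof (rule eq_matI)
  fix i j assume "i < dim_row B" "j < dim_col B"
  with assms(1,2) have ij: "i < n" "j < m" by auto
  have "(A *\<^sub>v unit_vec m j) $v i = (B *\<^sub>v unit_vec m j) $v i" using assms(3) by simp
  with ij assms(1,2) show "A $$ (i,j) = B $$ (i,j)" by (simp add: carrier_mat_mult_unit_vec[of _ n m])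
qed (use assms in auto)

lemma mult_zero_mat_vec: "v \<in> carrier_vec m \<Longrightarrow> 0\<^sub>m n m *\<^sub>v v = (0\<^sub>v n :: complex Matrix.vec)"
  by (intro eq_vecI) auto

lemma smult_one_mult_mat_vec:
  "v \<in> carrier_vec n \<Longrightarrow> (c \<cdot>\<^sub>m 1\<^sub>m n) *\<^sub>v v = (c \<cdot>\<^sub>v v :: complex Matrix.vec)"
  by (intro eq_vecI) (auto simp: smult_scalar_prod_distrib[of _ n])

lemma vec_minus_eq_zeroD:
  assumes "v - w = 0\<^sub>v n" "v \<in> carrier_vec n" "w \<in> carrier_vec n"
  shows "v = (w :: complex Matrix.vec)"
proof (rule eq_vecI)
  fix i assume "i < dim_vec w"
  moreover from this have "(v - w) $v i = 0" using assms by auto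
  ultimately have "v $v i - w $v i = 0" using assms by (metis carrier_vecD index_minus_vec(1))
  then show "v $v i = w $v i" by simp
qed (use assms in auto)

text \<open>The traces of \<open>A * B\<close> and \<open>B * A\<close> agree, and they are
  \<open>n\<close> and \<open>m\<close>.\<close>

lemma rectangular_two_sided_inverse_dims:
  fixes A B :: "complex mat"
  assumes "A \<in> carrier_mat n m" "B \<in> carrier_mat m n" "A * B = 1\<^sub>m n" "B * A = 1\<^sub>m m"
  shows "n = m"
proof -
  have "(\<Sum>i<n. (A * B) $$ (i,i)) = (\<Sum>i<n. \<Sum>j<m. A $$ (i,j) * B $$ (j,i))"
    using assms(1,2) by (intro sum.cong) (auto simp: scalar_prod_def lessThan_atLeast0)
  also have "\<dots> = (\<Sum>j<m. \<Sum>i<n. B $$ (j,i) * A $$ (i,j))"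
    by (subst sum.swap) (simp add: mult.commute)
  also have "\<dots> = (\<Sum>j<m. (B * A) $$ (j,j))"
    using assms(1,2) by (intro sum.cong) (auto simp: scalar_prod_def lessThan_atLeast0)
  finally have "of_nat n = (of_nat m :: complex)" using assms(3,4) by simp
  then show ?thesis by simp
qed

section \<open>Representations that factor through a finite quotient\<close>

locale fin_quot_group = group G for G (structure) +
  fixes K :: "'a set"
  assumes normal: "K \<lhd> G" and fin_index: "finite (rcosets K)"
begin

abbreviation "N_idx \<equiv> card (rcosets K)"

lemma K_sub: "K \<subseteq> carrier G" using normal normal_imp_subgroup subgroup.subset by blast

definition coset_inv :: "('a \<Rightarrow> 'c) \<Rightarrow> bool" where
  "coset_inv F \<longleftrightarrow> (\<forall>g\<in>carrier G. \<forall>k\<in>K. F (k \<otimes> g) = F g)"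

text \<open>A sum over the quotient, taken at chosen representatives; it does not depend on the
  choice for functions that satisfy \<open>coset_inv\<close>.\<close>

definition csum :: "('a \<Rightarrow> complex) \<Rightarrow> complex" where
  "csum F = (\<Sum>C\<in>rcosets K. F (SOME x. x \<in> C))"

lemma some_coset: "C \<in> rcosets K \<Longrightarrow> (SOME x. x \<in> C) \<in> C \<and> (SOME x. x \<in> C) \<in> carrier G"
proof -
  assume C: "C \<in> rcosets K"
  then obtain g where g: "g \<in> carrier G" "C = K #> g" by (auto simp: RCOSETS_def)
  have "\<one> \<in> K" using normal normal_imp_subgroup subgroup.one_closed by blast
  then have "g \<in> C" using g by (force simp: r_coset_def)
  then have "(SOME x. x \<in> C) \<in> C" by (rule someI)
  then show ?thesis using g K_sub by (auto simp: r_coset_def)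
qed

lemma coset_inv_some:
  assumes "coset_inv F" "g \<in> carrier G"
  shows "F (SOME x. x \<in> K #> g) = F g"
proof -
  have "K #> g \<in> rcosets K" using assms K_sub by (auto simp: RCOSETS_def)
  from some_coset[OF this] show ?thesis using assms by (auto simp: r_coset_def coset_inv_def)
qed

lemma csum_reindex:
  fixes F :: "_ \<Rightarrow> complex"
  assumes F: "coset_inv F" and bij: "bij_betw f (rcosets K) (rcosets K)"
    and f: "\<And>g. g \<in> carrier G \<Longrightarrow> f (K #> g) = K #> \<phi> g" and \<phi>: "\<And>g. g \<in> carrier G \<Longrightarrow> \<phi> g \<in> carrier G"
  shows "csum (\<lambda>x. F (\<phi> x)) = csum F"
proof -
  have "csum F = (\<Sum>C\<in>rcosets K. F (SOME x. x \<in> f C))"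
    unfolding csum_def using bij by (rule sum.reindex_bij_betw[symmetric])
  also have "\<dots> = csum (\<lambda>x. F (\<phi> x))"
    unfolding csum_def
  proof (rule sum.cong[OF refl])
    fix C assume C: "C \<in> rcosets K"
    define g where "g = (SOME x. x \<in> C)"
    have g: "g \<in> C" "g \<in> carrier G" using some_coset[OF C] by (auto simp: g_def)
    then have "C = K #> g"
      using C repr_independence[of _ K] normal normal_imp_subgroup by (auto simp: RCOSETS_def)
    then have "f C = K #> \<phi> g" using f[OF g(2)] by simp
    then show "F (SOME x. x \<in> f C) = F (\<phi> (SOME x. x \<in> C))"
      unfolding g_def[symmetric] using coset_inv_some[OF F \<phi>[OF g(2)]] by simp
  qed
  finally show ?thesis by simp
qed

lemma csum_right:
  assumes "coset_inv F" "h \<in> carrier G"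
  shows "csum (\<lambda>x. F (x \<otimes> h)) = csum F"
proof (rule csum_reindex[OF assms(1)])
  show "K #> g #> h = K #> (g \<otimes> h)" if "g \<in> carrier G" for g
    using that assms K_sub by (simp add: coset_mult_assoc)
  show "bij_betw (\<lambda>C. C #> h) (rcosets K) (rcosets K)"
  proof (rule bij_betw_byWitness[where f' = "\<lambda>C. C #> inv h"])
    have "K #> g #> h #> inv h = K #> g" "K #> g #> inv h #> h = K #> g" if "g \<in> carrier G" for g
      using that assms K_sub by (auto simp: coset_mult_assoc m_assoc)
    then show "\<forall>C\<in>rcosets K. C #> h #> inv h = C" "\<forall>C\<in>rcosets K. C #> inv h #> h = C"
      by (auto simp: RCOSETS_def)
    show "(\<lambda>C. C #> h) ` (rcosets K) \<subseteq> rcosets K" "(\<lambda>C. C #> inv h) ` (rcosets K) \<subseteq> rcosets K"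
      using assms K_sub by (auto simp: RCOSETS_def coset_mult_assoc intro!: bexI)
  qed
qed (use assms in auto)

text \<open>Left translation permutes the right cosets because \<open>K\<close> is normal.\<close>

lemma csum_left:
  assumes "coset_inv F" "h \<in> carrier G"
  shows "csum (\<lambda>x. F (h \<otimes> x)) = csum F"
proof (rule csum_reindex[OF assms(1)])
  have *: "h <# (K #> g) = K #> (h \<otimes> g)" if gh: "g \<in> carrier G" "h \<in> carrier G" for g h
  proof (intro equalityI subsetI)
    fix x assume "x \<in> h <# (K #> g)"
    then obtain k where k: "k \<in> K" "x = h \<otimes> (k \<otimes> g)" by (auto simp: l_coset_def r_coset_def)
    then have "x = (h \<otimes> k \<otimes> inv h) \<otimes> (h \<otimes> g)"
      using gh K_sub by (simp add: m_assoc subset_iff inv_solve_left)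
    moreover have "h \<otimes> k \<otimes> inv h \<in> K" using normal.inv_op_closed2[OF normal gh(2) k(1)] .
    ultimately show "x \<in> K #> (h \<otimes> g)" by (auto simp: r_coset_def)
  next
    fix x assume "x \<in> K #> (h \<otimes> g)"
    then obtain k where k: "k \<in> K" "x = k \<otimes> (h \<otimes> g)" by (auto simp: r_coset_def)
    then have kc: "k \<in> carrier G" using K_sub by auto
    have "x = h \<otimes> ((inv h \<otimes> k \<otimes> h) \<otimes> g)"
      using gh k kc by (simp add: m_assoc[symmetric])
    moreover have "inv h \<otimes> k \<otimes> h \<in> K" using normal.inv_op_closed1[OF normal gh(2) k(1)] .
    ultimately show "x \<in> h <# (K #> g)" by (auto simp: l_coset_def r_coset_def)
  qed
  show "h <# (K #> g) = K #> (h \<otimes> g)" if "g \<in> carrier G" for g using * that assms by simp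
  show "bij_betw (\<lambda>C. h <# C) (rcosets K) (rcosets K)"
  proof (rule bij_betw_byWitness[where f' = "\<lambda>C. inv h <# C"])
    show "\<forall>C\<in>rcosets K. inv h <# (h <# C) = C" "\<forall>C\<in>rcosets K. h <# (inv h <# C) = C"
      using assms * by (auto simp: RCOSETS_def m_assoc[symmetric])
    show "(\<lambda>C. h <# C) ` (rcosets K) \<subseteq> rcosets K" "(\<lambda>C. inv h <# C) ` (rcosets K) \<subseteq> rcosets K"
      using assms * by (auto simp: RCOSETS_def intro!: bexI)
  qed
qed (use assms in auto)

text \<open>Representations of the quotient by \<open>K\<close>, kept as functions on
  \<open>G\<close>: all levels of the filtration then share one type and can be compared.\<close>

definition krep :: "nat \<Rightarrow> ('a \<Rightarrow> complex mat) \<Rightarrow> bool" where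
  "krep n \<rho> \<longleftrightarrow> (\<forall>g\<in>carrier G. \<rho> g \<in> carrier_mat n n) \<and>
     (\<forall>g\<in>carrier G. \<forall>h\<in>carrier G. \<rho> (g \<otimes> h) = \<rho> g * \<rho> h) \<and> (\<forall>k\<in>K. \<rho> k = 1\<^sub>m n)"

lemma krepD:
  assumes "krep n \<rho>"
  shows "g \<in> carrier G \<Longrightarrow> \<rho> g \<in> carrier_mat n n"
    "g \<in> carrier G \<Longrightarrow> h \<in> carrier G \<Longrightarrow> \<rho> (g \<otimes> h) = \<rho> g * \<rho> h"
    "k \<in> K \<Longrightarrow> \<rho> k = 1\<^sub>m n" "\<rho> \<one> = 1\<^sub>m n"
    "g \<in> carrier G \<Longrightarrow> \<rho> g * \<rho> (inv g) = 1\<^sub>m n"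
    "g \<in> carrier G \<Longrightarrow> \<rho> (inv g) * \<rho> g = 1\<^sub>m n"
proof -
  show A: "g \<in> carrier G \<Longrightarrow> h \<in> carrier G \<Longrightarrow> \<rho> (g \<otimes> h) = \<rho> g * \<rho> h" for g h
    using assms by (auto simp: krep_def)
  show B: "\<rho> \<one> = 1\<^sub>m n"
    using assms normal normal_imp_subgroup subgroup.one_closed by (fastforce simp: krep_def)
  show "g \<in> carrier G \<Longrightarrow> \<rho> g * \<rho> (inv g) = 1\<^sub>m n" "g \<in> carrier G \<Longrightarrow> \<rho> (inv g) * \<rho> g = 1\<^sub>m n"
    using A[of g "inv g"] A[of "inv g" g] B by auto
qed (use assms in \<open>auto simp: krep_def\<close>)

definition irred :: "nat \<Rightarrow> ('a \<Rightarrow> complex mat) \<Rightarrow> bool" where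
  "irred n \<rho> \<longleftrightarrow> krep n \<rho> \<and> irreducible_rep G n \<rho>"

lemma irredD:
  assumes "irred n \<rho>"
  shows "krep n \<rho>" "0 < n"
    "lin_closed n W \<Longrightarrow> (\<And>g w. g \<in> carrier G \<Longrightarrow> w \<in> W \<Longrightarrow> \<rho> g *\<^sub>v w \<in> W) \<Longrightarrow> W = {0\<^sub>v n} \<or> W = carrier_vec n"
  using assms unfolding irred_def irreducible_rep_def lin_closed_iff_subspace by auto

lemma krep_coset_inv: "krep n \<rho> \<Longrightarrow> coset_inv \<rho>"
  unfolding coset_inv_def
proof (intro ballI)
  fix g k assume \<rho>: "krep n \<rho>" and gk: "g \<in> carrier G" "k \<in> K"
  then have "\<rho> (k \<otimes> g) = \<rho> k * \<rho> g" using K_sub krepD(2)[OF \<rho>] by blast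
  then show "\<rho> (k \<otimes> g) = \<rho> g" using krepD(1,3)[OF \<rho>] gk left_mult_one_mat[of "\<rho> g" n n] by simp
qed

lemma krep_inv_coset_inv: "krep n \<rho> \<Longrightarrow> coset_inv (\<lambda>x. \<rho> (inv x))"
  unfolding coset_inv_def
proof (intro ballI)
  fix g k assume \<rho>: "krep n \<rho>" and gk: "g \<in> carrier G" "k \<in> K"
  have k: "k \<in> carrier G" "inv k \<in> K" using gk K_sub normal normal_imp_subgroup subgroup.m_inv_closed[OF normal_imp_subgroup[OF normal]] by auto
  have "\<rho> (inv (k \<otimes> g)) = \<rho> (inv g) * \<rho> (inv k)"
    using gk k krepD(2)[OF \<rho>] by (simp add: inv_mult_group)
  then show "\<rho> (inv (k \<otimes> g)) = \<rho> (inv g)" using krepD(1)[OF \<rho>, of "inv g"] krepD(3)[OF \<rho> k(2)] gk right_mult_one_mat[of "\<rho> (inv g)" n n] by simp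
qed

text \<open>Schur's lemma: the kernel \<open>W\<close> and the image \<open>V\<close> of an
  intertwiner are invariant, hence trivial or everything. Rectangular \<open>T\<close> are allowed,
  so that representations of different dimensions are covered.\<close>

lemma schur_intertwiner:
  assumes \<rho>: "irred n \<rho>" and \<sigma>: "irred m \<sigma>" and T: "T \<in> carrier_mat n m"
    and int: "\<And>g. g \<in> carrier G \<Longrightarrow> \<rho> g * T = T * \<sigma> g"
  shows "T = 0\<^sub>m n m \<or> (n = m \<and> invertible_mat T)"
proof -
  note r = irredD[OF \<rho>] krepD[OF irredD(1)[OF \<rho>]] and s = irredD[OF \<sigma>] krepD[OF irredD(1)[OF \<sigma>]]
  define W where "W = {v \<in> carrier_vec m. T *\<^sub>v v = 0\<^sub>v n}"
  have "lin_closed m W" using T unfolding lin_closed_def W_def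
    by (auto simp: mult_add_distrib_mat_vec[of _ n m] mult_mat_vec[of _ n m])
  moreover have "\<sigma> g *\<^sub>v w \<in> W" if g: "g \<in> carrier G" and w: "w \<in> W" for g w
  proof -
    have "T *\<^sub>v (\<sigma> g *\<^sub>v w) = (\<rho> g * T) *\<^sub>v w"
      using T s(4)[OF g] w by (simp add: int[OF g] W_def assoc_mult_mat_vec[of _ n m _ m])
    also have "\<dots> = 0\<^sub>v n"
      using T r(4)[OF g] w by (auto simp: W_def assoc_mult_mat_vec[of _ n n _ m])
    finally show ?thesis using w s(4)[OF g] by (auto simp: W_def)
  qed
  ultimately have "W = {0\<^sub>v m} \<or> W = carrier_vec m" by (rule s(3))
  then show ?thesis
  proof
    assume "W = carrier_vec m"
    then have "T = 0\<^sub>m n m" using T by (intro mat_eq_if_vecs[of _ n m]) (auto simp: W_def mult_zero_mat_vec)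
    then show ?thesis ..
  next
    assume inj: "W = {0\<^sub>v m}"
    define V where "V = (\<lambda>v. T *\<^sub>v v) ` carrier_vec m"
    have "lin_closed n V" unfolding lin_closed_def
    proof (intro conjI ballI allI)
      show "0\<^sub>v n \<in> V" using T unfolding V_def by (intro image_eqI[of _ _ "0\<^sub>v m"]) auto
      fix v assume "v \<in> V"
      then obtain v' where v': "v' \<in> carrier_vec m" "v = T *\<^sub>v v'" by (auto simp: V_def)
      have "c \<cdot>\<^sub>v v = T *\<^sub>v (c \<cdot>\<^sub>v v')" for c using v' T by (simp add: mult_mat_vec[of _ n m])
      then show "c \<cdot>\<^sub>v v \<in> V" for c unfolding V_def using v' by (intro image_eqI[of _ _ "c \<cdot>\<^sub>v v'"]) auto
      fix w assume "w \<in> V"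
      then obtain w' where w': "w' \<in> carrier_vec m" "w = T *\<^sub>v w'" by (auto simp: V_def)
      have "v + w = T *\<^sub>v (v' + w')" using v' w' T by (simp add: mult_add_distrib_mat_vec[of _ n m])
      then show "v + w \<in> V" unfolding V_def using v' w' by (intro image_eqI[of _ _ "v' + w'"]) auto
    qed (use T in \<open>auto simp: V_def\<close>)
    moreover have "\<rho> g *\<^sub>v w \<in> V" if g: "g \<in> carrier G" and w: "w \<in> V" for g w
    proof -
      from w obtain v where v: "v \<in> carrier_vec m" "w = T *\<^sub>v v" by (auto simp: V_def)
      have "\<rho> g *\<^sub>v w = T *\<^sub>v (\<sigma> g *\<^sub>v v)"
        using assoc_mult_mat_vec[OF r(4)[OF g] T v(1)] assoc_mult_mat_vec[OF T s(4)[OF g] v(1)] int[OF g] v(2)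
        by simp
      moreover have "\<sigma> g *\<^sub>v v \<in> carrier_vec m" using s(4)[OF g] v by auto
      ultimately show ?thesis by (auto simp: V_def)
    qed
    ultimately have "V = {0\<^sub>v n} \<or> V = carrier_vec n" by (rule r(3))
    then show ?thesis
    proof
      assume "V = {0\<^sub>v n}"
      then have "T = 0\<^sub>m n m" using T by (intro mat_eq_if_vecs[of _ n m]) (auto simp: V_def mult_zero_mat_vec)
      then show ?thesis ..
    next
      assume V: "V = carrier_vec n"
      have "\<exists>v\<in>carrier_vec m. T *\<^sub>v v = unit_vec n j" for j
      proof -
        have "unit_vec n j \<in> V" unfolding V by simp
        then show ?thesis by (auto simp: V_def)
      qed
      then obtain f where f: "\<And>j. f j \<in> carrier_vec m" "\<And>j. T *\<^sub>v f j = unit_vec n j" by metis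
      \<comment> \<open>The columns of \<open>S\<close> are preimages of the unit vectors, so
        \<open>S\<close> is a right inverse; injectivity of \<open>T\<close> makes it a left inverse
        too, and comparison of traces gives \<open>n = m\<close>.\<close>
      define S where "S = Matrix.mat m n (\<lambda>(i,j). f j $v i)"
      have S: "S \<in> carrier_mat m n" by (simp add: S_def)
      have col: "Matrix.col S j = f j" if "j < n" for j using f(1)[of j] that by (intro eq_vecI) (auto simp: S_def)
      have TS: "T * S = 1\<^sub>m n"
      proof (rule eq_matI)
        fix i j assume "i < dim_row (1\<^sub>m n)" "j < dim_col (1\<^sub>m n)"
        then have ij: "i < n" "j < n" by auto
        then have "(T * S) $$ (i,j) = (T *\<^sub>v f j) $v i" using T S col by simp
        then show "(T * S) $$ (i,j) = 1\<^sub>m n $$ (i,j)" using ij f(2) by simp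
      qed (use T S in auto)
      have ST: "S * T = 1\<^sub>m m"
      proof (rule mat_eq_if_vecs[of _ m m])
        fix v :: "complex Matrix.vec" assume v: "v \<in> carrier_vec m"
        have "T *\<^sub>v ((S * T) *\<^sub>v v) = (T * S * T) *\<^sub>v v"
          using assoc_mult_mat[OF T S T] assoc_mult_mat_vec[OF T mult_carrier_mat[OF S T] v] by simp
        then have "T *\<^sub>v ((S * T) *\<^sub>v v) = T *\<^sub>v v" using T by (simp add: TS)
        moreover have c: "(S * T) *\<^sub>v v \<in> carrier_vec m" using S T v by (intro mult_mat_vec_carrier[of _ m m]) auto
        ultimately have "T *\<^sub>v ((S * T) *\<^sub>v v - v) = 0\<^sub>v n"
          using T v by (simp add: mult_minus_distrib_mat_vec[of _ n m])
        then have "(S * T) *\<^sub>v v - v \<in> W" unfolding W_def using v c by auto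
        then have "(S * T) *\<^sub>v v - v = 0\<^sub>v m" using inj by simp
        then have "(S * T) *\<^sub>v v = v" using c v by (rule vec_minus_eq_zeroD)
        then show "(S * T) *\<^sub>v v = 1\<^sub>m m *\<^sub>v v" using v by simp
      qed (use S T in auto)
      have "n = m" using rectangular_two_sided_inverse_dims[OF T S TS ST] .
      moreover have "invertible_mat T"
        using T S TS ST \<open>n = m\<close> unfolding invertible_mat_def inverts_mat_def by auto
      ultimately show ?thesis by blast
    qed
  qed
qed

text \<open>Subtracting an eigenvalue gives an intertwiner that kills a nonzero vector, which by
  Schur's lemma is zero.\<close>

lemma schur_scalar:
  assumes \<rho>: "irred n \<rho>" and M: "M \<in> carrier_mat n n"
    and comm: "\<And>g. g \<in> carrier G \<Longrightarrow> \<rho> g * M = M * \<rho> g"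
  obtains c where "M = c \<cdot>\<^sub>m 1\<^sub>m n"
proof -
  note r = irredD[OF \<rho>] krepD[OF irredD(1)[OF \<rho>]]
  have "degree (char_poly M) = n" using degree_monic_char_poly[OF M] by simp
  then have "\<not> constant (poly (char_poly M))" using r(2) by (simp add: constant_degree)
  then obtain c where "poly (char_poly M) c = 0" using fundamental_theorem_of_algebra by blast
  then have "eigenvalue M c" using eigenvalue_root_char_poly[OF M] by simp
  then obtain v where v: "v \<in> carrier_vec n" "v \<noteq> 0\<^sub>v n" "M *\<^sub>v v = c \<cdot>\<^sub>v v"
    using M by (auto simp: eigenvalue_def eigenvector_def)
  define T where "T = M - c \<cdot>\<^sub>m 1\<^sub>m n"
  have T: "T \<in> carrier_mat n n" using M by (auto simp: T_def intro!: minus_carrier_mat)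
  have "\<rho> g * T = T * \<rho> g" if g: "g \<in> carrier G" for g
    using M comm[OF g] r(4)[OF g] by (simp add: T_def mult_minus_distrib_mat[of _ n n] minus_mult_distrib_mat[of _ n n]
        mult_smult_distrib[of "\<rho> g" n n _ n] mult_smult_assoc_mat[of _ n n _ n] left_mult_one_mat[of _ n n] right_mult_one_mat[of _ n n])
  from schur_intertwiner[OF \<rho> \<rho> T this] have "T = 0\<^sub>m n n \<or> invertible_mat T" by blast
  then show ?thesis
  proof
    assume T0: "T = 0\<^sub>m n n"
    have "M = c \<cdot>\<^sub>m 1\<^sub>m n"
    proof (rule eq_matI)
      fix i j assume "i < dim_row (c \<cdot>\<^sub>m 1\<^sub>m n :: complex mat)" "j < dim_col (c \<cdot>\<^sub>m 1\<^sub>m n :: complex mat)"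
      then have "T $$ (i,j) = M $$ (i,j) - (c \<cdot>\<^sub>m 1\<^sub>m n) $$ (i,j)" using M by (simp add: T_def)
      then show "M $$ (i,j) = (c \<cdot>\<^sub>m 1\<^sub>m n) $$ (i,j)" using T0 \<open>i < _\<close> \<open>j < _\<close> by simp
    qed (use M in auto)
    then show ?thesis by (rule that)
  next
    assume "invertible_mat T"
    then obtain B where B: "B * T = 1\<^sub>m (dim_row B)" "T * B = 1\<^sub>m n"
      using T unfolding invertible_mat_def inverts_mat_def by auto
    have Bc: "B \<in> carrier_mat n n"
    proof -
      have "dim_col (T * B) = n" "dim_col (B * T) = dim_row B" using B by auto
      then show ?thesis using T by auto
    qed
    have "T *\<^sub>v v = 0\<^sub>v n" unfolding T_def using M v
      by (simp add: minus_mult_distrib_mat_vec[of _ n n] smult_one_mult_mat_vec)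
    then have "B *\<^sub>v (T *\<^sub>v v) = 0\<^sub>v n" using Bc by auto
    then have "v = 0\<^sub>v n" using B(1) Bc v assoc_mult_mat_vec[OF Bc T v(1)] by simp
    with v show ?thesis by simp
  qed
qed

end

section \<open>Bases of subspaces\<close>

lemma mat_mult_entry:
  assumes "A \<in> carrier_mat n m" "B \<in> carrier_mat m l" "i < n" "j < l"
  shows "(A * B) $$ (i,j) = (\<Sum>a<m. A $$ (i,a) * B $$ (a,j))"
  using assms by (auto simp: scalar_prod_def lessThan_atLeast0 intro!: sum.cong)

lemma mat_vec_entry:
  assumes "A \<in> carrier_mat n m" "v \<in> carrier_vec m" "i < n"
  shows "(A *\<^sub>v v) $v i = (\<Sum>a<m. A $$ (i,a) * v $v a)"
  using assms by (auto simp: scalar_prod_def lessThan_atLeast0 intro!: sum.cong)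

lemma sum_single_mult:
  fixes F :: "nat \<Rightarrow> complex"
  assumes "k < r"
  shows "(\<Sum>i<r. (if i = k then 1 else 0) * F i) = F k"
proof -
  have "(\<Sum>i<r. (if i = k then 1 else 0) * F i) = (\<Sum>i\<in>{k}. F i)"
    using assms by (intro sum.mono_neutral_cong_right) auto
  then show ?thesis by simp
qed

lemma sum_double_single:
  fixes F :: "nat \<Rightarrow> nat \<Rightarrow> complex"
  assumes "j < n" "l < m" "\<And>i k. \<not> (i = j \<and> k = l) \<Longrightarrow> F i k = 0"
  shows "(\<Sum>i<n. \<Sum>k<m. F i k) = F j l"
proof -
  have "(\<Sum>i<n. \<Sum>k<m. F i k) = (\<Sum>i\<in>{j}. \<Sum>k<m. F i k)"
    using assms by (intro sum.mono_neutral_right) auto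
  also have "\<dots> = (\<Sum>k<m. F j k)" by simp
  also have "(\<Sum>k<m. F j k) = (\<Sum>k\<in>{l}. F j k)"
    using assms by (intro sum.mono_neutral_right) auto
  finally show ?thesis by simp
qed

lemma injective_mat_dims:
  fixes B :: "complex mat"
  assumes B: "B \<in> carrier_mat n s" and inj: "\<And>c. c \<in> carrier_vec s \<Longrightarrow> B *\<^sub>v c = 0\<^sub>v n \<Longrightarrow> c = 0\<^sub>v s"
  shows "s \<le> n"
proof (rule ccontr)
  assume "\<not> s \<le> n"
  then obtain c where c: "\<exists>i\<in>{..<s}. c i \<noteq> 0" "\<forall>j\<in>{..<n}. (\<Sum>i<s. c i * B $$ (j,i)) = 0"
    using underdetermined[of "{..<n}" "{..<s}" "\<lambda>i j. B $$ (j,i)"] by auto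
  have "B *\<^sub>v Matrix.vec s c = 0\<^sub>v n"
  proof (rule eq_vecI)
    fix i assume "i < dim_vec (0\<^sub>v n :: complex Matrix.vec)"
    then show "(B *\<^sub>v Matrix.vec s c) $v i = 0\<^sub>v n $v i"
      using c(2) mat_vec_entry[OF B, of "Matrix.vec s c" i] by (simp add: mult.commute)
  qed (use B in auto)
  then have "Matrix.vec s c = 0\<^sub>v s" by (intro inj) auto
  with c(1) show False by (metis index_vec index_zero_vec(1) lessThan_iff)
qed

lemma append_col_injective:
  fixes B :: "complex mat"
  assumes B: "B \<in> carrier_mat n s" and inj: "\<And>c. c \<in> carrier_vec s \<Longrightarrow> B *\<^sub>v c = 0\<^sub>v n \<Longrightarrow> c = 0\<^sub>v s"
    and w: "w \<in> carrier_vec n" "\<And>c. c \<in> carrier_vec s \<Longrightarrow> w \<noteq> B *\<^sub>v c"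
  defines "B' \<equiv> Matrix.mat n (Suc s) (\<lambda>(i,j). if j < s then B $$ (i,j) else w $v i)"
  shows "\<And>c. c \<in> carrier_vec (Suc s) \<Longrightarrow> B' *\<^sub>v c = B *\<^sub>v Matrix.vec s (\<lambda>i. c $v i) + c $v s \<cdot>\<^sub>v w"
    and "\<And>c. c \<in> carrier_vec (Suc s) \<Longrightarrow> B' *\<^sub>v c = 0\<^sub>v n \<Longrightarrow> c = 0\<^sub>v (Suc s)"
proof -
  have B': "B' \<in> carrier_mat n (Suc s)" by (simp add: B'_def)
  show eq: "B' *\<^sub>v c = B *\<^sub>v Matrix.vec s (\<lambda>i. c $v i) + c $v s \<cdot>\<^sub>v w" if c: "c \<in> carrier_vec (Suc s)" for c
  proof (rule eq_vecI)
    fix i assume "i < dim_vec (B *\<^sub>v Matrix.vec s (\<lambda>i. c $v i) + c $v s \<cdot>\<^sub>v w)"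
    then have i: "i < n" using w by simp
    have "(B' *\<^sub>v c) $v i = (\<Sum>a<Suc s. B' $$ (i,a) * c $v a)"
      using mat_vec_entry[OF B' c i] .
    also have "\<dots> = (\<Sum>a<s. B $$ (i,a) * c $v a) + w $v i * c $v s"
      using i by (simp add: B'_def)
    also have "(\<Sum>a<s. B $$ (i,a) * c $v a) = (B *\<^sub>v Matrix.vec s (\<lambda>i. c $v i)) $v i"
      using mat_vec_entry[OF B _ i, of "Matrix.vec s (\<lambda>i. c $v i)"] by simp
    finally show "(B' *\<^sub>v c) $v i = (B *\<^sub>v Matrix.vec s (\<lambda>i. c $v i) + c $v s \<cdot>\<^sub>v w) $v i"
      using i w B by (simp add: mult.commute)
  qed (use B' w in auto)
  fix c :: "complex Matrix.vec" assume c: "c \<in> carrier_vec (Suc s)" and 0: "B' *\<^sub>v c = 0\<^sub>v n"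
  let ?c = "Matrix.vec s (\<lambda>i. c $v i)"
  have Bc: "B *\<^sub>v ?c \<in> carrier_vec n" using B by (intro mult_mat_vec_carrier[of _ n s]) auto
  have ent: "(B *\<^sub>v ?c) $v i + c $v s * w $v i = 0" if "i < n" for i
  proof -
    have "(B *\<^sub>v ?c + c $v s \<cdot>\<^sub>v w) $v i = 0" using that 0 eq[OF c] by simp
    then show ?thesis using that w B by simp
  qed
  have cs: "c $v s = 0"
  proof (rule ccontr)
    assume nz: "c $v s \<noteq> 0"
    have "w = B *\<^sub>v ((- 1 / c $v s) \<cdot>\<^sub>v ?c)"
    proof (rule eq_vecI)
      fix i assume "i < dim_vec (B *\<^sub>v ((- 1 / c $v s) \<cdot>\<^sub>v ?c))"
      then have i: "i < n" using B by simp
      have "(B *\<^sub>v ((- 1 / c $v s) \<cdot>\<^sub>v ?c)) $v i = (- 1 / c $v s) * (B *\<^sub>v ?c) $v i"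
        using B i Bc by (simp add: mult_mat_vec[of _ n s])
      also have "\<dots> = w $v i" using ent[OF i] nz by (simp add: field_simps add_eq_0_iff)
      finally show "w $v i = (B *\<^sub>v ((- 1 / c $v s) \<cdot>\<^sub>v ?c)) $v i" by simp
    qed (use B w in auto)
    then show False using w(2)[of "(- 1 / c $v s) \<cdot>\<^sub>v ?c"] by simp
  qed
  have "B *\<^sub>v ?c = 0\<^sub>v n" using ent cs B by (intro eq_vecI) auto
  then have c0: "?c = 0\<^sub>v s" by (intro inj) auto
  show "c = 0\<^sub>v (Suc s)"
  proof (rule eq_vecI)
    fix i assume "i < dim_vec (0\<^sub>v (Suc s) :: complex Matrix.vec)"
    then have "i < s \<or> i = s" by auto
    then show "c $v i = 0\<^sub>v (Suc s) $v i"
    proof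
      assume "i < s"
      then have "?c $v i = 0" using c0 by simp
      then show ?thesis using \<open>i < s\<close> by simp
    qed (use cs in simp)
  qed (use c in auto)
qed

text \<open>\<open>B\<close> is an injective matrix with range in \<open>W\<close> and as many
  columns as possible; a vector of \<open>W\<close> outside its range could be appended. The last
  conclusion holds since an injective matrix with \<open>n\<close> columns cannot be extended even
  inside \<open>carrier_vec n\<close>.\<close>

lemma lin_closed_basis:
  assumes W: "lin_closed n W"
  obtains s B where "s \<le> n" "B \<in> carrier_mat n s" "W = (\<lambda>c. B *\<^sub>v c) ` carrier_vec s"
    "\<And>c. c \<in> carrier_vec s \<Longrightarrow> B *\<^sub>v c = 0\<^sub>v n \<Longrightarrow> c = 0\<^sub>v s" "s = n \<Longrightarrow> W = carrier_vec n"
proof -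
  define good where "good U s B \<longleftrightarrow> B \<in> carrier_mat n s \<and> (\<forall>c\<in>carrier_vec s. B *\<^sub>v c \<in> U) \<and>
      (\<forall>c\<in>carrier_vec s. B *\<^sub>v c = 0\<^sub>v n \<longrightarrow> c = 0\<^sub>v s)" for U s and B :: "complex mat"
  have bound: "s \<le> n" if "good U s B" for U s B
    using that injective_mat_dims[of B n s] by (auto simp: good_def)
  have extend: "\<exists>B'. good U (Suc s) B'"
    if U: "lin_closed n U" and B: "good U s B" and w: "w \<in> U" "w \<notin> (\<lambda>c. B *\<^sub>v c) ` carrier_vec s" for U s B w
  proof -
    let ?B = "Matrix.mat n (Suc s) (\<lambda>(i,j). if j < s then B $$ (i,j) else w $v i)"
    note ac = append_col_injective[of B n s w]
    have wn: "w \<in> carrier_vec n" using U w by (auto simp: lin_closed_def)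
    have "?B *\<^sub>v c \<in> U" if c: "c \<in> carrier_vec (Suc s)" for c
    proof -
      have nin: "\<And>c. c \<in> carrier_vec s \<Longrightarrow> w \<noteq> B *\<^sub>v c" using w by auto
      have "?B *\<^sub>v c = B *\<^sub>v Matrix.vec s (\<lambda>i. c $v i) + c $v s \<cdot>\<^sub>v w"
        using B by (intro ac(1)[OF _ _ wn nin c]) (auto simp: good_def)
      moreover have "B *\<^sub>v Matrix.vec s (\<lambda>i. c $v i) \<in> U" using B by (auto simp: good_def)
      ultimately show ?thesis using U w by (auto simp: lin_closed_def)
    qed
    moreover have "c = 0\<^sub>v (Suc s)" if c: "c \<in> carrier_vec (Suc s)" "?B *\<^sub>v c = 0\<^sub>v n" for c
      using ac(2)[OF _ _ wn _ c] B w by (auto simp: good_def)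
    ultimately show ?thesis by (intro exI[of _ ?B]) (auto simp: good_def)
  qed
  define s where "s = (GREATEST s. \<exists>B. good W s B)"
  have ex0: "\<exists>B. good W 0 B"
    using W by (intro exI[of _ "0\<^sub>m n 0"]) (auto simp: good_def lin_closed_def mult_zero_mat_vec)
  then have "\<exists>B. good W s B" unfolding s_def
    by (rule GreatestI_nat[of "\<lambda>s. \<exists>B. good W s B" _ n]) (use bound in blast)
  then obtain B where B: "good W s B" by blast
  have max: "\<not> (\<exists>B. good W (Suc s) B)"
    using Greatest_le_nat[of "\<lambda>s. \<exists>B. good W s B" "Suc s" n] bound by (auto simp flip: s_def)
  have img: "W = (\<lambda>c. B *\<^sub>v c) ` carrier_vec s"
  proof (intro equalityI subsetI)
    fix x assume "x \<in> W"
    then show "x \<in> (\<lambda>c. B *\<^sub>v c) ` carrier_vec s" using extend[OF W B, of x] max by blast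
  qed (use B in \<open>auto simp: good_def\<close>)
  have full: "W = carrier_vec n" if "s = n"
  proof -
    have BU: "good (carrier_vec n) s B" using B W by (auto simp: good_def lin_closed_def)
    have U: "lin_closed n (carrier_vec n)" by (auto simp: lin_closed_def)
    have "\<not> good (carrier_vec n) (Suc s) B'" for B' using bound[of "carrier_vec n" "Suc s" B'] that by auto
    then have "carrier_vec n \<subseteq> (\<lambda>c. B *\<^sub>v c) ` carrier_vec s" using extend[OF U BU] by blast
    then show ?thesis using img W by (auto simp: lin_closed_def)
  qed
  show ?thesis
    by (rule that[OF bound[OF B] _ img _ full]) (use B in \<open>auto simp: good_def\<close>)
qed

section \<open>Orthogonality and independence of matrix coefficients\<close>

context fin_quot_group
begin

lemma csum_cmult: "csum (\<lambda>x. c * f x) = c * csum f"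
  by (simp add: csum_def sum_distrib_left)

lemma csum_sum: "csum (\<lambda>x. \<Sum>i\<in>I. f i x) = (\<Sum>i\<in>I. csum (f i))"
  by (simp add: csum_def sum.swap[of _ I])

lemma csum_cong: "(\<And>g. g \<in> carrier G \<Longrightarrow> f g = f' g) \<Longrightarrow> csum f = csum f'"
  unfolding csum_def using some_coset by (intro sum.cong) auto

lemma csum_const: "csum (\<lambda>_. c) = of_nat N_idx * c"
  by (simp add: csum_def)

lemma N_idx_pos: "N_idx > 0"
proof -
  have "K #> \<one> \<in> rcosets K" unfolding RCOSETS_def by blast
  then show ?thesis using fin_index by (auto simp: card_gt_0_iff)
qed

text \<open>\<open>T\<close> is the sum of \<open>\<rho> g * E * \<sigma> (inv g)\<close> over the
  quotient, where \<open>E\<close> has a single entry 1, at position \<open>(k,l)\<close>.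
  Invariance of the sum under left translation by \<open>h\<close> moves \<open>\<rho> h\<close>
  across.\<close>

lemma coeff_average_intertwines:
  assumes \<rho>: "krep n \<rho>" and \<sigma>: "krep m \<sigma>" and kl: "k < n" "l < m" and h: "h \<in> carrier G"
  defines "T \<equiv> Matrix.mat n m (\<lambda>(i,j). csum (\<lambda>g. \<rho> g $$ (i,k) * \<sigma> (inv g) $$ (l,j)))"
  shows "\<rho> h * T = T * \<sigma> h"
proof (rule eq_matI)
  have T: "T \<in> carrier_mat n m" by (simp add: T_def)
  note r = krepD[OF \<rho>] and s = krepD[OF \<sigma>]
  fix i j assume "i < dim_row (T * \<sigma> h)" "j < dim_col (T * \<sigma> h)"
  then have ij: "i < n" "j < m" using T s(1)[OF h] by auto
  define F where "F x = \<rho> x $$ (i,k) * (\<sigma> (inv x) * \<sigma> h) $$ (l,j)" for x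
  have F: "coset_inv F" using krep_coset_inv[OF \<rho>] krep_inv_coset_inv[OF \<sigma>] by (auto simp: coset_inv_def F_def)
  have "(\<rho> h * T) $$ (i,j) = (\<Sum>a<n. \<rho> h $$ (i,a) * csum (\<lambda>g. \<rho> g $$ (a,k) * \<sigma> (inv g) $$ (l,j)))"
    using ij by (subst mat_mult_entry[OF r(1)[OF h] T]) (auto simp: T_def intro!: sum.cong)
  also have "\<dots> = csum (\<lambda>g. \<Sum>a<n. \<rho> h $$ (i,a) * (\<rho> g $$ (a,k) * \<sigma> (inv g) $$ (l,j)))"
    by (simp add: csum_sum csum_cmult)
  also have "\<dots> = csum (\<lambda>g. F (h \<otimes> g))"
  proof (rule csum_cong)
    fix g assume g: "g \<in> carrier G"
    have "\<sigma> (inv (h \<otimes> g)) * \<sigma> h = \<sigma> (inv g)"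
      using g h by (simp add: s(2)[symmetric] m_assoc inv_mult_group)
    moreover have "\<rho> (h \<otimes> g) $$ (i,k) = (\<Sum>a<n. \<rho> h $$ (i,a) * \<rho> g $$ (a,k))"
      using g h ij kl by (simp add: r(2) mat_mult_entry[OF r(1)[OF h] r(1)[OF g]])
    ultimately show "(\<Sum>a<n. \<rho> h $$ (i,a) * (\<rho> g $$ (a,k) * \<sigma> (inv g) $$ (l,j))) = F (h \<otimes> g)"
      by (simp add: F_def sum_distrib_right mult.assoc)
  qed
  also have "\<dots> = csum F" using F h by (rule csum_left)
  also have "\<dots> = csum (\<lambda>g. \<Sum>a<m. \<rho> g $$ (i,k) * \<sigma> (inv g) $$ (l,a) * \<sigma> h $$ (a,j))"
    unfolding F_def using kl ij h
    by (intro csum_cong) (simp add: mat_mult_entry[OF s(1) s(1)] sum_distrib_left mult.assoc)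
  also have "\<dots> = (\<Sum>a<m. csum (\<lambda>g. \<rho> g $$ (i,k) * \<sigma> (inv g) $$ (l,a)) * \<sigma> h $$ (a,j))"
    by (simp add: csum_sum csum_cmult mult.commute[of _ "\<sigma> h $$ _"])
  also have "\<dots> = (T * \<sigma> h) $$ (i,j)"
    using ij by (subst mat_mult_entry[OF T s(1)[OF h]]) (auto simp: T_def intro!: sum.cong)
  finally show "(\<rho> h * T) $$ (i,j) = (T * \<sigma> h) $$ (i,j)" .
qed (use krepD(1)[OF \<rho> h] krepD(1)[OF \<sigma> h] in \<open>auto simp: T_def\<close>)

lemma orthogonality_distinct:
  assumes \<rho>: "irred n \<rho>" and \<sigma>: "irred m \<sigma>" and noniso: "\<not> (n = m \<and> rep_iso G n \<sigma> \<rho>)"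
    and "i < n" "k < n" "l < m" "j < m"
  shows "csum (\<lambda>g. \<rho> g $$ (i,k) * \<sigma> (inv g) $$ (l,j)) = 0"
proof -
  define T where "T = Matrix.mat n m (\<lambda>(i,j). csum (\<lambda>g. \<rho> g $$ (i,k) * \<sigma> (inv g) $$ (l,j)))"
  have T: "T \<in> carrier_mat n m" by (simp add: T_def)
  have int: "\<rho> h * T = T * \<sigma> h" if "h \<in> carrier G" for h
    unfolding T_def using coeff_average_intertwines[OF irredD(1)[OF \<rho>] irredD(1)[OF \<sigma>] assms(5,6) that] .
  from schur_intertwiner[OF \<rho> \<sigma> T int] noniso T int have "T = 0\<^sub>m n m"
    by (auto simp: rep_iso_def)
  then have "T $$ (i,j) = 0" using assms by simp
  then show ?thesis using assms by (simp add: T_def)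
qed

text \<open>By Schur's lemma the averaged matrix unit is a scalar \<open>c\<close>; its trace
  collapses to the \<open>(l,k)\<close> entry of \<open>\<rho> (inv g) * \<rho> g\<close>, the
  identity, and so determines \<open>c\<close>.\<close>

lemma orthogonality_same:
  assumes \<rho>: "irred n \<rho>" and "i < n" "k < n" "l < n" "j < n"
  shows "csum (\<lambda>g. \<rho> g $$ (i,k) * \<rho> (inv g) $$ (l,j)) = (if i = j \<and> k = l then of_nat N_idx / of_nat n else 0)"
proof -
  note r = krepD[OF irredD(1)[OF \<rho>]]
  define T where "T = Matrix.mat n n (\<lambda>(i,j). csum (\<lambda>g. \<rho> g $$ (i,k) * \<rho> (inv g) $$ (l,j)))"
  have T: "T \<in> carrier_mat n n" by (simp add: T_def)
  have int: "\<rho> h * T = T * \<rho> h" if "h \<in> carrier G" for h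
    unfolding T_def using coeff_average_intertwines[OF irredD(1)[OF \<rho>] irredD(1)[OF \<rho>] assms(3,4) that] .
  obtain c where c: "T = c \<cdot>\<^sub>m 1\<^sub>m n" using schur_scalar[OF \<rho> T int] by blast
  have "of_nat n * c = (\<Sum>i<n. T $$ (i,i))" by (simp add: c)
  also have "\<dots> = (\<Sum>i<n. csum (\<lambda>g. \<rho> g $$ (i,k) * \<rho> (inv g) $$ (l,i)))" by (simp add: T_def)
  also have "\<dots> = csum (\<lambda>g. \<Sum>i<n. \<rho> (inv g) $$ (l,i) * \<rho> g $$ (i,k))" by (simp add: csum_sum mult.commute)
  also have "\<dots> = csum (\<lambda>g. (1\<^sub>m n) $$ (l,k))"
    using assms by (intro csum_cong) (simp add: mat_mult_entry[OF r(1) r(1), symmetric] r(6))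
  also have "\<dots> = (if k = l then of_nat N_idx else 0)" using assms by (auto simp: csum_const)
  finally have "c = (if k = l then of_nat N_idx / of_nat n else 0)"
    using irredD(2)[OF \<rho>] by (auto simp: field_simps)
  moreover have "csum (\<lambda>g. \<rho> g $$ (i,k) * \<rho> (inv g) $$ (l,j)) = T $$ (i,j)" using assms by (simp add: T_def)
  ultimately show ?thesis using assms c by auto
qed

text \<open>Burnside's theorem in dual form: no nonzero linear functional on matrices vanishes on
  all \<open>\<rho> g\<close>, so these operators span. Pairing the relation with a coefficient of
  the inverse isolates a single \<open>A j l\<close>.\<close>

lemma burnside:
  assumes \<rho>: "irred n \<rho>" and A: "\<And>g. g \<in> carrier G \<Longrightarrow> (\<Sum>i<n. \<Sum>k<n. A i k * \<rho> g $$ (i,k)) = 0"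
    and "j < n" "l < n"
  shows "A j l = 0"
proof -
  have "0 = csum (\<lambda>g. (\<Sum>i<n. \<Sum>k<n. A i k * \<rho> g $$ (i,k)) * \<rho> (inv g) $$ (l,j))"
    using A by (subst csum_cong[of _ "\<lambda>_. 0"]) (auto simp: csum_const)
  also have "\<dots> = (\<Sum>i<n. \<Sum>k<n. A i k * csum (\<lambda>g. \<rho> g $$ (i,k) * \<rho> (inv g) $$ (l,j)))"
    by (simp add: sum_distrib_right csum_sum csum_cmult mult.assoc)
  also have "\<dots> = (\<Sum>i<n. \<Sum>k<n. A i k * (if i = j \<and> k = l then of_nat N_idx / of_nat n else 0))"
    by (intro sum.cong refl) (simp add: orthogonality_same[OF \<rho>] assms)
  also have "\<dots> = A j l * (of_nat N_idx / of_nat n)"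
    using assms(3,4) by (subst sum_double_single[of j n l n]) auto
  finally show ?thesis using N_idx_pos irredD(2)[OF \<rho>] by simp
qed

text \<open>There is one unknown for each coefficient function and one equation for each coset. Too
  many unknowns would give a nontrivial linear relation, and orthogonality isolates each of its
  coefficients.\<close>

lemma sum_squares_le:
  assumes S: "finite S" "\<And>n \<rho>. (n,\<rho>) \<in> S \<Longrightarrow> irred n \<rho>"
    and noniso: "\<And>n \<rho> \<sigma>. (n,\<rho>) \<in> S \<Longrightarrow> (n,\<sigma>) \<in> S \<Longrightarrow> rep_iso G n \<rho> \<sigma> \<Longrightarrow> \<rho> = \<sigma>"
  shows "(\<Sum>(n,\<rho>)\<in>S. n\<^sup>2) \<le> N_idx"
proof (rule ccontr)
  let ?I = "SIGMA s:S. {..<fst s} \<times> {..<fst s}"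
  let ?a = "\<lambda>s C. snd (fst s) (SOME x. x \<in> C) $$ snd s"
  assume "\<not> ?thesis"
  moreover have card: "card ?I = (\<Sum>(n,\<rho>)\<in>S. n\<^sup>2)"
    using S(1) by (simp add: card_SigmaI card_cartesian_product power2_eq_square case_prod_beta)
  ultimately obtain c where c: "\<exists>s\<in>?I. c s \<noteq> 0" "\<forall>C\<in>rcosets K. (\<Sum>s\<in>?I. c s * ?a s C) = 0"
    using underdetermined[OF fin_index, of ?I ?a] S(1) by auto
  from c(1) obtain m \<sigma> j l where m: "(m,\<sigma>) \<in> S" "j < m" "l < m" and nz: "c ((m,\<sigma>),(j,l)) \<noteq> 0" by auto
  note \<sigma> = S(2)[OF m(1)]
  have orth: "csum (\<lambda>g. snd (fst s) g $$ snd s * \<sigma> (inv g) $$ (l,j)) =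
      (if s = ((m,\<sigma>),(j,l)) then of_nat N_idx / of_nat m else 0)" if s: "s \<in> ?I" for s
  proof -
    obtain n \<rho> i k where s': "s = ((n,\<rho>),(i,k))" by (metis prod.collapse)
    with s have *: "(n,\<rho>) \<in> S" "i < n" "k < n" by auto
    show ?thesis
    proof (cases "(n,\<rho>) = (m,\<sigma>)")
      case True
      then show ?thesis using orthogonality_same[OF \<sigma>, of i k l j] * m s' by auto
    next
      case False
      then have "\<not> (n = m \<and> rep_iso G n \<sigma> \<rho>)" using noniso m(1) *(1) by blast
      then show ?thesis using orthogonality_distinct[OF S(2)[OF *(1)] \<sigma> _ *(2,3) m(3,2)] False s' by auto
    qed
  qed
  have fI: "finite ?I" using S(1) by auto
  have "0 = csum (\<lambda>g. (\<Sum>s\<in>?I. c s * snd (fst s) g $$ snd s) * \<sigma> (inv g) $$ (l,j))"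
    unfolding csum_def using c(2) by simp
  also have "\<dots> = (\<Sum>s\<in>?I. c s * csum (\<lambda>g. snd (fst s) g $$ snd s * \<sigma> (inv g) $$ (l,j)))"
    by (simp add: sum_distrib_right csum_sum csum_cmult mult.assoc)
  also have "\<dots> = (\<Sum>s\<in>?I. if s = ((m,\<sigma>),(j,l)) then c s * (of_nat N_idx / of_nat m) else 0)"
    by (intro sum.cong refl) (simp add: orth)
  also have "\<dots> = c ((m,\<sigma>),(j,l)) * (of_nat N_idx / of_nat m)"
    using m fI by (subst sum.delta) auto
  finally show False using nz N_idx_pos m(2) by simp
qed

section \<open>Completeness of the matrix coefficients\<close>

text \<open>Generators of a nonzero space of functions on the quotient that is stable under right
  translation and orthogonal to every irreducible coefficient. They may be dependent; for the least
  \<open>r\<close> they are not. The nonexistence of such a space is the completeness statement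
  behind the sum of squares.\<close>

definition stable_family :: "nat \<Rightarrow> (nat \<Rightarrow> 'a \<Rightarrow> complex) \<Rightarrow> bool" where
  "stable_family r w \<longleftrightarrow> (\<forall>i<r. coset_inv (w i)) \<and>
     (\<forall>i<r. \<forall>n \<rho> a b. irred n \<rho> \<longrightarrow> a < n \<longrightarrow> b < n \<longrightarrow> csum (\<lambda>g. w i g * cnj (\<rho> g $$ (a,b))) = 0) \<and>
     (\<exists>i<r. \<exists>g\<in>carrier G. w i g \<noteq> 0) \<and>
     (\<forall>x\<in>carrier G. \<forall>j<r. \<exists>c. \<forall>g\<in>carrier G. w j (g \<otimes> x) = (\<Sum>i<r. c i * w i g))"

lemma stable_family_linear_combination:
  assumes w: "stable_family r w"
    and u: "\<And>j. j < s \<Longrightarrow> u j = (\<lambda>g. \<Sum>i<r. b i j * w i g)"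
    and nz: "\<exists>j<s. \<exists>g\<in>carrier G. u j g \<noteq> 0"
    and st: "\<And>x j. x \<in> carrier G \<Longrightarrow> j < s \<Longrightarrow> \<exists>c. \<forall>g\<in>carrier G. u j (g \<otimes> x) = (\<Sum>i<s. c i * u i g)"
  shows "stable_family s u"
  unfolding stable_family_def
proof (intro conjI allI impI ballI)
  fix j assume j: "j < s"
  show "coset_inv (u j)" using w u[OF j] by (auto simp: stable_family_def coset_inv_def)
  fix n \<rho> a c assume "irred n \<rho>" "a < n" "c < n"
  then have "csum (\<lambda>g. w i g * cnj (\<rho> g $$ (a,c))) = 0" if "i < r" for i
    using w that by (auto simp: stable_family_def)
  then show "csum (\<lambda>g. u j g * cnj (\<rho> g $$ (a,c))) = 0"
    using u[OF j] by (simp add: sum_distrib_right csum_sum csum_cmult mult.assoc)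
qed (use nz st in auto)

lemma minimal_stable_family_independent:
  assumes w: "stable_family r w" and min: "\<And>s u. s < r \<Longrightarrow> \<not> stable_family s u"
    and c: "\<And>g. g \<in> carrier G \<Longrightarrow> (\<Sum>i<r. c i * w i g) = 0" and i0: "i0 < r"
  shows "c i0 = 0"
proof (rule ccontr)
  assume nz: "c i0 \<noteq> 0"
  define u where "u j = (if j < i0 then w j else w (Suc j))" for j
  define f where "f j = (if j < i0 then j else Suc j)" for j
  have bij: "bij_betw f {..<r-1} ({..<r} - {i0})"
    by (rule bij_betw_byWitness[where f' = "\<lambda>i. if i < i0 then i else i - 1"]) (use i0 in \<open>auto simp: f_def\<close>)
  have uf: "u j = w (f j)" for j by (simp add: u_def f_def)
  have reduce: "(\<Sum>i<r. d i * w i g) = (\<Sum>j<r-1. (d (f j) - d i0 / c i0 * c (f j)) * u j g)" if g: "g \<in> carrier G" for d g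
  proof -
    have "(\<Sum>i<r. c i * w i g) = c i0 * w i0 g + (\<Sum>i\<in>{..<r}-{i0}. c i * w i g)"
      using i0 by (intro sum.remove) auto
    then have "c i0 * w i0 g = - (\<Sum>i\<in>{..<r}-{i0}. c i * w i g)" using c[OF g] by (simp add: eq_neg_iff_add_eq_0)
    then have w0: "w i0 g = - (\<Sum>i\<in>{..<r}-{i0}. c i * w i g) / c i0" using nz by (simp add: field_simps)
    have "(\<Sum>i<r. d i * w i g) = d i0 * w i0 g + (\<Sum>i\<in>{..<r}-{i0}. d i * w i g)"
      using i0 by (intro sum.remove) auto
    also have "\<dots> = (\<Sum>i\<in>{..<r}-{i0}. (d i - d i0 / c i0 * c i) * w i g)"
      unfolding w0 by (simp add: left_diff_distrib sum_subtractf sum_distrib_left sum_divide_distrib mult.assoc)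
    also have "\<dots> = (\<Sum>j<r-1. (d (f j) - d i0 / c i0 * c (f j)) * u j g)"
      by (simp add: sum.reindex_bij_betw[OF bij, symmetric] uf)
    finally show ?thesis .
  qed
  have flt: "f j < r" if "j < r - 1" for j using bij_betwE[OF bij] that by auto
  have "stable_family (r - 1) u"
  proof (rule stable_family_linear_combination[OF w, where b = "\<lambda>i j. if i = f j then 1 else 0"])
    fix j assume j: "j < r - 1"
    show "u j = (\<lambda>g. \<Sum>i<r. (if i = f j then 1 else 0) * w i g)"
      unfolding sum_single_mult[OF flt[OF j]] by (simp add: uf)
    fix x assume x: "x \<in> carrier G"
    obtain d where d: "\<And>g. g \<in> carrier G \<Longrightarrow> w (f j) (g \<otimes> x) = (\<Sum>i<r. d i * w i g)"
      using w flt[OF j] x unfolding stable_family_def by meson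
    then show "\<exists>c. \<forall>g\<in>carrier G. u j (g \<otimes> x) = (\<Sum>i<r - 1. c i * u i g)"
      using reduce[of _ d] by (auto simp: uf)
  next
    obtain i g where ig: "i < r" "g \<in> carrier G" "w i g \<noteq> 0" using w by (auto simp: stable_family_def)
    then have "(\<Sum>i'<r. (if i' = i then 1 else 0) * w i' g) \<noteq> 0" by (simp only: sum_single_mult not_False_eq_True)
    then show "\<exists>j<r - 1. \<exists>g\<in>carrier G. u j g \<noteq> 0"
      using reduce[OF ig(2), of "\<lambda>i'. if i' = i then 1 else 0"] ig(2)
      by (metis (no_types, lifting) lessThan_iff mult_zero_right sum.neutral)
  qed
  then show False using min[of "r - 1" u] i0 by auto
qed

text \<open>A family of least length is a basis of its span, so right translation acts on it by
  matrices \<open>\<rho>\<close>. A proper invariant subspace would give a shorter family, so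
  \<open>\<rho>\<close> is irreducible and the family is orthogonal to the coefficients of
  \<open>\<rho>\<close>. But it consists of combinations of these very coefficients.\<close>

lemma no_stable_family: "\<not> stable_family r w"
proof
  assume "stable_family r w"
  then have ex: "\<exists>r w. stable_family r w" by blast
  define r0 where "r0 = (LEAST r. \<exists>w. stable_family r w)"
  obtain w where w: "stable_family r0 w" using LeastI_ex[OF ex] unfolding r0_def by blast
  have min: "\<not> stable_family s u" if "s < r0" for s u using not_less_Least that unfolding r0_def by blast
  note indep = minimal_stable_family_independent[OF w min]
  have uniq: "c i = d i" if "\<And>g. g \<in> carrier G \<Longrightarrow> (\<Sum>i<r0. c i * w i g) = (\<Sum>i<r0. d i * w i g)" "i < r0" for c d i
    using indep[of "\<lambda>i. c i - d i" i] that by (simp add: left_diff_distrib sum_subtractf)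
  have "\<forall>x\<in>carrier G. \<forall>j<r0. \<exists>c. \<forall>g\<in>carrier G. w j (g \<otimes> x) = (\<Sum>i<r0. c i * w i g)"
    using w by (simp add: stable_family_def)
  then obtain co where co: "\<And>x j g. x \<in> carrier G \<Longrightarrow> j < r0 \<Longrightarrow> g \<in> carrier G \<Longrightarrow>
      w j (g \<otimes> x) = (\<Sum>i<r0. co x j i * w i g)" by metis
  define \<rho> where "\<rho> x = Matrix.mat r0 r0 (\<lambda>(i,j). co x j i)" for x
  have \<rho>c: "\<rho> x \<in> carrier_mat r0 r0" for x by (simp add: \<rho>_def)
  have tr: "w j (g \<otimes> x) = (\<Sum>i<r0. \<rho> x $$ (i,j) * w i g)" if "x \<in> carrier G" "j < r0" "g \<in> carrier G" for x j g
    using co[OF that] that by (simp add: \<rho>_def)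
  have ci: "coset_inv (w j)" if "j < r0" for j using w that by (simp add: stable_family_def)
  have krep: "krep r0 \<rho>"
    unfolding krep_def
  proof (intro conjI ballI)
    fix x y assume xy: "x \<in> carrier G" "y \<in> carrier G"
    show "\<rho> (x \<otimes> y) = \<rho> x * \<rho> y"
    proof (rule eq_matI)
      fix i j assume "i < dim_row (\<rho> x * \<rho> y)" "j < dim_col (\<rho> x * \<rho> y)"
      then have ij: "i < r0" "j < r0" using carrier_matD[OF \<rho>c] by auto
      show "\<rho> (x \<otimes> y) $$ (i,j) = (\<rho> x * \<rho> y) $$ (i,j)"
      proof (rule uniq[OF _ ij(1)])
        fix g assume g: "g \<in> carrier G"
        have "(\<Sum>i<r0. \<rho> (x \<otimes> y) $$ (i,j) * w i g) = w j (g \<otimes> (x \<otimes> y))"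
          using tr[of "x \<otimes> y" j g] xy g ij by simp
        also have "\<dots> = w j ((g \<otimes> x) \<otimes> y)" using xy g by (simp add: m_assoc)
        also have "\<dots> = (\<Sum>a<r0. \<rho> y $$ (a,j) * (\<Sum>i<r0. \<rho> x $$ (i,a) * w i g))"
          using tr[of y j "g \<otimes> x"] tr[of x _ g] xy g ij by simp
        also have "\<dots> = (\<Sum>i<r0. (\<Sum>a<r0. \<rho> x $$ (i,a) * \<rho> y $$ (a,j)) * w i g)"
          by (simp add: sum_distrib_left sum_distrib_right mult_ac) (rule sum.swap)
        also have "\<dots> = (\<Sum>i<r0. (\<rho> x * \<rho> y) $$ (i,j) * w i g)"
          using ij by (intro sum.cong) (auto simp: mat_mult_entry[OF \<rho>c \<rho>c])
        finally show "(\<Sum>i<r0. \<rho> (x \<otimes> y) $$ (i,j) * w i g) = (\<Sum>i<r0. (\<rho> x * \<rho> y) $$ (i,j) * w i g)" .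
      qed
    qed (use carrier_matD[OF \<rho>c] in auto)
  next
    fix k assume k: "k \<in> K"
    show "\<rho> k = 1\<^sub>m r0"
    proof (rule eq_matI)
      fix i j assume "i < dim_row (1\<^sub>m r0 :: complex mat)" "j < dim_col (1\<^sub>m r0 :: complex mat)"
      then have ij: "i < r0" "j < r0" by auto
      show "\<rho> k $$ (i,j) = 1\<^sub>m r0 $$ (i,j)"
      proof (rule uniq[OF _ ij(1)])
        fix g assume g: "g \<in> carrier G"
        have kc: "k \<in> carrier G" using k K_sub by auto
        have "g \<otimes> k = (g \<otimes> k \<otimes> inv g) \<otimes> g" using g kc by (simp add: m_assoc)
        moreover have "g \<otimes> k \<otimes> inv g \<in> K" using normal.inv_op_closed2[OF normal g k] .
        ultimately have "w j (g \<otimes> k) = w j g" using ci[OF ij(2)] g by (metis coset_inv_def)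
        also have "\<dots> = (\<Sum>i<r0. (if i = j then 1 else 0) * w i g)" using sum_single_mult[OF ij(2), of "\<lambda>i. w i g"] by simp
        also have "\<dots> = (\<Sum>i<r0. 1\<^sub>m r0 $$ (i,j) * w i g)" using ij by (intro sum.cong) auto
        finally show "(\<Sum>i<r0. \<rho> k $$ (i,j) * w i g) = (\<Sum>i<r0. 1\<^sub>m r0 $$ (i,j) * w i g)"
          using tr[OF kc ij(2) g] by simp
      qed
    qed (use \<rho>c in auto)
  qed (rule \<rho>c)
  have pos: "0 < r0" using w by (auto simp: stable_family_def)
  have "irred r0 \<rho>"
    unfolding irred_def irreducible_rep_def
  proof (intro conjI allI impI krep pos)
    fix W assume "VectorSpace.subspace class_ring W (module_vec TYPE(complex) r0)"
    then have W: "lin_closed r0 W" by (simp add: lin_closed_iff_subspace)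
    assume inv: "\<forall>g\<in>carrier G. \<forall>w\<in>W. \<rho> g *\<^sub>v w \<in> W"
    obtain s B where B: "s \<le> r0" "B \<in> carrier_mat r0 s" "W = (\<lambda>c. B *\<^sub>v c) ` carrier_vec s"
      "\<And>c. c \<in> carrier_vec s \<Longrightarrow> B *\<^sub>v c = 0\<^sub>v r0 \<Longrightarrow> c = 0\<^sub>v s" "s = r0 \<Longrightarrow> W = carrier_vec r0"
      using lin_closed_basis[OF W] by metis
    show "W = {0\<^sub>v r0} \<or> W = carrier_vec r0"
    proof (cases "s = 0 \<or> s = r0")
      case True
      then show ?thesis
      proof
        assume "s = 0"
        moreover have "carrier_vec 0 = {0\<^sub>v 0 :: complex Matrix.vec}" by (auto intro!: eq_vecI)
        ultimately have "(\<lambda>c. B *\<^sub>v c) ` carrier_vec s = {B *\<^sub>v 0\<^sub>v 0}" by simp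
        moreover have "B *\<^sub>v 0\<^sub>v 0 = 0\<^sub>v r0" using B(2) \<open>s = 0\<close> by auto
        ultimately show ?thesis using B(3) by simp
      qed (use B in simp)
    next
      case False
      with B(1) have s: "0 < s" "s < r0" by auto
      \<comment> \<open>The columns of \<open>B\<close> are a basis of \<open>W\<close>; invariance
        of \<open>W\<close> under \<open>\<rho>\<close> says that the span of the combinations
        \<open>u\<close> is stable under translation.\<close>
      define u where "u j g = (\<Sum>i<r0. B $$ (i,j) * w i g)" for j g
      have Bu: "B *\<^sub>v unit_vec s j \<in> W" for j unfolding B(3) by auto
      have "stable_family s u"
      proof (rule stable_family_linear_combination[OF w, where b = "\<lambda>i j. B $$ (i,j)"])
        show "\<exists>j<s. \<exists>g\<in>carrier G. u j g \<noteq> 0"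
        proof (rule ccontr)
          assume "\<not> ?thesis"
          then have "B $$ (i,0) = 0" if "i < r0" for i
            using indep[of "\<lambda>i. B $$ (i,0)" i] s that by (auto simp: u_def)
          then have "B *\<^sub>v unit_vec s 0 = 0\<^sub>v r0"
            using B(2) s by (intro eq_vecI) (auto simp: carrier_mat_mult_unit_vec simp del: index_mult_mat_vec)
          then have "unit_vec s 0 = (0\<^sub>v s :: complex Matrix.vec)" using B(4) by simp
          then have "unit_vec s 0 $v 0 = (0\<^sub>v s :: complex Matrix.vec) $v 0" by simp
          then show False using s by simp
        qed
      next
        fix x j assume x: "x \<in> carrier G" and j: "j < s"
        have "\<rho> x *\<^sub>v (B *\<^sub>v unit_vec s j) \<in> W" using inv x Bu by blast
        then obtain d where d: "d \<in> carrier_vec s" "\<rho> x *\<^sub>v (B *\<^sub>v unit_vec s j) = B *\<^sub>v d" using B(3) by auto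
        have Bj: "(B *\<^sub>v unit_vec s j) $v a = B $$ (a,j)" if "a < r0" for a
          using carrier_mat_mult_unit_vec[OF B(2) that j] .
        have ent: "(\<Sum>a<r0. \<rho> x $$ (i,a) * B $$ (a,j)) = (\<Sum>b<s. B $$ (i,b) * d $v b)" if i: "i < r0" for i
        proof -
          have "(\<rho> x *\<^sub>v (B *\<^sub>v unit_vec s j)) $v i = (\<Sum>a<r0. \<rho> x $$ (i,a) * (B *\<^sub>v unit_vec s j) $v a)"
            using B(2) i by (intro mat_vec_entry[OF \<rho>c]) auto
          also have "\<dots> = (\<Sum>a<r0. \<rho> x $$ (i,a) * B $$ (a,j))" using Bj by (intro sum.cong) auto
          finally show ?thesis using d mat_vec_entry[OF B(2) d(1) i] by simp
        qed
        have "u j (g \<otimes> x) = (\<Sum>b<s. d $v b * u b g)" if g: "g \<in> carrier G" for g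
        proof -
          have "u j (g \<otimes> x) = (\<Sum>a<r0. B $$ (a,j) * (\<Sum>i<r0. \<rho> x $$ (i,a) * w i g))"
            unfolding u_def using tr[OF x _ g] by simp
          also have "\<dots> = (\<Sum>i<r0. (\<Sum>a<r0. \<rho> x $$ (i,a) * B $$ (a,j)) * w i g)"
            by (simp add: sum_distrib_left sum_distrib_right mult_ac) (rule sum.swap)
          also have "\<dots> = (\<Sum>i<r0. (\<Sum>b<s. B $$ (i,b) * d $v b) * w i g)" by (intro sum.cong) (auto simp: ent)
          also have "\<dots> = (\<Sum>b<s. d $v b * u b g)"
            unfolding u_def by (simp add: sum_distrib_left sum_distrib_right mult_ac) (rule sum.swap)
          finally show ?thesis .
        qed
        then show "\<exists>c. \<forall>g\<in>carrier G. u j (g \<otimes> x) = (\<Sum>i<s. c i * u i g)" by blast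
      qed (rule ext, simp add: u_def)
      with min s show ?thesis by blast
    qed
  qed
  then have orth: "csum (\<lambda>g. w j g * cnj (\<rho> g $$ (i,j))) = 0" if "i < r0" "j < r0" for i j
    using w that unfolding stable_family_def by blast
  obtain j g where jg: "j < r0" "g \<in> carrier G" "w j g \<noteq> 0" using w by (auto simp: stable_family_def)
  \<comment> \<open>Evaluating the translation formula at the identity writes \<open>w j\<close>
    through coefficients of \<open>\<rho>\<close>. Its pairing with itself is therefore zero,
    although it is a sum of squared absolute values.\<close>
  have "csum (\<lambda>g. w j g * cnj (w j g)) = csum (\<lambda>g. \<Sum>i<r0. cnj (w i \<one>) * (w j g * cnj (\<rho> g $$ (i,j))))"
  proof (rule csum_cong)
    fix g assume g: "g \<in> carrier G"
    have "w j g = (\<Sum>i<r0. \<rho> g $$ (i,j) * w i \<one>)" using tr[OF g jg(1) one_closed] g by simp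
    then have "cnj (w j g) = (\<Sum>i<r0. cnj (\<rho> g $$ (i,j)) * cnj (w i \<one>))" by simp
    then show "w j g * cnj (w j g) = (\<Sum>i<r0. cnj (w i \<one>) * (w j g * cnj (\<rho> g $$ (i,j))))"
      by (simp add: sum_distrib_left mult_ac)
  qed
  also have "\<dots> = 0" using orth jg by (simp add: csum_sum csum_cmult)
  finally have "complex_of_real (\<Sum>C\<in>rcosets K. (cmod (w j (SOME x. x \<in> C)))\<^sup>2) = 0"
    unfolding csum_def of_real_sum complex_norm_square .
  then have "(\<Sum>C\<in>rcosets K. (cmod (w j (SOME x. x \<in> C)))\<^sup>2) = 0" by (simp only: of_real_eq_0_iff)
  then have "\<forall>C\<in>rcosets K. w j (SOME x. x \<in> C) = 0" using fin_index by (simp add: sum_nonneg_eq_0_iff)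
  moreover have "K #> g \<in> rcosets K" using jg by (auto simp: RCOSETS_def)
  ultimately have "w j g = 0" using coset_inv_some[OF ci[OF jg(1)] jg(2)] by auto
  with jg show False by simp
qed

section \<open>Isomorphism classes and the sum of squares\<close>

lemma rep_iso_refl: "krep n \<rho> \<Longrightarrow> rep_iso G n \<rho> \<rho>"
  unfolding rep_iso_def
  by (intro bexI[of _ "1\<^sub>m n"])
    (auto simp: invertible_mat_def inverts_mat_def dest: krepD(1) intro!: exI[of _ "1\<^sub>m n"])

lemma invertible_matE:
  assumes "P \<in> carrier_mat n n" "invertible_mat P"
  obtains Q where "Q \<in> carrier_mat n n" "P * Q = 1\<^sub>m n" "Q * P = 1\<^sub>m n"
proof -
  obtain Q where PQ: "P * Q = 1\<^sub>m n" "Q * P = 1\<^sub>m (dim_row Q)"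
    using assms by (auto simp: invertible_mat_def inverts_mat_def)
  have "dim_col (P * Q) = n" "dim_col (Q * P) = dim_row Q" using PQ by auto
  then have Q: "Q \<in> carrier_mat n n" using assms(1) carrier_matD[OF assms(1)] by (intro carrier_matI) simp_all
  then show ?thesis using PQ by (intro that) simp_all
qed

lemma rep_iso_sym:
  assumes \<rho>: "krep n \<rho>" and \<sigma>: "krep n \<sigma>" and iso: "rep_iso G n \<rho> \<sigma>"
  shows "rep_iso G n \<sigma> \<rho>"
proof -
  obtain P where P: "P \<in> carrier_mat n n" "invertible_mat P" "\<And>g. g \<in> carrier G \<Longrightarrow> P * \<rho> g = \<sigma> g * P"
    using iso by (auto simp: rep_iso_def)
  obtain Q where Q: "Q \<in> carrier_mat n n" and PQ: "P * Q = 1\<^sub>m n" "Q * P = 1\<^sub>m n"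
    using invertible_matE[OF P(1,2)] .
  have "Q * \<sigma> g = \<rho> g * Q" if g: "g \<in> carrier G" for g
  proof -
    note s = krepD(1)[OF \<sigma> g] and r = krepD(1)[OF \<rho> g]
    have "Q * \<sigma> g = Q * (\<sigma> g * (P * Q))" using PQ s Q by simp
    also have "\<dots> = Q * ((\<sigma> g * P) * Q)" using assoc_mult_mat[OF s P(1) Q] by simp
    also have "\<dots> = Q * ((P * \<rho> g) * Q)" using P(3)[OF g] by simp
    also have "\<dots> = Q * (P * (\<rho> g * Q))" using assoc_mult_mat[OF P(1) r Q] by simp
    also have "\<dots> = (Q * P) * (\<rho> g * Q)" using assoc_mult_mat[OF Q P(1) mult_carrier_mat[OF r Q]] by simp
    also have "\<dots> = \<rho> g * Q" using PQ(2) Q left_mult_one_mat[OF mult_carrier_mat[OF r Q]] by simp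
    finally show ?thesis .
  qed
  moreover have "invertible_mat Q" using PQ Q P(1) by (auto simp: invertible_mat_def inverts_mat_def)
  ultimately show ?thesis using Q by (auto simp: rep_iso_def)
qed

lemma invertible_mat_mult:
  assumes "P \<in> carrier_mat n n" "P' \<in> carrier_mat n n" "invertible_mat P" "invertible_mat (P' :: complex mat)"
  shows "invertible_mat (P * P')"
proof -
  obtain Q where Q: "Q \<in> carrier_mat n n" "P * Q = 1\<^sub>m n" "Q * P = 1\<^sub>m n"
    using invertible_matE[OF assms(1,3)] .
  obtain Q' where Q': "Q' \<in> carrier_mat n n" "P' * Q' = 1\<^sub>m n" "Q' * P' = 1\<^sub>m n"
    using invertible_matE[OF assms(2,4)] .
  have "(P * P') * (Q' * Q) = P * ((P' * Q') * Q)"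
    using assms Q(1) Q'(1) by (simp add: assoc_mult_mat[of _ n n _ n _ n])
  moreover have "(Q' * Q) * (P * P') = Q' * ((Q * P) * P')"
    using assms Q(1) Q'(1) by (simp add: assoc_mult_mat[of _ n n _ n _ n])
  ultimately have "(P * P') * (Q' * Q) = 1\<^sub>m n" "(Q' * Q) * (P * P') = 1\<^sub>m n"
    using Q Q' assms by simp_all
  then show ?thesis
    using assms Q(1) Q'(1) unfolding invertible_mat_def inverts_mat_def by auto
qed

lemma rep_iso_trans:
  assumes \<rho>: "krep n \<rho>" and \<sigma>: "krep n \<sigma>" and \<tau>: "krep n \<tau>"
    and "rep_iso G n \<rho> \<sigma>" "rep_iso G n \<sigma> \<tau>"
  shows "rep_iso G n \<rho> \<tau>"
proof -
  obtain P where P: "P \<in> carrier_mat n n" "invertible_mat P" "\<And>g. g \<in> carrier G \<Longrightarrow> P * \<rho> g = \<sigma> g * P"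
    using assms(4) by (auto simp: rep_iso_def)
  obtain Q where Q: "Q \<in> carrier_mat n n" "invertible_mat Q" "\<And>g. g \<in> carrier G \<Longrightarrow> Q * \<sigma> g = \<tau> g * Q"
    using assms(5) by (auto simp: rep_iso_def)
  have "Q * P * \<rho> g = \<tau> g * (Q * P)" if g: "g \<in> carrier G" for g
    using assoc_mult_mat[OF Q(1) P(1) krepD(1)[OF \<rho> g]] P(3)[OF g] Q(3)[OF g]
      assoc_mult_mat[OF Q(1) krepD(1)[OF \<sigma> g] P(1)] assoc_mult_mat[OF krepD(1)[OF \<tau> g] Q(1) P(1)] by simp
  then show ?thesis using P Q invertible_mat_mult[of Q n P] by (auto simp: rep_iso_def intro!: bexI[of _ "Q * P"])
qed

definition iso_rel :: "nat \<Rightarrow> (('a \<Rightarrow> complex mat) \<times> ('a \<Rightarrow> complex mat)) set" where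
  "iso_rel n = {(\<rho>,\<sigma>). irred n \<rho> \<and> irred n \<sigma> \<and> rep_iso G n \<rho> \<sigma>}"

lemma equiv_iso_rel: "equiv {\<rho>. irred n \<rho>} (iso_rel n)"
proof (rule equivI)
  show "refl_on {\<rho>. irred n \<rho>} (iso_rel n)"
    unfolding refl_on_def iso_rel_def using rep_iso_refl irredD(1) by auto
  show "sym (iso_rel n)" unfolding sym_def iso_rel_def using rep_iso_sym irredD(1) by auto
  show "trans (iso_rel n)" unfolding trans_def iso_rel_def using rep_iso_trans irredD(1) by blast
qed (auto simp: iso_rel_def)

definition iso_classes :: "nat \<Rightarrow> ('a \<Rightarrow> complex mat) set set" where
  "iso_classes n = {\<rho>. irred n \<rho>} // iso_rel n"

lemma some_in_class:
  assumes "C \<in> iso_classes n"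
  shows "(SOME \<rho>. \<rho> \<in> C) \<in> C" "irred n (SOME \<rho>. \<rho> \<in> C)"
proof -
  have "C \<noteq> {}" "C \<subseteq> {\<rho>. irred n \<rho>}"
    using assms in_quotient_imp_non_empty[OF equiv_iso_rel] in_quotient_imp_subset[OF equiv_iso_rel]
    unfolding iso_classes_def by blast+
  then have "(SOME \<rho>. \<rho> \<in> C) \<in> C" by (simp add: some_in_eq)
  then show "(SOME \<rho>. \<rho> \<in> C) \<in> C" "irred n (SOME \<rho>. \<rho> \<in> C)"
    using \<open>C \<subseteq> {\<rho>. irred n \<rho>}\<close> by blast+
qed

lemma class_reps:
  assumes "C \<in> iso_classes n" "C' \<in> iso_classes n" "rep_iso G n (SOME \<rho>. \<rho> \<in> C) (SOME \<rho>. \<rho> \<in> C')"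
  shows "C = C'"
proof (rule ccontr)
  assume "C \<noteq> C'"
  then have "C \<inter> C' = {}" using quotient_disj[OF equiv_iso_rel] assms unfolding iso_classes_def by blast
  moreover have "(SOME \<rho>. \<rho> \<in> C, SOME \<rho>. \<rho> \<in> C') \<in> iso_rel n"
    using assms some_in_class by (auto simp: iso_rel_def)
  then have "(SOME \<rho>. \<rho> \<in> C') \<in> C"
    using in_quotient_imp_closed[OF equiv_iso_rel _ some_in_class(1)[OF assms(1)]] assms(1)
    unfolding iso_classes_def by blast
  ultimately show False using some_in_class(1)[OF assms(2)] by blast
qed

definition class_rep :: "nat \<times> ('a \<Rightarrow> complex mat) set \<Rightarrow> nat \<times> ('a \<Rightarrow> complex mat)" where
  "class_rep z = (fst z, SOME \<rho>. \<rho> \<in> snd z)"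

lemma inj_class_rep: "inj_on class_rep (SIGMA n:UNIV. iso_classes n)"
proof (rule inj_onI)
  fix x y assume x: "x \<in> (SIGMA n:UNIV. iso_classes n)" and y: "y \<in> (SIGMA n:UNIV. iso_classes n)"
    and eq: "class_rep x = class_rep y"
  then obtain n C C' where xy: "x = (n,C)" "y = (n,C')" "C \<in> iso_classes n" "C' \<in> iso_classes n"
    by (auto simp: class_rep_def)
  then have "rep_iso G n (SOME \<rho>. \<rho> \<in> C) (SOME \<rho>. \<rho> \<in> C')"
    using eq rep_iso_refl irredD(1) some_in_class(2) by (simp add: class_rep_def)
  then show "x = y" using class_reps xy by blast
qed

lemma class_sum_squares_le:
  assumes "finite F" "F \<subseteq> (SIGMA n:UNIV. iso_classes n)"
  shows "(\<Sum>(n,C)\<in>F. n\<^sup>2) \<le> N_idx"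
proof -
  have "(\<Sum>(n,C)\<in>F. n\<^sup>2) = (\<Sum>(n,\<rho>)\<in>class_rep ` F. n\<^sup>2)"
    using inj_on_subset[OF inj_class_rep assms(2)]
    by (subst sum.reindex) (auto simp: class_rep_def case_prod_beta)
  also have "\<dots> \<le> N_idx"
  proof (rule sum_squares_le)
    show "finite (class_rep ` F)" using assms by simp
    show "irred n \<rho>" if "(n,\<rho>) \<in> class_rep ` F" for n \<rho>
      using that assms some_in_class(2) by (auto simp: class_rep_def)
    show "\<rho> = \<sigma>" if mem: "(n,\<rho>) \<in> class_rep ` F" "(n,\<sigma>) \<in> class_rep ` F" and iso: "rep_iso G n \<rho> \<sigma>" for n \<rho> \<sigma>
    proof -
      obtain z z' where z: "z \<in> F" "(n,\<rho>) = class_rep z" "z' \<in> F" "(n,\<sigma>) = class_rep z'"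
        using mem by (metis imageE)
      obtain C C' where C: "(n,C) \<in> F" "\<rho> = (SOME \<rho>. \<rho> \<in> C)" "(n,C') \<in> F" "\<sigma> = (SOME \<rho>. \<rho> \<in> C')"
        using z by (cases z, cases z') (auto simp: class_rep_def)
      then have "C = C'" using class_reps[of C n C'] iso assms by auto
      then show ?thesis using C by simp
    qed
  qed
  finally show ?thesis .
qed

text \<open>Every class contributes at least 1 to the sum of squares, so any finite set of classes
  has at most \<open>N_idx\<close> elements.\<close>

lemma finite_all_classes: "finite (SIGMA n:UNIV. iso_classes n)"
proof (rule finite_if_finite_subsets_card_bdd[of _ N_idx, THEN conjunct1])
  fix F assume F: "F \<subseteq> (SIGMA n:UNIV. iso_classes n)" "finite F"
  have "card F = (\<Sum>z\<in>F. 1)" by simp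
  also have "\<dots> \<le> (\<Sum>(n,C)\<in>F. n\<^sup>2)"
  proof (rule sum_mono)
    fix z assume "z \<in> F"
    then obtain n C where z: "z = (n,C)" "C \<in> iso_classes n" using F by auto
    then have "0 < n" using some_in_class(2) irredD(2) by blast
    then show "1 \<le> (case z of (n,C) \<Rightarrow> n\<^sup>2)" using z by simp
  qed
  also have "\<dots> \<le> N_idx" using class_sum_squares_le F by blast
  finally show "card F \<le> N_idx" .
qed

text \<open>If the sum fell short, the conditions of orthogonality to all coefficients of chosen
  representatives would be fewer than the cosets, so a nonzero function \<open>H\<close> on the
  cosets would satisfy them. Its right translates would form a stable family.\<close>

theorem class_sum_squares: "(\<Sum>(n,C)\<in>(SIGMA n:UNIV. iso_classes n). n\<^sup>2) = N_idx"
proof (rule ccontr)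
  let ?Z = "SIGMA n:UNIV. iso_classes n"
  let ?I = "SIGMA z:?Z. {..<fst z} \<times> {..<fst z}"
  let ?a = "\<lambda>C s. cnj (snd (class_rep (fst s)) (SOME x. x \<in> C) $$ snd s)"
  assume "\<not> ?thesis"
  then have "(\<Sum>(n,C)\<in>?Z. n\<^sup>2) < N_idx" using class_sum_squares_le[OF finite_all_classes] by simp
  moreover have "card ?I = (\<Sum>(n,\<rho>)\<in>?Z. n\<^sup>2)"
    using finite_all_classes by (simp add: card_SigmaI card_cartesian_product power2_eq_square case_prod_beta)
  ultimately obtain h where h: "\<exists>C\<in>rcosets K. h C \<noteq> 0"
      "\<forall>s\<in>?I. (\<Sum>C\<in>rcosets K. h C * ?a C s) = 0"
    using underdetermined[of ?I "rcosets K" ?a] fin_index finite_all_classes by auto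
  define H where "H g = h (K #> g)" for g
  have Hinv: "coset_inv H"
    unfolding coset_inv_def H_def
  proof (intro ballI)
    fix g k assume gk: "g \<in> carrier G" "k \<in> K"
    then have "K #> (k \<otimes> g) = (K #> k) #> g" using K_sub by (simp add: coset_mult_assoc subset_iff)
    also have "K #> k = K" using gk normal normal_imp_subgroup K_sub by (intro coset_join2) auto
    finally show "h (K #> (k \<otimes> g)) = h (K #> g)" by simp
  qed
  have coset_eq: "K #> (SOME x. x \<in> C) = C" if C: "C \<in> rcosets K" for C
    using some_coset[OF C] C repr_independence[OF _ _ normal_imp_subgroup[OF normal]]
    by (auto simp: RCOSETS_def)
  have csumH: "csum (\<lambda>g. H g * f g) = (\<Sum>C\<in>rcosets K. h C * f (SOME x. x \<in> C))" for f
    unfolding csum_def H_def by (intro sum.cong) (auto simp: coset_eq)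
  \<comment> \<open>The conditions were imposed on one representative of each class; conjugation by
    \<open>P\<close> carries them to every irreducible representation.\<close>
  have orth: "csum (\<lambda>g. H g * cnj (\<rho> g $$ (a,b))) = 0" if \<rho>: "irred n \<rho>" and ab: "a < n" "b < n" for n \<rho> a b
  proof -
    let ?C = "iso_rel n `` {\<rho>}"
    have C: "?C \<in> iso_classes n" unfolding iso_classes_def using \<rho> by (intro quotientI) simp
    define \<sigma> where "\<sigma> = (SOME \<rho>. \<rho> \<in> ?C)"
    have \<sigma>: "irred n \<sigma>" "rep_iso G n \<sigma> \<rho>"
      using some_in_class[OF C] rep_iso_sym[of n \<rho> \<sigma>] irredD(1) by (auto simp: \<sigma>_def iso_rel_def)
    have orth\<sigma>: "csum (\<lambda>g. H g * cnj (\<sigma> g $$ (c,d))) = 0" if "c < n" "d < n" for c d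
      using h(2)[rule_format, of "((n,?C),(c,d))"] C that by (auto simp: csumH class_rep_def \<sigma>_def)
    obtain P where P: "P \<in> carrier_mat n n" "invertible_mat P" "\<And>g. g \<in> carrier G \<Longrightarrow> P * \<sigma> g = \<rho> g * P"
      using \<sigma>(2) by (auto simp: rep_iso_def)
    obtain Q where Q: "Q \<in> carrier_mat n n" and PQ: "P * Q = 1\<^sub>m n" "Q * P = 1\<^sub>m n"
      using invertible_matE[OF P(1,2)] .
    have ent: "\<rho> g $$ (a,b) = (\<Sum>d<n. \<Sum>c<n. P $$ (a,c) * \<sigma> g $$ (c,d) * Q $$ (d,b))" if g: "g \<in> carrier G" for g
    proof -
      note s = krepD(1)[OF irredD(1)[OF \<sigma>(1)] g] and r = krepD(1)[OF irredD(1)[OF \<rho>] g]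
      have "\<rho> g = \<rho> g * (P * Q)" using PQ r by simp
      also have "\<dots> = (P * \<sigma> g) * Q" using assoc_mult_mat[OF r P(1) Q] P(3)[OF g] by simp
      finally have "\<rho> g $$ (a,b) = ((P * \<sigma> g) * Q) $$ (a,b)" by simp
      also have "\<dots> = (\<Sum>d<n. (P * \<sigma> g) $$ (a,d) * Q $$ (d,b))"
        by (rule mat_mult_entry[OF mult_carrier_mat[OF P(1) s] Q ab])
      also have "\<dots> = (\<Sum>d<n. (\<Sum>c<n. P $$ (a,c) * \<sigma> g $$ (c,d)) * Q $$ (d,b))"
        using ab by (intro sum.cong) (auto simp: mat_mult_entry[OF P(1) s])
      finally show ?thesis by (simp add: sum_distrib_right)
    qed
    have "csum (\<lambda>g. H g * cnj (\<rho> g $$ (a,b))) =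
        csum (\<lambda>g. \<Sum>d<n. \<Sum>c<n. cnj (P $$ (a,c)) * cnj (Q $$ (d,b)) * (H g * cnj (\<sigma> g $$ (c,d))))"
      by (intro csum_cong) (simp add: ent sum_distrib_left mult_ac)
    then show ?thesis using orth\<sigma> by (simp add: csum_sum csum_cmult)
  qed
  obtain e where e: "bij_betw e {..<N_idx} (rcosets K)"
    using ex_bij_betw_nat_finite[OF fin_index] by (auto simp: atLeast0LessThan)
  define x where "x i = (SOME x. x \<in> e i)" for i
  have ei: "e i \<in> rcosets K" if "i < N_idx" for i using e that by (auto simp: bij_betw_def)
  have xi: "x i \<in> carrier G" "K #> x i = e i" if "i < N_idx" for i
    using some_coset[OF ei[OF that]] coset_eq[OF ei[OF that]] by (auto simp: x_def)
  \<comment> \<open>Finitely many translates suffice: translating by \<open>k \<otimes> x i\<close>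
    with \<open>k\<close> in the normal subgroup \<open>K\<close> has the same effect on
    \<open>H\<close> as translating by \<open>x i\<close>.\<close>
  define w where "w i g = H (g \<otimes> x i)" for i g
  have trans: "\<exists>i<N_idx. \<forall>g\<in>carrier G. H (g \<otimes> y) = w i g" if y: "y \<in> carrier G" for y
  proof -
    have "K #> y \<in> e ` {..<N_idx}" using y bij_betw_imp_surj_on[OF e] by (auto simp: RCOSETS_def)
    then obtain i where i: "i < N_idx" "e i = K #> y" by auto
    have "y \<in> K #> x i" using xi(2)[OF i(1)] i(2) y normal_imp_subgroup[OF normal] rcos_self by auto
    then obtain k where k: "k \<in> K" "y = k \<otimes> x i" by (auto simp: r_coset_def)
    have "H (g \<otimes> y) = w i g" if g: "g \<in> carrier G" for g
    proof -
      have kc: "k \<in> carrier G" using k K_sub by auto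
      have "g \<otimes> y = (g \<otimes> k \<otimes> inv g) \<otimes> (g \<otimes> x i)" using g kc k xi(1)[OF i(1)]
        by (simp add: m_assoc inv_solve_left)
      moreover have "g \<otimes> k \<otimes> inv g \<in> K" using normal.inv_op_closed2[OF normal g k(1)] .
      moreover have "g \<otimes> x i \<in> carrier G" using g xi(1)[OF i(1)] by simp
      ultimately show ?thesis using Hinv unfolding coset_inv_def w_def by metis
    qed
    then show ?thesis using i by blast
  qed
  have "stable_family N_idx w"
    unfolding stable_family_def
  proof (intro conjI allI impI ballI)
    fix i assume i: "i < N_idx"
    show "coset_inv (w i)"
      using Hinv xi(1)[OF i] K_sub unfolding coset_inv_def w_def by (simp add: m_assoc subset_iff)
    fix n \<rho> a b assume \<rho>: "irred n \<rho>" and ab: "a < n" "b < n"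
    note r = krepD[OF irredD(1)[OF \<rho>]]
    \<comment> \<open>The translation is moved from \<open>H\<close> to the coefficient, where it
      yields a combination of coefficients of the same \<open>\<rho>\<close>.\<close>
    define F where "F g = H g * cnj ((\<rho> g * \<rho> (inv (x i))) $$ (a,b))" for g
    have F: "coset_inv F" using Hinv krep_coset_inv[OF irredD(1)[OF \<rho>]] by (auto simp: coset_inv_def F_def)
    have "csum (\<lambda>g. w i g * cnj (\<rho> g $$ (a,b))) = csum (\<lambda>g. F (g \<otimes> x i))"
      using xi(1)[OF i] by (intro csum_cong) (simp add: F_def w_def r(2)[symmetric] m_assoc)
    also have "\<dots> = csum F" using F xi(1)[OF i] by (rule csum_right)
    also have "\<dots> = csum (\<lambda>g. \<Sum>c<n. cnj (\<rho> (inv (x i)) $$ (c,b)) * (H g * cnj (\<rho> g $$ (a,c))))"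
      using xi(1)[OF i] ab by (intro csum_cong)
        (simp add: F_def mat_mult_entry[OF r(1) r(1)] sum_distrib_left mult_ac)
    also have "\<dots> = 0" using orth[OF \<rho>] ab by (simp add: csum_sum csum_cmult)
    finally show "csum (\<lambda>g. w i g * cnj (\<rho> g $$ (a,b))) = 0" .
  next
    obtain C where C: "C \<in> rcosets K" "h C \<noteq> 0" using h by blast
    define g where "g = (SOME x. x \<in> C)"
    have g: "g \<in> carrier G" "H g \<noteq> 0" using some_coset[OF C(1)] coset_eq[OF C(1)] C by (auto simp: g_def H_def)
    obtain i where "i < N_idx" "\<forall>g\<in>carrier G. H (g \<otimes> \<one>) = w i g" using trans[OF one_closed] by blast
    then show "\<exists>i<N_idx. \<exists>g\<in>carrier G. w i g \<noteq> 0" using g by auto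
  next
    fix y j assume y: "y \<in> carrier G" and j: "j < N_idx"
    have "y \<otimes> x j \<in> carrier G" using y xi(1)[OF j] by simp
    from trans[OF this] obtain i where i: "i < N_idx" "\<And>g. g \<in> carrier G \<Longrightarrow> H (g \<otimes> (y \<otimes> x j)) = w i g" by blast
    have "w j (g \<otimes> y) = (\<Sum>a<N_idx. (if a = i then 1 else 0) * w a g)" if g: "g \<in> carrier G" for g
      unfolding sum_single_mult[OF i(1)] i(2)[OF g, symmetric] using g y xi(1)[OF j] by (simp add: w_def m_assoc)
    then show "\<exists>c. \<forall>g\<in>carrier G. w j (g \<otimes> y) = (\<Sum>i<N_idx. c i * w i g)"
      by (intro exI[of _ "\<lambda>a. if a = i then 1 else 0"] ballI)
  qed
  then show False using no_stable_family by blast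
qed

end

section \<open>Simultaneous eigenvectors\<close>

text \<open>\<open>A'\<close> is the matrix of the restriction of \<open>A\<close> to
  \<open>W\<close> in the basis formed by the columns of \<open>B\<close>; an eigenvector of
  \<open>A'\<close> is carried by \<open>B\<close> to one of \<open>A\<close>.\<close>

lemma eigenvector_in_subspace:
  assumes W: "lin_closed n W" "W \<noteq> {0\<^sub>v n}" and A: "A \<in> carrier_mat n n" "\<And>w. w \<in> W \<Longrightarrow> A *\<^sub>v w \<in> W"
  obtains v c where "v \<in> W" "v \<noteq> 0\<^sub>v n" "A *\<^sub>v v = c \<cdot>\<^sub>v v"
proof -
  obtain s B where B: "B \<in> carrier_mat n s" "W = (\<lambda>c. B *\<^sub>v c) ` carrier_vec s"
      "\<And>c. c \<in> carrier_vec s \<Longrightarrow> B *\<^sub>v c = 0\<^sub>v n \<Longrightarrow> c = 0\<^sub>v s"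
    using lin_closed_basis[OF W(1)] by metis
  have "\<exists>d\<in>carrier_vec s. A *\<^sub>v (B *\<^sub>v unit_vec s j) = B *\<^sub>v d" for j
  proof -
    have "B *\<^sub>v unit_vec s j \<in> W" unfolding B(2) by auto
    then have "A *\<^sub>v (B *\<^sub>v unit_vec s j) \<in> W" by (rule A(2))
    then show ?thesis unfolding B(2) by auto
  qed
  then obtain f where f: "\<And>j. f j \<in> carrier_vec s" "\<And>j. A *\<^sub>v (B *\<^sub>v unit_vec s j) = B *\<^sub>v f j" by metis
  define A' where "A' = Matrix.mat s s (\<lambda>(i,j). f j $v i)"
  have A': "A' \<in> carrier_mat s s" by (simp add: A'_def)
  have eq: "A * B = B * A'"
  proof (rule eq_matI)
    fix i j assume "i < dim_row (B * A')" "j < dim_col (B * A')"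
    then have ij: "i < n" "j < s" using B(1) A' by auto
    have "(A * B) $$ (i,j) = ((A * B) *\<^sub>v unit_vec s j) $v i"
      using carrier_mat_mult_unit_vec[OF mult_carrier_mat[OF A(1) B(1)] ij] by simp
    also have "(A * B) *\<^sub>v unit_vec s j = A *\<^sub>v (B *\<^sub>v unit_vec s j)"
      by (rule assoc_mult_mat_vec[OF A(1) B(1)]) simp
    also have "\<dots> $v i = (\<Sum>a<s. B $$ (i,a) * f j $v a)"
      unfolding f(2) by (rule mat_vec_entry[OF B(1) f(1) ij(1)])
    also have "\<dots> = (B * A') $$ (i,j)" unfolding mat_mult_entry[OF B(1) A' ij] using ij by (simp add: A'_def)
    finally show "(A * B) $$ (i,j) = (B * A') $$ (i,j)" .
  qed (use A B(1) A' in auto)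
  have s: "s > 0"
  proof (rule ccontr)
    assume "\<not> s > 0"
    then have "B *\<^sub>v c = 0\<^sub>v n" if "c \<in> carrier_vec s" for c using B(1) that by (intro eq_vecI) (auto simp: scalar_prod_def)
    then have "W \<subseteq> {0\<^sub>v n}" unfolding B(2) by auto
    then show False using W by (auto simp: lin_closed_def)
  qed
  have "degree (char_poly A') = s" using degree_monic_char_poly[OF A'] by simp
  then have "\<not> constant (poly (char_poly A'))" using s by (simp add: constant_degree)
  then obtain c where "poly (char_poly A') c = 0" using fundamental_theorem_of_algebra by blast
  then have "eigenvalue A' c" using eigenvalue_root_char_poly[OF A'] by simp
  then obtain v where v: "v \<in> carrier_vec s" "v \<noteq> 0\<^sub>v s" "A' *\<^sub>v v = c \<cdot>\<^sub>v v"
    using A' by (auto simp: eigenvalue_def eigenvector_def)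
  show ?thesis
  proof (rule that[of "B *\<^sub>v v" c])
    show "B *\<^sub>v v \<in> W" using v B(2) by auto
    show "B *\<^sub>v v \<noteq> 0\<^sub>v n" using v B(3) by auto
    have "A *\<^sub>v (B *\<^sub>v v) = B *\<^sub>v (A' *\<^sub>v v)"
      using assoc_mult_mat_vec[OF A(1) B(1) v(1)] assoc_mult_mat_vec[OF B(1) A' v(1)] eq by simp
    then show "A *\<^sub>v (B *\<^sub>v v) = c \<cdot>\<^sub>v (B *\<^sub>v v)" using mult_mat_vec[OF B(1) v(1)] v(3) by simp
  qed
qed

lemma lin_closed_eigenspace:
  assumes "lin_closed n W" "A \<in> carrier_mat n n"
  shows "lin_closed n {w \<in> W. A *\<^sub>v w = c \<cdot>\<^sub>v w}"
  using assms unfolding lin_closed_def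
  by (auto simp: subset_iff mult_add_distrib_mat_vec[of _ n n] mult_mat_vec[of _ n n] smult_add_distrib_vec[of _ n]
      smult_smult_assoc mult.commute)

text \<open>Induction over the operators, passing to an eigenspace of each. Commutation is assumed
  on \<open>W\<close> only, because the centralizers in the upper bound are known to commute only on
  a simultaneous eigenspace of a smaller subgroup.\<close>

lemma common_eigenvector:
  assumes "finite F" "lin_closed n W" "W \<noteq> {0\<^sub>v n}"
    "\<And>A. A \<in> F \<Longrightarrow> A \<in> carrier_mat n n" "\<And>A w. A \<in> F \<Longrightarrow> w \<in> W \<Longrightarrow> A *\<^sub>v w \<in> W"
    "\<And>A B w. A \<in> F \<Longrightarrow> B \<in> F \<Longrightarrow> w \<in> W \<Longrightarrow> A *\<^sub>v (B *\<^sub>v w) = B *\<^sub>v (A *\<^sub>v w)"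
  shows "\<exists>v\<in>W. v \<noteq> 0\<^sub>v n \<and> (\<forall>A\<in>F. \<exists>c. A *\<^sub>v v = c \<cdot>\<^sub>v v)"
  using assms
proof (induction F arbitrary: W rule: finite_induct)
  case empty
  then show ?case by (auto simp: lin_closed_def)
next
  case (insert A F)
  have A: "A \<in> carrier_mat n n" using insert.prems by simp
  obtain v c where v: "v \<in> W" "v \<noteq> 0\<^sub>v n" "A *\<^sub>v v = c \<cdot>\<^sub>v v"
    using eigenvector_in_subspace[OF insert.prems(1,2) A] insert.prems(4) by blast
  let ?W = "{w \<in> W. A *\<^sub>v w = c \<cdot>\<^sub>v w}"
  have "\<exists>v\<in>?W. v \<noteq> 0\<^sub>v n \<and> (\<forall>A\<in>F. \<exists>c. A *\<^sub>v v = c \<cdot>\<^sub>v v)"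
  proof (rule insert.IH)
    show "lin_closed n ?W" using lin_closed_eigenspace[OF insert.prems(1) A] .
    show "?W \<noteq> {0\<^sub>v n}" using v by auto
    fix B w assume B: "B \<in> F" and w: "w \<in> ?W"
    have wn: "w \<in> carrier_vec n" using w insert.prems(1) by (auto simp: lin_closed_def)
    have "A *\<^sub>v (B *\<^sub>v w) = B *\<^sub>v (A *\<^sub>v w)" using insert.prems(5)[of A B w] B w by auto
    then have "A *\<^sub>v (B *\<^sub>v w) = c \<cdot>\<^sub>v (B *\<^sub>v w)" using w mult_mat_vec[OF insert.prems(3) wn] B by auto
    then show "B *\<^sub>v w \<in> ?W" using insert.prems(4)[of B w] B w by auto
  qed (use insert.prems in auto)
  then show ?case by auto
qed

section \<open>General bounds for the dimension of an irreducible representation\<close>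

context fin_quot_group
begin

lemma finite_rep_image:
  assumes "krep n \<rho>"
  shows "finite (\<rho> ` carrier G)"
proof (rule finite_subset)
  show "\<rho> ` carrier G \<subseteq> (\<lambda>C. \<rho> (SOME x. x \<in> C)) ` (rcosets K)"
  proof
    fix y assume "y \<in> \<rho> ` carrier G"
    then obtain g where g: "g \<in> carrier G" "y = \<rho> g" by auto
    then have "y = \<rho> (SOME x. x \<in> K #> g)" using coset_inv_some[OF krep_coset_inv[OF assms]] by simp
    then show "y \<in> (\<lambda>C. \<rho> (SOME x. x \<in> C)) ` (rcosets K)" using g by (auto simp: RCOSETS_def)
  qed
qed (use fin_index in auto)

text \<open>All operators are scalar by Schur's lemma, so in dimension at least 2 the
  \<open>(0,1)\<close> coefficient vanishes identically, against \<open>burnside\<close>.\<close>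

lemma irred_commuting_dim:
  assumes \<rho>: "irred n \<rho>" and comm: "\<And>g h. g \<in> carrier G \<Longrightarrow> h \<in> carrier G \<Longrightarrow> \<rho> g * \<rho> h = \<rho> h * \<rho> g"
  shows "n = 1"
proof (rule ccontr)
  assume "n \<noteq> 1"
  then have n: "0 < n" "1 < n" using irredD(2)[OF \<rho>] by auto
  have "\<rho> g $$ (0,1) = 0" if g: "g \<in> carrier G" for g
  proof -
    obtain c where "\<rho> g = c \<cdot>\<^sub>m 1\<^sub>m n" using schur_scalar[OF \<rho> krepD(1)[OF irredD(1)[OF \<rho>] g]] comm g by metis
    then show ?thesis using n by simp
  qed
  then have "(\<Sum>i<n. \<Sum>k<n. (if i = 0 \<and> k = 1 then 1 else 0) * \<rho> g $$ (i,k)) = 0" if "g \<in> carrier G" for g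
    using that n by (subst sum_double_single[of 0 n 1 n]) auto
  from burnside[OF \<rho> this n] show False by simp
qed

lemma entry_triple:
  fixes A B C :: "complex mat"
  assumes "A \<in> carrier_mat n n" "B \<in> carrier_mat n n" "C \<in> carrier_mat n n" "i < n" "j < n"
  shows "(A * B * C) $$ (i,j) = (\<Sum>a<n. \<Sum>b<n. A $$ (i,a) * C $$ (b,j) * B $$ (a,b))"
proof -
  have "(A * B * C) $$ (i,j) = (\<Sum>b<n. (\<Sum>a<n. A $$ (i,a) * B $$ (a,b)) * C $$ (b,j))"
    unfolding mat_mult_entry[OF mult_carrier_mat[OF assms(1,2)] assms(3-5)]
    using mat_mult_entry[OF assms(1,2,4)] by simp
  also have "\<dots> = (\<Sum>b<n. \<Sum>a<n. A $$ (i,a) * C $$ (b,j) * B $$ (a,b))"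
    by (simp only: sum_distrib_right) (intro sum.cong refl, simp add: mult_ac)
  finally show ?thesis by (subst sum.swap)
qed

text \<open>Conjugation by a suitable element, minus its eigenvalue on \<open>\<rho> w\<close>, removes \<open>\<rho> w\<close> from a
  linear relation and multiplies the coefficient of the identity by a nonzero number.\<close>

lemma identity_coefficient_zero:
  assumes \<rho>: "krep n \<rho>" and n: "0 < n" and C: "\<And>i. C i \<subseteq> carrier G" and W: "finite W"
    and sep: "\<And>w. w \<in> W \<Longrightarrow> w \<in> carrier G \<and>
      (\<exists>u\<in>C (lv w). \<exists>z. z \<noteq> 1 \<and> \<rho> u * \<rho> w * \<rho> (inv u) = z \<cdot>\<^sub>m \<rho> w)"
    and eig: "\<And>w j u. w \<in> W \<Longrightarrow> j \<le> (lv w :: nat) \<Longrightarrow> u \<in> C j \<Longrightarrow> \<exists>z. \<rho> u * \<rho> w * \<rho> (inv u) = z \<cdot>\<^sub>m \<rho> w"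
    and rel: "\<And>i j. i < n \<Longrightarrow> j < n \<Longrightarrow> c * 1\<^sub>m n $$ (i,j) + (\<Sum>w\<in>W. d w * \<rho> w $$ (i,j)) = 0"
  shows "c = 0"
  using W sep eig rel
proof (induction "card W" arbitrary: W c d)
  case 0
  then have "W = {}" by simp
  then show ?case using 0(5)[OF n n] n by simp
next
  case (Suc k)
  note r = krepD[OF \<rho>]
  have Wne: "W \<noteq> {}" using Suc(2) by auto
  \<comment> \<open>The term of least level is the one to remove: its separating conjugator
    \<open>u\<close> lies in \<open>C (lv w0)\<close> and so acts by a scalar on all other terms,
    whose levels are at least as large.\<close>
  obtain w0 where w0: "w0 \<in> W" "\<And>w. w \<in> W \<Longrightarrow> lv w0 \<le> lv w"
    using arg_min_if_finite[OF Suc(3) Wne, of lv] by (metis not_le)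
  obtain u z where u: "u \<in> C (lv w0)" "z \<noteq> 1" "\<rho> u * \<rho> w0 * \<rho> (inv u) = z \<cdot>\<^sub>m \<rho> w0"
    using Suc(4)[OF w0(1)] by blast
  have uc: "u \<in> carrier G" using u C by blast
  have "\<exists>z. \<rho> u * \<rho> w * \<rho> (inv u) = z \<cdot>\<^sub>m \<rho> w" if "w \<in> W" for w
    using Suc(5)[OF that w0(2)[OF that] u(1)] .
  then obtain e where e: "\<And>w. w \<in> W \<Longrightarrow> \<rho> u * \<rho> w * \<rho> (inv u) = e w \<cdot>\<^sub>m \<rho> w" by metis
  define e' where "e' w = (if w = w0 then z else e w)" for w
  have e': "\<rho> u * \<rho> w * \<rho> (inv u) = e' w \<cdot>\<^sub>m \<rho> w" if "w \<in> W" for w using e that u by (auto simp: e'_def)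
  have wc: "w \<in> carrier G" if "w \<in> W" for w using Suc(4) that by blast
  have "c * (1 - z) = 0"
  proof (rule Suc(1)[of "W - {w0}" "c * (1 - z)" "\<lambda>w. d w * (e' w - z)"])
    fix i j assume ij: "i < n" "j < n"
    note u1 = r(1)[OF uc] and u2 = r(1)[OF inv_closed[OF uc]]
    have one: "(\<Sum>a<n. \<Sum>b<n. \<rho> u $$ (i,a) * \<rho> (inv u) $$ (b,j) * 1\<^sub>m n $$ (a,b)) = 1\<^sub>m n $$ (i,j)"
      using entry_triple[OF u1 one_carrier_mat u2 ij] r(5)[OF uc] u1 by simp
    have wt: "(\<Sum>a<n. \<Sum>b<n. \<rho> u $$ (i,a) * \<rho> (inv u) $$ (b,j) * \<rho> w $$ (a,b)) = e' w * \<rho> w $$ (i,j)" if "w \<in> W" for w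
      using entry_triple[OF u1 r(1)[OF wc[OF that]] u2 ij] e'[OF that] ij r(1)[OF wc[OF that]] by simp
    have "0 = (\<Sum>a<n. \<Sum>b<n. \<rho> u $$ (i,a) * \<rho> (inv u) $$ (b,j) *
        (c * 1\<^sub>m n $$ (a,b) + (\<Sum>w\<in>W. d w * \<rho> w $$ (a,b))))"
      by (rule sym, intro sum.neutral ballI) (use Suc(6) in simp)
    also have "\<dots> = c * (\<Sum>a<n. \<Sum>b<n. \<rho> u $$ (i,a) * \<rho> (inv u) $$ (b,j) * 1\<^sub>m n $$ (a,b)) +
        (\<Sum>a<n. \<Sum>b<n. \<Sum>w\<in>W. d w * (\<rho> u $$ (i,a) * \<rho> (inv u) $$ (b,j) * \<rho> w $$ (a,b)))"
      by (simp only: distrib_left sum.distrib sum_distrib_left mult.left_commute mult.assoc)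
    also have "(\<Sum>a<n. \<Sum>b<n. \<Sum>w\<in>W. d w * (\<rho> u $$ (i,a) * \<rho> (inv u) $$ (b,j) * \<rho> w $$ (a,b))) =
        (\<Sum>w\<in>W. d w * (\<Sum>a<n. \<Sum>b<n. \<rho> u $$ (i,a) * \<rho> (inv u) $$ (b,j) * \<rho> w $$ (a,b)))"
      by (simp only: sum_distrib_left sum.swap[of _ _ W])
    also have "\<dots> = (\<Sum>w\<in>W. d w * (e' w * \<rho> w $$ (i,j)))" using wt by simp
    finally have 1: "c * 1\<^sub>m n $$ (i,j) + (\<Sum>w\<in>W. d w * (e' w * \<rho> w $$ (i,j))) = 0" using one by simp
    have 2: "z * (c * 1\<^sub>m n $$ (i,j) + (\<Sum>w\<in>W. d w * \<rho> w $$ (i,j))) = 0" using Suc(6)[OF ij] by simp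
    have "c * (1 - z) * 1\<^sub>m n $$ (i,j) + (\<Sum>w\<in>W. d w * (e' w - z) * \<rho> w $$ (i,j)) = 0"
    proof -
      have "(\<Sum>w\<in>W. d w * (e' w - z) * \<rho> w $$ (i,j)) =
          (\<Sum>w\<in>W. d w * (e' w * \<rho> w $$ (i,j))) - z * (\<Sum>w\<in>W. d w * \<rho> w $$ (i,j))"
        by (simp add: sum_subtractf[symmetric] sum_distrib_left algebra_simps)
      then have "c * (1 - z) * 1\<^sub>m n $$ (i,j) + (\<Sum>w\<in>W. d w * (e' w - z) * \<rho> w $$ (i,j)) =
          (c * 1\<^sub>m n $$ (i,j) + (\<Sum>w\<in>W. d w * (e' w * \<rho> w $$ (i,j)))) -
          z * (c * 1\<^sub>m n $$ (i,j) + (\<Sum>w\<in>W. d w * \<rho> w $$ (i,j)))"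
        by (simp add: algebra_simps)
      then show ?thesis using 1 2 by simp
    qed
    moreover have "(\<Sum>w\<in>W. d w * (e' w - z) * \<rho> w $$ (i,j)) = (\<Sum>w\<in>W-{w0}. d w * (e' w - z) * \<rho> w $$ (i,j))"
      using Suc(3) by (intro sum.mono_neutral_right) (auto simp: e'_def)
    ultimately show "c * (1 - z) * 1\<^sub>m n $$ (i,j) + (\<Sum>w\<in>W-{w0}. d w * (e' w - z) * \<rho> w $$ (i,j)) = 0" by simp
  qed (use Suc(2-5) w0(1) in auto)
  then show ?case using u(2) by simp
qed

text \<open>The matrices \<open>\<rho> t\<close> are linearly independent in a space of dimension
  \<open>n\<^sup>2\<close>. Multiplying a relation by \<open>\<rho> (inv t0)\<close> turns the term
  of \<open>t0\<close> into the identity, so only quotients of elements of \<open>T\<close> have to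
  be separated by conjugation.\<close>

lemma rep_dim_lower_bound:
  assumes \<rho>: "krep n \<rho>" and n: "0 < n" and C: "\<And>i. C i \<subseteq> carrier G" and T: "finite T" "T \<subseteq> carrier G"
    and sep: "\<And>t t'. t \<in> T \<Longrightarrow> t' \<in> T \<Longrightarrow> t \<noteq> t' \<Longrightarrow>
      \<exists>u\<in>C (lv (inv t \<otimes> t')). \<exists>z. z \<noteq> 1 \<and> \<rho> u * \<rho> (inv t \<otimes> t') * \<rho> (inv u) = z \<cdot>\<^sub>m \<rho> (inv t \<otimes> t')"
    and eig: "\<And>t t' j u. t \<in> T \<Longrightarrow> t' \<in> T \<Longrightarrow> t \<noteq> t' \<Longrightarrow> j \<le> (lv (inv t \<otimes> t') :: nat) \<Longrightarrow> u \<in> C j \<Longrightarrow>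
      \<exists>z. \<rho> u * \<rho> (inv t \<otimes> t') * \<rho> (inv u) = z \<cdot>\<^sub>m \<rho> (inv t \<otimes> t')"
  shows "card T \<le> n\<^sup>2"
proof (rule ccontr)
  assume "\<not> ?thesis"
  then have "card ({..<n} \<times> {..<n}) < card T" by (simp add: card_cartesian_product power2_eq_square)
  then obtain c where c: "\<exists>t\<in>T. c t \<noteq> 0" "\<forall>s\<in>{..<n}\<times>{..<n}. (\<Sum>t\<in>T. c t * \<rho> t $$ s) = 0"
    using underdetermined[of "{..<n} \<times> {..<n}" T "\<lambda>t s. \<rho> t $$ s"] T by auto
  then obtain t0 where t0: "t0 \<in> T" "c t0 \<noteq> 0" by blast
  note r = krepD[OF \<rho>]
  have tc: "t \<in> carrier G" if "t \<in> T" for t using that T by auto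
  let ?f = "\<lambda>t. inv t0 \<otimes> t"
  let ?W = "?f ` (T - {t0})"
  have inj: "inj_on ?f (T - {t0})" using tc t0 by (intro inj_onI) (simp add: l_cancel)
  have inv_f: "t0 \<otimes> (inv t0 \<otimes> t) = t" if "t \<in> T" for t using tc t0 that by (simp add: m_assoc[symmetric])
  have "c t0 = 0"
  proof (rule identity_coefficient_zero[where C = C and W = ?W and lv = lv and d = "\<lambda>w. c (t0 \<otimes> w)", OF \<rho> n C])
    show "finite ?W" using T by simp
    show "w \<in> carrier G \<and> (\<exists>u\<in>C (lv w). \<exists>z. z \<noteq> 1 \<and> \<rho> u * \<rho> w * \<rho> (inv u) = z \<cdot>\<^sub>m \<rho> w)" if w: "w \<in> ?W" for w
    proof -
      obtain t where t: "t \<in> T" "t0 \<noteq> t" "w = inv t0 \<otimes> t" using w by blast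
      then show ?thesis using sep[OF t0(1) t(1,2)] tc t0(1) by simp
    qed
    show "\<exists>z. \<rho> u * \<rho> w * \<rho> (inv u) = z \<cdot>\<^sub>m \<rho> w" if w: "w \<in> ?W" and "j \<le> lv w" "u \<in> C j" for w j u
    proof -
      obtain t where t: "t \<in> T" "t0 \<noteq> t" "w = inv t0 \<otimes> t" using w by blast
      then show ?thesis using eig[OF t0(1) t(1,2)] that by simp
    qed
    fix i j assume ij: "i < n" "j < n"
    note i0 = r(1)[OF inv_closed[OF tc[OF t0(1)]]]
    have "(\<Sum>a<n. \<rho> (inv t0) $$ (i,a) * (\<Sum>t\<in>T. c t * \<rho> t $$ (a,j))) = (\<Sum>t\<in>T. c t * \<rho> (inv t0 \<otimes> t) $$ (i,j))"
    proof -
      have "(\<Sum>a<n. \<rho> (inv t0) $$ (i,a) * (\<Sum>t\<in>T. c t * \<rho> t $$ (a,j))) =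
          (\<Sum>t\<in>T. c t * (\<Sum>a<n. \<rho> (inv t0) $$ (i,a) * \<rho> t $$ (a,j)))"
        by (simp only: sum_distrib_left sum.swap[of _ _ T] mult.left_commute)
      also have "\<dots> = (\<Sum>t\<in>T. c t * \<rho> (inv t0 \<otimes> t) $$ (i,j))"
        using tc t0 ij by (intro sum.cong refl) (simp add: r(2) mat_mult_entry[OF i0 r(1)])
      finally show ?thesis .
    qed
    moreover have "(\<Sum>a<n. \<rho> (inv t0) $$ (i,a) * (\<Sum>t\<in>T. c t * \<rho> t $$ (a,j))) = 0"
      using c(2) ij by (intro sum.neutral) auto
    ultimately have "(\<Sum>t\<in>T. c t * \<rho> (inv t0 \<otimes> t) $$ (i,j)) = 0" by simp
    moreover have "(\<Sum>t\<in>T. c t * \<rho> (inv t0 \<otimes> t) $$ (i,j)) =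
        c t0 * 1\<^sub>m n $$ (i,j) + (\<Sum>t\<in>T-{t0}. c t * \<rho> (inv t0 \<otimes> t) $$ (i,j))"
      using sum.remove[OF T(1) t0(1), of "\<lambda>t. c t * \<rho> (inv t0 \<otimes> t) $$ (i,j)"] tc[OF t0(1)] r(4) by simp
    moreover have "(\<Sum>w\<in>?W. c (t0 \<otimes> w) * \<rho> w $$ (i,j)) = (\<Sum>t\<in>T-{t0}. c t * \<rho> (inv t0 \<otimes> t) $$ (i,j))"
      using inv_f by (simp add: sum.reindex[OF inj])
    ultimately show "c t0 * 1\<^sub>m n $$ (i,j) + (\<Sum>w\<in>?W. c (t0 \<otimes> w) * \<rho> w $$ (i,j)) = 0" by simp
  qed
  with t0 show False by simp
qed

text \<open>With \<open>s\<close> the dimension of the common eigenspace, \<open>n \<le> card T1 * s\<close> because its translates span,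
  and \<open>n * s \<le> card T2\<close> because the restrictions of the operators \<open>\<rho> g\<close> to it span all linear maps.\<close>

lemma rep_dim_upper_bound:
  assumes \<rho>: "irred n \<rho>" and P: "P1 \<subseteq> carrier G" "P2 \<subseteq> carrier G"
    and v0: "v0 \<in> carrier_vec n" "v0 \<noteq> 0\<^sub>v n" "\<And>z. z \<in> P2 \<Longrightarrow> \<rho> z *\<^sub>v v0 = ch z \<cdot>\<^sub>v v0"
    and stable: "\<And>g v. g \<in> P1 \<Longrightarrow> v \<in> carrier_vec n \<Longrightarrow> (\<And>z. z \<in> P2 \<Longrightarrow> \<rho> z *\<^sub>v v = ch z \<cdot>\<^sub>v v) \<Longrightarrow>
       (\<And>z. z \<in> P2 \<Longrightarrow> \<rho> z *\<^sub>v (\<rho> g *\<^sub>v v) = ch z \<cdot>\<^sub>v (\<rho> g *\<^sub>v v))"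
    and T: "finite T1" "T1 \<subseteq> carrier G" "finite T2" "T2 \<subseteq> carrier G"
    and cover: "\<And>g. g \<in> carrier G \<Longrightarrow> \<exists>t\<in>T1. \<exists>p\<in>P1. g = t \<otimes> p"
       "\<And>g. g \<in> carrier G \<Longrightarrow> \<exists>t\<in>T2. \<exists>p\<in>P2. g = t \<otimes> p"
  shows "n\<^sup>2 \<le> card T1 * card T2"
proof -
  note r = krepD[OF irredD(1)[OF \<rho>]]
  define V where "V = {v \<in> carrier_vec n. \<forall>z\<in>P2. \<rho> z *\<^sub>v v = ch z \<cdot>\<^sub>v v}"
  have "lin_closed n V"
    unfolding lin_closed_def
  proof (intro conjI ballI allI)
    have "\<rho> z *\<^sub>v 0\<^sub>v n = 0\<^sub>v n" if "z \<in> P2" for z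
      using carrier_matD[OF r(1)[of z]] that P by (intro eq_vecI) (auto simp: scalar_prod_def)
    moreover have "c \<cdot>\<^sub>v 0\<^sub>v n = 0\<^sub>v n" for c :: complex by (intro eq_vecI) auto
    ultimately show "0\<^sub>v n \<in> V" by (simp add: V_def)
    fix v assume v: "v \<in> V"
    show "c \<cdot>\<^sub>v v \<in> V" for c
      using v r(1) P by (auto simp: V_def mult_mat_vec[of _ n n] smult_smult_assoc mult.commute subset_iff)
    fix w assume "w \<in> V"
    then show "v + w \<in> V"
      using v r(1) P by (auto simp: V_def mult_add_distrib_mat_vec[of _ n n] smult_add_distrib_vec[of _ n] subset_iff)
  qed (auto simp: V_def)
  then obtain s B where B: "B \<in> carrier_mat n s" "V = (\<lambda>c. B *\<^sub>v c) ` carrier_vec s"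
      "\<And>c. c \<in> carrier_vec s \<Longrightarrow> B *\<^sub>v c = 0\<^sub>v n \<Longrightarrow> c = 0\<^sub>v s"
    using lin_closed_basis by metis
  have col: "B *\<^sub>v unit_vec s a \<in> V" for a unfolding B(2) by auto
  have cole: "(B *\<^sub>v unit_vec s a) $v i = B $$ (i,a)" if "a < s" "i < n" for a i
    using carrier_mat_mult_unit_vec[OF B(1) that(2,1)] .
  have s: "s > 0"
  proof (rule ccontr)
    assume "\<not> s > 0"
    then have "B *\<^sub>v c = 0\<^sub>v n" if "c \<in> carrier_vec s" for c using B(1) that by (intro eq_vecI) (auto simp: scalar_prod_def)
    then have "V \<subseteq> {0\<^sub>v n}" unfolding B(2) by auto
    then show False using v0 by (auto simp: V_def)
  qed
  have fst: "n \<le> card T1 * s"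
  proof (rule ccontr)
    assume "\<not> ?thesis"
    then have "card (T1 \<times> {..<s}) < card {..<n}" using T by (simp add: card_cartesian_product)
    then obtain x where x: "\<exists>i\<in>{..<n}. x i \<noteq> 0" "\<forall>j\<in>T1\<times>{..<s}. (\<Sum>i<n. x i * (\<rho> (fst j) * B) $$ (i, snd j)) = 0"
      using underdetermined[of "T1 \<times> {..<s}" "{..<n}" "\<lambda>i j. (\<rho> (fst j) * B) $$ (i, snd j)"] T by auto
    \<comment> \<open>A functional \<open>x\<close> that kills the translates of the eigenspace by
      \<open>T1\<close> kills all its translates, as \<open>P1\<close> preserves it. The matrix with
      entries \<open>x i * B $$ (k,0)\<close> then annihilates every
      \<open>\<rho> g\<close>.\<close>
    have "(\<Sum>i<n. \<Sum>k<n. (x i * B $$ (k,0)) * \<rho> g $$ (i,k)) = 0" if g: "g \<in> carrier G" for g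
    proof -
      obtain t p where tp: "t \<in> T1" "p \<in> P1" "g = t \<otimes> p" using cover(1)[OF g] by blast
      have tpc: "t \<in> carrier G" "p \<in> carrier G" using tp T P by auto
      have "\<rho> p *\<^sub>v (B *\<^sub>v unit_vec s 0) \<in> V"
        using stable[OF tp(2)] col[of 0] r(1)[OF tpc(2)] by (auto simp: V_def)
      then obtain d where d: "d \<in> carrier_vec s" "\<rho> p *\<^sub>v (B *\<^sub>v unit_vec s 0) = B *\<^sub>v d" using B(2) by auto
      have "(\<Sum>i<n. \<Sum>k<n. (x i * B $$ (k,0)) * \<rho> g $$ (i,k)) = (\<Sum>i<n. x i * (\<rho> g *\<^sub>v (B *\<^sub>v unit_vec s 0)) $v i)"
      proof (intro sum.cong refl)
        fix i assume i: "i \<in> {..<n}"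
        have "(\<rho> g *\<^sub>v (B *\<^sub>v unit_vec s 0)) $v i = (\<Sum>k<n. \<rho> g $$ (i,k) * (B *\<^sub>v unit_vec s 0) $v k)"
          using i B(1) by (intro mat_vec_entry[OF r(1)[OF g]]) auto
        also have "\<dots> = (\<Sum>k<n. \<rho> g $$ (i,k) * B $$ (k,0))" using cole s by (intro sum.cong) auto
        finally show "(\<Sum>k<n. (x i * B $$ (k,0)) * \<rho> g $$ (i,k)) = x i * (\<rho> g *\<^sub>v (B *\<^sub>v unit_vec s 0)) $v i"
          by (simp add: sum_distrib_left mult_ac)
      qed
      also have "\<rho> g *\<^sub>v (B *\<^sub>v unit_vec s 0) = (\<rho> t * B) *\<^sub>v d"
        using r(2)[OF tpc] tp(3) d assoc_mult_mat_vec[OF r(1)[OF tpc(1)] r(1)[OF tpc(2)], of "B *\<^sub>v unit_vec s 0"]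
          assoc_mult_mat_vec[OF r(1)[OF tpc(1)] B(1) d(1)] B(1) by simp
      also have "(\<Sum>i<n. x i * ((\<rho> t * B) *\<^sub>v d) $v i) = (\<Sum>i<n. \<Sum>a<s. d $v a * (x i * (\<rho> t * B) $$ (i,a)))"
        using mat_vec_entry[OF mult_carrier_mat[OF r(1)[OF tpc(1)] B(1)] d(1)]
        by (intro sum.cong refl) (simp add: sum_distrib_left mult_ac del: index_mult_mat_vec)
      also have "\<dots> = (\<Sum>a<s. d $v a * (\<Sum>i<n. x i * (\<rho> t * B) $$ (i,a)))"
        by (subst sum.swap) (simp add: sum_distrib_left)
      also have "\<dots> = 0" using x(2) tp(1) by (intro sum.neutral) auto
      finally show ?thesis .
    qed
    then have *: "x i * B $$ (k,0) = 0" if "i < n" "k < n" for i k using burnside[OF \<rho>, of "\<lambda>i k. x i * B $$ (k,0)"] that by blast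
    then have "B *\<^sub>v unit_vec s 0 = 0\<^sub>v n"
      using x(1) B(1) s by (intro eq_vecI) (auto simp: cole simp del: index_mult_mat_vec)
    then have "unit_vec s 0 = (0\<^sub>v s :: complex Matrix.vec)" using B(3) by simp
    then have "unit_vec s 0 $v 0 = (0\<^sub>v s :: complex Matrix.vec) $v 0" by simp
    then show False using s by simp
  qed
  have snd: "n * s \<le> card T2"
  proof (rule ccontr)
    assume "\<not> ?thesis"
    then have "card T2 < card ({..<s} \<times> {..<n})" by (simp add: card_cartesian_product mult.commute)
    then obtain x where x: "\<exists>j\<in>{..<s}\<times>{..<n}. x j \<noteq> 0"
        "\<forall>t\<in>T2. (\<Sum>j\<in>{..<s}\<times>{..<n}. x j * (\<rho> t * B) $$ (snd j, fst j)) = 0"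
      using underdetermined[of T2 "{..<s} \<times> {..<n}" "\<lambda>j t. (\<rho> t * B) $$ (snd j, fst j)"] T by auto
    \<comment> \<open>As \<open>P2\<close> acts on the eigenspace by the scalars \<open>ch\<close>,
      the restriction of \<open>\<rho> g\<close> to it is a multiple of the restriction of some
      \<open>\<rho> t\<close> with \<open>t\<close> in \<open>T2\<close>; a functional that kills
      the latter kills all of them.\<close>
    have "(\<Sum>i<n. \<Sum>k<n. (\<Sum>a<s. x (a,i) * B $$ (k,a)) * \<rho> g $$ (i,k)) = 0" if g: "g \<in> carrier G" for g
    proof -
      obtain t p where tp: "t \<in> T2" "p \<in> P2" "g = t \<otimes> p" using cover(2)[OF g] by blast
      have tpc: "t \<in> carrier G" "p \<in> carrier G" using tp T P by auto
      have gB: "(\<rho> g * B) $$ (i,a) = ch p * (\<rho> t * B) $$ (i,a)" if ia: "i < n" "a < s" for i a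
      proof -
        note tB = mult_carrier_mat[OF r(1)[OF tpc(1)] B(1)]
        have Bv: "B *\<^sub>v unit_vec s a \<in> carrier_vec n" using B(1) by auto
        have "(\<rho> g * B) *\<^sub>v unit_vec s a = \<rho> t *\<^sub>v (\<rho> p *\<^sub>v (B *\<^sub>v unit_vec s a))"
          using assoc_mult_mat_vec[OF r(1)[OF g] B(1), of "unit_vec s a"] tp(3) r(2)[OF tpc]
            assoc_mult_mat_vec[OF r(1)[OF tpc(1)] r(1)[OF tpc(2)] Bv] by simp
        also have "\<rho> p *\<^sub>v (B *\<^sub>v unit_vec s a) = ch p \<cdot>\<^sub>v (B *\<^sub>v unit_vec s a)" using col tp(2) by (auto simp: V_def)
        also have "\<rho> t *\<^sub>v (ch p \<cdot>\<^sub>v (B *\<^sub>v unit_vec s a)) = ch p \<cdot>\<^sub>v ((\<rho> t * B) *\<^sub>v unit_vec s a)"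
          using mult_mat_vec[OF r(1)[OF tpc(1)] Bv] assoc_mult_mat_vec[OF r(1)[OF tpc(1)] B(1), of "unit_vec s a"] by simp
        finally have "((\<rho> g * B) *\<^sub>v unit_vec s a) $v i = (ch p \<cdot>\<^sub>v ((\<rho> t * B) *\<^sub>v unit_vec s a)) $v i" by simp
        also have "\<dots> = ch p * ((\<rho> t * B) *\<^sub>v unit_vec s a) $v i" using tB ia carrier_matD[OF tB] by simp
        finally show ?thesis
          using carrier_mat_mult_unit_vec[OF tB ia] carrier_mat_mult_unit_vec[OF mult_carrier_mat[OF r(1)[OF g] B(1)] ia] by simp
      qed
      have "(\<Sum>i<n. \<Sum>k<n. (\<Sum>a<s. x (a,i) * B $$ (k,a)) * \<rho> g $$ (i,k)) =
          (\<Sum>i<n. \<Sum>a<s. x (a,i) * (\<Sum>k<n. \<rho> g $$ (i,k) * B $$ (k,a)))"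
        by (simp add: sum_distrib_left sum_distrib_right mult_ac sum.swap[of _ "{..<s}"])
      also have "\<dots> = (\<Sum>i<n. \<Sum>a<s. x (a,i) * (\<rho> g * B) $$ (i,a))"
        by (intro sum.cong refl) (simp add: mat_mult_entry[OF r(1)[OF g] B(1)])
      also have "\<dots> = ch p * (\<Sum>a<s. \<Sum>i<n. x (a,i) * (\<rho> t * B) $$ (i,a))"
        by (subst sum.swap) (simp add: gB sum_distrib_left mult_ac)
      also have "(\<Sum>a<s. \<Sum>i<n. x (a,i) * (\<rho> t * B) $$ (i,a)) = 0"
        using x(2) tp(1) by (simp add: sum.cartesian_product case_prod_beta)
      finally show ?thesis by simp
    qed
    then have z: "(\<Sum>a<s. x (a,i) * B $$ (k,a)) = 0" if "i < n" "k < n" for i k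
      using burnside[OF \<rho>, of "\<lambda>i k. \<Sum>a<s. x (a,i) * B $$ (k,a)"] that by blast
    have "x (a,i) = 0" if ai: "a < s" "i < n" for a i
    proof -
      have "B *\<^sub>v Matrix.vec s (\<lambda>a. x (a,i)) = 0\<^sub>v n"
      proof (rule eq_vecI)
        fix k assume "k < dim_vec (0\<^sub>v n :: complex Matrix.vec)"
        then have k: "k < n" by simp
        then show "(B *\<^sub>v Matrix.vec s (\<lambda>a. x (a,i))) $v k = 0\<^sub>v n $v k"
          using z[OF ai(2) k] mat_vec_entry[OF B(1) _ k, of "Matrix.vec s (\<lambda>a. x (a,i))"] by (simp add: mult.commute)
      qed (use B(1) in auto)
      then have "Matrix.vec s (\<lambda>a. x (a,i)) = 0\<^sub>v s" by (intro B(3)) auto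
      then have "Matrix.vec s (\<lambda>a. x (a,i)) $v a = 0\<^sub>v s $v a" by simp
      then show ?thesis using ai by simp
    qed
    with x(1) show False by auto
  qed
  have "n\<^sup>2 * s \<le> (card T1 * s) * card T2"
    using mult_le_mono[OF fst snd] by (simp add: power2_eq_square mult_ac)
  then show ?thesis using s by (simp add: mult_ac)
qed

lemma rep_mult_vec:
  assumes "krep n \<rho>" "g \<in> carrier G" "h \<in> carrier G" "v \<in> carrier_vec n"
  shows "\<rho> (g \<otimes> h) *\<^sub>v v = \<rho> g *\<^sub>v (\<rho> h *\<^sub>v v)"
  using krepD(1,2)[OF assms(1)] assms by (simp add: assoc_mult_mat_vec[of _ n n _ n])

lemma rep_vec_closed:
  assumes "krep n \<rho>" "g \<in> carrier G" "v \<in> carrier_vec n"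
  shows "\<rho> g *\<^sub>v v \<in> carrier_vec n"
  using krepD(1)[OF assms(1,2)] assms(3) by (rule mult_mat_vec_carrier)

text \<open>On the \<open>\<psi>\<close>-eigenspace \<open>V\<close> of \<open>Z\<close> the
  commutators of \<open>P1\<close> with \<open>P2\<close> act trivially. Hence \<open>P1\<close>
  preserves \<open>V\<close>, and \<open>P2\<close> acts on \<open>V\<close> by commuting operators
  and has a common eigenvector there. Its eigenvalues \<open>l\<close> extend \<open>\<psi>\<close>,
  and \<open>P1\<close> preserves the eigenspace of \<open>l\<close>.\<close>

lemma dim_upper_bound_central_pair:
  assumes \<rho>: "irred n \<rho>" and P1: "subgroup P1 G" and P2: "subgroup P2 G" and sub: "Z \<subseteq> P2" "P2 \<subseteq> P1"
    and v0: "v0 \<in> carrier_vec n" "v0 \<noteq> 0\<^sub>v n" "\<And>z. z \<in> Z \<Longrightarrow> \<rho> z *\<^sub>v v0 = \<psi> z \<cdot>\<^sub>v v0"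
    and comm: "\<And>g h. g \<in> P1 \<Longrightarrow> h \<in> P2 \<Longrightarrow> g \<otimes> h \<otimes> inv g \<otimes> inv h \<in> Z \<and> \<psi> (g \<otimes> h \<otimes> inv g \<otimes> inv h) = 1"
    and T: "finite T1" "T1 \<subseteq> carrier G" "finite T2" "T2 \<subseteq> carrier G"
    and cover: "\<And>g. g \<in> carrier G \<Longrightarrow> \<exists>t\<in>T1. \<exists>p\<in>P1. g = t \<otimes> p"
       "\<And>g. g \<in> carrier G \<Longrightarrow> \<exists>t\<in>T2. \<exists>p\<in>P2. g = t \<otimes> p"
  shows "n\<^sup>2 \<le> card T1 * card T2"
proof -
  note kr = irredD(1)[OF \<rho>]
  note r = krepD[OF kr]
  have P1c: "P1 \<subseteq> carrier G" and P2c: "P2 \<subseteq> carrier G" using P1 P2 subgroup.subset by blast+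
  have Zc: "Z \<subseteq> carrier G" using sub P2c by blast
  define V where "V = {v \<in> carrier_vec n. \<forall>z\<in>Z. \<rho> z *\<^sub>v v = \<psi> z \<cdot>\<^sub>v v}"
  have Vlin: "lin_closed n V"
    unfolding lin_closed_def
  proof (intro conjI ballI allI)
    show "V \<subseteq> carrier_vec n" by (auto simp: V_def)
    have "\<rho> z *\<^sub>v 0\<^sub>v n = \<psi> z \<cdot>\<^sub>v 0\<^sub>v n" if "z \<in> Z" for z
      using carrier_matD[OF r(1)[of z]] that Zc by (intro eq_vecI) (auto simp: scalar_prod_def)
    then show "0\<^sub>v n \<in> V" by (simp add: V_def)
    fix v assume v: "v \<in> V"
    have "\<rho> z *\<^sub>v (c \<cdot>\<^sub>v v) = \<psi> z \<cdot>\<^sub>v (c \<cdot>\<^sub>v v)" if "z \<in> Z" for z c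
      using v that mult_mat_vec[OF r(1)[of z], of v c] Zc by (auto simp: V_def smult_smult_assoc mult.commute)
    then show "c \<cdot>\<^sub>v v \<in> V" for c using v by (auto simp: V_def)
    fix w assume w: "w \<in> V"
    have "\<rho> z *\<^sub>v (v + w) = \<psi> z \<cdot>\<^sub>v (v + w)" if "z \<in> Z" for z
      using v w that mult_add_distrib_mat_vec[OF r(1)[of z], of v w] Zc smult_add_distrib_vec[of v n w "\<psi> z"]
      by (auto simp: V_def)
    then show "v + w \<in> V" using v w by (auto simp: V_def)
  qed
  have VD: "v \<in> carrier_vec n" "\<And>z. z \<in> Z \<Longrightarrow> \<rho> z *\<^sub>v v = \<psi> z \<cdot>\<^sub>v v" if "v \<in> V" for v using that by (auto simp: V_def)
  have smult_comm: "\<rho> g *\<^sub>v (c \<cdot>\<^sub>v v) = c \<cdot>\<^sub>v (\<rho> g *\<^sub>v v)" if "g \<in> carrier G" "v \<in> carrier_vec n" for g c v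
    using mult_mat_vec[OF r(1)[OF that(1)] that(2)] .
  have one_smult: "1 \<cdot>\<^sub>v v = v" for v :: "complex Matrix.vec" by (intro eq_vecI) auto
  \<comment> \<open>With \<open>c\<close> the commutator of \<open>inv g\<close> and
    \<open>z\<close>, one has \<open>z \<otimes> g = g \<otimes> (c \<otimes> z)\<close>, and
    \<open>c\<close> fixes the vector \<open>\<rho> z *\<^sub>v v\<close> of
    \<open>V\<close>.\<close>
  have swap: "\<rho> z *\<^sub>v (\<rho> g *\<^sub>v v) = \<rho> g *\<^sub>v (\<rho> z *\<^sub>v v)"
    if g: "g \<in> P1" and z: "z \<in> P2" and zv: "\<rho> z *\<^sub>v v \<in> V" and v: "v \<in> carrier_vec n" for g z v
  proof -
    have gc: "g \<in> carrier G" and zc: "z \<in> carrier G" using g z P1c P2c by blast+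
    have ig: "inv g \<in> P1" using subgroup.m_inv_closed[OF P1 g] .
    define c where "c = inv g \<otimes> z \<otimes> inv (inv g) \<otimes> inv z"
    have c: "c \<in> Z" "\<psi> c = 1" using comm[OF ig z] by (simp_all add: c_def)
    have cc: "c \<in> carrier G" using c Zc by blast
    have "z \<otimes> g = g \<otimes> (c \<otimes> z)"
    proof -
      have "c = inv g \<otimes> z \<otimes> g \<otimes> inv z" using gc by (simp add: c_def)
      moreover have "g \<otimes> (inv g \<otimes> z \<otimes> g \<otimes> inv z \<otimes> z) = z \<otimes> g"
        using gc zc by (simp add: m_assoc) (simp add: m_assoc[symmetric])
      ultimately show ?thesis by simp
    qed
    then have "\<rho> z *\<^sub>v (\<rho> g *\<^sub>v v) = \<rho> g *\<^sub>v (\<rho> c *\<^sub>v (\<rho> z *\<^sub>v v))"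
      using rep_mult_vec[OF kr zc gc v] rep_mult_vec[OF kr gc m_closed[OF cc zc] v] rep_mult_vec[OF kr cc zc v] by simp
    also have "\<rho> c *\<^sub>v (\<rho> z *\<^sub>v v) = \<rho> z *\<^sub>v v" using VD(2)[OF zv c(1)] c(2) one_smult by simp
    finally show ?thesis .
  qed
  have stab: "\<rho> g *\<^sub>v v \<in> V" if g: "g \<in> P1" and v: "v \<in> V" for g v
  proof -
    have gc: "g \<in> carrier G" using g P1c by blast
    have "\<rho> z *\<^sub>v (\<rho> g *\<^sub>v v) = \<psi> z \<cdot>\<^sub>v (\<rho> g *\<^sub>v v)" if z: "z \<in> Z" for z
    proof -
      have zv: "\<rho> z *\<^sub>v v = \<psi> z \<cdot>\<^sub>v v" using VD(2)[OF v z] .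
      have "\<rho> z *\<^sub>v v \<in> V" unfolding zv using Vlin v by (auto simp: lin_closed_def)
      from swap[OF g _ this VD(1)[OF v]] z sub show ?thesis
        unfolding zv using smult_comm[OF gc VD(1)[OF v]] by auto
    qed
    then show ?thesis using rep_vec_closed[OF kr gc VD(1)[OF v]] by (simp add: V_def)
  qed
  have "v0 \<in> V" using v0 by (simp add: V_def)
  then have Vne: "V \<noteq> {0\<^sub>v n}" using v0(2) by auto
  have "\<exists>v\<in>V. v \<noteq> 0\<^sub>v n \<and> (\<forall>A\<in>\<rho> ` P2. \<exists>c. A *\<^sub>v v = c \<cdot>\<^sub>v v)"
  proof (rule common_eigenvector[OF _ Vlin Vne])
    show "finite (\<rho> ` P2)" using finite_subset[OF image_mono[OF P2c] finite_rep_image[OF kr]] .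
    show "A \<in> carrier_mat n n" if "A \<in> \<rho> ` P2" for A using that r(1) P2c by auto
    show "A *\<^sub>v w \<in> V" if "A \<in> \<rho> ` P2" "w \<in> V" for A w using that stab sub by auto
    show "A *\<^sub>v (B *\<^sub>v w) = B *\<^sub>v (A *\<^sub>v w)" if "A \<in> \<rho> ` P2" "B \<in> \<rho> ` P2" "w \<in> V" for A B w
    proof -
      from that(1) obtain g where g: "A = \<rho> g" "g \<in> P2" by (rule imageE)
      from that(2) obtain h where h: "B = \<rho> h" "h \<in> P2" by (rule imageE)
      have gh: "g \<in> P1" "h \<in> P1" using g h sub by blast+
      show ?thesis using swap[OF gh(2) g(2) stab[OF gh(1) that(3)] VD(1)[OF that(3)]] unfolding g h .
    qed
  qed
  then obtain v1 where v1: "v1 \<in> V" "v1 \<noteq> 0\<^sub>v n" "\<And>z. z \<in> P2 \<Longrightarrow> \<exists>c. \<rho> z *\<^sub>v v1 = c \<cdot>\<^sub>v v1" by auto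
  then obtain l where l: "\<And>z. z \<in> P2 \<Longrightarrow> \<rho> z *\<^sub>v v1 = l z \<cdot>\<^sub>v v1" by metis
  \<comment> \<open>Since \<open>l\<close> agrees with \<open>\<psi>\<close> on \<open>Z\<close>,
    every vector with eigenvalues \<open>l\<close> under \<open>P2\<close> lies in \<open>V\<close>,
    where \<open>swap\<close> applies.\<close>
  have l\<psi>: "l z = \<psi> z" if z: "z \<in> Z" for z
  proof -
    have eq: "l z \<cdot>\<^sub>v v1 = \<psi> z \<cdot>\<^sub>v v1" using l[of z] VD(2)[OF v1(1) z] z sub by auto
    obtain i where i: "i < n" "v1 $v i \<noteq> 0"
    proof (rule ccontr)
      assume "\<not> thesis"
      then have "\<forall>i<n. v1 $v i = 0" using that by blast
      then have "v1 = 0\<^sub>v n" using VD(1)[OF v1(1)] by (intro eq_vecI) auto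
      then show False using v1(2) by simp
    qed
    have "(l z \<cdot>\<^sub>v v1) $v i = (\<psi> z \<cdot>\<^sub>v v1) $v i" using eq by simp
    then show ?thesis using i VD(1)[OF v1(1)] by simp
  qed
  show ?thesis
  proof (rule rep_dim_upper_bound[OF \<rho> P1c P2c VD(1)[OF v1(1)] v1(2) l _ T cover])
    fix g v z assume g: "g \<in> P1" and v: "v \<in> carrier_vec n" and e: "\<And>z. z \<in> P2 \<Longrightarrow> \<rho> z *\<^sub>v v = l z \<cdot>\<^sub>v v" and z: "z \<in> P2"
    have vV: "v \<in> V" using v e l\<psi> sub by (auto simp: V_def)
    have "\<rho> z *\<^sub>v v \<in> V" using e[OF z] Vlin vV by (auto simp: lin_closed_def)
    from swap[OF g z this v] show "\<rho> z *\<^sub>v (\<rho> g *\<^sub>v v) = l z \<cdot>\<^sub>v (\<rho> g *\<^sub>v v)"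
      using e[OF z] smult_comm[of g v "l z"] g P1c v by auto
  qed
qed

end

no_notation Matrix.vec_index (infixl \<open>$\<close> 100)

section \<open>Discrete valuation rings through a uniformizer\<close>

text \<open>The properties of the ring from which the group theory proceeds: divisibility by powers
  of \<open>\<pi>\<close> takes the place of the valuation, and the size of the residue field is
  recorded by a system of representatives.\<close>

locale uniformized =
  fixes \<pi> :: "'o::idom" and q :: nat
  assumes pi_nz: "\<pi> \<noteq> 0" and pi_nonunit: "\<not> \<pi> dvd 1"
    and local: "\<And>x. \<not> \<pi> dvd x \<Longrightarrow> x dvd 1"
    and residues: "\<exists>R. finite R \<and> card R = q \<and> (\<forall>x. \<exists>!r. r \<in> R \<and> \<pi> dvd x - r)"
begin

lemma pi_pow_nz: "\<pi> ^ n \<noteq> 0" using pi_nz by simp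

lemma unit_iff: "x dvd 1 \<longleftrightarrow> \<not> \<pi> dvd x"
  using local pi_nonunit dvd_trans by blast

lemma unit_mult: "x dvd 1 \<Longrightarrow> y dvd 1 \<Longrightarrow> x * y dvd (1::'o)"
  by (metis mult_1_left mult_dvd_mono)

lemma pi_pow_dvd_iff: "\<pi> ^ a dvd \<pi> ^ b \<longleftrightarrow> a \<le> b"
proof
  assume dvd: "\<pi> ^ a dvd \<pi> ^ b"
  show "a \<le> b"
  proof (rule ccontr)
    assume "\<not> a \<le> b"
    then obtain c where "a = b + Suc c" by (metis add_Suc_right less_imp_Suc_add not_le)
    then have "\<pi> ^ b * \<pi> ^ Suc c dvd \<pi> ^ b * 1" using dvd by (simp add: power_add)
    then have "\<pi> ^ Suc c dvd 1" using pi_pow_nz by (simp only: dvd_mult_cancel_left) simp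
    then show False using pi_nonunit by (metis dvd_trans dvd_triv_left power_Suc)
  qed
qed (rule le_imp_power_dvd)

lemma unit_mult_dvd: "u dvd 1 \<Longrightarrow> \<pi> ^ n dvd u * x \<longleftrightarrow> \<pi> ^ n dvd x"
proof
  assume u: "u dvd 1" and d: "\<pi> ^ n dvd u * x"
  then obtain w where w: "1 = u * w" unfolding dvd_def by blast
  have "\<pi> ^ n dvd w * (u * x)" using d by (rule dvd_mult)
  also have "w * (u * x) = x" using w by (metis mult.assoc mult.commute mult_1_left)
  finally show "\<pi> ^ n dvd x" .
qed (rule dvd_mult)

lemma one_plus_unit: "\<pi> dvd x \<Longrightarrow> (1 + x) dvd 1"
  unfolding unit_iff using pi_nonunit dvd_diff[of \<pi> "1 + x" x] by auto

lemma pow_mult_dvd: "\<pi> ^ a dvd x \<Longrightarrow> \<pi> ^ b dvd y \<Longrightarrow> n \<le> a + b \<Longrightarrow> \<pi> ^ n dvd x * y"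
  using dvd_trans[OF le_imp_power_dvd[of n "a + b" \<pi>], of "x * y"] by (simp add: power_add mult_dvd_mono)

lemma pow_le_dvd: "\<pi> ^ a dvd x \<Longrightarrow> n \<le> a \<Longrightarrow> \<pi> ^ n dvd x"
  by (rule dvd_trans[OF le_imp_power_dvd])

lemma pi_cancel: "\<pi> ^ (a + b) dvd \<pi> ^ a * x \<longleftrightarrow> \<pi> ^ b dvd x"
  unfolding power_add using pi_pow_nz by (simp only: dvd_mult_cancel_left) simp

text \<open>Expansion in base \<open>\<pi>\<close>: a representative modulo the next power is
  \<open>r + \<pi> ^ n * s\<close> with one more digit \<open>s\<close>.\<close>

lemma residue_system_exists: "\<exists>R. finite R \<and> card R = q ^ n \<and> (\<forall>x. \<exists>!r. r \<in> R \<and> \<pi> ^ n dvd x - r)"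
proof (induction n)
  case 0
  show ?case by (intro exI[of _ "{0}"]) auto
next
  case (Suc n)
  obtain R where R: "finite R" "card R = q ^ n" "\<And>x. \<exists>!r. r \<in> R \<and> \<pi> ^ n dvd x - r" using Suc by blast
  obtain S where S: "finite S" "card S = q" "\<And>x. \<exists>!r. r \<in> S \<and> \<pi> dvd x - r" using residues by blast
  define f where "f = (\<lambda>(r,s). r + \<pi> ^ n * s)"
  have uniq: "r = r' \<and> s = s'" if "r \<in> R" "r' \<in> R" "s \<in> S" "s' \<in> S"
    and d: "\<pi> ^ Suc n dvd (r + \<pi> ^ n * s) - (r' + \<pi> ^ n * s')" for r r' s s'
  proof -
    have "\<pi> ^ n dvd (r + \<pi> ^ n * s) - (r' + \<pi> ^ n * s') - \<pi> ^ n * (s - s')"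
      using dvd_diff[OF pow_le_dvd[OF d, of n] dvd_triv_left] by simp
    then have "\<pi> ^ n dvd r - r'" by (simp add: algebra_simps)
    then have r: "r = r'" using R(3)[of r] that by auto
    then have "\<pi> ^ n * \<pi> dvd \<pi> ^ n * (s - s')" using d by (simp add: algebra_simps)
    then have "\<pi> dvd s - s'" using pi_pow_nz by (simp only: dvd_mult_cancel_left) simp
    then show ?thesis using r S(3)[of s] that by auto
  qed
  have inj: "inj_on f (R \<times> S)"
    unfolding f_def using uniq by (auto intro!: inj_onI)
  show ?case
  proof (intro exI[of _ "f ` (R \<times> S)"] conjI allI)
    show "finite (f ` (R \<times> S))" using R S by simp
    show "card (f ` (R \<times> S)) = q ^ Suc n" using R S inj by (simp add: card_image card_cartesian_product)
    fix x
    obtain r where r: "r \<in> R" "\<pi> ^ n dvd x - r" using R(3) by blast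
    then obtain y where y: "x - r = \<pi> ^ n * y" by (auto elim: dvdE)
    obtain s where s: "s \<in> S" "\<pi> dvd y - s" using S(3) by blast
    have "x - (r + \<pi> ^ n * s) = \<pi> ^ n * (y - s)" using y by (simp add: algebra_simps)
    then have d: "\<pi> ^ Suc n dvd x - (r + \<pi> ^ n * s)" using s(2) by (simp add: mult.commute mult_dvd_mono)
    show "\<exists>!t. t \<in> f ` (R \<times> S) \<and> \<pi> ^ Suc n dvd x - t"
    proof (intro ex1I[of _ "r + \<pi> ^ n * s"] conjI)
      show "r + \<pi> ^ n * s \<in> f ` (R \<times> S)" using r s by (auto simp: f_def)
      fix t assume t: "t \<in> f ` (R \<times> S) \<and> \<pi> ^ Suc n dvd x - t"
      then obtain r' s' where t': "t = r' + \<pi> ^ n * s'" "r' \<in> R" "s' \<in> S" by (auto simp: f_def)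
      have "\<pi> ^ Suc n dvd (x - (r' + \<pi> ^ n * s')) - (x - (r + \<pi> ^ n * s))" using dvd_diff[OF conjunct2[OF t] d] t'(1) by simp
      then have "\<pi> ^ Suc n dvd (r + \<pi> ^ n * s) - (r' + \<pi> ^ n * s')" by (simp add: algebra_simps)
      then show "t = r + \<pi> ^ n * s" using uniq[OF r(1) t'(2) s(1) t'(3)] t'(1) by simp
    qed (rule d)
  qed
qed

definition res :: "nat \<Rightarrow> 'o set" where
  "res n = (SOME R. finite R \<and> card R = q ^ n \<and> (\<forall>x. \<exists>!r. r \<in> R \<and> \<pi> ^ n dvd x - r))"

lemma res: "finite (res n)" "card (res n) = q ^ n" "\<exists>!r. r \<in> res n \<and> \<pi> ^ n dvd x - r"
  unfolding res_def using someI_ex[OF residue_system_exists[of n]] by auto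

lemma res_unique: "r \<in> res n \<Longrightarrow> r' \<in> res n \<Longrightarrow> \<pi> ^ n dvd r - r' \<Longrightarrow> r = r'"
  using res(3)[where x = r and n = n] by auto

lemma q_ge_2: "2 \<le> q"
proof -
  obtain r s where rs: "r \<in> res 1" "\<pi> dvd 0 - r" "s \<in> res 1" "\<pi> dvd 1 - s"    using res(3)[where x = 0 and n = 1] res(3)[where x = 1 and n = 1] by auto
  have "r \<noteq> s"
  proof
    assume "r = s"
    have "\<pi> dvd (1 - s) - (0 - r)" using dvd_diff[OF rs(4,2)] .
    then show False using \<open>r = s\<close> pi_nonunit by simp
  qed
  then have "card {r,s} = 2" by simp
  moreover have "card {r,s} \<le> card (res 1)" using rs by (intro card_mono res(1)) auto
  ultimately show ?thesis using res(2)[of 1] by simp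
qed

end

section \<open>Compact discrete valuation rings\<close>

lemma cgenideal_class_ring: "cgenideal (class_ring :: 'o::comm_ring_1 ring) a = {x. a dvd x}"
  by (auto simp: cgenideal_def dvd_def mult.commute)

text \<open>A nonzero non-unit has an irreducible divisor, whose ideal is maximal in a principal
  domain and hence is the only maximal ideal; so \<open>\<pi>\<close> divides it.\<close>

lemma dvr_uniformizer:
  assumes "discrete_valuation_ring TYPE('o::idom)"
  obtains \<pi> :: "'o::idom" where "\<pi> \<noteq> 0" "\<not> \<pi> dvd 1" "\<And>x. \<not> \<pi> dvd x \<Longrightarrow> x dvd 1"
    "max_ideal = {x. \<pi> dvd x}" "ideal (max_ideal :: 'o::idom set) class_ring"
proof -
  let ?R = "class_ring :: 'o ring"
  interpret R: principal_domain ?R using assms by (simp add: discrete_valuation_ring_def)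
  have cring: "cring ?R" using R.principal_domain_axioms principal_domain.axioms(1) domain.axioms(1) by blast
  have ex1: "\<exists>!M. maximalideal M ?R" and nf: "\<not> field ?R"
    using assms by (auto simp: discrete_valuation_ring_def)
  have M: "maximalideal max_ideal ?R" unfolding max_ideal_def using theI'[OF ex1] .
  interpret M: maximalideal max_ideal ?R by (rule M)
  obtain \<pi> :: 'o where pi: "max_ideal = {x. \<pi> dvd x}"
    using R.exists_gen[OF M.ideal_axioms] unfolding cgenideal_class_ring by auto
  have "\<pi> \<noteq> 0"
  proof
    assume "\<pi> = 0"
    then have "max_ideal = {\<zero>\<^bsub>?R\<^esub>}" using pi by auto
    then have "field ?R" using M cring.zeromaximalideal_fieldI[OF cring] by metis
    with nf show False by simp
  qed
  moreover have "\<not> \<pi> dvd 1"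
  proof
    assume "\<pi> dvd 1"
    then have "max_ideal = (UNIV :: 'o set)" unfolding pi using dvd_trans[OF _ one_dvd] by auto
    then show False using M.I_notcarr by simp
  qed
  moreover have "x dvd 1" if x: "\<not> \<pi> dvd x" for x
  proof (rule ccontr)
    assume nu: "\<not> x dvd 1"
    have "x \<noteq> 0" using x by auto
    then have x0: "x \<in> carrier ?R - {\<zero>\<^bsub>?R\<^esub>}" by simp
    have xu: "x \<notin> Units ?R"
    proof
      assume "x \<in> Units ?R"
      then obtain y where "y * x = 1" by (auto simp: Units_def)
      then show False using nu by (metis dvd_triv_right)
    qed
    obtain b where b: "ring_irreducible\<^bsub>?R\<^esub> b" "b divides\<^bsub>?R\<^esub> x"
      by (rule R.exists_irreducible_divisor[OF x0 xu])
    then have "maximalideal (PIdl\<^bsub>?R\<^esub> b) ?R" using R.irreducible_imp_maximalideal[of b] by simp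
    then have "{x. b dvd x} = {x. \<pi> dvd x}" using ex1 M unfolding cgenideal_class_ring pi by blast
    moreover have "b dvd x" using b(2) by (auto simp: factor_def)
    ultimately show False using x by blast
  qed
  ultimately show ?thesis using that pi M.ideal_axioms by blast
qed

lemma max_ideal_pow_eq:
  fixes \<pi> :: "'o::idom"
  assumes pi: "max_ideal = {x. \<pi> dvd x}"
  shows "max_ideal_pow k = {x. \<pi> ^ k dvd x}"
proof (induction k)
  case (Suc k)
  show ?case
  proof (intro equalityI subsetI)
    fix x :: 'o assume "x \<in> max_ideal_pow (Suc k)"
    then have "x \<in> ideal_prod (class_ring :: 'o ring) {x. \<pi> ^ k dvd x} {x. \<pi> dvd x}" using Suc pi by simp
    then show "x \<in> {x. \<pi> ^ Suc k dvd x}"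
      by (induction rule: ideal_prod.induct) (auto simp: mult.commute[of \<pi>] intro: mult_dvd_mono)
  next
    fix x :: 'o assume "x \<in> {x. \<pi> ^ Suc k dvd x}"
    then obtain y where "x = \<pi> ^ k * (\<pi> * y)" by (auto simp: dvd_def mult_ac)
    moreover have "\<pi> ^ k \<otimes>\<^bsub>(class_ring :: 'o ring)\<^esub> (\<pi> * y) \<in> ideal_prod (class_ring :: 'o ring) {x. \<pi> ^ k dvd x} {x. \<pi> dvd x}"
      by (rule ideal_prod.prod) auto
    ultimately show "x \<in> max_ideal_pow (Suc k)" using Suc pi by simp
  qed
qed simp

text \<open>Translates the ring-theoretic notions of residue field, residue characteristic and
  ramification index into divisibility by powers of \<open>\<pi>\<close>; compactness is what makes
  the residue field finite.\<close>

lemma compact_dvr_uniformized: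
  assumes dvr: "compact_dvr TYPE('o::{idom, ring_char_0, topological_space})"
  obtains \<pi> :: "'o::{idom, ring_char_0, topological_space}" where "uniformized \<pi> (residue_card TYPE('o))"
    "\<And>k. max_ideal_pow k = {x::'o. \<pi> ^ k dvd x}"
    "\<pi> dvd of_nat (residue_char TYPE('o))" "0 < residue_char TYPE('o)"
    "\<And>k. 0 < k \<Longrightarrow> \<pi> dvd of_nat k \<Longrightarrow> residue_char TYPE('o) \<le> k"
    "\<And>e. residue_char TYPE('o) = 2 \<Longrightarrow> abs_ramification_index TYPE('o) = e \<Longrightarrow> \<exists>u. u dvd 1 \<and> 2 = u * \<pi> ^ e"
proof -
  let ?R = "class_ring :: 'o ring" and ?F = "residue_field TYPE('o)"
  have dv: "discrete_valuation_ring TYPE('o)" and comp: "compact (UNIV :: 'o set)"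
    and top: "\<And>U :: 'o set. open U \<longleftrightarrow> (\<forall>x\<in>U. \<exists>k. \<forall>y. y - x \<in> max_ideal_pow k \<longrightarrow> y \<in> U)"
    using dvr by (auto simp: compact_dvr_def)
  obtain \<pi> :: 'o where pi: "\<pi> \<noteq> 0" "\<not> \<pi> dvd 1" "\<And>x. \<not> \<pi> dvd x \<Longrightarrow> x dvd 1"
    and M: "max_ideal = {x. \<pi> dvd x}" and I: "ideal (max_ideal :: 'o set) class_ring"
    using dvr_uniformizer[OF dv] by metis
  note pow = max_ideal_pow_eq[OF M]
  interpret R: principal_domain ?R using dv by (simp add: discrete_valuation_ring_def)
  have cring: "cring ?R" using R.principal_domain_axioms principal_domain.axioms(1) domain.axioms(1) by blast
  have sub: "abelian_subgroup max_ideal ?R"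
    by (rule abelian_subgroupI3[OF ideal.axioms(1)[OF I] ring.is_abelian_group[OF cring.axioms(1)[OF cring]]])
  define cs where "cs x = {y. \<pi> dvd y - x}" for x
  have cs: "a_r_coset ?R max_ideal x = cs x" for x
  proof -
    have "a_r_coset ?R max_ideal x = (\<lambda>h. h + x) ` {h. \<pi> dvd h}"
      unfolding a_r_coset_def r_coset_def M UNION_singleton_eq_range by simp
    also have "\<dots> = cs x"
    proof (intro equalityI subsetI)
      fix y assume "y \<in> cs x"
      then have "\<pi> dvd y - x" by (simp add: cs_def)
      moreover have "y = (y - x) + x" by simp
      ultimately show "y \<in> (\<lambda>h. h + x) ` {h. \<pi> dvd h}" by blast
    next
      fix y assume "y \<in> (\<lambda>h. h + x) ` {h. \<pi> dvd h}"
      then obtain h where "\<pi> dvd h" "y = h + x" by blast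
      then show "y \<in> cs x" by (simp add: cs_def)
    qed
    finally show ?thesis .
  qed
  have cs_eq: "cs x = cs y \<longleftrightarrow> \<pi> dvd x - y" for x y
  proof
    assume "cs x = cs y"
    moreover have "x \<in> cs x" by (simp add: cs_def)
    ultimately show "\<pi> dvd x - y" by (simp add: cs_def)
  next
    assume d: "\<pi> dvd x - y"
    have "\<pi> dvd z - x \<longleftrightarrow> \<pi> dvd z - y" for z
      using dvd_add_left_iff[OF d, of "z - x"] by simp
    then show "cs x = cs y" by (simp add: cs_def)
  qed
  have carF: "carrier ?F = range cs"
  proof -
    have "carrier ?F = range (\<lambda>x. a_r_coset ?R max_ideal x)"
      unfolding residue_field_def FactRing_def A_RCOSETS_def RCOSETS_def a_r_coset_def by auto
    then show ?thesis by (simp add: cs)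
  qed
  \<comment> \<open>The residue classes are an open cover of a compact space, and two classes that
    meet are equal.\<close>
  have "finite (range cs)"
  proof -
    have op: "open (cs x)" for x
    proof (subst top, intro ballI exI[of _ 1] allI impI)
      fix z y assume zy: "z \<in> cs x" "y - z \<in> max_ideal_pow 1"
      then have "\<pi> dvd (y - z) + (z - x)" unfolding pow by (intro dvd_add) (auto simp: cs_def)
      then show "y \<in> cs x" by (simp add: cs_def)
    qed
    have "x \<in> cs x" for x by (simp add: cs_def)
    then have "UNIV \<subseteq> (\<Union>x\<in>UNIV. cs x)" by blast
    then obtain X where X: "finite X" "UNIV \<subseteq> (\<Union>x\<in>X. cs x)"
      by (rule compactE_image[OF comp op])
    have "range cs \<subseteq> cs ` X"
    proof
      fix c assume "c \<in> range cs"
      then obtain y where y: "c = cs y" by auto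
      obtain x where "x \<in> X" "y \<in> cs x" using X(2) by blast
      then show "c \<in> cs ` X" unfolding y using cs_eq[of y x] by (auto simp: cs_def)
    qed
    then show ?thesis using X(1) finite_surj by auto
  qed
  define R where "R = (\<lambda>C. SOME x. x \<in> C) ` range cs"
  have some: "cs (SOME x. x \<in> cs y) = cs y" for y
  proof -
    have "y \<in> cs y" by (simp add: cs_def)
    then have "(SOME x. x \<in> cs y) \<in> cs y" by (rule someI)
    then show ?thesis unfolding cs_eq by (simp add: cs_def)
  qed
  have R: "finite R" "card R = card (range cs)"
  proof -
    have "inj_on (\<lambda>C. SOME x. x \<in> C) (range cs)"
    proof (rule inj_onI)
      fix C D assume "C \<in> range cs" "D \<in> range cs" and eq: "(SOME x. x \<in> C) = (SOME x. x \<in> D)"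
      have id: "cs (SOME x. x \<in> E) = E" if "E \<in> range cs" for E using that some by (elim imageE) (simp only:)
      have "C = cs (SOME x. x \<in> C)" using id[OF \<open>C \<in> range cs\<close>] by (rule sym)
      also have "\<dots> = D" unfolding eq by (rule id[OF \<open>D \<in> range cs\<close>])
      finally show "C = D" .
    qed
    then show "finite R" "card R = card (range cs)"
      using \<open>finite (range cs)\<close> unfolding R_def by (simp_all only: card_image finite_imageI)
  qed
  have Rex: "\<exists>!r. r \<in> R \<and> \<pi> dvd x - r" for x
  proof (intro ex1I[of _ "SOME z. z \<in> cs x"] conjI)
    show "(SOME z. z \<in> cs x) \<in> R" by (auto simp: R_def)
    show "\<pi> dvd x - (SOME z. z \<in> cs x)" using some[of x] cs_eq by metis
    fix r assume r: "r \<in> R \<and> \<pi> dvd x - r"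
    then obtain y where y: "r = (SOME z. z \<in> cs y)" by (auto simp: R_def)
    have "cs x = cs y" using r cs_eq[of x r] some[of y] y by simp
    then show "r = (SOME z. z \<in> cs x)" using y by simp
  qed
  have uni: "uniformized \<pi> (residue_card TYPE('o))"
  proof
    show "\<exists>R. finite R \<and> card R = residue_card TYPE('o) \<and> (\<forall>x. \<exists>!r. r \<in> R \<and> \<pi> dvd x - r)"
      using R Rex carF by (intro exI[of _ R]) (simp add: residue_card_def)
  qed (use pi in auto)
  interpret uniformized \<pi> "residue_card TYPE('o)" by (rule uni)
  have zero: "\<zero>\<^bsub>?F\<^esub> = cs 0"
    by (simp add: residue_field_def FactRing_def M cs_def)
  have "\<one>\<^bsub>?F\<^esub> = a_r_coset ?R max_ideal 1"
    by (simp add: residue_field_def FactRing_def)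
  then have one: "\<one>\<^bsub>?F\<^esub> = cs 1" by (simp only: cs)
  have addF: "cs x \<oplus>\<^bsub>?F\<^esub> cs y = cs (x + y)" for x y
    using abelian_subgroup.a_rcos_sum[OF sub, of x y] by (simp add: residue_field_def FactRing_def cs)
  have powF: "add_pow ?F (k::nat) \<one>\<^bsub>?F\<^esub> = cs (of_nat k)" for k
  proof (induction k)
    case 0
    show ?case by (simp add: add_pow_def zero)
  next
    case (Suc k)
    then show ?case using addF[of "of_nat k" 1] by (simp add: add_pow_def one add.commute)
  qed
  have rc: "residue_char TYPE('o) = (LEAST k. 0 < k \<and> \<pi> dvd of_nat k)"
    unfolding residue_char_def powF zero cs_eq by simp
  \<comment> \<open>Finitely many residue classes cannot separate the natural numbers; the
    difference of two congruent ones is divisible by \<open>\<pi>\<close>.\<close>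
  have ex: "\<exists>k>0. \<pi> dvd (of_nat k :: 'o)"
  proof -
    have "\<not> inj_on (\<lambda>k::nat. cs (of_nat k)) UNIV"
    proof
      assume "inj_on (\<lambda>k::nat. cs (of_nat k)) UNIV"
      moreover have "finite (range (\<lambda>k::nat. cs (of_nat k)))"
        by (rule finite_subset[OF _ \<open>finite (range cs)\<close>]) auto
      ultimately show False using finite_imageD infinite_UNIV_nat by blast
    qed
    then obtain a b :: nat where "a \<noteq> b" "cs (of_nat a) = cs (of_nat b)" by (auto simp: inj_on_def)
    then have "\<exists>a b :: nat. a < b \<and> cs (of_nat b) = cs (of_nat a)"
      by (cases a b rule: linorder_cases) auto
    then obtain a b :: nat where ab: "a < b" "cs (of_nat b) = cs (of_nat a)" by blast
    then have "\<pi> dvd of_nat (b - a)" "b - a > 0" by (auto simp: cs_eq of_nat_diff)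
    then show ?thesis by blast
  qed
  have least: "0 < residue_char TYPE('o)" "\<pi> dvd of_nat (residue_char TYPE('o))"
    unfolding rc using LeastI_ex[OF ex] by auto
  have le: "residue_char TYPE('o) \<le> k" if "0 < k" "\<pi> dvd of_nat k" for k
    unfolding rc using that by (intro Least_le) auto
  have val: "\<exists>e u. u dvd 1 \<and> x = u * \<pi> ^ e" if x: "x \<noteq> 0" for x :: 'o
  proof (cases "\<forall>k. \<pi> ^ k dvd x")
    case True
    then have "\<forall>k. \<exists>y. x = \<pi> ^ k * y" by (simp add: dvd_def)
    then obtain y where y: "\<And>k. x = \<pi> ^ k * y k" by metis
    have ynz: "y k \<noteq> 0" for k
    proof
      assume "y k = 0"
      then show False using y[of k] x by simp
    qed
    have ys: "y k = \<pi> * y (Suc k)" for k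
    proof -
      have "\<pi> ^ k * y k = \<pi> ^ k * (\<pi> * y (Suc k))"
        using y[of "Suc k"] unfolding y[of k, symmetric] by (simp only: power_Suc mult.assoc mult.left_commute)
      then show ?thesis using pi_pow_nz[of k] by (metis mult_left_cancel)
    qed
    \<comment> \<open>\<open>J\<close> is the union of the ascending chain of ideals generated by
      the quotients \<open>y k\<close> of \<open>x\<close> by \<open>\<pi> ^ k\<close>. A generator
      \<open>g\<close> of \<open>J\<close> is a multiple of some
      \<open>y k = \<pi> * y (Suc k)\<close>, yet it divides \<open>y (Suc k)\<close>; so
      \<open>\<pi>\<close> would be a unit.\<close>
    define J where "J = {z. \<exists>k. x dvd \<pi> ^ k * z}"
    have "ideal J ?R"
    proof (rule idealI)
      show "ring ?R" using cring by (rule cring.axioms(1))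
      show "subgroup J (add_monoid ?R)"
      proof
        fix a b assume "a \<in> J" "b \<in> J"
        then obtain k l where "x dvd \<pi> ^ k * a" "x dvd \<pi> ^ l * b" by (auto simp: J_def)
        then have "x dvd \<pi> ^ l * (\<pi> ^ k * a) + \<pi> ^ k * (\<pi> ^ l * b)"
          by (rule dvd_add[OF dvd_mult dvd_mult])
        also have "\<pi> ^ l * (\<pi> ^ k * a) + \<pi> ^ k * (\<pi> ^ l * b) = \<pi> ^ (k + l) * (a + b)"
          by (simp add: power_add algebra_simps)
        finally show "a \<otimes>\<^bsub>add_monoid ?R\<^esub> b \<in> J" by (auto simp: J_def)
      next
        show "\<one>\<^bsub>add_monoid ?R\<^esub> \<in> J" by (auto simp: J_def)
      next
        fix a assume "a \<in> J"
        then obtain k where "x dvd \<pi> ^ k * a" by (auto simp: J_def)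
        then have "x dvd \<pi> ^ k * (- a)" by simp
        then have "- a \<in> J" unfolding J_def by blast
        moreover have "inv\<^bsub>add_monoid ?R\<^esub> a = - a"
          using cring.axioms(1)[OF cring]
          by (intro group.inv_equality[OF abelian_group.a_group[OF ring.is_abelian_group]]) auto
        ultimately show "inv\<^bsub>add_monoid ?R\<^esub> a \<in> J" by simp
      qed simp
      fix a b assume "a \<in> J"
      then obtain k where "x dvd \<pi> ^ k * a" by (auto simp: J_def)
      then have "x dvd \<pi> ^ k * (b * a)" using dvd_mult[of x "\<pi> ^ k * a" b] by (simp only: mult.left_commute)
      then show "b \<otimes>\<^bsub>?R\<^esub> a \<in> J" "a \<otimes>\<^bsub>?R\<^esub> b \<in> J" by (auto simp: J_def mult.commute)
    qed
    then obtain g where g: "J = {z. g dvd z}"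
      using R.exists_gen[of J] unfolding cgenideal_class_ring by auto
    then have "g \<in> J" by simp
    then obtain k c where "\<pi> ^ k * g = x * c" by (auto simp: J_def dvd_def)
    then have "\<pi> ^ k * g = \<pi> ^ k * (y k * c)" using y[of k] by (metis mult.assoc)
    then have gc: "g = y k * c" using pi_pow_nz[of k] by (metis mult_left_cancel)
    have "x dvd \<pi> ^ Suc k * y (Suc k)" by (simp only: y[of "Suc k", symmetric] dvd_refl)
    then have "y (Suc k) \<in> J" unfolding J_def by blast
    then obtain d where "y (Suc k) = g * d" unfolding g by (auto simp: dvd_def)
    then have "y (Suc k) * 1 = y (Suc k) * (\<pi> * (c * d))" using gc ys[of k] by (simp add: mult_ac)
    then have "1 = \<pi> * (c * d)" using ynz by (metis mult_left_cancel)
    then show ?thesis using pi(2) by (metis dvd_triv_left)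
  next
    case False
    then obtain k where k: "\<not> \<pi> ^ k dvd x" by blast
    define e where "e = (LEAST k. \<not> \<pi> ^ k dvd x)"
    have e: "\<not> \<pi> ^ e dvd x" unfolding e_def using k by (rule LeastI)
    have "e \<noteq> 0"
    proof
      assume "e = 0"
      then show False using e by simp
    qed
    then obtain e' where e': "e = Suc e'" by (cases e) auto
    then have "\<pi> ^ e' dvd x" using not_less_Least[of e' "\<lambda>k. \<not> \<pi> ^ k dvd x"] unfolding e_def by auto
    then obtain u where u: "x = \<pi> ^ e' * u" by (rule dvdE)
    have "\<not> \<pi> dvd u"
    proof
      assume "\<pi> dvd u"
      then have "\<pi> ^ e dvd x" unfolding u e' by (simp add: mult.commute mult_dvd_mono)
      with e show False by simp
    qed
    then show ?thesis using u pi(3)[of u] by (auto simp: mult.commute)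
  qed
  have ram: "\<exists>u. u dvd 1 \<and> (2::'o) = u * \<pi> ^ e"
    if p2: "residue_char TYPE('o) = 2" and e: "abs_ramification_index TYPE('o) = e" for e
  proof -
    have "(2::'o) \<noteq> 0" by simp
    then obtain e0 u where u: "u dvd 1" "(2::'o) = u * \<pi> ^ e0" using val by blast
    obtain w where w: "1 = u * w" using u(1) by (rule dvdE)
    have pw: "\<pi> ^ e0 = w * 2" unfolding u(2) using w by (metis mult.assoc mult.commute mult_1_left)
    have d1: "2 dvd \<pi> ^ e0" unfolding pw by simp
    have d2: "\<pi> ^ e0 dvd 2" by (subst u(2)) simp
    have two: "{x. 2 dvd x} = {x :: 'o. \<pi> ^ e0 dvd x}"
      by (intro Collect_cong iffI) (erule dvd_trans[OF d2], erule dvd_trans[OF d1])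
    have "(cgenideal ?R (of_nat (residue_char TYPE('o))) = max_ideal_pow e') \<longleftrightarrow> e' = e0" for e'
    proof
      assume "cgenideal ?R (of_nat (residue_char TYPE('o))) = max_ideal_pow e'"
      then have eq: "{x :: 'o. \<pi> ^ e0 dvd x} = {x. \<pi> ^ e' dvd x}"
        unfolding cgenideal_class_ring pow p2 using two by simp
      have "\<pi> ^ e' \<in> {x :: 'o. \<pi> ^ e0 dvd x}" unfolding eq by simp
      moreover have "\<pi> ^ e0 \<in> {x :: 'o. \<pi> ^ e' dvd x}" unfolding eq[symmetric] by simp
      ultimately show "e' = e0" unfolding mem_Collect_eq pi_pow_dvd_iff by simp
    next
      assume "e' = e0"
      then show "cgenideal ?R (of_nat (residue_char TYPE('o))) = max_ideal_pow e'"
        unfolding cgenideal_class_ring pow p2 using two by simp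
    qed
    then have "abs_ramification_index TYPE('o) = e0" unfolding abs_ramification_index_def by simp
    then show ?thesis using u e by blast
  qed
  show ?thesis by (rule that[OF uni pow least(2,1) le ram])
qed

section \<open>Congruence subgroups\<close>

definition mat22 :: "'a \<Rightarrow> 'a \<Rightarrow> 'a \<Rightarrow> 'a \<Rightarrow> 'a^2^2" where
  "mat22 a b c d = (\<chi> i j. if i = 1 then (if j = 1 then a else b) else (if j = 1 then c else d))"

lemma mat22_nth [simp]:
  "mat22 a b c d $ 1 $ 1 = a" "mat22 a b c d $ 1 $ 2 = b"
  "mat22 a b c d $ 2 $ 1 = c" "mat22 a b c d $ 2 $ 2 = d"
  by (simp_all add: mat22_def)

lemma mat22_eq_iff: "A = B \<longleftrightarrow> A $ 1 $ 1 = B $ 1 $ 1 \<and> A $ 1 $ 2 = B $ 1 $ 2 \<and> A $ 2 $ 1 = B $ 2 $ 1 \<and> A $ 2 $ 2 = B $ 2 $ 2"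
  for A B :: "'a^2^2"
  unfolding Finite_Cartesian_Product.vec_eq_iff forall_2 by auto

lemma mult22_nth [simp]:
  fixes A B :: "'a::comm_ring_1^2^2"
  shows "(A ** B) $ i $ j = A $ i $ 1 * B $ 1 $ j + A $ i $ 2 * B $ 2 $ j"
  by (simp add: matrix_matrix_mult_def sum_2)

lemma one22_nth [simp]:
  "(Finite_Cartesian_Product.mat 1 :: 'a::comm_ring_1^2^2) $ 1 $ 1 = 1" "(Finite_Cartesian_Product.mat 1 :: 'a^2^2) $ 1 $ 2 = 0"
  "(Finite_Cartesian_Product.mat 1 :: 'a^2^2) $ 2 $ 1 = 0" "(Finite_Cartesian_Product.mat 1 :: 'a^2^2) $ 2 $ 2 = 1"
  by (simp_all add: Finite_Cartesian_Product.mat_def)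

definition adj22 :: "'a::comm_ring_1^2^2 \<Rightarrow> 'a^2^2" where
  "adj22 A = mat22 (A $ 2 $ 2) (- A $ 1 $ 2) (- A $ 2 $ 1) (A $ 1 $ 1)"

lemma adj22_nth [simp]:
  "adj22 A $ 1 $ 1 = A $ 2 $ 2" "adj22 A $ 1 $ 2 = - A $ 1 $ 2"
  "adj22 A $ 2 $ 1 = - A $ 2 $ 1" "adj22 A $ 2 $ 2 = A $ 1 $ 1"
  by (simp_all add: adj22_def)

text \<open>\<open>v\<close> is the valuation of 2, hence 0 when 2 is a unit. The inequality
  \<open>v < m\<close> makes terms quadratic in deviations of level at least \<open>m\<close>
  smaller than linear terms multiplied by 2.\<close>

locale sl2_congruence = uniformized \<pi> q for \<pi> :: "'o::idom" and q +
  fixes m v :: nat and \<epsilon> :: 'o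
  assumes two: "2 = \<epsilon> * \<pi> ^ v" and eps: "\<epsilon> dvd 1" and v_less_m: "v < m"
begin

definition Lev :: "nat \<Rightarrow> ('o^2^2) set" where
  "Lev n = {A. A $ 1 $ 1 * A $ 2 $ 2 - A $ 1 $ 2 * A $ 2 $ 1 = 1 \<and> \<pi> ^ n dvd A $ 1 $ 1 - 1 \<and> \<pi> ^ n dvd A $ 1 $ 2 \<and>
     \<pi> ^ n dvd A $ 2 $ 1 \<and> \<pi> ^ n dvd A $ 2 $ 2 - 1}"

definition G :: "('o^2^2) monoid" where
  "G = \<lparr>carrier = Lev m, monoid.mult = (**), one = Finite_Cartesian_Product.mat 1\<rparr>"

definition Ker :: "nat \<Rightarrow> ('o^2^2) set" where
  "Ker n = {A \<in> Lev m. \<pi> ^ n dvd A $ 1 $ 1 - A $ 2 $ 2 \<and> \<pi> ^ n dvd A $ 1 $ 2 \<and> \<pi> ^ n dvd A $ 2 $ 1}"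

lemma G_simps [simp]: "carrier G = Lev m" "mult G = (**)" "one G = Finite_Cartesian_Product.mat 1"
  by (simp_all add: G_def)

lemma two_dvd: "\<pi> ^ v dvd 2" by (simp add: two)

lemma two_mult_dvd: "\<pi> ^ (n + v) dvd 2 * x \<longleftrightarrow> \<pi> ^ n dvd x"
proof -
  have "2 * x = \<epsilon> * (x * \<pi> ^ v)" by (simp add: two mult_ac)
  then have "\<pi> ^ (n + v) dvd 2 * x \<longleftrightarrow> \<pi> ^ (n + v) dvd x * \<pi> ^ v"
    by (simp only: unit_mult_dvd[OF eps])
  also have "\<dots> \<longleftrightarrow> \<pi> ^ n * \<pi> ^ v dvd x * \<pi> ^ v" by (simp only: power_add)
  also have "\<dots> \<longleftrightarrow> \<pi> ^ n dvd x" using pi_pow_nz by (simp only: dvd_mult_cancel_right) simp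
  finally show ?thesis .
qed

lemma LevD:
  assumes "A \<in> Lev n"
  shows "A $ 1 $ 1 * A $ 2 $ 2 - A $ 1 $ 2 * A $ 2 $ 1 = 1" "\<pi> ^ n dvd A $ 1 $ 1 - 1" "\<pi> ^ n dvd A $ 1 $ 2"
    "\<pi> ^ n dvd A $ 2 $ 1" "\<pi> ^ n dvd A $ 2 $ 2 - 1"
  using assms by (simp_all add: Lev_def)

lemma Lev_mono: "i \<le> j \<Longrightarrow> Lev j \<subseteq> Lev i"
  unfolding Lev_def by (auto intro: pow_le_dvd)

lemma Lev_diff: "A \<in> Lev n \<Longrightarrow> \<pi> ^ n dvd A $ 1 $ 1 - A $ 2 $ 2"
  using dvd_diff[OF LevD(2) LevD(5), of A n] by simp

lemma Lev_mult:
  assumes "A \<in> Lev n" "B \<in> Lev n"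
  shows "A ** B \<in> Lev n"
proof -
  note A = LevD[OF assms(1)] and B = LevD[OF assms(2)]
  have "(A ** B) $ 1 $ 1 * (A ** B) $ 2 $ 2 - (A ** B) $ 1 $ 2 * (A ** B) $ 2 $ 1 =
      (A $ 1 $ 1 * A $ 2 $ 2 - A $ 1 $ 2 * A $ 2 $ 1) * (B $ 1 $ 1 * B $ 2 $ 2 - B $ 1 $ 2 * B $ 2 $ 1)"
    by (simp add: algebra_simps)
  then have det: "(A ** B) $ 1 $ 1 * (A ** B) $ 2 $ 2 - (A ** B) $ 1 $ 2 * (A ** B) $ 2 $ 1 = 1"
    using A(1) B(1) by (simp only: mult_1_left)
  have 11: "(A ** B) $ 1 $ 1 - 1 = (A $ 1 $ 1 - 1) * B $ 1 $ 1 + (B $ 1 $ 1 - 1) + A $ 1 $ 2 * B $ 2 $ 1"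
   and 22: "(A ** B) $ 2 $ 2 - 1 = (A $ 2 $ 2 - 1) * B $ 2 $ 2 + (B $ 2 $ 2 - 1) + A $ 2 $ 1 * B $ 1 $ 2"
    by (simp_all add: algebra_simps)
  show ?thesis
    unfolding Lev_def mem_Collect_eq det 11 22
    unfolding mult22_nth[of A B 1 2] mult22_nth[of A B 2 1]
    by (intro conjI refl dvd_add dvd_mult2[OF A(2)] dvd_mult2[OF A(3)] dvd_mult2[OF A(4)] dvd_mult2[OF A(5)] B
        dvd_mult[OF B(3)] dvd_mult[OF B(4)])
qed

lemma Lev_one: "Finite_Cartesian_Product.mat 1 \<in> Lev n"
  by (simp add: Lev_def)

lemma Lev_adj: "A \<in> Lev n \<Longrightarrow> adj22 A \<in> Lev n"
  by (simp add: Lev_def mult.commute)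

lemma adj_mult:
  assumes "A \<in> Lev n"
  shows "A ** adj22 A = Finite_Cartesian_Product.mat 1" "adj22 A ** A = Finite_Cartesian_Product.mat 1"
  using LevD(1)[OF assms] by (simp_all add: mat22_eq_iff algebra_simps)

lemma group_G: "group G"
proof (rule groupI)
  fix x assume x: "x \<in> carrier G"
  then show "\<exists>y\<in>carrier G. y \<otimes>\<^bsub>G\<^esub> x = \<one>\<^bsub>G\<^esub>"
    using Lev_adj adj_mult(2) by (intro bexI[of _ "adj22 x"]) auto
qed (auto simp: Lev_mult Lev_one matrix_mul_assoc)

lemma inv_G [simp]: "A \<in> Lev m \<Longrightarrow> inv\<^bsub>G\<^esub> A = adj22 A"
  using group.inv_equality[OF group_G, of "adj22 A" A] Lev_adj adj_mult(2) by simp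

lemma KerD:
  assumes "A \<in> Ker n"
  shows "A \<in> Lev m" "\<pi> ^ n dvd A $ 1 $ 1 - A $ 2 $ 2" "\<pi> ^ n dvd A $ 1 $ 2" "\<pi> ^ n dvd A $ 2 $ 1"
  using assms by (simp_all add: Ker_def)

lemma Ker_mono: "i \<le> j \<Longrightarrow> Ker j \<subseteq> Ker i"
  unfolding Ker_def by (auto intro: pow_le_dvd)

lemma Lev_in_Ker: "A \<in> Lev n \<Longrightarrow> m \<le> n \<Longrightarrow> A \<in> Ker n"
  using Lev_mono[of m n] Lev_diff LevD(3,4) by (auto simp: Ker_def)

lemma Ker_subgroup: "subgroup (Ker n) G"
proof (rule group.subgroupI[OF group_G])
  show "Ker n \<subseteq> carrier G" by (auto simp: Ker_def)
  have "Finite_Cartesian_Product.mat 1 \<in> Ker n" by (simp add: Ker_def Lev_one)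
  then show "Ker n \<noteq> {}" by auto
next
  fix A assume "A \<in> Ker n"
  note A = KerD[OF this]
  have "\<pi> ^ n dvd - (A $ 1 $ 1 - A $ 2 $ 2)" using A(2) by (simp only: dvd_minus_iff)
  then have "\<pi> ^ n dvd A $ 2 $ 2 - A $ 1 $ 1" by simp
  then show "inv\<^bsub>G\<^esub> A \<in> Ker n" using A by (simp add: Ker_def Lev_adj)
next
  fix A B assume A: "A \<in> Ker n" and B: "B \<in> Ker n"
  have "(A ** B) $ 1 $ 1 - (A ** B) $ 2 $ 2 = (A $ 1 $ 1 - A $ 2 $ 2) * B $ 1 $ 1 + A $ 2 $ 2 * (B $ 1 $ 1 - B $ 2 $ 2)
      + (A $ 1 $ 2 * B $ 2 $ 1 - A $ 2 $ 1 * B $ 1 $ 2)"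
    by (simp add: algebra_simps)
  moreover have "\<pi> ^ n dvd \<dots>" using KerD[OF A] KerD[OF B] by (intro dvd_add dvd_diff) (simp_all add: dvd_mult dvd_mult2)
  ultimately have "\<pi> ^ n dvd (A ** B) $ 1 $ 1 - (A ** B) $ 2 $ 2" by (simp only:)
  then show "A \<otimes>\<^bsub>G\<^esub> B \<in> Ker n"
    using KerD[OF A] KerD[OF B] Lev_mult[of A m B] by (simp add: Ker_def dvd_add dvd_mult dvd_mult2)
qed

lemma Ker_normal: "Ker n \<lhd> G"
proof (subst group.normal_inv_iff[OF group_G], intro conjI ballI)
  show "subgroup (Ker n) G" by (rule Ker_subgroup)
  fix g k assume g: "g \<in> carrier G" and k: "k \<in> Ker n"
  note kd = KerD[OF k]
  let ?x = "g ** k ** adj22 g"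
  have x: "?x \<in> Lev m" using g kd(1) Lev_mult Lev_adj by simp
  have 12: "?x $ 1 $ 2 = g $ 1 $ 1 * g $ 1 $ 1 * k $ 1 $ 2 - g $ 1 $ 2 * g $ 1 $ 2 * k $ 2 $ 1 - g $ 1 $ 1 * g $ 1 $ 2 * (k $ 1 $ 1 - k $ 2 $ 2)"
    by (simp add: algebra_simps)
  have 21: "?x $ 2 $ 1 = g $ 2 $ 2 * g $ 2 $ 2 * k $ 2 $ 1 - g $ 2 $ 1 * g $ 2 $ 1 * k $ 1 $ 2 + g $ 2 $ 1 * g $ 2 $ 2 * (k $ 1 $ 1 - k $ 2 $ 2)"
    by (simp add: algebra_simps)
  have d: "?x $ 1 $ 1 - ?x $ 2 $ 2 = (g $ 1 $ 1 * g $ 2 $ 2 + g $ 1 $ 2 * g $ 2 $ 1) * (k $ 1 $ 1 - k $ 2 $ 2)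
      + 2 * (g $ 1 $ 2 * g $ 2 $ 2) * k $ 2 $ 1 - 2 * (g $ 1 $ 1 * g $ 2 $ 1) * k $ 1 $ 2"
    by (simp add: algebra_simps)
  have "?x \<in> Ker n"
    unfolding Ker_def mem_Collect_eq 12 21 d using x kd(2-4)
    by (intro conjI dvd_add dvd_diff) (simp_all add: dvd_mult)
  then show "g \<otimes>\<^bsub>G\<^esub> k \<otimes>\<^bsub>G\<^esub> inv\<^bsub>G\<^esub> g \<in> Ker n" using g by simp
qed

definition comm :: "'o^2^2 \<Rightarrow> 'o^2^2 \<Rightarrow> 'o^2^2" where
  "comm u w = u ** w ** adj22 u ** adj22 w"

lemma comm_Lev: "u \<in> Lev m \<Longrightarrow> w \<in> Lev m \<Longrightarrow> comm u w \<in> Lev m"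
  by (simp add: comm_def Lev_mult Lev_adj)

lemma conj_eq_comm: "u \<in> Lev m \<Longrightarrow> w \<in> Lev m \<Longrightarrow> u \<otimes>\<^bsub>G\<^esub> w \<otimes>\<^bsub>G\<^esub> inv\<^bsub>G\<^esub> u = comm u w \<otimes>\<^bsub>G\<^esub> w"
  using adj_mult(2)[of w m] by (simp add: comm_def matrix_mul_assoc[symmetric])

text \<open>The entries of \<open>(u w - w u) u\<^sup>-\<^sup>1 w\<^sup>-\<^sup>1\<close>; only the classes of \<open>u\<close> and \<open>w\<close> modulo scalars
  enter the first factor.\<close>

lemma comm_entries:
  assumes "u \<in> Lev m" "w \<in> Lev m"
  defines "Y11 \<equiv> u $ 1 $ 2 * w $ 2 $ 1 - u $ 2 $ 1 * w $ 1 $ 2"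
    and "Y12 \<equiv> (u $ 1 $ 1 - u $ 2 $ 2) * w $ 1 $ 2 - u $ 1 $ 2 * (w $ 1 $ 1 - w $ 2 $ 2)"
    and "Y21 \<equiv> u $ 2 $ 1 * (w $ 1 $ 1 - w $ 2 $ 2) - (u $ 1 $ 1 - u $ 2 $ 2) * w $ 2 $ 1"
    and "E \<equiv> adj22 u ** adj22 w"
  shows "comm u w $ 1 $ 1 = 1 + (Y11 * E $ 1 $ 1 + Y12 * E $ 2 $ 1)"
    "comm u w $ 1 $ 2 = Y11 * E $ 1 $ 2 + Y12 * E $ 2 $ 2"
    "comm u w $ 2 $ 1 = Y21 * E $ 1 $ 1 - Y11 * E $ 2 $ 1"
    "comm u w $ 2 $ 2 = 1 + (Y21 * E $ 1 $ 2 - Y11 * E $ 2 $ 2)"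
proof -
  define Y where "Y = mat22 Y11 Y12 Y21 (- Y11)"
  have uw: "u ** w = w ** u + Y"
    by (simp add: mat22_eq_iff Y_def Y11_def Y12_def Y21_def algebra_simps)
  have "w ** u ** E = w ** (u ** adj22 u) ** adj22 w" by (simp add: E_def matrix_mul_assoc)
  then have wE: "w ** u ** E = Finite_Cartesian_Product.mat 1"
    using adj_mult(1)[OF assms(1)] adj_mult(1)[OF assms(2)] by simp
  have "comm u w = (u ** w) ** E" by (simp add: comm_def E_def matrix_mul_assoc)
  moreover have "(w ** u + Y) ** E = w ** u ** E + Y ** E"
    by (simp add: mat22_eq_iff algebra_simps)
  ultimately have c: "comm u w = Finite_Cartesian_Product.mat 1 + Y ** E"
    unfolding uw wE by (simp only:)
  show "comm u w $ 1 $ 1 = 1 + (Y11 * E $ 1 $ 1 + Y12 * E $ 2 $ 1)"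
    "comm u w $ 1 $ 2 = Y11 * E $ 1 $ 2 + Y12 * E $ 2 $ 2"
    "comm u w $ 2 $ 1 = Y21 * E $ 1 $ 1 - Y11 * E $ 2 $ 1"
    "comm u w $ 2 $ 2 = 1 + (Y21 * E $ 1 $ 2 - Y11 * E $ 2 $ 2)"
    unfolding c by (simp_all add: Y_def)
qed

text \<open>The first factor in \<open>comm_entries\<close> is bilinear in the coordinates of
  \<open>u\<close> and \<open>w\<close> modulo scalars, and multiplication by \<open>E\<close>
  preserves divisibility.\<close>

lemma comm_in_Lev_sum:
  assumes u: "u \<in> Ker i" and w: "w \<in> Ker j"
  shows "comm u w \<in> Lev (i + j)"
proof -
  note U = KerD[OF u] and W = KerD[OF w]
  have c: "comm u w \<in> Lev m" using U W by (intro comm_Lev)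
  have Y: "\<pi> ^ (i + j) dvd u $ 1 $ 2 * w $ 2 $ 1 - u $ 2 $ 1 * w $ 1 $ 2"
    "\<pi> ^ (i + j) dvd (u $ 1 $ 1 - u $ 2 $ 2) * w $ 1 $ 2 - u $ 1 $ 2 * (w $ 1 $ 1 - w $ 2 $ 2)"
    "\<pi> ^ (i + j) dvd u $ 2 $ 1 * (w $ 1 $ 1 - w $ 2 $ 2) - (u $ 1 $ 1 - u $ 2 $ 2) * w $ 2 $ 1"
    unfolding power_add by (intro dvd_diff mult_dvd_mono U W)+
  show ?thesis
    unfolding Lev_def mem_Collect_eq LevD(1)[OF c] unfolding comm_entries[OF U(1) W(1)]
    using Y by (simp add: dvd_add dvd_diff dvd_mult2 del: mult22_nth)
qed

text \<open>In the determinant condition the terms quadratic in the deviations have level at least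
  \<open>2 * i\<close>, which exceeds \<open>i + v\<close> because \<open>v < m \<le> i\<close>.
  What remains is the trace-zero condition, by which the diagonal difference is minus twice the
  deviation of the lower right entry.\<close>

lemma diag_diff:
  assumes u: "u \<in> Lev i" and i: "m \<le> i"
  shows "\<pi> ^ (i + v + 1) dvd (u $ 1 $ 1 - u $ 2 $ 2) + 2 * (u $ 2 $ 2 - 1)" "\<pi> ^ (i + v) dvd u $ 1 $ 1 - u $ 2 $ 2"
proof -
  note U = LevD[OF u]
  have "(u $ 1 $ 1 - u $ 2 $ 2) + 2 * (u $ 2 $ 2 - 1) =
      u $ 1 $ 2 * u $ 2 $ 1 - (u $ 2 $ 2 - 1) * (u $ 2 $ 2 - 1) - (u $ 2 $ 2 - 1) * (u $ 1 $ 1 - u $ 2 $ 2)"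
    using U(1) by (simp add: algebra_simps eq_diff_eq)
  also have "\<pi> ^ (i + v + 1) dvd \<dots>"
  proof -
    have a: "\<pi> ^ (i + v + 1) dvd x * y" if "\<pi> ^ i dvd x" "\<pi> ^ i dvd y" for x y
      using i v_less_m by (intro pow_mult_dvd[OF that]) simp
    show ?thesis by (intro dvd_diff[of _ "_ - _ * _" "_ * _"] dvd_diff[of _ "_ * _" "_ * _"] a U Lev_diff[OF u])
  qed
  finally show 1: "\<pi> ^ (i + v + 1) dvd (u $ 1 $ 1 - u $ 2 $ 2) + 2 * (u $ 2 $ 2 - 1)" .
  have "\<pi> ^ (i + v) dvd 2 * (u $ 2 $ 2 - 1)" by (rule iffD2[OF two_mult_dvd U(5)])
  from dvd_diff[OF pow_le_dvd[OF 1] this] show "\<pi> ^ (i + v) dvd u $ 1 $ 1 - u $ 2 $ 2" by simp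
qed

text \<open>To leading order the commutator is the bracket of the trace-zero matrices with rows
  \<open>(-d, b)\<close> and \<open>(c, d)\<close>, where \<open>d\<close> is the deviation of the
  lower right entry from 1. In coordinates modulo scalars each component of this bracket is twice an
  alternating form, so the leading terms have level \<open>i + j + v\<close>.\<close>

lemma comm_leading_terms:
  assumes u: "u \<in> Lev i" and w: "w \<in> Lev j" and ij: "m \<le> i" "m \<le> j"
  shows "\<pi> ^ (i + j + v + 1) dvd (comm u w $ 1 $ 1 - comm u w $ 2 $ 2) - 2 * (u $ 1 $ 2 * w $ 2 $ 1 - u $ 2 $ 1 * w $ 1 $ 2)"
    "\<pi> ^ (i + j + v + 1) dvd comm u w $ 1 $ 2 - 2 * (u $ 1 $ 2 * (w $ 2 $ 2 - 1) - (u $ 2 $ 2 - 1) * w $ 1 $ 2)"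
    "\<pi> ^ (i + j + v + 1) dvd comm u w $ 2 $ 1 - 2 * ((u $ 2 $ 2 - 1) * w $ 2 $ 1 - u $ 2 $ 1 * (w $ 2 $ 2 - 1))"
proof -
  let ?M = "i + j + v + 1"
  note U = LevD[OF u] and W = LevD[OF w]
  have um: "u \<in> Lev m" and wm: "w \<in> Lev m" using u w ij Lev_mono by blast+
  define Y11 Y12 Y21 E where "Y11 = u $ 1 $ 2 * w $ 2 $ 1 - u $ 2 $ 1 * w $ 1 $ 2"
    and "Y12 = (u $ 1 $ 1 - u $ 2 $ 2) * w $ 1 $ 2 - u $ 1 $ 2 * (w $ 1 $ 1 - w $ 2 $ 2)"
    and "Y21 = u $ 2 $ 1 * (w $ 1 $ 1 - w $ 2 $ 2) - (u $ 1 $ 1 - u $ 2 $ 2) * w $ 2 $ 1"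
    and "E = adj22 u ** adj22 w"
  note ce = comm_entries[OF um wm, folded Y11_def Y12_def Y21_def E_def]
  have E: "E \<in> Lev m" unfolding E_def using um wm by (intro Lev_mult Lev_adj)
  note Ed = LevD[OF E]
  have Y11: "\<pi> ^ (i + j) dvd Y11" unfolding Y11_def by (intro dvd_diff pow_mult_dvd[of i _ j] U W) auto
  have Y12': "Y12 - 2 * (u $ 1 $ 2 * (w $ 2 $ 2 - 1) - (u $ 2 $ 2 - 1) * w $ 1 $ 2) =
     ((u $ 1 $ 1 - u $ 2 $ 2) + 2 * (u $ 2 $ 2 - 1)) * w $ 1 $ 2 - u $ 1 $ 2 * ((w $ 1 $ 1 - w $ 2 $ 2) + 2 * (w $ 2 $ 2 - 1))"
    by (simp add: Y12_def algebra_simps)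
  have Y12: "\<pi> ^ ?M dvd Y12 - 2 * (u $ 1 $ 2 * (w $ 2 $ 2 - 1) - (u $ 2 $ 2 - 1) * w $ 1 $ 2)"
    unfolding Y12' by (intro dvd_diff pow_mult_dvd[OF diag_diff(1)[OF u ij(1)] W(3)]
      pow_mult_dvd[OF U(3) diag_diff(1)[OF w ij(2)]]) auto
  have Y12'': "\<pi> ^ (i + j + v) dvd Y12"
    unfolding Y12_def by (intro dvd_diff pow_mult_dvd[OF diag_diff(2)[OF u ij(1)] W(3)]
      pow_mult_dvd[OF U(3) diag_diff(2)[OF w ij(2)]]) auto
  have Y21': "Y21 - 2 * ((u $ 2 $ 2 - 1) * w $ 2 $ 1 - u $ 2 $ 1 * (w $ 2 $ 2 - 1)) =
     u $ 2 $ 1 * ((w $ 1 $ 1 - w $ 2 $ 2) + 2 * (w $ 2 $ 2 - 1)) - ((u $ 1 $ 1 - u $ 2 $ 2) + 2 * (u $ 2 $ 2 - 1)) * w $ 2 $ 1"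
    by (simp add: Y21_def algebra_simps)
  have Y21: "\<pi> ^ ?M dvd Y21 - 2 * ((u $ 2 $ 2 - 1) * w $ 2 $ 1 - u $ 2 $ 1 * (w $ 2 $ 2 - 1))"
    unfolding Y21' by (intro dvd_diff pow_mult_dvd[OF diag_diff(1)[OF u ij(1)] W(4)]
      pow_mult_dvd[OF U(4) diag_diff(1)[OF w ij(2)]]) auto
  have Y21'': "\<pi> ^ (i + j + v) dvd Y21"
    unfolding Y21_def by (intro dvd_diff pow_mult_dvd[OF diag_diff(2)[OF u ij(1)] W(4)]
      pow_mult_dvd[OF U(4) diag_diff(2)[OF w ij(2)]]) auto
  have Y12E: "\<pi> ^ ?M dvd Y12 * x" if "\<pi> ^ m dvd x" for x using v_less_m by (intro pow_mult_dvd[OF Y12'' that]) auto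
  have Y21E: "\<pi> ^ ?M dvd Y21 * x" if "\<pi> ^ m dvd x" for x using v_less_m by (intro pow_mult_dvd[OF Y21'' that]) auto
  have Y11E: "\<pi> ^ ?M dvd Y11 * x" if "\<pi> ^ m dvd x" for x using v_less_m by (intro pow_mult_dvd[OF Y11 that]) auto
  have "(comm u w $ 1 $ 1 - comm u w $ 2 $ 2) - 2 * Y11 =
      Y11 * (E $ 1 $ 1 - 1) + Y11 * (E $ 2 $ 2 - 1) + Y12 * E $ 2 $ 1 - Y21 * E $ 1 $ 2"
    unfolding ce by (simp add: algebra_simps)
  also have "\<pi> ^ ?M dvd \<dots>" by (intro dvd_diff dvd_add Y11E Y12E Y21E Ed)
  finally show "\<pi> ^ ?M dvd (comm u w $ 1 $ 1 - comm u w $ 2 $ 2) - 2 * (u $ 1 $ 2 * w $ 2 $ 1 - u $ 2 $ 1 * w $ 1 $ 2)"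
    unfolding Y11_def .
  have "comm u w $ 1 $ 2 - 2 * (u $ 1 $ 2 * (w $ 2 $ 2 - 1) - (u $ 2 $ 2 - 1) * w $ 1 $ 2) =
      Y11 * E $ 1 $ 2 + Y12 * (E $ 2 $ 2 - 1) + (Y12 - 2 * (u $ 1 $ 2 * (w $ 2 $ 2 - 1) - (u $ 2 $ 2 - 1) * w $ 1 $ 2))"
    unfolding ce by (simp add: algebra_simps)
  also have "\<pi> ^ ?M dvd \<dots>" by (intro dvd_add Y11E Y12E Ed Y12)
  finally show "\<pi> ^ ?M dvd comm u w $ 1 $ 2 - 2 * (u $ 1 $ 2 * (w $ 2 $ 2 - 1) - (u $ 2 $ 2 - 1) * w $ 1 $ 2)" .
  have "comm u w $ 2 $ 1 - 2 * ((u $ 2 $ 2 - 1) * w $ 2 $ 1 - u $ 2 $ 1 * (w $ 2 $ 2 - 1)) =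
      Y21 * (E $ 1 $ 1 - 1) - Y11 * E $ 2 $ 1 + (Y21 - 2 * ((u $ 2 $ 2 - 1) * w $ 2 $ 1 - u $ 2 $ 1 * (w $ 2 $ 2 - 1)))"
    unfolding ce by (simp add: algebra_simps)
  also have "\<pi> ^ ?M dvd \<dots>" by (intro dvd_add dvd_diff Y11E Y21E Ed Y21)
  finally show "\<pi> ^ ?M dvd comm u w $ 2 $ 1 - 2 * ((u $ 2 $ 2 - 1) * w $ 2 $ 1 - u $ 2 $ 1 * (w $ 2 $ 2 - 1))" .
qed

lemma comm_in_Ker:
  assumes u: "u \<in> Lev i" and w: "w \<in> Lev j" and ij: "m \<le> i" "m \<le> j"
  shows "comm u w \<in> Ker (i + j + v)"
proof -
  note U = LevD[OF u] and W = LevD[OF w]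
  have um: "u \<in> Lev m" and wm: "w \<in> Lev m" using u w ij Lev_mono by blast+
  have *: "\<pi> ^ (i + j + v) dvd x" if "\<pi> ^ (i + j + v + 1) dvd x - 2 * y" "\<pi> ^ (i + j) dvd y" for x y
    using dvd_add[OF pow_le_dvd[OF that(1)], of "i + j + v" "2 * y"] that(2) two_mult_dvd[of "i + j" y] by simp
  have 1: "\<pi> ^ (i + j) dvd u $ 1 $ 2 * w $ 2 $ 1 - u $ 2 $ 1 * w $ 1 $ 2"
    "\<pi> ^ (i + j) dvd u $ 1 $ 2 * (w $ 2 $ 2 - 1) - (u $ 2 $ 2 - 1) * w $ 1 $ 2"
    "\<pi> ^ (i + j) dvd (u $ 2 $ 2 - 1) * w $ 2 $ 1 - u $ 2 $ 1 * (w $ 2 $ 2 - 1)"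
    by (intro dvd_diff pow_mult_dvd[of i _ j] U W; simp)+
  show ?thesis
    unfolding Ker_def mem_Collect_eq
    by (intro conjI comm_Lev um wm) (rule *[OF comm_leading_terms(1)[OF u w ij] 1(1)]
      *[OF comm_leading_terms(2)[OF u w ij] 1(2)] *[OF comm_leading_terms(3)[OF u w ij] 1(3)])+
qed

text \<open>With entries \<open>a\<close>, \<open>b\<close>, \<open>c\<close>, \<open>d\<close>, the
  determinant condition reads \<open>d * (a - d) = b * c - (d - 1) * (d + 1)\<close>. Here
  \<open>d\<close> is a unit, and \<open>d + 1 = 2 + (d - 1)\<close> has valuation exactly
  \<open>v\<close> since \<open>\<pi> ^ m\<close> divides \<open>d - 1\<close>. So being scalar to
  level \<open>N\<close> fixes \<open>d\<close> only to level \<open>N - v\<close>.\<close>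

lemma Ker_iff:
  assumes N: "m + v \<le> N"
  shows "A \<in> Ker N \<longleftrightarrow> A \<in> Lev m \<and> \<pi> ^ N dvd A $ 1 $ 2 \<and> \<pi> ^ N dvd A $ 2 $ 1 \<and> \<pi> ^ (N - v) dvd A $ 2 $ 2 - 1"
proof -
  have "\<pi> ^ N dvd A $ 1 $ 1 - A $ 2 $ 2 \<longleftrightarrow> \<pi> ^ (N - v) dvd A $ 2 $ 2 - 1"
    if A: "A \<in> Lev m" and b: "\<pi> ^ N dvd A $ 1 $ 2"
  proof -
    note Ad = LevD[OF A]
    let ?d = "A $ 2 $ 2"
    have pim: "\<pi> dvd x" if "\<pi> ^ m dvd x" for x using pow_le_dvd[OF that, of 1] v_less_m by simp
    have du: "?d dvd 1" using one_plus_unit[OF pim[OF Ad(5)]] by simp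
    have "?d * (A $ 1 $ 1 - ?d) = A $ 1 $ 2 * A $ 2 $ 1 - (?d - 1) * (?d + 1)"
      using Ad(1) by (simp add: algebra_simps eq_diff_eq)
    then have "\<pi> ^ N dvd A $ 1 $ 1 - ?d \<longleftrightarrow> \<pi> ^ N dvd A $ 1 $ 2 * A $ 2 $ 1 - (?d - 1) * (?d + 1)"
      using unit_mult_dvd[OF du, of N "A $ 1 $ 1 - ?d"] by simp
    also have "\<dots> \<longleftrightarrow> \<pi> ^ N dvd (?d - 1) * (?d + 1)"
    proof
      let ?P = "A $ 1 $ 2 * A $ 2 $ 1" and ?Q = "(?d - 1) * (?d + 1)"
      note P = dvd_mult2[OF b, of "A $ 2 $ 1"]
      show "\<pi> ^ N dvd ?Q" if "\<pi> ^ N dvd ?P - ?Q" using dvd_diff[OF P that] by (simp only: diff_diff_eq2 add_diff_cancel_left')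
      show "\<pi> ^ N dvd ?P - ?Q" if "\<pi> ^ N dvd ?Q" by (rule dvd_diff[OF P that])
    qed
    also have "\<dots> \<longleftrightarrow> \<pi> ^ (N - v) dvd ?d - 1"
    proof -
      obtain y where y: "?d - 1 = \<pi> ^ m * y" using Ad(5) by (auto simp: dvd_def)
      have pm: "\<pi> ^ m = \<pi> ^ v * (\<pi> * \<pi> ^ (m - v - 1))"
      proof -
        have "m = v + Suc (m - v - 1)" using v_less_m by simp
        then show ?thesis by (metis power_add power_Suc)
      qed
      have "?d + 1 = (?d - 1) + 2" by simp
      also have "\<dots> = \<pi> ^ v * (\<epsilon> + \<pi> * (\<pi> ^ (m - v - 1) * y))" unfolding y pm two by (simp add: algebra_simps)
      finally have d1: "?d + 1 = \<pi> ^ v * (\<epsilon> + \<pi> * (\<pi> ^ (m - v - 1) * y))" .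
      have "\<not> \<pi> dvd \<epsilon>" using eps unit_iff by simp
      then have u: "(\<epsilon> + \<pi> * (\<pi> ^ (m - v - 1) * y)) dvd 1" unfolding unit_iff
        using dvd_add_left_iff[OF dvd_triv_left[of \<pi> "\<pi> ^ (m - v - 1) * y"], of \<epsilon>] by simp
      have NN: "\<pi> ^ N = \<pi> ^ v * \<pi> ^ (N - v)" using N by (simp flip: power_add)
      have "(?d - 1) * (?d + 1) = \<pi> ^ v * ((\<epsilon> + \<pi> * (\<pi> ^ (m - v - 1) * y)) * (?d - 1))" unfolding d1 by (simp add: mult_ac)
      then have "\<pi> ^ N dvd (?d - 1) * (?d + 1) \<longleftrightarrow> \<pi> ^ v * \<pi> ^ (N - v) dvd \<pi> ^ v * ((\<epsilon> + \<pi> * (\<pi> ^ (m - v - 1) * y)) * (?d - 1))"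
        unfolding NN by (simp only:)
      also have "\<dots> \<longleftrightarrow> \<pi> ^ (N - v) dvd (\<epsilon> + \<pi> * (\<pi> ^ (m - v - 1) * y)) * (?d - 1)"
        using pi_pow_nz by (simp only: dvd_mult_cancel_left) simp
      also have "\<dots> \<longleftrightarrow> \<pi> ^ (N - v) dvd ?d - 1" by (rule unit_mult_dvd[OF u])
      finally show ?thesis .
    qed
    finally show ?thesis .
  qed
  then show ?thesis unfolding Ker_def by blast
qed

definition unit_inv :: "'o \<Rightarrow> 'o" where
  "unit_inv x = (SOME y. x * y = 1)"

lemma unit_inv: "x dvd 1 \<Longrightarrow> x * unit_inv x = 1"
  unfolding unit_inv_def by (rule someI_ex) (metis dvd_def)

lemma pi_dvd: "\<pi> ^ n dvd x \<Longrightarrow> 0 < n \<Longrightarrow> \<pi> dvd x"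
  using pow_le_dvd[of n x 1] by simp

text \<open>Coordinates on the group: the upper left entry is determined by the other three through
  the determinant, \<open>1 + x\<close> being a unit when \<open>\<pi>\<close> divides
  \<open>x\<close>.\<close>

definition elt :: "'o \<Rightarrow> 'o \<Rightarrow> 'o \<Rightarrow> 'o^2^2" where
  "elt x y z = mat22 ((1 + y * z) * unit_inv (1 + x)) y z (1 + x)"

lemma elt_nth [simp]: "elt x y z $ 1 $ 2 = y" "elt x y z $ 2 $ 1 = z" "elt x y z $ 2 $ 2 = 1 + x"
  by (simp_all add: elt_def)

lemma elt_11: "\<pi> dvd x \<Longrightarrow> elt x y z $ 1 $ 1 * (1 + x) = 1 + y * z"
  using unit_inv[OF one_plus_unit[of x]] by (simp add: elt_def mult_ac)

lemma elt_Lev: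
  assumes n: "0 < n" and d: "\<pi> ^ n dvd x" "\<pi> ^ n dvd y" "\<pi> ^ n dvd z"
  shows "elt x y z \<in> Lev n"
proof -
  have x: "\<pi> dvd x" using pi_dvd[OF d(1) n] .
  note e = elt_11[OF x, of y z]
  have "(1 + x) * (elt x y z $ 1 $ 1 - 1) = y * z - x" using e by (simp add: algebra_simps)
  moreover have "\<pi> ^ n dvd y * z - x" by (intro dvd_diff dvd_mult2 d)
  ultimately have "\<pi> ^ n dvd elt x y z $ 1 $ 1 - 1"
    using unit_mult_dvd[OF one_plus_unit[OF x], of n "elt x y z $ 1 $ 1 - 1"] by simp
  then show ?thesis using e d by (simp add: Lev_def)
qed

text \<open>A diagonal deviation known only to level \<open>N - v\<close> enters an off-diagonal
  coordinate after multiplication by an off-diagonal entry, of level \<open>m > v\<close>, so the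
  two moduli are compatible.\<close>

lemma Ker_quotient_iff:
  assumes A: "A \<in> Lev m" and B: "B \<in> Lev m" and N: "m + v \<le> N"
  shows "A ** adj22 B \<in> Ker N \<longleftrightarrow>
    \<pi> ^ N dvd A $ 1 $ 2 - B $ 1 $ 2 \<and> \<pi> ^ N dvd A $ 2 $ 1 - B $ 2 $ 1 \<and> \<pi> ^ (N - v) dvd A $ 2 $ 2 - B $ 2 $ 2"
proof
  note Ad = LevD[OF A] and Bd = LevD[OF B]
  have Nv: "N - v \<le> N" "N \<le> (N - v) + m" using v_less_m N by auto
  {
    assume "A ** adj22 B \<in> Ker N"
    moreover define C where "C = A ** adj22 B"
    ultimately have C: "C \<in> Ker N" by simp
    note c = KerD[OF C]
    have c22: "\<pi> ^ (N - v) dvd C $ 2 $ 2 - 1" using C Ker_iff[OF N] by blast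
    have "\<pi> ^ (N - v) dvd (C $ 1 $ 1 - C $ 2 $ 2) + (C $ 2 $ 2 - 1)"
      by (rule dvd_add[OF pow_le_dvd[OF c(2) Nv(1)] c22])
    then have c11: "\<pi> ^ (N - v) dvd C $ 1 $ 1 - 1" by simp
    have "A = C ** B" unfolding C_def using adj_mult(2)[OF B] by (simp add: matrix_mul_assoc[symmetric])
    then have e: "A $ 1 $ 2 - B $ 1 $ 2 = (C $ 1 $ 1 - 1) * B $ 1 $ 2 + C $ 1 $ 2 * B $ 2 $ 2"
      "A $ 2 $ 1 - B $ 2 $ 1 = C $ 2 $ 1 * B $ 1 $ 1 + (C $ 2 $ 2 - 1) * B $ 2 $ 1"
      "A $ 2 $ 2 - B $ 2 $ 2 = C $ 2 $ 1 * B $ 1 $ 2 + (C $ 2 $ 2 - 1) * B $ 2 $ 2"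
      by (simp_all add: algebra_simps)
    show "\<pi> ^ N dvd A $ 1 $ 2 - B $ 1 $ 2 \<and> \<pi> ^ N dvd A $ 2 $ 1 - B $ 2 $ 1 \<and> \<pi> ^ (N - v) dvd A $ 2 $ 2 - B $ 2 $ 2"
      unfolding e by (intro conjI dvd_add pow_mult_dvd[OF c11 Bd(3) Nv(2)] pow_mult_dvd[OF c22 Bd(4) Nv(2)]
        dvd_mult2[OF c(3)] dvd_mult2[OF c(4)] dvd_mult2[OF c22] dvd_mult2[OF pow_le_dvd[OF c(4) Nv(1)]])
  next
    assume h: "\<pi> ^ N dvd A $ 1 $ 2 - B $ 1 $ 2 \<and> \<pi> ^ N dvd A $ 2 $ 1 - B $ 2 $ 1 \<and> \<pi> ^ (N - v) dvd A $ 2 $ 2 - B $ 2 $ 2"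
    then have h1: "\<pi> ^ N dvd A $ 1 $ 2 - B $ 1 $ 2" and h2: "\<pi> ^ N dvd A $ 2 $ 1 - B $ 2 $ 1"
      and h3: "\<pi> ^ (N - v) dvd A $ 2 $ 2 - B $ 2 $ 2" by blast+
    have "A $ 2 $ 2 * (A $ 1 $ 1 - B $ 1 $ 1) =
      (A $ 1 $ 1 * A $ 2 $ 2 - A $ 1 $ 2 * A $ 2 $ 1) - (B $ 1 $ 1 * B $ 2 $ 2 - B $ 1 $ 2 * B $ 2 $ 1)
      + (A $ 1 $ 2 - B $ 1 $ 2) * A $ 2 $ 1 + (A $ 2 $ 1 - B $ 2 $ 1) * B $ 1 $ 2 - (A $ 2 $ 2 - B $ 2 $ 2) * B $ 1 $ 1"
      by (simp add: algebra_simps)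
    also have "\<dots> = (A $ 1 $ 2 - B $ 1 $ 2) * A $ 2 $ 1 + (A $ 2 $ 1 - B $ 2 $ 1) * B $ 1 $ 2 - (A $ 2 $ 2 - B $ 2 $ 2) * B $ 1 $ 1"
      unfolding Ad(1) Bd(1) by simp
    also have "\<pi> ^ (N - v) dvd \<dots>"
      by (intro dvd_diff[of _ "_ + _" "_ * _"] dvd_add dvd_mult2[OF pow_le_dvd[OF h1 Nv(1)]]
        dvd_mult2[OF pow_le_dvd[OF h2 Nv(1)]] dvd_mult2[OF h3])
    finally have "\<pi> ^ (N - v) dvd A $ 2 $ 2 * (A $ 1 $ 1 - B $ 1 $ 1)" .
    moreover have "A $ 2 $ 2 dvd 1" using one_plus_unit[OF pi_dvd[OF Ad(5)]] v_less_m by simp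
    ultimately have h4: "\<pi> ^ (N - v) dvd A $ 1 $ 1 - B $ 1 $ 1" using unit_mult_dvd by blast
    define C where "C = A ** adj22 B"
    have CL: "C \<in> Lev m" unfolding C_def using A B by (intro Lev_mult Lev_adj)
    have "C $ 1 $ 2 = (A $ 1 $ 2 - B $ 1 $ 2) * B $ 1 $ 1 - (A $ 1 $ 1 - B $ 1 $ 1) * B $ 1 $ 2"
      "C $ 2 $ 1 = (A $ 2 $ 1 - B $ 2 $ 1) * B $ 2 $ 2 - (A $ 2 $ 2 - B $ 2 $ 2) * B $ 2 $ 1"
      by (simp_all add: C_def algebra_simps)
    moreover have "C $ 2 $ 2 - (B $ 1 $ 1 * B $ 2 $ 2 - B $ 1 $ 2 * B $ 2 $ 1) =
        (A $ 2 $ 2 - B $ 2 $ 2) * B $ 1 $ 1 - (A $ 2 $ 1 - B $ 2 $ 1) * B $ 1 $ 2"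
      by (simp add: C_def algebra_simps)
    then have "C $ 2 $ 2 - 1 = (A $ 2 $ 2 - B $ 2 $ 2) * B $ 1 $ 1 - (A $ 2 $ 1 - B $ 2 $ 1) * B $ 1 $ 2"
      unfolding Bd(1) .
    ultimately have "\<pi> ^ N dvd C $ 1 $ 2" "\<pi> ^ N dvd C $ 2 $ 1" "\<pi> ^ (N - v) dvd C $ 2 $ 2 - 1"
      using dvd_diff[OF dvd_mult2[OF h1] pow_mult_dvd[OF h4 Bd(3) Nv(2)], of "B $ 1 $ 1"]
        dvd_diff[OF dvd_mult2[OF h2] pow_mult_dvd[OF h3 Bd(4) Nv(2)], of "B $ 2 $ 2"]
        dvd_diff[OF dvd_mult2[OF h3] dvd_mult2[OF pow_le_dvd[OF h2 Nv(1)]], of "B $ 1 $ 1" "B $ 1 $ 2"] by (simp_all only:)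
    then show "A ** adj22 B \<in> Ker N" using CL unfolding C_def[symmetric] Ker_iff[OF N] by blast
  }
qed

lemma Ker_coset_eq_iff:
  assumes A: "A \<in> Lev m" and B: "B \<in> Lev m"
  shows "Ker N #>\<^bsub>G\<^esub> A = Ker N #>\<^bsub>G\<^esub> B \<longleftrightarrow> A ** adj22 B \<in> Ker N"
proof -
  interpret group G by (rule group_G)
  have "A \<in> Ker N #>\<^bsub>G\<^esub> B \<longleftrightarrow> A ** adj22 B \<in> Ker N"
    using subgroup.rcos_module[OF Ker_subgroup group_G, of B A N] A B by simp
  moreover have "A \<in> Ker N #>\<^bsub>G\<^esub> A" using A rcos_self[OF _ Ker_subgroup] by simp
  ultimately show ?thesis using repr_independence[OF _ _ Ker_subgroup, of A N B] B by auto
qed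

text \<open>All coordinates start at \<open>\<pi> ^ m\<close>, so \<open>N - m\<close> digits are
  free, but only \<open>N - v - m\<close> in the diagonal coordinate.\<close>

lemma bij_Ker_cosets:
  assumes N: "m + v \<le> N"
  shows "bij_betw (\<lambda>(x,y,z). Ker N #>\<^bsub>G\<^esub> elt (\<pi> ^ m * x) (\<pi> ^ m * y) (\<pi> ^ m * z))
    (res (N - v - m) \<times> res (N - m) \<times> res (N - m)) (rcosets\<^bsub>G\<^esub> Ker N)"
proof -
  let ?f = "\<lambda>x y z. elt (\<pi> ^ m * x) (\<pi> ^ m * y) (\<pi> ^ m * z)"
  have L: "?f x y z \<in> Lev m" for x y z using v_less_m by (intro elt_Lev) auto
  have e1: "N = m + (N - m)" and e2: "N - v = m + (N - v - m)" using N by auto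
  have c1: "\<pi> ^ N dvd \<pi> ^ m * x \<longleftrightarrow> \<pi> ^ (N - m) dvd x" for x by (subst e1) (rule pi_cancel)
  have c2: "\<pi> ^ (N - v) dvd \<pi> ^ m * x \<longleftrightarrow> \<pi> ^ (N - v - m) dvd x" for x by (subst e2) (rule pi_cancel)
  show ?thesis
    unfolding bij_betw_def
  proof (intro conjI inj_onI)
    fix s t assume s: "s \<in> res (N - v - m) \<times> res (N - m) \<times> res (N - m)"
      and t: "t \<in> res (N - v - m) \<times> res (N - m) \<times> res (N - m)"
      and eq: "(\<lambda>(x,y,z). Ker N #>\<^bsub>G\<^esub> ?f x y z) s = (\<lambda>(x,y,z). Ker N #>\<^bsub>G\<^esub> ?f x y z) t"
    obtain x y z where s': "s = (x,y,z)" by (cases s)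
    obtain x' y' z' where t': "t = (x',y',z')" by (cases t)
    have "Ker N #>\<^bsub>G\<^esub> ?f x y z = Ker N #>\<^bsub>G\<^esub> ?f x' y' z'" using eq by (simp add: s' t')
    then have "\<pi> ^ N dvd \<pi> ^ m * (y - y')" "\<pi> ^ N dvd \<pi> ^ m * (z - z')" "\<pi> ^ (N - v) dvd \<pi> ^ m * (x - x')"
      unfolding Ker_coset_eq_iff[OF L L] Ker_quotient_iff[OF L L N] by (simp_all add: right_diff_distrib)
    then have "\<pi> ^ (N - m) dvd y - y'" "\<pi> ^ (N - m) dvd z - z'" "\<pi> ^ (N - v - m) dvd x - x'"
      unfolding c1 c2 .
    moreover have "x \<in> res (N - v - m)" "x' \<in> res (N - v - m)" "y \<in> res (N - m)" "y' \<in> res (N - m)"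
      "z \<in> res (N - m)" "z' \<in> res (N - m)" using s t unfolding s' t' by simp_all
    ultimately have "y = y'" "z = z'" "x = x'" by (blast intro: res_unique)+
    then show "s = t" unfolding s' t' by simp
  next
    show "(\<lambda>(x,y,z). Ker N #>\<^bsub>G\<^esub> ?f x y z) ` (res (N - v - m) \<times> res (N - m) \<times> res (N - m)) = rcosets\<^bsub>G\<^esub> Ker N"
    proof (intro equalityI subsetI)
      fix C assume "C \<in> rcosets\<^bsub>G\<^esub> Ker N"
      then obtain A where A: "A \<in> Lev m" "C = Ker N #>\<^bsub>G\<^esub> A" by (auto simp: RCOSETS_def)
      note Ad = LevD[OF A(1)]
      obtain x y z where xyz: "A $ 2 $ 2 - 1 = \<pi> ^ m * x" "A $ 1 $ 2 = \<pi> ^ m * y" "A $ 2 $ 1 = \<pi> ^ m * z"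
        using Ad(3-5) unfolding dvd_def by blast
      obtain x' where x': "x' \<in> res (N - v - m)" "\<pi> ^ (N - v - m) dvd x - x'" using res(3) by blast
      obtain y' where y': "y' \<in> res (N - m)" "\<pi> ^ (N - m) dvd y - y'" using res(3) by blast
      obtain z' where z': "z' \<in> res (N - m)" "\<pi> ^ (N - m) dvd z - z'" using res(3) by blast
      have "A ** adj22 (?f x' y' z') \<in> Ker N"
      proof (subst Ker_quotient_iff[OF A(1) L N], intro conjI)
        show "\<pi> ^ N dvd A $ 1 $ 2 - ?f x' y' z' $ 1 $ 2" using y'(2) c1[of "y - y'"] xyz by (simp add: right_diff_distrib)
        show "\<pi> ^ N dvd A $ 2 $ 1 - ?f x' y' z' $ 2 $ 1" using z'(2) c1[of "z - z'"] xyz by (simp add: right_diff_distrib)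
        have "A $ 2 $ 2 - ?f x' y' z' $ 2 $ 2 = \<pi> ^ m * (x - x')"
          using xyz(1) by (simp add: algebra_simps)
        then show "\<pi> ^ (N - v) dvd A $ 2 $ 2 - ?f x' y' z' $ 2 $ 2" using x'(2) c2[of "x - x'"] by simp
      qed
      then have "C = Ker N #>\<^bsub>G\<^esub> ?f x' y' z'" unfolding A(2) Ker_coset_eq_iff[OF A(1) L] .
      then show "C \<in> (\<lambda>(x,y,z). Ker N #>\<^bsub>G\<^esub> ?f x y z) ` (res (N - v - m) \<times> res (N - m) \<times> res (N - m))"
        using x' y' z' by (intro image_eqI[of _ _ "(x',y',z')"]) auto
    next
      fix C assume "C \<in> (\<lambda>(x,y,z). Ker N #>\<^bsub>G\<^esub> ?f x y z) ` (res (N - v - m) \<times> res (N - m) \<times> res (N - m))"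
      then show "C \<in> rcosets\<^bsub>G\<^esub> Ker N" using L by (auto simp: RCOSETS_def)
    qed
  qed
qed

lemma card_Ker_cosets:
  assumes N: "m + v \<le> N"
  shows "finite (rcosets\<^bsub>G\<^esub> Ker N)" "card (rcosets\<^bsub>G\<^esub> Ker N) = q ^ (3 * (N - m) - v)"
proof -
  let ?S = "res (N - v - m) \<times> res (N - m) \<times> res (N - m)"
  show "finite (rcosets\<^bsub>G\<^esub> Ker N)" using bij_betw_finite[OF bij_Ker_cosets[OF N]] res(1) by simp
  have "card (rcosets\<^bsub>G\<^esub> Ker N) = card ?S" using bij_betw_same_card[OF bij_Ker_cosets[OF N]] by simp
  also have "\<dots> = q ^ ((N - v - m) + (N - m) + (N - m))"
    by (simp add: card_cartesian_product res(2) power_add)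
  also have "(N - v - m) + (N - m) + (N - m) = 3 * (N - m) - v" using N by simp
  finally show "card (rcosets\<^bsub>G\<^esub> Ker N) = q ^ (3 * (N - m) - v)" .
qed

lemma fin_quot_group_Ker: "m + v \<le> N \<Longrightarrow> fin_quot_group G (Ker N)"
  by (intro fin_quot_group.intro group_G fin_quot_group_axioms.intro Ker_normal card_Ker_cosets(1))

section \<open>Lower bound for the dimension\<close>

lemma rep_conj:
  assumes "fin_quot_group.krep G K n \<rho>" "fin_quot_group G K" "u \<in> Lev m" "w \<in> Lev m"
  shows "\<rho> u * \<rho> w * \<rho> (inv\<^bsub>G\<^esub> u) = \<rho> (comm u w) * \<rho> w"
proof -
  interpret Q: fin_quot_group G K by fact
  note r = Q.krepD[OF assms(1)]
  have iu: "inv\<^bsub>G\<^esub> u \<in> Lev m" using assms(3) Lev_adj by simp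
  have "\<rho> (u \<otimes>\<^bsub>G\<^esub> w \<otimes>\<^bsub>G\<^esub> inv\<^bsub>G\<^esub> u) = \<rho> u * \<rho> w * \<rho> (inv\<^bsub>G\<^esub> u)"
    using r(2)[of "u \<otimes>\<^bsub>G\<^esub> w" "inv\<^bsub>G\<^esub> u"] r(2)[of u w] assms(3,4) iu Lev_mult by simp
  then show ?thesis
    using r(2)[of "comm u w" w] comm_Lev assms(3,4) unfolding conj_eq_comm[OF assms(3,4)] by simp
qed

lemma rep_commute:
  assumes kr: "fin_quot_group.krep G K n \<rho>" and Q: "fin_quot_group G K" and u: "u \<in> Lev m" and w: "w \<in> Lev m"
    and c: "\<rho> (comm u w) = 1\<^sub>m n"
  shows "\<rho> u * \<rho> w = \<rho> w * \<rho> u"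
proof -
  interpret Q: fin_quot_group G K by (rule Q)
  note r = Q.krepD[OF kr]
  have uc: "\<rho> u \<in> carrier_mat n n" and wc: "\<rho> w \<in> carrier_mat n n" and ic: "\<rho> (inv\<^bsub>G\<^esub> u) \<in> carrier_mat n n"
    and iu: "\<rho> (inv\<^bsub>G\<^esub> u) * \<rho> u = 1\<^sub>m n"
    using r(1)[of u] r(1)[of w] r(1)[of "inv\<^bsub>G\<^esub> u"] r(6)[of u] u w Lev_adj by simp_all
  have "\<rho> u * \<rho> w = \<rho> u * \<rho> w * (\<rho> (inv\<^bsub>G\<^esub> u) * \<rho> u)"
    unfolding iu using right_mult_one_mat[OF mult_carrier_mat[OF uc wc]] by simp
  also have "\<dots> = \<rho> u * \<rho> w * \<rho> (inv\<^bsub>G\<^esub> u) * \<rho> u"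
    using assoc_mult_mat[OF mult_carrier_mat[OF uc wc] ic uc] by simp
  also have "\<rho> u * \<rho> w * \<rho> (inv\<^bsub>G\<^esub> u) = \<rho> w"
    unfolding rep_conj[OF kr Q u w] c using wc by simp
  finally show ?thesis .
qed

text \<open>\<open>Ker (N - 1)\<close> is central modulo \<open>Ker N\<close>, since commutators
  with arbitrary elements of the group gain \<open>m \<ge> 1\<close> levels; Schur's lemma
  applies.\<close>

lemma rep_Ker_scalar:
  assumes \<rho>: "fin_quot_group.irred G (Ker N) n \<rho>" and N: "m + v \<le> N" and z: "z \<in> Ker (N - 1)"
  obtains c where "\<rho> z = c \<cdot>\<^sub>m 1\<^sub>m n"
proof -
  note Q' = fin_quot_group_Ker[OF N]
  interpret Q: fin_quot_group G "Ker N" by (rule Q')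
  note kr = Q.irredD(1)[OF \<rho>] and r = Q.krepD[OF Q.irredD(1)[OF \<rho>]]
  have zL: "z \<in> Lev m" using KerD(1)[OF z] .
  have zc: "\<rho> z \<in> carrier_mat n n" using r(1) zL by simp
  have "\<rho> g * \<rho> z = \<rho> z * \<rho> g" if g: "g \<in> carrier G" for g
  proof -
    have gL: "g \<in> Lev m" using g by simp
    have "comm g z \<in> Lev (m + (N - 1))" using comm_in_Lev_sum[OF Lev_in_Ker[OF gL] z] by simp
    then have "comm g z \<in> Lev N" by (rule subsetD[OF Lev_mono, rotated]) (use v_less_m in simp)
    then have "comm g z \<in> Ker N" using N by (intro Lev_in_Ker) simp_all
    then show ?thesis using rep_commute[OF kr Q' gL zL] r(3) by simp
  qed
  then show ?thesis using Q.schur_scalar[OF \<rho> zc] that by metis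
qed

text \<open>The quotient \<open>z ** adj22 z'\<close> lies in \<open>Ker N\<close>: apart from the
  three given differences, its coordinates involve only products of an entry of level
  \<open>N - 1\<close> with one of level \<open>m\<close> or \<open>N - 1\<close>.\<close>

lemma rep_Ker_cong:
  assumes kr: "fin_quot_group.krep G (Ker N) n \<rho>" and N: "m + v \<le> N" "2 \<le> N"
    and z: "z \<in> Ker (N - 1)" and z': "z' \<in> Ker (N - 1)"
    and h: "\<pi> ^ N dvd (z $ 1 $ 1 - z $ 2 $ 2) - (z' $ 1 $ 1 - z' $ 2 $ 2)"
      "\<pi> ^ N dvd z $ 1 $ 2 - z' $ 1 $ 2" "\<pi> ^ N dvd z $ 2 $ 1 - z' $ 2 $ 1"
  shows "\<rho> z = \<rho> z'"
proof -
  interpret Q: fin_quot_group G "Ker N" by (rule fin_quot_group_Ker[OF N(1)])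
  note r = Q.krepD[OF kr]
  note Z = KerD[OF z] and Z' = KerD[OF z']
  note L = LevD[OF Z(1)] and L' = LevD[OF Z'(1)]
  define C where "C = z ** adj22 z'"
  have CL: "C \<in> Lev m" unfolding C_def using Z(1) Z'(1) by (intro Lev_mult Lev_adj)
  have le: "N \<le> (N - 1) + m" "N \<le> (N - 1) + (N - 1)" using v_less_m N by auto
  have 11: "\<pi> ^ m dvd z $ 1 $ 1 - z' $ 1 $ 1" using dvd_diff[OF L(2) L'(2)] by simp
  have 22: "\<pi> ^ m dvd z $ 2 $ 2 - z' $ 2 $ 2" using dvd_diff[OF L(5) L'(5)] by simp
  have c: "C $ 1 $ 2 = (z $ 1 $ 2 - z' $ 1 $ 2) * z' $ 1 $ 1 - z' $ 1 $ 2 * (z $ 1 $ 1 - z' $ 1 $ 1)"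
    "C $ 2 $ 1 = (z $ 2 $ 1 - z' $ 2 $ 1) * z' $ 2 $ 2 - z' $ 2 $ 1 * (z $ 2 $ 2 - z' $ 2 $ 2)"
    "C $ 1 $ 1 - C $ 2 $ 2 = ((z $ 1 $ 1 - z $ 2 $ 2) - (z' $ 1 $ 1 - z' $ 2 $ 2)) * z' $ 2 $ 2
       - (z' $ 1 $ 1 - z' $ 2 $ 2) * (z $ 2 $ 2 - z' $ 2 $ 2) + (z $ 2 $ 1 * z' $ 1 $ 2 - z $ 1 $ 2 * z' $ 2 $ 1)"
    by (simp_all add: C_def algebra_simps)
  have "C \<in> Ker N"
    unfolding Ker_def mem_Collect_eq c
    by (intro conjI CL dvd_add dvd_diff[of _ "_ * _" "_ * _"] dvd_mult2[OF h(1)] dvd_mult2[OF h(2)] dvd_mult2[OF h(3)]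
      pow_mult_dvd[OF Z'(2) 22 le(1)] pow_mult_dvd[OF Z'(3) 11 le(1)] pow_mult_dvd[OF Z'(4) 22 le(1)]
      pow_mult_dvd[OF Z(4) Z'(3) le(2)] pow_mult_dvd[OF Z(3) Z'(4) le(2)])
  then have "\<rho> C = 1\<^sub>m n" by (rule r(3))
  moreover have "C ** z' = z" unfolding C_def using adj_mult(2)[OF Z'(1)] by (simp add: matrix_mul_assoc[symmetric])
  then have "\<rho> z = \<rho> C * \<rho> z'" using r(2)[of C z'] CL Z'(1) by simp
  ultimately show ?thesis using r(1)[of z'] Z'(1) by simp
qed

text \<open>Two elements of the family differ by some \<open>w\<close> of level \<open>i\<close>. A
  partner \<open>u\<close> of level \<open>N - 1 - v - i\<close> has its commutator with
  \<open>w\<close> in \<open>Ker (N - 1)\<close>, where \<open>\<rho>\<close> is scalar. The three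
  congruences prescribe the leading terms so that this commutator acts like \<open>z\<close>, by a
  scalar other than 1.\<close>

lemma dim_lower_bound_from_family:
  assumes \<rho>: "fin_quot_group.irred G (Ker N) n \<rho>" and k: "0 < k" and N: "N = 2 * m + v + k"
    and z: "z \<in> Ker (N - 1)" "\<rho> z \<noteq> 1\<^sub>m n"
    and T: "finite T" "T \<subseteq> Lev m"
    and sep: "\<And>t t'. t \<in> T \<Longrightarrow> t' \<in> T \<Longrightarrow> t \<noteq> t' \<Longrightarrow> \<exists>i u. m \<le> i \<and> i < m + k \<and> adj22 t ** t' \<in> Lev i \<and> u \<in> Lev (N - 1 - v - i) \<and>
        \<pi> ^ N dvd 2 * (u $ 1 $ 2 * (adj22 t ** t') $ 2 $ 1 - u $ 2 $ 1 * (adj22 t ** t') $ 1 $ 2) - (z $ 1 $ 1 - z $ 2 $ 2) \<and>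
        \<pi> ^ N dvd 2 * (u $ 1 $ 2 * ((adj22 t ** t') $ 2 $ 2 - 1) - (u $ 2 $ 2 - 1) * (adj22 t ** t') $ 1 $ 2) - z $ 1 $ 2 \<and>
        \<pi> ^ N dvd 2 * ((u $ 2 $ 2 - 1) * (adj22 t ** t') $ 2 $ 1 - u $ 2 $ 1 * ((adj22 t ** t') $ 2 $ 2 - 1)) - z $ 2 $ 1"
  shows "card T \<le> n\<^sup>2"
proof -
  have Nm: "m + v \<le> N" "2 \<le> N" using N v_less_m k by auto
  note Q' = fin_quot_group_Ker[OF Nm(1)]
  interpret Q: fin_quot_group G "Ker N" by (rule Q')
  note kr = Q.irredD(1)[OF \<rho>] and r = Q.krepD[OF Q.irredD(1)[OF \<rho>]]
  define ok where "ok w i \<longleftrightarrow> m \<le> i \<and> i < m + k \<and> w \<in> Lev i \<and> (\<exists>u. u \<in> Lev (N - 1 - v - i) \<and>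
        \<pi> ^ N dvd 2 * (u $ 1 $ 2 * w $ 2 $ 1 - u $ 2 $ 1 * w $ 1 $ 2) - (z $ 1 $ 1 - z $ 2 $ 2) \<and>
        \<pi> ^ N dvd 2 * (u $ 1 $ 2 * (w $ 2 $ 2 - 1) - (u $ 2 $ 2 - 1) * w $ 1 $ 2) - z $ 1 $ 2 \<and>
        \<pi> ^ N dvd 2 * ((u $ 2 $ 2 - 1) * w $ 2 $ 1 - u $ 2 $ 1 * (w $ 2 $ 2 - 1)) - z $ 2 $ 1)" for w i
  define lv where "lv w = (SOME i. ok w i)" for w
  have lv: "ok (adj22 t ** t') (lv (adj22 t ** t'))" if "t \<in> T" "t' \<in> T" "t \<noteq> t'" for t t'
    unfolding lv_def by (rule someI_ex) (use sep[OF that] in \<open>auto simp: ok_def simp del: mult22_nth\<close>)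
  \<comment> \<open>The commutators of these elements with elements of level \<open>j\<close> fall
    into \<open>Ker (N - 1)\<close>; the maximum with \<open>m\<close> keeps \<open>C j\<close>
    inside the group for large \<open>j\<close>.\<close>
  define C where "C j = Lev (max m (N - 1 - v - j))" for j
  have CL: "C j \<subseteq> Lev m" for j unfolding C_def by (rule Lev_mono) simp
  have wL: "adj22 t ** t' \<in> Lev m" "inv\<^bsub>G\<^esub> t \<otimes>\<^bsub>G\<^esub> t' = adj22 t ** t'" if "t \<in> T" "t' \<in> T" for t t'
    using subsetD[OF T(2) that(1)] subsetD[OF T(2) that(2)] by (simp_all add: Lev_mult Lev_adj)
  have tri: "\<pi> ^ N dvd a - c" if "\<pi> ^ N dvd a - b" "\<pi> ^ N dvd b - c" for a b c
    using dvd_add[OF that] by simp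
  obtain cz where cz: "\<rho> z = cz \<cdot>\<^sub>m 1\<^sub>m n" using rep_Ker_scalar[OF \<rho> Nm(1) z(1)] .
  have cz1: "cz \<noteq> 1" using cz z(2) by auto
  have key: "comm u w \<in> Ker (N - 1)" if "w \<in> Lev i" "u \<in> Lev (N - 1 - v - i)" "m \<le> i" "i < m + k" for u w i
  proof -
    have le: "m \<le> N - 1 - v - i" using N that by simp
    have e: "(N - 1 - v - i) + i + v = N - 1" using N that by simp
    show ?thesis using comm_in_Ker[OF that(2,1) le that(3)] unfolding e .
  qed
  have "card T \<le> n\<^sup>2"
  proof (rule Q.rep_dim_lower_bound[where C = C and lv = lv, OF kr Q.irredD(2)[OF \<rho>]])
    show "C i \<subseteq> carrier G" for i using CL by simp
    show "finite T" "T \<subseteq> carrier G" using T by auto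
  next
    fix t t' assume t: "t \<in> T" "t' \<in> T" "t \<noteq> t'"
    define w where "w = adj22 t ** t'"
    define i where "i = lv w"
    have ok: "ok w i" using lv[OF t] by (simp add: w_def i_def)
    have w: "w \<in> Lev m" using wL(1)[OF t(1,2)] by (simp add: w_def)
    from ok obtain u where u: "u \<in> Lev (N - 1 - v - i)"
        "\<pi> ^ N dvd 2 * (u $ 1 $ 2 * w $ 2 $ 1 - u $ 2 $ 1 * w $ 1 $ 2) - (z $ 1 $ 1 - z $ 2 $ 2)"
        "\<pi> ^ N dvd 2 * (u $ 1 $ 2 * (w $ 2 $ 2 - 1) - (u $ 2 $ 2 - 1) * w $ 1 $ 2) - z $ 1 $ 2"
        "\<pi> ^ N dvd 2 * ((u $ 2 $ 2 - 1) * w $ 2 $ 1 - u $ 2 $ 1 * (w $ 2 $ 2 - 1)) - z $ 2 $ 1"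
      and i: "m \<le> i" "i < m + k" "w \<in> Lev i" unfolding ok_def by blast
    have le: "m \<le> N - 1 - v - i" using N i by simp
    have uL: "u \<in> Lev m" using u(1) Lev_mono[OF le] by blast
    have e: "(N - 1 - v - i) + i + v + 1 = N" using N i by simp
    note lead = comm_leading_terms[OF u(1) i(3) le i(1), unfolded e]
    have "\<rho> (comm u w) = \<rho> z"
    proof (rule rep_Ker_cong[OF kr Nm key[OF i(3) u(1) i(1,2)] z(1)])
      show "\<pi> ^ N dvd (comm u w $ 1 $ 1 - comm u w $ 2 $ 2) - (z $ 1 $ 1 - z $ 2 $ 2)"
        by (rule tri[OF lead(1) u(2)])
      show "\<pi> ^ N dvd comm u w $ 1 $ 2 - z $ 1 $ 2" by (rule tri[OF lead(2) u(3)])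
      show "\<pi> ^ N dvd comm u w $ 2 $ 1 - z $ 2 $ 1" by (rule tri[OF lead(3) u(4)])
    qed
    then have "\<rho> u * \<rho> w * \<rho> (inv\<^bsub>G\<^esub> u) = (cz \<cdot>\<^sub>m 1\<^sub>m n) * \<rho> w" using rep_conj[OF kr Q' uL w] cz by simp
    also have "\<dots> = cz \<cdot>\<^sub>m \<rho> w" using r(1)[of w] w mult_smult_assoc_mat[of "1\<^sub>m n" n n "\<rho> w" n cz] by simp
    finally have "\<rho> u * \<rho> w * \<rho> (inv\<^bsub>G\<^esub> u) = cz \<cdot>\<^sub>m \<rho> w" .
    moreover have "u \<in> C i" using u(1) le by (simp add: C_def max_def)
    ultimately show "\<exists>u\<in>C (lv (inv\<^bsub>G\<^esub> t \<otimes>\<^bsub>G\<^esub> t')). \<exists>z. z \<noteq> 1 \<and>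
        \<rho> u * \<rho> (inv\<^bsub>G\<^esub> t \<otimes>\<^bsub>G\<^esub> t') * \<rho> (inv\<^bsub>G\<^esub> u) = z \<cdot>\<^sub>m \<rho> (inv\<^bsub>G\<^esub> t \<otimes>\<^bsub>G\<^esub> t')"
      unfolding wL(2)[OF t(1,2)] w_def[symmetric] i_def[symmetric] using cz1 by blast
    fix j u' assume j: "j \<le> lv (inv\<^bsub>G\<^esub> t \<otimes>\<^bsub>G\<^esub> t')" and u': "u' \<in> C j"
    have ji: "j \<le> i" using j unfolding wL(2)[OF t(1,2)] w_def[symmetric] i_def[symmetric] .
    have "max m (N - 1 - v - j) = N - 1 - v - j" using le ji by simp
    then have "u' \<in> Lev (N - 1 - v - j)" using u' unfolding C_def by (simp only:)
    then have u'': "u' \<in> Lev (N - 1 - v - i)" using Lev_mono[OF diff_le_mono2[OF ji]] by blast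
    have u'L: "u' \<in> Lev m" using u' CL by blast
    obtain c where c: "\<rho> (comm u' w) = c \<cdot>\<^sub>m 1\<^sub>m n"
      using rep_Ker_scalar[OF \<rho> Nm(1) key[OF i(3) u'' i(1,2)]] .
    have "\<rho> u' * \<rho> w * \<rho> (inv\<^bsub>G\<^esub> u') = (c \<cdot>\<^sub>m 1\<^sub>m n) * \<rho> w" using rep_conj[OF kr Q' u'L w] c by simp
    also have "\<dots> = c \<cdot>\<^sub>m \<rho> w" using r(1)[of w] w mult_smult_assoc_mat[of "1\<^sub>m n" n n "\<rho> w" n c] by simp
    finally show "\<exists>z. \<rho> u' * \<rho> (inv\<^bsub>G\<^esub> t \<otimes>\<^bsub>G\<^esub> t') * \<rho> (inv\<^bsub>G\<^esub> u') = z \<cdot>\<^sub>m \<rho> (inv\<^bsub>G\<^esub> t \<otimes>\<^bsub>G\<^esub> t')"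
      unfolding wL(2)[OF t(1,2)] w_def[symmetric] by blast
  qed
  then show ?thesis .
qed

lemma exact_level_pair:
  assumes "\<pi> ^ a dvd x" "\<pi> ^ a dvd y" "\<not> (\<pi> ^ b dvd x \<and> \<pi> ^ b dvd y)"
  obtains i where "a \<le> i" "i < b" "\<pi> ^ i dvd x" "\<pi> ^ i dvd y"
    "(\<exists>u. u dvd 1 \<and> x = \<pi> ^ i * u) \<or> (\<exists>u. u dvd 1 \<and> y = \<pi> ^ i * u)"
proof -
  let ?P = "\<lambda>j. \<not> (\<pi> ^ j dvd x \<and> \<pi> ^ j dvd y)"
  define j where "j = (LEAST j. ?P j)"
  have j: "?P j" unfolding j_def using assms(3) by (rule LeastI)
  have jb: "j \<le> b" unfolding j_def using assms(3) by (rule Least_le)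
  have aj: "a < j"
  proof (rule ccontr)
    assume "\<not> a < j"
    then have "j \<le> a" by simp
    then show False using j pow_le_dvd[OF assms(1)] pow_le_dvd[OF assms(2)] by blast
  qed
  then obtain i where i: "j = Suc i" by (cases j) auto
  have "\<not> ?P i" using not_less_Least[of i ?P] i unfolding j_def by simp
  then have d: "\<pi> ^ i dvd x" "\<pi> ^ i dvd y" by auto
  have unit: "u dvd 1" if "w = \<pi> ^ i * u" "\<not> \<pi> ^ j dvd w" for w u
  proof -
    have "\<not> \<pi> dvd u"
    proof
      assume "\<pi> dvd u"
      then have "\<pi> ^ i * \<pi> dvd \<pi> ^ i * u" by (rule mult_dvd_mono[OF dvd_refl])
      then show False using that i by (simp add: mult.commute)
    qed
    then show ?thesis by (rule local)
  qed
  obtain x' y' where "x = \<pi> ^ i * x'" "y = \<pi> ^ i * y'" using d unfolding dvd_def by blast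
  then have "(\<exists>u. u dvd 1 \<and> x = \<pi> ^ i * u) \<or> (\<exists>u. u dvd 1 \<and> y = \<pi> ^ i * u)"
    using j unit[of x x'] unit[of y y'] by blast
  then show ?thesis using that[of i] aj jb i d by simp
qed

text \<open>\<open>2 * x\<close> is a unit times \<open>\<pi> ^ (v + i)\<close>, so \<open>s\<close>
  is a quotient.\<close>

lemma solve_two_mult:
  assumes x: "x = \<pi> ^ i * u" "u dvd 1" and b: "\<pi> ^ (N - 1) dvd b" and i: "i + v \<le> N - 1"
  obtains s where "\<pi> ^ (N - 1 - v - i) dvd s" "2 * (s * x) = b"
proof -
  obtain \<beta> where \<beta>: "b = \<pi> ^ (N - 1) * \<beta>" using b unfolding dvd_def by blast
  have eu: "\<epsilon> * u dvd 1" by (rule unit_mult[OF eps x(2)])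
  have "N - 1 = (N - 1 - v - i) + v + i" using i by simp
  then have pN: "\<pi> ^ (N - 1) = \<pi> ^ (N - 1 - v - i) * \<pi> ^ v * \<pi> ^ i" by (metis power_add)
  show ?thesis
  proof (rule that[of "\<pi> ^ (N - 1 - v - i) * (unit_inv (\<epsilon> * u) * \<beta>)"])
    have "2 * (\<pi> ^ (N - 1 - v - i) * (unit_inv (\<epsilon> * u) * \<beta>) * x) =
        (\<epsilon> * u * unit_inv (\<epsilon> * u)) * (\<pi> ^ (N - 1 - v - i) * \<pi> ^ v * \<pi> ^ i) * \<beta>"
      unfolding two x(1) by (simp only: mult_ac)
    then show "2 * (\<pi> ^ (N - 1 - v - i) * (unit_inv (\<epsilon> * u) * \<beta>) * x) = b"
      unfolding unit_inv[OF eu] pN[symmetric] \<beta> by simp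
  qed simp
qed

lemma Lev_intro:
  assumes A: "A \<in> Lev m" and d: "\<pi> ^ i dvd A $ 1 $ 2" "\<pi> ^ i dvd A $ 2 $ 1" "\<pi> ^ i dvd A $ 2 $ 2 - 1"
  shows "A \<in> Lev i"
proof -
  note Ad = LevD[OF A]
  have "A $ 2 $ 2 * (A $ 1 $ 1 - 1) = (A $ 1 $ 1 * A $ 2 $ 2 - A $ 1 $ 2 * A $ 2 $ 1) - 1 + A $ 1 $ 2 * A $ 2 $ 1 - (A $ 2 $ 2 - 1)"
    by (simp add: algebra_simps)
  also have "\<dots> = A $ 1 $ 2 * A $ 2 $ 1 - (A $ 2 $ 2 - 1)" unfolding Ad(1) by simp
  also have "\<pi> ^ i dvd \<dots>" by (intro dvd_diff[OF dvd_mult2[OF d(1)] d(3)])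
  finally have "\<pi> ^ i dvd A $ 2 $ 2 * (A $ 1 $ 1 - 1)" .
  moreover have "A $ 2 $ 2 dvd 1" using one_plus_unit[OF pi_dvd[OF Ad(5)]] v_less_m by simp
  ultimately have "\<pi> ^ i dvd A $ 1 $ 1 - 1" using unit_mult_dvd by blast
  then show ?thesis using d Ad(1) by (simp add: Lev_def)
qed

lemma card_res_pairs:
  assumes "inj_on f ((\<lambda>r. \<pi> ^ m * r) ` res k \<times> (\<lambda>r. \<pi> ^ m * r) ` res k)"
  shows "card (f ` ((\<lambda>r. \<pi> ^ m * r) ` res k \<times> (\<lambda>r. \<pi> ^ m * r) ` res k)) = q ^ (2 * k)"
proof -
  have "inj_on (\<lambda>r. \<pi> ^ m * r) (res k)" by (rule inj_onI) (simp only: mult_left_cancel[OF pi_pow_nz])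
  then show ?thesis
    using assms by (simp add: card_image card_cartesian_product res(2) mult_2 power_add)
qed

lemma elt_mult_unipotent:
  "elt 0 b 0 ** elt 0 (- b) 0 = Finite_Cartesian_Product.mat 1" "elt 0 0 c ** elt 0 0 (- c) = Finite_Cartesian_Product.mat 1"
  "elt 0 b 0 $ 1 $ 1 = 1" "elt 0 0 c $ 1 $ 1 = 1"
  using elt_11[of 0 b 0] elt_11[of 0 0 c] elt_11[of 0 "-b" 0] elt_11[of 0 0 "-c"] by (auto simp: mat22_eq_iff)

text \<open>The family has two coordinates with \<open>k\<close> free digits each, hence
  \<open>q ^ (2 * k)\<close> members. The partner \<open>u\<close> is sought in the form
  \<open>elt d b c\<close>, which turns separation into three congruences linear in
  \<open>d\<close>, \<open>b\<close>, \<open>c\<close>.\<close>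

lemma dim_lower_bound_axis:
  assumes \<rho>: "fin_quot_group.irred G (Ker N) n \<rho>" and k: "0 < k" and N: "N = 2 * m + v + k"
    and z: "z \<in> Ker (N - 1)" "\<rho> z \<noteq> 1\<^sub>m n"
    and f: "\<And>x y. \<pi> ^ m dvd x \<Longrightarrow> \<pi> ^ m dvd y \<Longrightarrow> f x y \<in> Lev m" "\<And>x y x' y'. f x y = f x' y' \<Longrightarrow> x = x' \<and> y = y'"
    and sol: "\<And>x y x' y' i. \<pi> ^ m dvd x \<Longrightarrow> \<pi> ^ m dvd y \<Longrightarrow> \<pi> ^ m dvd x' \<Longrightarrow> \<pi> ^ m dvd y' \<Longrightarrow>
        m \<le> i \<Longrightarrow> i < m + k \<Longrightarrow> i + v \<le> N - 1 \<Longrightarrow> \<pi> ^ i dvd x' - x \<Longrightarrow> \<pi> ^ i dvd y' - y \<Longrightarrow>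
        (\<exists>u. u dvd 1 \<and> x' - x = \<pi> ^ i * u) \<or> (\<exists>u. u dvd 1 \<and> y' - y = \<pi> ^ i * u) \<Longrightarrow>
        \<pi> ^ i dvd (adj22 (f x y) ** f x' y') $ 1 $ 2 \<and> \<pi> ^ i dvd (adj22 (f x y) ** f x' y') $ 2 $ 1 \<and>
        \<pi> ^ i dvd (adj22 (f x y) ** f x' y') $ 2 $ 2 - 1 \<and>
        (\<exists>d b c. \<pi> ^ (N - 1 - v - i) dvd d \<and> \<pi> ^ (N - 1 - v - i) dvd b \<and> \<pi> ^ (N - 1 - v - i) dvd c \<and>
        \<pi> ^ N dvd 2 * (b * (adj22 (f x y) ** f x' y') $ 2 $ 1 - c * (adj22 (f x y) ** f x' y') $ 1 $ 2) - (z $ 1 $ 1 - z $ 2 $ 2) \<and>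
        \<pi> ^ N dvd 2 * (b * ((adj22 (f x y) ** f x' y') $ 2 $ 2 - 1) - d * (adj22 (f x y) ** f x' y') $ 1 $ 2) - z $ 1 $ 2 \<and>
        \<pi> ^ N dvd 2 * (d * (adj22 (f x y) ** f x' y') $ 2 $ 1 - c * ((adj22 (f x y) ** f x' y') $ 2 $ 2 - 1)) - z $ 2 $ 1)"
  shows "q ^ (2 * k) \<le> n\<^sup>2"
proof -
  let ?P = "(\<lambda>r. \<pi> ^ m * r) ` res k"
  let ?T = "(\<lambda>(x,y). f x y) ` (?P \<times> ?P)"
  have inj: "inj_on (\<lambda>(x,y). f x y) (?P \<times> ?P)"
  proof (rule inj_onI)
    fix s t assume "(\<lambda>(x,y). f x y) s = (\<lambda>(x,y). f x y) t"
    then show "s = t" using f(2)[of "fst s" "snd s" "fst t" "snd t"] by (cases s, cases t) simp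
  qed
  have card: "card ?T = q ^ (2 * k)" by (rule card_res_pairs[OF inj])
  have "card ?T \<le> n\<^sup>2"
  proof (rule dim_lower_bound_from_family[OF \<rho> k N z])
    show "finite ?T" using res(1) by simp
    show "?T \<subseteq> Lev m" using f(1) by auto
    fix t t' assume "t \<in> ?T" "t' \<in> ?T" and ne: "t \<noteq> t'"
    then obtain x0 y0 x0' y0' where r: "x0 \<in> res k" "y0 \<in> res k" "x0' \<in> res k" "y0' \<in> res k"
      and t: "t = f (\<pi> ^ m * x0) (\<pi> ^ m * y0)" and t': "t' = f (\<pi> ^ m * x0') (\<pi> ^ m * y0')" by auto
    define x y x' y' where xy: "x = \<pi> ^ m * x0" "y = \<pi> ^ m * y0" "x' = \<pi> ^ m * x0'" "y' = \<pi> ^ m * y0'"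
    have pm: "\<pi> ^ m dvd x" "\<pi> ^ m dvd y" "\<pi> ^ m dvd x'" "\<pi> ^ m dvd y'" unfolding xy by simp_all
    have not: "\<not> (\<pi> ^ (m + k) dvd x' - x \<and> \<pi> ^ (m + k) dvd y' - y)"
    proof
      assume "\<pi> ^ (m + k) dvd x' - x \<and> \<pi> ^ (m + k) dvd y' - y"
      then have "\<pi> ^ k dvd x0' - x0" "\<pi> ^ k dvd y0' - y0"
        unfolding xy right_diff_distrib[symmetric] pi_cancel by blast+
      then have "x0' = x0" "y0' = y0" using r by (blast intro: res_unique)+
      then show False using ne t t' by simp
    qed
    obtain i where i: "m \<le> i" "i < m + k" "\<pi> ^ i dvd x' - x" "\<pi> ^ i dvd y' - y"
      "(\<exists>u. u dvd 1 \<and> x' - x = \<pi> ^ i * u) \<or> (\<exists>u. u dvd 1 \<and> y' - y = \<pi> ^ i * u)"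
      by (rule exact_level_pair[OF dvd_diff[OF pm(3,1)] dvd_diff[OF pm(4,2)] not])
    have le: "i + v \<le> N - 1" using i N by simp
    define w where "w = adj22 t ** t'"
    have w': "w = adj22 (f x y) ** f x' y'" unfolding w_def t t' xy ..
    note s = sol[OF pm i(1,2) le i(3-5), folded w']
    have wL: "w \<in> Lev m" unfolding w' using f(1)[OF pm(1,2)] f(1)[OF pm(3,4)] by (intro Lev_mult Lev_adj)
    obtain d b c where dbc: "\<pi> ^ (N - 1 - v - i) dvd d" "\<pi> ^ (N - 1 - v - i) dvd b" "\<pi> ^ (N - 1 - v - i) dvd c"
        "\<pi> ^ N dvd 2 * (b * w $ 2 $ 1 - c * w $ 1 $ 2) - (z $ 1 $ 1 - z $ 2 $ 2)"
        "\<pi> ^ N dvd 2 * (b * (w $ 2 $ 2 - 1) - d * w $ 1 $ 2) - z $ 1 $ 2"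
        "\<pi> ^ N dvd 2 * (d * w $ 2 $ 1 - c * (w $ 2 $ 2 - 1)) - z $ 2 $ 1" using s by blast
    have "w \<in> Lev i" using s by (intro Lev_intro[OF wL]) blast+
    moreover have "elt d b c \<in> Lev (N - 1 - v - i)" by (rule elt_Lev[OF _ dbc(1-3)]) (use N i v_less_m in simp)
    moreover have "elt d b c $ 2 $ 2 - 1 = d" by simp
    ultimately show "\<exists>i u. m \<le> i \<and> i < m + k \<and> adj22 t ** t' \<in> Lev i \<and> u \<in> Lev (N - 1 - v - i) \<and>
        \<pi> ^ N dvd 2 * (u $ 1 $ 2 * (adj22 t ** t') $ 2 $ 1 - u $ 2 $ 1 * (adj22 t ** t') $ 1 $ 2) - (z $ 1 $ 1 - z $ 2 $ 2) \<and>
        \<pi> ^ N dvd 2 * (u $ 1 $ 2 * ((adj22 t ** t') $ 2 $ 2 - 1) - (u $ 2 $ 2 - 1) * (adj22 t ** t') $ 1 $ 2) - z $ 1 $ 2 \<and>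
        \<pi> ^ N dvd 2 * ((u $ 2 $ 2 - 1) * (adj22 t ** t') $ 2 $ 1 - u $ 2 $ 1 * ((adj22 t ** t') $ 2 $ 2 - 1)) - z $ 2 $ 1"
      unfolding w_def[symmetric] using i(1,2) dbc(4-6) by (intro exI[of _ i] exI[of _ "elt d b c"]) (simp only: elt_nth simp_thms)
  qed
  then show ?thesis unfolding card .
qed

text \<open>Modulo \<open>Ker N\<close>, \<open>z0\<close> is a product of an upper unipotent, a
  lower unipotent and a diagonal part, and one of them acts nontrivially. Each part corresponds to
  one component of the bracket, an alternating form in two of the three coordinates; the family
  varies exactly these two, on which the form is nondegenerate.\<close>

lemma dim_lower_bound:
  assumes \<rho>: "fin_quot_group.irred G (Ker N) n \<rho>" and k: "0 < k" and N: "N = 2 * m + v + k"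
    and z0: "z0 \<in> Ker (N - 1)" "\<rho> z0 \<noteq> 1\<^sub>m n"
  shows "q ^ (2 * k) \<le> n\<^sup>2"
proof -
  have Nm: "m + v \<le> N" "2 \<le> N" "0 < N - 1" "m \<le> N - 1" using N v_less_m k by auto
  have m0: "0 < m" using v_less_m by simp
  note Q' = fin_quot_group_Ker[OF Nm(1)]
  interpret Q: fin_quot_group G "Ker N" by (rule Q')
  note kr = Q.irredD(1)[OF \<rho>] and r = Q.krepD[OF Q.irredD(1)[OF \<rho>]]
  note Z = KerD[OF z0(1)]
  let ?b = "z0 $ 1 $ 2" and ?c = "z0 $ 2 $ 1"
  have UL: "elt 0 b 0 \<in> Lev (N - 1)" "elt 0 0 b \<in> Lev (N - 1)" if "\<pi> ^ (N - 1) dvd b" for b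
    using that Nm(3) by (auto intro!: elt_Lev)
  have UK: "elt 0 b 0 \<in> Ker (N - 1)" "elt 0 0 b \<in> Ker (N - 1)" if "\<pi> ^ (N - 1) dvd b" for b
    using UL[OF that] Nm(4) Lev_in_Ker by blast+
  have inv11: "elt x y w $ 1 $ 1 * (1 + x) = 1 + y * w" if "\<pi> ^ m dvd x" for x y w
    using elt_11[OF pi_dvd[OF that m0]] .
  have u1: "(1 + x) dvd 1" if "\<pi> ^ m dvd x" for x using one_plus_unit[OF pi_dvd[OF that m0]] .
  have plus_unit: "(u + x) dvd 1" if "u dvd 1" "\<pi> dvd x" for u x
    using that dvd_add_left_iff[OF that(2), of u] unfolding unit_iff by simp
  have minus: "\<pi> ^ a dvd - s" if "\<pi> ^ a dvd s" for a s using that by simp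
  consider (U) "\<rho> (elt 0 ?b 0) \<noteq> 1\<^sub>m n" | (L) "\<rho> (elt 0 0 ?c) \<noteq> 1\<^sub>m n"
    | (H) "\<rho> (elt 0 ?b 0) = 1\<^sub>m n" "\<rho> (elt 0 0 ?c) = 1\<^sub>m n" by blast
  then show ?thesis
  proof cases
    \<comment> \<open>For the upper right component the family is upper triangular. With
      \<open>c = 0\<close> and \<open>w $ 2 $ 1 = 0\<close> the other components vanish. One of the
      two remaining coordinates of \<open>w\<close> is a unit times \<open>\<pi> ^ i\<close>, so the
      component can take any value divisible by \<open>\<pi> ^ (N - 1)\<close>.\<close>
    case U
    show ?thesis
    proof (rule dim_lower_bound_axis[OF \<rho> k N UK(1)[OF Z(3)] U, of "\<lambda>x y. elt x y 0"])
      show "elt x y 0 \<in> Lev m" if "\<pi> ^ m dvd x" "\<pi> ^ m dvd y" for x y using elt_Lev[OF m0 that] by simp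
      show "x = x' \<and> y = y'" if "elt x y 0 = elt x' y' 0" for x y x' y' using that by (simp add: mat22_eq_iff)
      fix x y x' y' i
      assume pm: "\<pi> ^ m dvd x" "\<pi> ^ m dvd y" "\<pi> ^ m dvd x'" "\<pi> ^ m dvd y'" and i: "i + v \<le> N - 1"
        and d: "\<pi> ^ i dvd x' - x" "\<pi> ^ i dvd y' - y"
        and un: "(\<exists>u. u dvd 1 \<and> x' - x = \<pi> ^ i * u) \<or> (\<exists>u. u dvd 1 \<and> y' - y = \<pi> ^ i * u)"
      define a where "a = elt x y 0 $ 1 $ 1"
      have a: "a * (1 + x) = 1" using inv11[OF pm(1), of y 0] by (simp add: a_def)
      have au: "a dvd 1" using a by (metis dvd_triv_left)
      define w where "w = adj22 (elt x y 0) ** elt x' y' 0"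
      have "w $ 2 $ 2 - a * (1 + x) = a * (x' - x)" by (simp add: w_def a_def algebra_simps)
      then have w: "w $ 2 $ 1 = 0" "w $ 2 $ 2 - 1 = a * (x' - x)" "w $ 1 $ 2 = (1 + x) * (y' - y) - y * (x' - x)"
        unfolding a by (simp_all add: w_def algebra_simps)
      have "\<exists>d b. \<pi> ^ (N - 1 - v - i) dvd d \<and> \<pi> ^ (N - 1 - v - i) dvd b \<and>
          2 * (b * (w $ 2 $ 2 - 1) - d * w $ 1 $ 2) = ?b"
        using un
      proof
        assume "\<exists>u. u dvd 1 \<and> x' - x = \<pi> ^ i * u"
        then obtain u where u: "u dvd 1" "x' - x = \<pi> ^ i * u" by blast
        have "w $ 2 $ 2 - 1 = \<pi> ^ i * (a * u)" unfolding w(2) u(2) by (simp only: mult_ac)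
        from solve_two_mult[OF this unit_mult[OF au u(1)] Z(3) i] obtain s where
          "\<pi> ^ (N - 1 - v - i) dvd s" "2 * (s * (w $ 2 $ 2 - 1)) = ?b" by blast
        then show ?thesis by (intro exI[of _ 0] exI[of _ s]) simp
      next
        assume "\<exists>u. u dvd 1 \<and> y' - y = \<pi> ^ i * u"
        then obtain u where u: "u dvd 1" "y' - y = \<pi> ^ i * u" by blast
        obtain e where e: "x' - x = \<pi> ^ i * e" using d(1) unfolding dvd_def by blast
        have w12: "w $ 1 $ 2 = \<pi> ^ i * ((1 + x) * u + y * (- e))" unfolding w(3) u(2) e by (simp add: algebra_simps)
        have "((1 + x) * u + y * (- e)) dvd 1"
          by (rule plus_unit[OF unit_mult[OF u1[OF pm(1)] u(1)] dvd_mult2[OF pi_dvd[OF pm(2) m0]]])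
        from solve_two_mult[OF w12 this Z(3) i] obtain s where
          s: "\<pi> ^ (N - 1 - v - i) dvd s" "2 * (s * w $ 1 $ 2) = ?b" by blast
        then show ?thesis using minus[OF s(1)] by (intro exI[of _ "- s"] exI[of _ 0]) simp
      qed
      then obtain d' b' where db: "\<pi> ^ (N - 1 - v - i) dvd d'" "\<pi> ^ (N - 1 - v - i) dvd b'"
          "2 * (b' * (w $ 2 $ 2 - 1) - d' * w $ 1 $ 2) = ?b" by blast
      have "\<pi> ^ i dvd w $ 1 $ 2 \<and> \<pi> ^ i dvd w $ 2 $ 1 \<and> \<pi> ^ i dvd w $ 2 $ 2 - 1"
        unfolding w by (intro conjI dvd_diff[OF dvd_mult[OF d(2)] dvd_mult[OF d(1)]] dvd_mult[OF d(1)]) simp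
      moreover have "\<pi> ^ N dvd 2 * (b' * w $ 2 $ 1 - 0 * w $ 1 $ 2) - (elt 0 ?b 0 $ 1 $ 1 - elt 0 ?b 0 $ 2 $ 2)"
        "\<pi> ^ N dvd 2 * (b' * (w $ 2 $ 2 - 1) - d' * w $ 1 $ 2) - elt 0 ?b 0 $ 1 $ 2"
        "\<pi> ^ N dvd 2 * (d' * w $ 2 $ 1 - 0 * (w $ 2 $ 2 - 1)) - elt 0 ?b 0 $ 2 $ 1"
        unfolding db(3) w(1) by (simp_all add: elt_mult_unipotent)
      ultimately show "\<pi> ^ i dvd (adj22 (elt x y 0) ** elt x' y' 0) $ 1 $ 2 \<and> \<pi> ^ i dvd (adj22 (elt x y 0) ** elt x' y' 0) $ 2 $ 1 \<and>
        \<pi> ^ i dvd (adj22 (elt x y 0) ** elt x' y' 0) $ 2 $ 2 - 1 \<and>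
        (\<exists>d b c. \<pi> ^ (N - 1 - v - i) dvd d \<and> \<pi> ^ (N - 1 - v - i) dvd b \<and> \<pi> ^ (N - 1 - v - i) dvd c \<and>
        \<pi> ^ N dvd 2 * (b * (adj22 (elt x y 0) ** elt x' y' 0) $ 2 $ 1 - c * (adj22 (elt x y 0) ** elt x' y' 0) $ 1 $ 2) - (elt 0 ?b 0 $ 1 $ 1 - elt 0 ?b 0 $ 2 $ 2) \<and>
        \<pi> ^ N dvd 2 * (b * ((adj22 (elt x y 0) ** elt x' y' 0) $ 2 $ 2 - 1) - d * (adj22 (elt x y 0) ** elt x' y' 0) $ 1 $ 2) - elt 0 ?b 0 $ 1 $ 2 \<and>
        \<pi> ^ N dvd 2 * (d * (adj22 (elt x y 0) ** elt x' y' 0) $ 2 $ 1 - c * ((adj22 (elt x y 0) ** elt x' y' 0) $ 2 $ 2 - 1)) - elt 0 ?b 0 $ 2 $ 1)"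
        unfolding w_def[symmetric] using db(1,2) dvd_0_right by blast
    qed
  next
    case L
    show ?thesis
    proof (rule dim_lower_bound_axis[OF \<rho> k N UK(2)[OF Z(4)] L, of "\<lambda>x y. elt x 0 y"])
      show "elt x 0 y \<in> Lev m" if "\<pi> ^ m dvd x" "\<pi> ^ m dvd y" for x y using elt_Lev[OF m0 that(1) _ that(2)] by simp
      show "x = x' \<and> y = y'" if "elt x 0 y = elt x' 0 y'" for x y x' y' using that by (simp add: mat22_eq_iff)
      fix x y x' y' i
      assume pm: "\<pi> ^ m dvd x" "\<pi> ^ m dvd y" "\<pi> ^ m dvd x'" "\<pi> ^ m dvd y'" and i: "i + v \<le> N - 1"
        and d: "\<pi> ^ i dvd x' - x" "\<pi> ^ i dvd y' - y"
        and un: "(\<exists>u. u dvd 1 \<and> x' - x = \<pi> ^ i * u) \<or> (\<exists>u. u dvd 1 \<and> y' - y = \<pi> ^ i * u)"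
      define a a' where "a = elt x 0 y $ 1 $ 1" and "a' = elt x' 0 y' $ 1 $ 1"
      have a: "a * (1 + x) = 1" using inv11[OF pm(1), of 0 y] by (simp add: a_def)
      have a': "a' * (1 + x') = 1" using inv11[OF pm(3), of 0 y'] by (simp add: a'_def)
      have au: "a dvd 1" "a' dvd 1" using a a' by (metis dvd_triv_left)+
      define w where "w = adj22 (elt x 0 y) ** elt x' 0 y'"
      have "w $ 2 $ 2 - a * (1 + x) = a * (x' - x)" by (simp add: w_def a_def algebra_simps)
      then have w: "w $ 1 $ 2 = 0" "w $ 2 $ 2 - 1 = a * (x' - x)" unfolding a by (simp_all add: w_def)
      have "w $ 2 $ 1 = (a' * (1 + x')) * a * y' - (a * (1 + x)) * a' * y"
        unfolding a a' by (simp add: w_def a_def a'_def algebra_simps)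
      then have w3: "w $ 2 $ 1 = (a * a') * ((1 + x') * (y' - y) + y * (x' - x))" by (simp add: algebra_simps)
      have "\<exists>d c. \<pi> ^ (N - 1 - v - i) dvd d \<and> \<pi> ^ (N - 1 - v - i) dvd c \<and>
          2 * (d * w $ 2 $ 1 - c * (w $ 2 $ 2 - 1)) = ?c"
        using un
      proof
        assume "\<exists>u. u dvd 1 \<and> x' - x = \<pi> ^ i * u"
        then obtain u where u: "u dvd 1" "x' - x = \<pi> ^ i * u" by blast
        have "w $ 2 $ 2 - 1 = \<pi> ^ i * (a * u)" unfolding w(2) u(2) by (simp only: mult_ac)
        from solve_two_mult[OF this unit_mult[OF au(1) u(1)] Z(4) i] obtain s where
          s: "\<pi> ^ (N - 1 - v - i) dvd s" "2 * (s * (w $ 2 $ 2 - 1)) = ?c" by blast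
        then show ?thesis using minus[OF s(1)] by (intro exI[of _ 0] exI[of _ "- s"]) simp
      next
        assume "\<exists>u. u dvd 1 \<and> y' - y = \<pi> ^ i * u"
        then obtain u where u: "u dvd 1" "y' - y = \<pi> ^ i * u" by blast
        obtain e where e: "x' - x = \<pi> ^ i * e" using d(1) unfolding dvd_def by blast
        have w21: "w $ 2 $ 1 = \<pi> ^ i * ((a * a') * ((1 + x') * u + y * e))" unfolding w3 u(2) e by (simp add: algebra_simps)
        have "((a * a') * ((1 + x') * u + y * e)) dvd 1"
          by (rule unit_mult[OF unit_mult[OF au]
            plus_unit[OF unit_mult[OF u1[OF pm(3)] u(1)] dvd_mult2[OF pi_dvd[OF pm(2) m0]]]])
        from solve_two_mult[OF w21 this Z(4) i] obtain s where
          s: "\<pi> ^ (N - 1 - v - i) dvd s" "2 * (s * w $ 2 $ 1) = ?c" by blast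
        then show ?thesis by (intro exI[of _ s] exI[of _ 0]) simp
      qed
      then obtain d' c' where db: "\<pi> ^ (N - 1 - v - i) dvd d'" "\<pi> ^ (N - 1 - v - i) dvd c'"
          "2 * (d' * w $ 2 $ 1 - c' * (w $ 2 $ 2 - 1)) = ?c" by blast
      have "\<pi> ^ i dvd w $ 1 $ 2 \<and> \<pi> ^ i dvd w $ 2 $ 1 \<and> \<pi> ^ i dvd w $ 2 $ 2 - 1"
        unfolding w w3 by (intro conjI dvd_mult[OF dvd_add[OF dvd_mult[OF d(2)] dvd_mult[OF d(1)]]] dvd_mult[OF d(1)]) simp
      moreover have "\<pi> ^ N dvd 2 * (0 * w $ 2 $ 1 - c' * w $ 1 $ 2) - (elt 0 0 ?c $ 1 $ 1 - elt 0 0 ?c $ 2 $ 2)"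
        "\<pi> ^ N dvd 2 * (0 * (w $ 2 $ 2 - 1) - d' * w $ 1 $ 2) - elt 0 0 ?c $ 1 $ 2"
        "\<pi> ^ N dvd 2 * (d' * w $ 2 $ 1 - c' * (w $ 2 $ 2 - 1)) - elt 0 0 ?c $ 2 $ 1"
        unfolding db(3) w(1) by (simp_all add: elt_mult_unipotent)
      ultimately show "\<pi> ^ i dvd (adj22 (elt x 0 y) ** elt x' 0 y') $ 1 $ 2 \<and> \<pi> ^ i dvd (adj22 (elt x 0 y) ** elt x' 0 y') $ 2 $ 1 \<and>
        \<pi> ^ i dvd (adj22 (elt x 0 y) ** elt x' 0 y') $ 2 $ 2 - 1 \<and>
        (\<exists>d b c. \<pi> ^ (N - 1 - v - i) dvd d \<and> \<pi> ^ (N - 1 - v - i) dvd b \<and> \<pi> ^ (N - 1 - v - i) dvd c \<and>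
        \<pi> ^ N dvd 2 * (b * (adj22 (elt x 0 y) ** elt x' 0 y') $ 2 $ 1 - c * (adj22 (elt x 0 y) ** elt x' 0 y') $ 1 $ 2) - (elt 0 0 ?c $ 1 $ 1 - elt 0 0 ?c $ 2 $ 2) \<and>
        \<pi> ^ N dvd 2 * (b * ((adj22 (elt x 0 y) ** elt x' 0 y') $ 2 $ 2 - 1) - d * (adj22 (elt x 0 y) ** elt x' 0 y') $ 1 $ 2) - elt 0 0 ?c $ 1 $ 2 \<and>
        \<pi> ^ N dvd 2 * (d * (adj22 (elt x 0 y) ** elt x' 0 y') $ 2 $ 1 - c * ((adj22 (elt x 0 y) ** elt x' 0 y') $ 2 $ 2 - 1)) - elt 0 0 ?c $ 2 $ 1)"
        unfolding w_def[symmetric] using db(1,2) dvd_0_right by blast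
    qed
  next
    case H
    have mb: "\<pi> ^ (N - 1) dvd - ?b" "\<pi> ^ (N - 1) dvd - ?c" using Z(3,4) by simp_all
    \<comment> \<open>Multiplying off the unipotent parts does not change the image and leaves an
      element whose off-diagonal entries vanish modulo \<open>\<pi> ^ N\<close>.\<close>
    define z where "z = z0 ** elt 0 (- ?b) 0 ** elt 0 0 (- ?c)"
    have mem: "elt 0 (- ?b) 0 \<in> Ker (N - 1)" "elt 0 0 (- ?c) \<in> Ker (N - 1)" using UK mb by blast+
    have memL: "elt 0 ?b 0 \<in> Lev m" "elt 0 0 ?c \<in> Lev m" "elt 0 (- ?b) 0 \<in> Lev m" "elt 0 0 (- ?c) \<in> Lev m"
      using KerD(1)[OF mem(1)] KerD(1)[OF mem(2)] KerD(1)[OF UK(1)[OF Z(3)]] KerD(1)[OF UK(2)[OF Z(4)]] by blast+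
    have zK: "z \<in> Ker (N - 1)" unfolding z_def
      using subgroup.m_closed[OF Ker_subgroup subgroup.m_closed[OF Ker_subgroup z0(1) mem(1)] mem(2)] by simp
    have inv1: "\<rho> (elt 0 (- ?b) 0) = 1\<^sub>m n" "\<rho> (elt 0 0 (- ?c)) = 1\<^sub>m n"
      using r(2)[of "elt 0 ?b 0" "elt 0 (- ?b) 0"] r(2)[of "elt 0 0 ?c" "elt 0 0 (- ?c)"] memL H r(4)
        r(1)[of "elt 0 (- ?b) 0"] r(1)[of "elt 0 0 (- ?c)"] by (simp_all add: elt_mult_unipotent)
    have "\<rho> z = \<rho> z0"
      unfolding z_def using r(2)[of "z0 ** elt 0 (- ?b) 0" "elt 0 0 (- ?c)"] r(2)[of z0 "elt 0 (- ?b) 0"] Z(1) memL inv1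
        Lev_mult[OF Z(1) memL(3)] r(1)[of z0] by simp
    then have zne: "\<rho> z \<noteq> 1\<^sub>m n" using z0(2) by simp
    note L0 = LevD[OF Z(1)]
    have z12: "z $ 1 $ 2 = - (?b * (z0 $ 1 $ 1 - 1))" by (simp add: z_def elt_mult_unipotent algebra_simps)
    have z21: "z $ 2 $ 1 = ?c * (?c * ?b) - ?c * (z0 $ 2 $ 2 - 1)" by (simp add: z_def elt_mult_unipotent algebra_simps)
    have le: "N \<le> (N - 1) + m" using m0 by simp
    have cb: "\<pi> ^ m dvd ?c * ?b" using dvd_mult2[OF L0(4)] .
    have zN: "\<pi> ^ N dvd z $ 1 $ 2" "\<pi> ^ N dvd z $ 2 $ 1"
      unfolding z12 z21 using pow_mult_dvd[OF Z(3) L0(2) le] dvd_diff[OF pow_mult_dvd[OF Z(4) cb le] pow_mult_dvd[OF Z(4) L0(5) le]]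
      by simp_all
    let ?h = "z $ 1 $ 1 - z $ 2 $ 2"
    have hN: "\<pi> ^ (N - 1) dvd ?h" using KerD(2)[OF zK] .
    show ?thesis
    proof (rule dim_lower_bound_axis[OF \<rho> k N zK zne, of "\<lambda>x y. elt 0 x y"])
      show "elt 0 x y \<in> Lev m" if "\<pi> ^ m dvd x" "\<pi> ^ m dvd y" for x y using elt_Lev[OF m0 _ that] by simp
      show "x = x' \<and> y = y'" if "elt 0 x y = elt 0 x' y'" for x y x' y' using that by (simp add: mat22_eq_iff)
      fix x y x' y' i
      assume pm: "\<pi> ^ m dvd x" "\<pi> ^ m dvd y" "\<pi> ^ m dvd x'" "\<pi> ^ m dvd y'" and i: "i + v \<le> N - 1"
        and d: "\<pi> ^ i dvd x' - x" "\<pi> ^ i dvd y' - y"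
        and un: "(\<exists>u. u dvd 1 \<and> x' - x = \<pi> ^ i * u) \<or> (\<exists>u. u dvd 1 \<and> y' - y = \<pi> ^ i * u)"
      have e11: "elt 0 s t $ 1 $ 1 = 1 + s * t" for s t using elt_11[of 0 s t] by simp
      define w where "w = adj22 (elt 0 x y) ** elt 0 x' y'"
      have w: "w $ 1 $ 2 = x' - x" "w $ 2 $ 2 - 1 = - (y * (x' - x))" "w $ 2 $ 1 = (y' - y) - y * y' * (x' - x)"
        by (simp_all add: w_def e11 algebra_simps)
      have "\<exists>b c. \<pi> ^ (N - 1 - v - i) dvd b \<and> \<pi> ^ (N - 1 - v - i) dvd c \<and>
          2 * (b * w $ 2 $ 1 - c * w $ 1 $ 2) = ?h"
        using un
      proof
        assume "\<exists>u. u dvd 1 \<and> x' - x = \<pi> ^ i * u"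
        then obtain u where u: "u dvd 1" "x' - x = \<pi> ^ i * u" by blast
        from solve_two_mult[OF u(2,1) hN i] obtain s where
          s: "\<pi> ^ (N - 1 - v - i) dvd s" "2 * (s * (x' - x)) = ?h" by blast
        then show ?thesis using minus[OF s(1)] by (intro exI[of _ 0] exI[of _ "- s"]) (simp add: w(1))
      next
        assume "\<exists>u. u dvd 1 \<and> y' - y = \<pi> ^ i * u"
        then obtain u where u: "u dvd 1" "y' - y = \<pi> ^ i * u" by blast
        obtain e where e: "x' - x = \<pi> ^ i * e" using d(1) unfolding dvd_def by blast
        have w21: "w $ 2 $ 1 = \<pi> ^ i * (u + y * (- (y' * e)))" unfolding w(3) u(2) e by (simp add: algebra_simps)
        have "(u + y * (- (y' * e))) dvd 1"
          by (rule plus_unit[OF u(1) dvd_mult2[OF pi_dvd[OF pm(2) m0]]])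
        from solve_two_mult[OF w21 this hN i] obtain s where
          s: "\<pi> ^ (N - 1 - v - i) dvd s" "2 * (s * w $ 2 $ 1) = ?h" by blast
        then show ?thesis by (intro exI[of _ s] exI[of _ 0]) simp
      qed
      then obtain b' c' where db: "\<pi> ^ (N - 1 - v - i) dvd b'" "\<pi> ^ (N - 1 - v - i) dvd c'"
          "2 * (b' * w $ 2 $ 1 - c' * w $ 1 $ 2) = ?h" by blast
      \<comment> \<open>The lower right deviation of \<open>w\<close> is a product of two small
        factors, so the other two components of the bracket vanish modulo
        \<open>\<pi> ^ N\<close>.\<close>
      have "\<pi> ^ (m + i) dvd w $ 2 $ 2 - 1" unfolding w by (rule minus) (rule pow_mult_dvd[OF pm(2) d(1)], simp)
      then have small: "\<pi> ^ N dvd 2 * (s * (w $ 2 $ 2 - 1))" if "\<pi> ^ (N - 1 - v - i) dvd s" for s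
        using pow_mult_dvd[OF two_dvd pow_mult_dvd[OF that], of "m + i" "w $ 2 $ 2 - 1" "N - 1 - v - i + (m + i)" N] i m0 by simp
      have "\<pi> ^ i dvd w $ 1 $ 2 \<and> \<pi> ^ i dvd w $ 2 $ 1 \<and> \<pi> ^ i dvd w $ 2 $ 2 - 1"
        unfolding w by (intro conjI d(1) dvd_diff[OF d(2) dvd_mult[OF d(1)]] minus dvd_mult[OF d(1)])
      moreover have "\<pi> ^ N dvd 2 * (b' * w $ 2 $ 1 - c' * w $ 1 $ 2) - (z $ 1 $ 1 - z $ 2 $ 2)"
        unfolding db(3) by simp
      moreover have "\<pi> ^ N dvd 2 * (b' * (w $ 2 $ 2 - 1) - 0 * w $ 1 $ 2) - z $ 1 $ 2"
        unfolding mult_zero_left diff_0_right by (rule dvd_diff[OF small[OF db(1)] zN(1)])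
      moreover have "\<pi> ^ N dvd 2 * (0 * w $ 2 $ 1 - c' * (w $ 2 $ 2 - 1)) - z $ 2 $ 1"
        using dvd_diff[OF minus[OF small[OF db(2)]] zN(2)] by simp
      ultimately show "\<pi> ^ i dvd (adj22 (elt 0 x y) ** elt 0 x' y') $ 1 $ 2 \<and> \<pi> ^ i dvd (adj22 (elt 0 x y) ** elt 0 x' y') $ 2 $ 1 \<and>
        \<pi> ^ i dvd (adj22 (elt 0 x y) ** elt 0 x' y') $ 2 $ 2 - 1 \<and>
        (\<exists>d b c. \<pi> ^ (N - 1 - v - i) dvd d \<and> \<pi> ^ (N - 1 - v - i) dvd b \<and> \<pi> ^ (N - 1 - v - i) dvd c \<and>
        \<pi> ^ N dvd 2 * (b * (adj22 (elt 0 x y) ** elt 0 x' y') $ 2 $ 1 - c * (adj22 (elt 0 x y) ** elt 0 x' y') $ 1 $ 2) - (z $ 1 $ 1 - z $ 2 $ 2) \<and>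
        \<pi> ^ N dvd 2 * (b * ((adj22 (elt 0 x y) ** elt 0 x' y') $ 2 $ 2 - 1) - d * (adj22 (elt 0 x y) ** elt 0 x' y') $ 1 $ 2) - z $ 1 $ 2 \<and>
        \<pi> ^ N dvd 2 * (d * (adj22 (elt 0 x y) ** elt 0 x' y') $ 2 $ 1 - c * ((adj22 (elt 0 x y) ** elt 0 x' y') $ 2 $ 2 - 1)) - z $ 2 $ 1)"
        unfolding w_def[symmetric] using db(1,2) dvd_0_right by blast
    qed
  qed
qed

end

context uniformized
begin

lemma exact_level_single:
  assumes "\<not> \<pi> ^ M dvd x"
  obtains e u where "e < M" "u dvd 1" "x = \<pi> ^ e * u"
proof -
  define j where "j = (LEAST j. \<not> \<pi> ^ j dvd x)"
  have j: "\<not> \<pi> ^ j dvd x" "j \<le> M" unfolding j_def using assms by (rule LeastI, rule Least_le)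
  obtain e where e: "j = Suc e" using j(1) by (cases j) auto
  have "\<pi> ^ e dvd x" using not_less_Least[of e "\<lambda>j. \<not> \<pi> ^ j dvd x"] e unfolding j_def by simp
  then obtain u where u: "x = \<pi> ^ e * u" unfolding dvd_def by blast
  have "\<not> \<pi> dvd u"
  proof
    assume "\<pi> dvd u"
    then have "\<pi> ^ e * \<pi> dvd \<pi> ^ e * u" by (rule mult_dvd_mono[OF dvd_refl])
    then show False using j(1) unfolding e u by (simp add: mult.commute)
  qed
  then show ?thesis using that[of e u] j(2) e u local by simp
qed

section \<open>Upper bound for the dimension\<close>

text \<open>Translation by \<open>x0\<close> permutes the residues and multiplies the sum by
  \<open>g x0\<close>.\<close>

lemma hom_sum_zero:
  fixes g :: "'o \<Rightarrow> complex"
  assumes hom: "\<And>x y. g (x + y) = g x * g y" and triv: "\<And>x. \<pi> ^ M dvd x \<Longrightarrow> g x = 1" and x0: "g x0 \<noteq> 1"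
  shows "(\<Sum>r\<in>res M. g r) = 0"
proof -
  define rp where "rp x = (THE r. r \<in> res M \<and> \<pi> ^ M dvd x - r)" for x
  have rp: "rp x \<in> res M" "\<pi> ^ M dvd x - rp x" for x
    using theI'[OF res(3)[where x = x and n = M]] by (simp_all add: rp_def)
  have grp: "g (rp x) = g x" for x
  proof -
    have "g x = g ((x - rp x) + rp x)" by simp
    also have "\<dots> = g (rp x)" unfolding hom using triv[OF rp(2)] by simp
    finally show ?thesis by simp
  qed
  have inj: "inj_on (\<lambda>r. rp (r + x0)) (res M)"
  proof (rule inj_onI)
    fix r s assume rs: "r \<in> res M" "s \<in> res M" "rp (r + x0) = rp (s + x0)"
    have "\<pi> ^ M dvd ((r + x0) - rp (r + x0)) - ((s + x0) - rp (s + x0))" by (rule dvd_diff[OF rp(2) rp(2)])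
    then have "\<pi> ^ M dvd r - s" using rs(3) by simp
    then show "r = s" using rs res_unique by blast
  qed
  have "bij_betw (\<lambda>r. rp (r + x0)) (res M) (res M)"
    using inj endo_inj_surj[OF res(1) _ inj] rp(1) by (auto simp: bij_betw_def)
  then have "(\<Sum>r\<in>res M. g r) = (\<Sum>r\<in>res M. g (rp (r + x0)))" by (rule sum.reindex_bij_betw[symmetric])
  also have "\<dots> = (\<Sum>r\<in>res M. g r) * g x0" by (simp add: grp hom sum_distrib_right)
  finally have "(\<Sum>r\<in>res M. g r) * (1 - g x0) = 0" by (simp add: algebra_simps)
  then show ?thesis using x0 by simp
qed

text \<open>Self-duality of the finite module \<open>\<pi>\<^sup>l O / \<pi>\<^sup>N O\<close>: if \<open>\<phi>\<close> were orthogonal to all \<open>x \<mapsto> \<theta> (\<xi> x)\<close>,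
  then summing over \<open>\<xi>\<close> would give a contradiction.\<close>

lemma character_duality:
  fixes \<theta> \<phi> :: "'o \<Rightarrow> complex"
  assumes \<theta>: "\<And>x y. \<pi> ^ l dvd x \<Longrightarrow> \<pi> ^ l dvd y \<Longrightarrow> \<theta> (x + y) = \<theta> x * \<theta> y" "\<And>x. \<pi> ^ N dvd x \<Longrightarrow> \<theta> x = 1"
    and \<phi>: "\<And>x y. \<pi> ^ l dvd x \<Longrightarrow> \<pi> ^ l dvd y \<Longrightarrow> \<phi> (x + y) = \<phi> x * \<phi> y" "\<And>x. \<pi> ^ N dvd x \<Longrightarrow> \<phi> x = 1"
    and l: "l < N" and nt: "\<pi> ^ (N - 1) dvd x1" "\<theta> x1 \<noteq> 1"
  shows "\<exists>\<xi>. \<forall>x. \<pi> ^ l dvd x \<longrightarrow> \<phi> x = \<theta> (\<xi> * x)"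
proof -
  define M where "M = N - l"
  have NM: "N = l + M" using l by (simp add: M_def)
  have inv: "\<theta> x * \<theta> (- x) = 1" if "\<pi> ^ l dvd x" for x
    using \<theta>(1)[of x "- x"] \<theta>(2)[of 0] that by simp
  have "\<exists>\<xi>\<in>res M. \<forall>x. \<phi> (\<pi> ^ l * x) * \<theta> (- (\<xi> * (\<pi> ^ l * x))) = 1"
  proof (rule ccontr)
    assume neg: "\<not> ?thesis"
    have "(\<Sum>x\<in>res M. \<phi> (\<pi> ^ l * x) * \<theta> (- (\<xi> * (\<pi> ^ l * x)))) = 0" if \<xi>: "\<xi> \<in> res M" for \<xi>
    proof -
      obtain x0 where "\<phi> (\<pi> ^ l * x0) * \<theta> (- (\<xi> * (\<pi> ^ l * x0))) \<noteq> 1" using neg \<xi> by blast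
      then show ?thesis
      proof (rule hom_sum_zero[of "\<lambda>x. \<phi> (\<pi> ^ l * x) * \<theta> (- (\<xi> * (\<pi> ^ l * x)))", rotated 2])
        fix x y
        have "- (\<xi> * (\<pi> ^ l * (x + y))) = - (\<xi> * (\<pi> ^ l * x)) + - (\<xi> * (\<pi> ^ l * y))" by (simp add: algebra_simps)
        moreover have "\<pi> ^ l dvd - (\<xi> * (\<pi> ^ l * z))" for z by simp
        ultimately have "\<theta> (- (\<xi> * (\<pi> ^ l * (x + y)))) = \<theta> (- (\<xi> * (\<pi> ^ l * x))) * \<theta> (- (\<xi> * (\<pi> ^ l * y)))"
          using \<theta>(1)[of "- (\<xi> * (\<pi> ^ l * x))" "- (\<xi> * (\<pi> ^ l * y))"] by (simp only:)
        moreover have "\<phi> (\<pi> ^ l * (x + y)) = \<phi> (\<pi> ^ l * x) * \<phi> (\<pi> ^ l * y)"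
          unfolding distrib_left by (rule \<phi>(1)) simp_all
        ultimately show "\<phi> (\<pi> ^ l * (x + y)) * \<theta> (- (\<xi> * (\<pi> ^ l * (x + y)))) =
          \<phi> (\<pi> ^ l * x) * \<theta> (- (\<xi> * (\<pi> ^ l * x))) * (\<phi> (\<pi> ^ l * y) * \<theta> (- (\<xi> * (\<pi> ^ l * y))))" by simp
      next
        fix x assume "\<pi> ^ M dvd x"
        then have d: "\<pi> ^ N dvd \<pi> ^ l * x" unfolding NM pi_cancel .
        then have "\<pi> ^ N dvd - (\<xi> * (\<pi> ^ l * x))" unfolding dvd_minus_iff by (rule dvd_mult)
        then show "\<phi> (\<pi> ^ l * x) * \<theta> (- (\<xi> * (\<pi> ^ l * x))) = 1" using \<theta>(2) \<phi>(2) d by simp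
      qed
    qed
    then have "0 = (\<Sum>\<xi>\<in>res M. \<Sum>x\<in>res M. \<phi> (\<pi> ^ l * x) * \<theta> (- (\<xi> * (\<pi> ^ l * x))))" by simp
    also have "\<dots> = (\<Sum>x\<in>res M. \<phi> (\<pi> ^ l * x) * (\<Sum>\<xi>\<in>res M. \<theta> (- (\<xi> * (\<pi> ^ l * x)))))"
      by (subst sum.swap) (simp add: sum_distrib_left)
    finally have sum0: "(\<Sum>x\<in>res M. \<phi> (\<pi> ^ l * x) * (\<Sum>\<xi>\<in>res M. \<theta> (- (\<xi> * (\<pi> ^ l * x))))) = 0" by simp
    \<comment> \<open>\<open>z\<close> represents 0. For every other residue \<open>x\<close> the
      inner sum runs over a nontrivial character of \<open>\<xi>\<close>, because
      \<open>\<pi> ^ l * x\<close> divides \<open>x1\<close>; only the term of \<open>z\<close>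
      survives, and its value is \<open>q ^ M\<close>.\<close>
    obtain z where z: "z \<in> res M" "\<pi> ^ M dvd 0 - z" using res(3)[where x = 0 and n = M] by blast
    have zN: "\<pi> ^ N dvd \<pi> ^ l * z" using z(2) unfolding NM pi_cancel by simp
    have "(\<Sum>\<xi>\<in>res M. \<theta> (- (\<xi> * (\<pi> ^ l * x)))) = 0" if x: "x \<in> res M" "x \<noteq> z" for x
    proof -
      have nd: "\<not> \<pi> ^ M dvd x"
      proof
        assume "\<pi> ^ M dvd x"
        then have "\<pi> ^ M dvd x - z" using dvd_add[OF _ z(2), of x] by simp
        then show False using res_unique[OF x(1) z(1)] x(2) by blast
      qed
      obtain e u where eu: "e < M" "u dvd 1" "x = \<pi> ^ e * u" using exact_level_single[OF nd] by blast
      obtain y1 where y1: "x1 = \<pi> ^ (N - 1) * y1" using nt(1) unfolding dvd_def by blast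
      obtain u' where u': "1 = u * u'" using eu(2) unfolding dvd_def by blast
      have "N - 1 = (M - 1 - e) + (l + e)" using eu(1) NM by simp
      then have p: "\<pi> ^ (N - 1) = \<pi> ^ (M - 1 - e) * (\<pi> ^ l * \<pi> ^ e)" by (metis power_add)
      have "- ((- (\<pi> ^ (M - 1 - e) * (u' * y1))) * (\<pi> ^ l * x)) = (u * u') * (\<pi> ^ (M - 1 - e) * (\<pi> ^ l * \<pi> ^ e) * y1)"
        unfolding eu(3) by (simp add: mult_ac)
      also have "\<dots> = x1" unfolding u'[symmetric] y1 p by simp
      finally have "\<theta> (- ((- (\<pi> ^ (M - 1 - e) * (u' * y1))) * (\<pi> ^ l * x))) \<noteq> 1" using nt(2) by simp
      then show ?thesis
      proof (rule hom_sum_zero[of "\<lambda>\<xi>. \<theta> (- (\<xi> * (\<pi> ^ l * x)))", rotated 2])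
        fix a b
        have "- ((a + b) * (\<pi> ^ l * x)) = - (a * (\<pi> ^ l * x)) + - (b * (\<pi> ^ l * x))" by (simp add: algebra_simps)
        moreover have "\<pi> ^ l dvd - (c * (\<pi> ^ l * x))" for c by simp
        ultimately show "\<theta> (- ((a + b) * (\<pi> ^ l * x))) = \<theta> (- (a * (\<pi> ^ l * x))) * \<theta> (- (b * (\<pi> ^ l * x)))"
          using \<theta>(1)[of "- (a * (\<pi> ^ l * x))" "- (b * (\<pi> ^ l * x))"] by (simp only:)
      next
        fix a assume "\<pi> ^ M dvd a"
        then have "\<pi> ^ l * \<pi> ^ M dvd \<pi> ^ l * x * a" by (intro mult_dvd_mono) simp_all
        then have "\<pi> ^ N dvd - (a * (\<pi> ^ l * x))" unfolding NM power_add by (simp add: mult_ac)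
        then show "\<theta> (- (a * (\<pi> ^ l * x))) = 1" by (rule \<theta>(2))
      qed
    qed
    then have "(\<Sum>x\<in>res M. \<phi> (\<pi> ^ l * x) * (\<Sum>\<xi>\<in>res M. \<theta> (- (\<xi> * (\<pi> ^ l * x))))) =
        (\<Sum>x\<in>{z}. \<phi> (\<pi> ^ l * x) * (\<Sum>\<xi>\<in>res M. \<theta> (- (\<xi> * (\<pi> ^ l * x)))))"
      using res(1) z(1) by (intro sum.mono_neutral_right) auto
    also have "\<dots> = (\<Sum>\<xi>\<in>res M. 1)"
    proof -
      have "\<theta> (- (\<xi> * (\<pi> ^ l * z))) = 1" for \<xi>
        by (rule \<theta>(2)) (unfold dvd_minus_iff, rule dvd_mult[OF zN])
      then show ?thesis using \<phi>(2)[OF zN] by simp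
    qed
    also have "\<dots> = of_nat (q ^ M)" by (simp add: res(2))
    finally have "of_nat (q ^ M) = (0::complex)" using sum0 by simp
    then show False using q_ge_2 by simp
  qed
  then obtain \<xi> where \<xi>: "\<And>x. \<phi> (\<pi> ^ l * x) * \<theta> (- (\<xi> * (\<pi> ^ l * x))) = 1" by blast
  have "\<phi> x = \<theta> (\<xi> * x)" if x: "\<pi> ^ l dvd x" for x
  proof -
    obtain y where y: "x = \<pi> ^ l * y" using x unfolding dvd_def by blast
    have "\<phi> x * (\<theta> (\<xi> * x) * \<theta> (- (\<xi> * x))) = \<theta> (\<xi> * x)" using \<xi>[of y] unfolding y by (simp add: mult_ac)
    then show ?thesis using inv[OF dvd_mult[OF x]] by simp
  qed
  then show ?thesis by blast
qed

text \<open>The congruences say that the cross product with \<open>(A, B, C)\<close> vanishes modulo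
  \<open>\<pi> ^ n\<close>. Division by a unit coordinate gives the multiplier \<open>s\<close>,
  which inherits the level \<open>m\<close> of the vector.\<close>

lemma parallel_decomposition:
  assumes unit: "A dvd 1 \<or> B dvd 1 \<or> C dvd 1"
    and par: "\<pi> ^ n dvd C * x - B * y" "\<pi> ^ n dvd B * d - A * x" "\<pi> ^ n dvd A * y - C * d"
    and w: "\<pi> ^ m dvd d" "\<pi> ^ m dvd x" "\<pi> ^ m dvd y"
  obtains s z1 z2 z3 where "\<pi> ^ m dvd s" "d = s * A + \<pi> ^ n * z1" "x = s * B + \<pi> ^ n * z2" "y = s * C + \<pi> ^ n * z3"
proof -
  obtain a b c where abc: "C * x - B * y = \<pi> ^ n * a" "B * d - A * x = \<pi> ^ n * b" "A * y - C * d = \<pi> ^ n * c"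
    using par unfolding dvd_def by blast
  from unit consider "A dvd 1" | "B dvd 1" | "C dvd 1" by blast
  then show ?thesis
  proof cases
    case 1
    then obtain i where i: "1 = A * i" by (rule dvdE)
    have "d = (d * i) * A + \<pi> ^ n * 0" using i by (simp add: mult_ac)
    moreover have "x = (d * i) * B + \<pi> ^ n * (- (b * i))"
    proof -
      have "x = x * (A * i)" using i by simp
      also have "\<dots> = (d * i) * B - (B * d - A * x) * i" by (simp add: algebra_simps)
      finally show ?thesis unfolding abc by (simp add: algebra_simps)
    qed
    moreover have "y = (d * i) * C + \<pi> ^ n * (c * i)"
    proof -
      have "y = y * (A * i)" using i by simp
      also have "\<dots> = (d * i) * C + (A * y - C * d) * i" by (simp add: algebra_simps)
      finally show ?thesis unfolding abc by (simp add: algebra_simps)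
    qed
    ultimately show ?thesis using that[of "d * i"] dvd_mult2[OF w(1)] by blast
  next
    case 2
    then obtain i where i: "1 = B * i" by (rule dvdE)
    have "x = (x * i) * B + \<pi> ^ n * 0" using i by (simp add: mult_ac)
    moreover have "d = (x * i) * A + \<pi> ^ n * (b * i)"
    proof -
      have "d = d * (B * i)" using i by simp
      also have "\<dots> = (x * i) * A + (B * d - A * x) * i" by (simp add: algebra_simps)
      finally show ?thesis unfolding abc by (simp add: algebra_simps)
    qed
    moreover have "y = (x * i) * C + \<pi> ^ n * (- (a * i))"
    proof -
      have "y = y * (B * i)" using i by simp
      also have "\<dots> = (x * i) * C - (C * x - B * y) * i" by (simp add: algebra_simps)
      finally show ?thesis unfolding abc by (simp add: algebra_simps)
    qed
    ultimately show ?thesis using that[of "x * i"] dvd_mult2[OF w(2)] by blast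
  next
    case 3
    then obtain i where i: "1 = C * i" by (rule dvdE)
    have "y = (y * i) * C + \<pi> ^ n * 0" using i by (simp add: mult_ac)
    moreover have "d = (y * i) * A + \<pi> ^ n * (- (c * i))"
    proof -
      have "d = d * (C * i)" using i by simp
      also have "\<dots> = (y * i) * A - (A * y - C * d) * i" by (simp add: algebra_simps)
      finally show ?thesis unfolding abc by (simp add: algebra_simps)
    qed
    moreover have "x = (y * i) * B + \<pi> ^ n * (a * i)"
    proof -
      have "x = x * (C * i)" using i by simp
      also have "\<dots> = (y * i) * B + (C * x - B * y) * i" by (simp add: algebra_simps)
      finally show ?thesis unfolding abc by (simp add: algebra_simps)
    qed
    ultimately show ?thesis using that[of "y * i"] dvd_mult2[OF w(3)] by blast
  qed
qed

text \<open>Let X have rows \<open>(A, B)\<close> and \<open>(C, 0)\<close>, and let Y be the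
  trace-zero matrix of the \<open>Y11\<close>, \<open>Y12\<close>, \<open>Y21\<close>. Modulo
  \<open>\<pi> ^ n\<close> the matrix E is a combination of 1 and X, and by Cayley-Hamilton the
  square of X is \<open>A\<close> times X plus a scalar. Hence the trace of XYE is a multiple of the
  trace of XY up to an error of level \<open>n + K\<close>.\<close>

lemma trace_pairing_dvd:
  assumes E: "E11 - E22 = r * A + \<pi> ^ n * w1" "E12 = r * B + \<pi> ^ n * w2" "E21 = r * C + \<pi> ^ n * w3"
    and Y: "\<pi> ^ K dvd Y11" "\<pi> ^ K dvd Y12" "\<pi> ^ K dvd Y21"
    and t: "\<pi> ^ M dvd A * Y11 + C * Y12 + B * Y21" and M: "M \<le> n + K"
  shows "\<pi> ^ M dvd A * (Y11 * E11 + Y12 * E21) + C * (Y11 * E12 + Y12 * E22) + B * (Y21 * E11 - Y11 * E21)"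
proof -
  have E11: "E11 = E22 + (r * A + \<pi> ^ n * w1)" using E(1) by (simp add: algebra_simps)
  have eq: "A * (Y11 * E11 + Y12 * E21) + C * (Y11 * E12 + Y12 * E22) + B * (Y21 * E11 - Y11 * E21) =
     (E22 + r * A) * (A * Y11 + C * Y12 + B * Y21) +
     \<pi> ^ n * ((w1 * A + w2 * C - w3 * B) * Y11 + w3 * A * Y12 + w1 * B * Y21)"
    unfolding E11 E(2,3) by (simp add: algebra_simps)
  have "\<pi> ^ K dvd (w1 * A + w2 * C - w3 * B) * Y11 + w3 * A * Y12 + w1 * B * Y21"
    by (intro dvd_add dvd_mult Y)
  then have "\<pi> ^ M dvd \<pi> ^ n * ((w1 * A + w2 * C - w3 * B) * Y11 + w3 * A * Y12 + w1 * B * Y21)"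
    by (intro pow_mult_dvd[OF dvd_refl _ M])
  then show ?thesis unfolding eq by (rule dvd_add[OF dvd_mult[OF t]])
qed

end

section \<open>Centralizers of a fixed matrix modulo powers of the uniformizer\<close>

context sl2_congruence
begin

text \<open>The congruences are entries of a commutation relation with the matrix with rows
  \<open>(A, B)\<close> and \<open>(C, 0)\<close>; the entry 0 normalizes this matrix modulo
  scalars.\<close>

definition Par :: "'o \<Rightarrow> 'o \<Rightarrow> 'o \<Rightarrow> nat \<Rightarrow> ('o^2^2) set" where
  "Par A B C n = {g \<in> Lev m. \<pi> ^ n dvd C * g $ 1 $ 2 - B * g $ 2 $ 1 \<and>
     \<pi> ^ n dvd B * (g $ 1 $ 1 - g $ 2 $ 2) - A * g $ 1 $ 2 \<and> \<pi> ^ n dvd A * g $ 2 $ 1 - C * (g $ 1 $ 1 - g $ 2 $ 2)}"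

lemma ParD:
  assumes "g \<in> Par A B C n"
  shows "g \<in> Lev m" "\<pi> ^ n dvd C * g $ 1 $ 2 - B * g $ 2 $ 1"
     "\<pi> ^ n dvd B * (g $ 1 $ 1 - g $ 2 $ 2) - A * g $ 1 $ 2" "\<pi> ^ n dvd A * g $ 2 $ 1 - C * (g $ 1 $ 1 - g $ 2 $ 2)"
  using assms by (simp_all add: Par_def)

lemma Par_mono: "i \<le> j \<Longrightarrow> Par A B C j \<subseteq> Par A B C i"
  unfolding Par_def by (auto intro: pow_le_dvd)

text \<open>The three identities are entries of the product rule for the additive commutator of
  \<open>g ** h\<close> with the fixed matrix.\<close>

lemma Par_mult:
  assumes g: "g \<in> Par A B C n" and h: "h \<in> Par A B C n"
  shows "g ** h \<in> Par A B C n"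
proof -
  note g = ParD[OF g] and h = ParD[OF h]
  have 1: "C * (g ** h) $ 1 $ 2 - B * (g ** h) $ 2 $ 1 =
      g $ 1 $ 1 * (C * h $ 1 $ 2 - B * h $ 2 $ 1) + g $ 1 $ 2 * (A * h $ 2 $ 1 - C * (h $ 1 $ 1 - h $ 2 $ 2)) +
      h $ 1 $ 1 * (C * g $ 1 $ 2 - B * g $ 2 $ 1) + h $ 2 $ 1 * (B * (g $ 1 $ 1 - g $ 2 $ 2) - A * g $ 1 $ 2)"
    by (simp add: algebra_simps)
  have 2: "B * ((g ** h) $ 1 $ 1 - (g ** h) $ 2 $ 2) - A * (g ** h) $ 1 $ 2 =
      g $ 1 $ 1 * (B * (h $ 1 $ 1 - h $ 2 $ 2) - A * h $ 1 $ 2) - g $ 1 $ 2 * (C * h $ 1 $ 2 - B * h $ 2 $ 1) +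
      h $ 1 $ 2 * (C * g $ 1 $ 2 - B * g $ 2 $ 1) + h $ 2 $ 2 * (B * (g $ 1 $ 1 - g $ 2 $ 2) - A * g $ 1 $ 2)"
    by (simp add: algebra_simps)
  have 3: "A * (g ** h) $ 2 $ 1 - C * ((g ** h) $ 1 $ 1 - (g ** h) $ 2 $ 2) =
      g $ 2 $ 1 * (C * h $ 1 $ 2 - B * h $ 2 $ 1) + g $ 2 $ 2 * (A * h $ 2 $ 1 - C * (h $ 1 $ 1 - h $ 2 $ 2)) +
      h $ 1 $ 1 * (A * g $ 2 $ 1 - C * (g $ 1 $ 1 - g $ 2 $ 2)) - h $ 2 $ 1 * (C * g $ 1 $ 2 - B * g $ 2 $ 1)"
    by (simp add: algebra_simps)
  show ?thesis
    unfolding Par_def mem_Collect_eq 1 2 3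
    by (intro conjI dvd_add dvd_diff[of _ "_ * (B * _ - _)" "_ * _"] dvd_diff[of _ "_ + _" "_ * _"]
        dvd_mult[OF g(2)] dvd_mult[OF g(3)] dvd_mult[OF g(4)] dvd_mult[OF h(2)] dvd_mult[OF h(3)] dvd_mult[OF h(4)]
        Lev_mult[OF g(1) h(1)])
qed

lemma Par_subgroup: "subgroup (Par A B C n) G"
proof (rule group.subgroupI[OF group_G])
  show "Par A B C n \<subseteq> carrier G" by (auto simp: Par_def)
  have "Finite_Cartesian_Product.mat 1 \<in> Par A B C n" by (simp add: Par_def Lev_one)
  then show "Par A B C n \<noteq> {}" by auto
next
  fix g assume "g \<in> Par A B C n"
  note g = ParD[OF this]
  have "C * adj22 g $ 1 $ 2 - B * adj22 g $ 2 $ 1 = - (C * g $ 1 $ 2 - B * g $ 2 $ 1)"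
    "B * (adj22 g $ 1 $ 1 - adj22 g $ 2 $ 2) - A * adj22 g $ 1 $ 2 = - (B * (g $ 1 $ 1 - g $ 2 $ 2) - A * g $ 1 $ 2)"
    "A * adj22 g $ 2 $ 1 - C * (adj22 g $ 1 $ 1 - adj22 g $ 2 $ 2) = - (A * g $ 2 $ 1 - C * (g $ 1 $ 1 - g $ 2 $ 2))"
    by (simp_all add: algebra_simps)
  then have "adj22 g \<in> Par A B C n"
    unfolding Par_def mem_Collect_eq using g Lev_adj by (simp only: dvd_minus_iff simp_thms)
  then show "inv\<^bsub>G\<^esub> g \<in> Par A B C n" using g(1) by simp
next
  show "g \<otimes>\<^bsub>G\<^esub> h \<in> Par A B C n" if "g \<in> Par A B C n" "h \<in> Par A B C n" for g h
    using Par_mult[OF that] by simp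
qed

lemma Ker_sub_Par: "Ker n \<subseteq> Par A B C n"
proof
  fix g assume "g \<in> Ker n"
  note g = KerD[OF this]
  show "g \<in> Par A B C n" unfolding Par_def using g by (auto intro!: dvd_diff dvd_mult)
qed

text \<open>The functional \<open>k \<mapsto> \<xi>\<^sub>1 (k\<^sub>1\<^sub>1 - k\<^sub>2\<^sub>2) + \<xi>\<^sub>2 k\<^sub>1\<^sub>2 + \<xi>\<^sub>3 k\<^sub>2\<^sub>1\<close> is, up to the factor \<open>\<pi>\<^sup>j\<close> and
  the quadratic error term \<open>\<xi>\<^sub>1 (tr k - 2)\<close>, the trace pairing with the matrix with rows \<open>(A, B)\<close> and \<open>(C, 0)\<close>;
  \<open>Par\<close> is the group of elements commuting with this matrix modulo \<open>\<pi>\<^sup>n\<close>.\<close>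

lemma functional_comm_dvd:
  assumes g: "g \<in> Par A B C n" and h: "h \<in> Par A B C l" and unit: "A dvd 1 \<or> B dvd 1 \<or> C dvd 1"
    and X: "2 * \<xi>1 = \<pi> ^ j * A" "\<xi>3 = \<pi> ^ j * B" "\<xi>2 = \<pi> ^ j * C"
    and N: "N = n + l + j" and nl: "n \<le> l" "m \<le> l" "l \<le> n + m" "l + j \<le> n + 2 * m"
  shows "\<pi> ^ N dvd \<xi>1 * (comm g h $ 1 $ 1 - comm g h $ 2 $ 2) + \<xi>2 * comm g h $ 1 $ 2 + \<xi>3 * comm g h $ 2 $ 1"
    "\<pi> ^ (n + m) dvd comm g h $ 1 $ 1 - comm g h $ 2 $ 2" "\<pi> ^ (n + m) dvd comm g h $ 1 $ 2"
    "\<pi> ^ (n + m) dvd comm g h $ 2 $ 1"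
proof -
  note gd = ParD[OF g] and hd = ParD[OF h]
  define Y11 Y12 Y21 E where "Y11 = g $ 1 $ 2 * h $ 2 $ 1 - g $ 2 $ 1 * h $ 1 $ 2"
    and "Y12 = (g $ 1 $ 1 - g $ 2 $ 2) * h $ 1 $ 2 - g $ 1 $ 2 * (h $ 1 $ 1 - h $ 2 $ 2)"
    and "Y21 = g $ 2 $ 1 * (h $ 1 $ 1 - h $ 2 $ 2) - (g $ 1 $ 1 - g $ 2 $ 2) * h $ 2 $ 1"
    and "E = adj22 g ** adj22 h"
  note ce = comm_entries[OF gd(1) hd(1), folded Y11_def Y12_def Y21_def E_def]
  obtain s z1 z2 z3 where s: "\<pi> ^ m dvd s" "g $ 1 $ 1 - g $ 2 $ 2 = s * A + \<pi> ^ n * z1"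
      "g $ 1 $ 2 = s * B + \<pi> ^ n * z2" "g $ 2 $ 1 = s * C + \<pi> ^ n * z3"
    by (rule parallel_decomposition[OF unit gd(2-4) Lev_diff[OF gd(1)] LevD(3,4)[OF gd(1)]])
  obtain s' y1 y2 y3 where s': "\<pi> ^ m dvd s'" "h $ 1 $ 1 - h $ 2 $ 2 = s' * A + \<pi> ^ l * y1"
      "h $ 1 $ 2 = s' * B + \<pi> ^ l * y2" "h $ 2 $ 1 = s' * C + \<pi> ^ l * y3"
    by (rule parallel_decomposition[OF unit hd(2-4) Lev_diff[OF hd(1)] LevD(3,4)[OF hd(1)]])
  have "h \<in> Par A B C n" using h Par_mono[OF nl(1)] by blast
  have adj: "adj22 u \<in> Par A B C n" if "u \<in> Par A B C n" for u
    using subgroup.m_inv_closed[OF Par_subgroup that] ParD(1)[OF that] by simp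
  have E: "E \<in> Par A B C n" unfolding E_def by (intro Par_mult adj g \<open>h \<in> Par A B C n\<close>)
  note Ed = ParD[OF E]
  obtain r w1 w2 w3 where r: "\<pi> ^ m dvd r" "E $ 1 $ 1 - E $ 2 $ 2 = r * A + \<pi> ^ n * w1"
      "E $ 1 $ 2 = r * B + \<pi> ^ n * w2" "E $ 2 $ 1 = r * C + \<pi> ^ n * w3"
    by (rule parallel_decomposition[OF unit Ed(2-4) Lev_diff[OF Ed(1)] LevD(3,4)[OF Ed(1)]])
  have cross: "\<pi> ^ (n + m) dvd s * (\<pi> ^ l * a) + s' * (\<pi> ^ n * b) + \<pi> ^ n * (\<pi> ^ l * c)" for a b c
    using nl by (intro dvd_add pow_mult_dvd[OF s(1) dvd_triv_left] pow_mult_dvd[OF s'(1) dvd_triv_left]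
        pow_mult_dvd[OF dvd_refl dvd_triv_left]) simp_all
  have "Y11 = s * (\<pi> ^ l * (B * y3 - C * y2)) + s' * (\<pi> ^ n * (z2 * C - z3 * B)) + \<pi> ^ n * (\<pi> ^ l * (z2 * y3 - z3 * y2))"
    "Y12 = s * (\<pi> ^ l * (A * y2 - B * y1)) + s' * (\<pi> ^ n * (z1 * B - z2 * A)) + \<pi> ^ n * (\<pi> ^ l * (z1 * y2 - z2 * y1))"
    "Y21 = s * (\<pi> ^ l * (C * y1 - A * y3)) + s' * (\<pi> ^ n * (z3 * A - z1 * C)) + \<pi> ^ n * (\<pi> ^ l * (z3 * y1 - z1 * y3))"
    unfolding Y11_def Y12_def Y21_def s(2-4) s'(2-4) by (simp_all add: algebra_simps)
  with cross have Y: "\<pi> ^ (n + m) dvd Y11" "\<pi> ^ (n + m) dvd Y12" "\<pi> ^ (n + m) dvd Y21" by (simp_all only:)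
  \<comment> \<open>The trace of the fixed matrix against the bracket is a triple product, so the
    components of \<open>g\<close> and \<open>h\<close> along the fixed matrix drop out and both
    error factors \<open>\<pi> ^ n\<close> and \<open>\<pi> ^ l\<close> remain.\<close>
  have "A * Y11 + C * Y12 + B * Y21 =
      \<pi> ^ (n + l) * (A * (z2 * y3 - z3 * y2) + C * (z1 * y2 - z2 * y1) + B * (z3 * y1 - z1 * y3))"
    unfolding Y11_def Y12_def Y21_def s(2-4) s'(2-4) power_add by (simp add: algebra_simps)
  then have t: "\<pi> ^ (n + l) dvd A * Y11 + C * Y12 + B * Y21" by simp
  define tr where "tr = A * (Y11 * E $ 1 $ 1 + Y12 * E $ 2 $ 1) + C * (Y11 * E $ 1 $ 2 + Y12 * E $ 2 $ 2) +
      B * (Y21 * E $ 1 $ 1 - Y11 * E $ 2 $ 1)"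
  have tr0: "\<pi> ^ (n + l) dvd tr"
    unfolding tr_def using nl by (intro trace_pairing_dvd[OF r(2-4) Y t]) linarith
  then have tr: "\<pi> ^ N dvd \<pi> ^ j * tr" unfolding N by (intro pow_mult_dvd[OF dvd_refl tr0]) simp
  \<comment> \<open>As the commutator has determinant 1, the trace of its difference from the
    identity is minus the determinant of that difference, hence quadratic in the bracket.\<close>
  have "(Y11 * Y11 + Y12 * Y21) * 1 = (Y11 * Y11 + Y12 * Y21) * (E $ 1 $ 1 * E $ 2 $ 2 - E $ 1 $ 2 * E $ 2 $ 1)"
    using LevD(1)[OF Ed(1)] by simp
  also have "\<dots> = - ((Y11 * E $ 1 $ 1 + Y12 * E $ 2 $ 1) * (Y21 * E $ 1 $ 2 - Y11 * E $ 2 $ 2) -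
      (Y11 * E $ 1 $ 2 + Y12 * E $ 2 $ 2) * (Y21 * E $ 1 $ 1 - Y11 * E $ 2 $ 1))"
    by (simp add: algebra_simps)
  also have "\<dots> = comm g h $ 1 $ 1 - 1 + (comm g h $ 2 $ 2 - 1) -
      (comm g h $ 1 $ 1 * comm g h $ 2 $ 2 - comm g h $ 1 $ 2 * comm g h $ 2 $ 1 - 1)"
    unfolding ce by (simp add: algebra_simps)
  finally have trace: "comm g h $ 1 $ 1 + comm g h $ 2 $ 2 - 2 = Y11 * Y11 + Y12 * Y21"
    using LevD(1)[OF comm_Lev[OF gd(1) hd(1)]] by simp
  have "\<pi> ^ N dvd Y11 * Y11 + Y12 * Y21"
    using nl unfolding N by (intro dvd_add pow_mult_dvd[OF Y(1) Y(1)] pow_mult_dvd[OF Y(2) Y(3)]) simp_all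
  then have q: "\<pi> ^ N dvd \<xi>1 * (comm g h $ 1 $ 1 + comm g h $ 2 $ 2 - 2)" unfolding trace by (rule dvd_mult)
  have "\<pi> ^ j * tr = (\<pi> ^ j * A) * (comm g h $ 1 $ 1 - 1) + (\<pi> ^ j * C) * comm g h $ 1 $ 2 + (\<pi> ^ j * B) * comm g h $ 2 $ 1"
    unfolding tr_def ce by (simp add: algebra_simps)
  also have "\<dots> = 2 * \<xi>1 * (comm g h $ 1 $ 1 - 1) + \<xi>2 * comm g h $ 1 $ 2 + \<xi>3 * comm g h $ 2 $ 1"
    unfolding X ..
  finally have "\<xi>1 * (comm g h $ 1 $ 1 - comm g h $ 2 $ 2) + \<xi>2 * comm g h $ 1 $ 2 + \<xi>3 * comm g h $ 2 $ 1 =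
      \<pi> ^ j * tr - \<xi>1 * (comm g h $ 1 $ 1 + comm g h $ 2 $ 2 - 2)"
    by (simp add: algebra_simps)
  then show "\<pi> ^ N dvd \<xi>1 * (comm g h $ 1 $ 1 - comm g h $ 2 $ 2) + \<xi>2 * comm g h $ 1 $ 2 + \<xi>3 * comm g h $ 2 $ 1"
    using dvd_diff[OF tr q] by (simp only:)
  show "\<pi> ^ (n + m) dvd comm g h $ 1 $ 2" "\<pi> ^ (n + m) dvd comm g h $ 2 $ 1"
    unfolding ce by (intro dvd_add dvd_diff dvd_mult2 Y)+
  show "\<pi> ^ (n + m) dvd comm g h $ 1 $ 1 - comm g h $ 2 $ 2"
    unfolding ce add_diff_cancel_left by (intro dvd_add dvd_diff dvd_mult2 Y)
qed

section \<open>Indices of the centralizers\<close>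

text \<open>An index bound in the form in which \<open>rep_dim_upper_bound\<close> takes it: at most
  \<open>q ^ k\<close> left representatives.\<close>

definition covers :: "('o^2^2) set \<Rightarrow> nat \<Rightarrow> bool" where
  "covers P k \<longleftrightarrow> (\<exists>T. finite T \<and> T \<subseteq> Lev m \<and> card T \<le> q ^ k \<and> (\<forall>g\<in>Lev m. \<exists>t\<in>T. \<exists>p\<in>P. g = t ** p))"

text \<open>Elements are sorted by the residues of two functions modulo \<open>\<pi> ^ n\<close>. As
  \<open>f1\<close> and \<open>f2\<close> are constant modulo \<open>\<pi> ^ i\<close> and
  \<open>\<pi> ^ j\<close>, only \<open>n - i\<close> and \<open>n - j\<close> digits are
  free.\<close>

lemma bounded_cover:
  assumes f: "\<And>g. g \<in> Lev m \<Longrightarrow> \<pi> ^ i dvd f1 g - b1" "\<And>g. g \<in> Lev m \<Longrightarrow> \<pi> ^ j dvd f2 g - b2"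
    and ij: "i \<le> n" "j \<le> n"
    and P: "\<And>g t. g \<in> Lev m \<Longrightarrow> t \<in> Lev m \<Longrightarrow> \<pi> ^ n dvd f1 g - f1 t \<Longrightarrow> \<pi> ^ n dvd f2 g - f2 t \<Longrightarrow> adj22 t ** g \<in> P"
  shows "covers P ((n - i) + (n - j))"
proof -
  have "\<exists>r\<in>res (n - k). \<pi> ^ n dvd f g - b - \<pi> ^ k * r"
    if k: "k \<le> n" "\<pi> ^ k dvd f g - b" for k and f :: "'o^2^2 \<Rightarrow> 'o" and b g
  proof -
    obtain y where y: "f g - b = \<pi> ^ k * y" using k(2) by (rule dvdE)
    obtain r where r: "r \<in> res (n - k)" "\<pi> ^ (n - k) dvd y - r" using res(3)[where x = y and n = "n - k"] by blast
    have "\<pi> ^ n dvd \<pi> ^ k * (y - r)" using k(1) by (intro pow_mult_dvd[OF dvd_refl r(2)]) simp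
    then show ?thesis using r(1) unfolding y by (intro bexI[of _ r]) (simp_all add: right_diff_distrib)
  qed
  then have "\<exists>r1\<in>res (n - i). \<pi> ^ n dvd f1 g - b1 - \<pi> ^ i * r1" "\<exists>r2\<in>res (n - j). \<pi> ^ n dvd f2 g - b2 - \<pi> ^ j * r2"
    if "g \<in> Lev m" for g using that f ij by blast+
  then obtain c1 c2 where c: "\<And>g. g \<in> Lev m \<Longrightarrow> c1 g \<in> res (n - i) \<and> \<pi> ^ n dvd f1 g - b1 - \<pi> ^ i * c1 g"
      "\<And>g. g \<in> Lev m \<Longrightarrow> c2 g \<in> res (n - j) \<and> \<pi> ^ n dvd f2 g - b2 - \<pi> ^ j * c2 g" by metis
  define code where "code g = (c1 g, c2 g)" for g
  define S where "S = code ` Lev m"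
  have S: "S \<subseteq> res (n - i) \<times> res (n - j)" unfolding S_def code_def using c by auto
  have finS: "finite S" by (rule finite_subset[OF S]) (simp add: res(1))
  have cardS: "card S \<le> q ^ ((n - i) + (n - j))"
    using card_mono[OF _ S] by (simp add: res card_cartesian_product power_add)
  define rp where "rp s = (SOME g. g \<in> Lev m \<and> code g = s)" for s
  have rp: "rp s \<in> Lev m" "code (rp s) = s" if "s \<in> S" for s
  proof -
    have "\<exists>g. g \<in> Lev m \<and> code g = s" using that by (auto simp: S_def)
    from someI_ex[OF this] show "rp s \<in> Lev m" "code (rp s) = s" by (simp_all add: rp_def)
  qed
  show ?thesis
    unfolding covers_def
  proof (intro exI[of _ "rp ` S"] conjI ballI)
    show "finite (rp ` S)" using finS by simp
    show "rp ` S \<subseteq> Lev m" using rp by blast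
    show "card (rp ` S) \<le> q ^ ((n - i) + (n - j))" using card_image_le[OF finS, of rp] cardS by linarith
    fix g assume g: "g \<in> Lev m"
    define t where "t = rp (code g)"
    have cS: "code g \<in> S" using g by (simp add: S_def)
    have t: "t \<in> Lev m" "code t = code g" using rp[OF cS] by (simp_all add: t_def)
    have "f1 g - f1 t = (f1 g - b1 - \<pi> ^ i * c1 g) - (f1 t - b1 - \<pi> ^ i * c1 t)"
      "f2 g - f2 t = (f2 g - b2 - \<pi> ^ j * c2 g) - (f2 t - b2 - \<pi> ^ j * c2 t)"
      using t(2) by (simp_all add: code_def)
    moreover have "\<pi> ^ n dvd (f1 g - b1 - \<pi> ^ i * c1 g) - (f1 t - b1 - \<pi> ^ i * c1 t)"
      "\<pi> ^ n dvd (f2 g - b2 - \<pi> ^ j * c2 g) - (f2 t - b2 - \<pi> ^ j * c2 t)"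
      by (rule dvd_diff; use c g t(1) in blast)+
    ultimately have "adj22 t ** g \<in> P" using P[OF g t(1)] by (simp only:)
    moreover have "g = t ** (adj22 t ** g)" using adj_mult(1)[OF t(1)] by (simp add: matrix_mul_assoc)
    ultimately show "\<exists>t\<in>rp ` S. \<exists>p\<in>P. g = t ** p" using cS unfolding t_def by blast
  qed
qed

lemma det22_mult:
  fixes P Q :: "'o^2^2"
  shows "(P ** Q) $ 1 $ 1 * (P ** Q) $ 2 $ 2 - (P ** Q) $ 1 $ 2 * (P ** Q) $ 2 $ 1 =
    (P $ 1 $ 1 * P $ 2 $ 2 - P $ 1 $ 2 * P $ 2 $ 1) * (Q $ 1 $ 1 * Q $ 2 $ 2 - Q $ 1 $ 2 * Q $ 2 $ 1)"
  by (simp add: algebra_simps)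

text \<open>The conjugation orbit of the fixed matrix, whose size modulo \<open>\<pi> ^ n\<close> is
  the index of \<open>Par A B C n\<close>. Invariance of trace and determinant will leave two free
  coordinates.\<close>

definition cj :: "'o \<Rightarrow> 'o \<Rightarrow> 'o \<Rightarrow> 'o^2^2 \<Rightarrow> 'o^2^2" where
  "cj A B C g = g ** mat22 A B C 0 ** adj22 g"

lemma cj_entries:
  assumes g: "g \<in> Lev m"
  shows "cj A B C g $ 1 $ 2 = g $ 1 $ 1 * g $ 1 $ 1 * B - g $ 1 $ 2 * g $ 1 $ 2 * C - g $ 1 $ 1 * g $ 1 $ 2 * A"
    "cj A B C g $ 2 $ 1 = g $ 2 $ 2 * g $ 2 $ 2 * C - g $ 2 $ 1 * g $ 2 $ 1 * B + g $ 2 $ 1 * g $ 2 $ 2 * A"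
    "cj A B C g $ 2 $ 2 = g $ 2 $ 1 * (g $ 1 $ 1 * B) - g $ 1 $ 2 * (g $ 2 $ 1 * A + g $ 2 $ 2 * C)"
    "cj A B C g $ 1 $ 1 = A - cj A B C g $ 2 $ 2"
    "(A - cj A B C g $ 2 $ 2) * cj A B C g $ 2 $ 2 - cj A B C g $ 1 $ 2 * cj A B C g $ 2 $ 1 = - (B * C)"
proof -
  show "cj A B C g $ 1 $ 2 = g $ 1 $ 1 * g $ 1 $ 1 * B - g $ 1 $ 2 * g $ 1 $ 2 * C - g $ 1 $ 1 * g $ 1 $ 2 * A"
    "cj A B C g $ 2 $ 1 = g $ 2 $ 2 * g $ 2 $ 2 * C - g $ 2 $ 1 * g $ 2 $ 1 * B + g $ 2 $ 1 * g $ 2 $ 2 * A"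
    "cj A B C g $ 2 $ 2 = g $ 2 $ 1 * (g $ 1 $ 1 * B) - g $ 1 $ 2 * (g $ 2 $ 1 * A + g $ 2 $ 2 * C)"
    by (simp_all add: cj_def algebra_simps)
  have "cj A B C g $ 1 $ 1 + cj A B C g $ 2 $ 2 = A * (g $ 1 $ 1 * g $ 2 $ 2 - g $ 1 $ 2 * g $ 2 $ 1)"
    by (simp add: cj_def algebra_simps)
  then show 11: "cj A B C g $ 1 $ 1 = A - cj A B C g $ 2 $ 2" using LevD(1)[OF g] by (simp add: algebra_simps)
  have "cj A B C g $ 1 $ 1 * cj A B C g $ 2 $ 2 - cj A B C g $ 1 $ 2 * cj A B C g $ 2 $ 1 =
      (g $ 1 $ 1 * g $ 2 $ 2 - g $ 1 $ 2 * g $ 2 $ 1) * (A * 0 - B * C) * (g $ 2 $ 2 * g $ 1 $ 1 - (- g $ 1 $ 2) * (- g $ 2 $ 1))"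
    unfolding cj_def det22_mult by simp
  also have "\<dots> = - (B * C) * ((g $ 1 $ 1 * g $ 2 $ 2 - g $ 1 $ 2 * g $ 2 $ 1) * (g $ 1 $ 1 * g $ 2 $ 2 - g $ 1 $ 2 * g $ 2 $ 1))"
    by (simp add: mult_ac)
  finally have "cj A B C g $ 1 $ 1 * cj A B C g $ 2 $ 2 - cj A B C g $ 1 $ 2 * cj A B C g $ 2 $ 1 =
    - (B * C) * ((g $ 1 $ 1 * g $ 2 $ 2 - g $ 1 $ 2 * g $ 2 $ 1) * (g $ 1 $ 1 * g $ 2 $ 2 - g $ 1 $ 2 * g $ 2 $ 1))" .
  then show "(A - cj A B C g $ 2 $ 2) * cj A B C g $ 2 $ 2 - cj A B C g $ 1 $ 2 * cj A B C g $ 2 $ 1 = - (B * C)"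
    unfolding LevD(1)[OF g] 11 by simp
qed

lemma mult_diff_dvd:
  fixes U V S Q :: "'o^2^2"
  assumes "\<And>i j. d dvd U $ i $ j - V $ i $ j"
  shows "d dvd (S ** U ** Q) $ i $ j - (S ** V ** Q) $ i $ j"
proof -
  have "(S ** U ** Q) $ i $ j - (S ** V ** Q) $ i $ j =
     S $ i $ 1 * Q $ 1 $ j * (U $ 1 $ 1 - V $ 1 $ 1) + S $ i $ 2 * Q $ 1 $ j * (U $ 2 $ 1 - V $ 2 $ 1) +
     S $ i $ 1 * Q $ 2 $ j * (U $ 1 $ 2 - V $ 1 $ 2) + S $ i $ 2 * Q $ 2 $ j * (U $ 2 $ 2 - V $ 2 $ 2)"
    by (simp add: algebra_simps)
  then show ?thesis by (simp only: dvd_add dvd_mult[OF assms])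
qed

text \<open>Orbit and stabilizer: two elements with the same conjugate differ by an element
  commuting with the fixed matrix.\<close>

lemma cj_cong_Par:
  assumes g: "g \<in> Lev m" and t: "t \<in> Lev m"
    and c: "\<pi> ^ n dvd cj A B C g $ 1 $ 2 - cj A B C t $ 1 $ 2" "\<pi> ^ n dvd cj A B C g $ 2 $ 1 - cj A B C t $ 2 $ 1"
      "\<pi> ^ n dvd cj A B C g $ 2 $ 2 - cj A B C t $ 2 $ 2"
  shows "adj22 t ** g \<in> Par A B C n"
proof -
  define h X where "h = adj22 t ** g" and "X = mat22 A B C 0"
  have "cj A B C g $ 1 $ 1 - cj A B C t $ 1 $ 1 = - (cj A B C g $ 2 $ 2 - cj A B C t $ 2 $ 2)"
    unfolding cj_entries(4)[OF g] cj_entries(4)[OF t] by simp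
  then have "\<pi> ^ n dvd cj A B C g $ 1 $ 1 - cj A B C t $ 1 $ 1" using c(3) by (simp only: dvd_minus_iff)
  with c have "\<forall>i j. \<pi> ^ n dvd cj A B C g $ i $ j - cj A B C t $ i $ j" by (simp add: forall_2)
  then have d: "\<pi> ^ n dvd (adj22 t ** cj A B C g ** g) $ i $ j - (adj22 t ** cj A B C t ** g) $ i $ j" for i j
    by (intro mult_diff_dvd) blast
  have "adj22 t ** cj A B C g ** g = adj22 t ** g ** X ** (adj22 g ** g)"
    by (simp add: cj_def X_def matrix_mul_assoc)
  then have 1: "adj22 t ** cj A B C g ** g = h ** X" using adj_mult(2)[OF g] by (simp add: h_def)
  have "adj22 t ** cj A B C t ** g = (adj22 t ** t) ** X ** adj22 t ** g"
    by (simp add: cj_def X_def matrix_mul_assoc)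
  then have 2: "adj22 t ** cj A B C t ** g = X ** h" using adj_mult(2)[OF t] by (simp add: h_def matrix_mul_assoc)
  note d = d[unfolded 1 2]
  have "h \<in> Lev m" unfolding h_def by (intro Lev_mult Lev_adj g t)
  moreover have "C * h $ 1 $ 2 - B * h $ 2 $ 1 = (h ** X) $ 1 $ 1 - (X ** h) $ 1 $ 1"
    "B * (h $ 1 $ 1 - h $ 2 $ 2) - A * h $ 1 $ 2 = (h ** X) $ 1 $ 2 - (X ** h) $ 1 $ 2"
    "A * h $ 2 $ 1 - C * (h $ 1 $ 1 - h $ 2 $ 2) = (h ** X) $ 2 $ 1 - (X ** h) $ 2 $ 1"
    by (simp_all add: X_def algebra_simps)
  ultimately have "h \<in> Par A B C n" unfolding Par_def mem_Collect_eq using d by (simp only: simp_thms)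
  then show ?thesis by (simp add: h_def)
qed

text \<open>The determinant recovers the diagonal coordinate from the off-diagonal ones: for two
  solutions, the difference \<open>z - z'\<close> occurs with the factor
  \<open>A - (z + z')\<close>, which is a unit.\<close>

lemma Par_cover_unit_diag:
  assumes A: "A dvd 1" and n: "m \<le> n"
  shows "covers (Par A B C n) (2 * (n - m))"
proof -
  have f: "\<pi> ^ m dvd cj A B C g $ 1 $ 2 - B" "\<pi> ^ m dvd cj A B C g $ 2 $ 1 - C" "\<pi> ^ m dvd cj A B C g $ 2 $ 2"
    if g: "g \<in> Lev m" for g
  proof -
    note gd = LevD[OF g]
    have "cj A B C g $ 1 $ 2 - B = (g $ 1 $ 1 + 1) * B * (g $ 1 $ 1 - 1) - g $ 1 $ 2 * C * g $ 1 $ 2 - g $ 1 $ 1 * A * g $ 1 $ 2"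
      "cj A B C g $ 2 $ 1 - C = (g $ 2 $ 2 + 1) * C * (g $ 2 $ 2 - 1) - g $ 2 $ 1 * B * g $ 2 $ 1 + g $ 2 $ 2 * A * g $ 2 $ 1"
      unfolding cj_entries[OF g] by (simp_all add: algebra_simps)
    moreover have "\<pi> ^ m dvd (g $ 1 $ 1 + 1) * B * (g $ 1 $ 1 - 1) - g $ 1 $ 2 * C * g $ 1 $ 2 - g $ 1 $ 1 * A * g $ 1 $ 2"
      "\<pi> ^ m dvd (g $ 2 $ 2 + 1) * C * (g $ 2 $ 2 - 1) - g $ 2 $ 1 * B * g $ 2 $ 1 + g $ 2 $ 2 * A * g $ 2 $ 1"
      by (intro dvd_add dvd_diff[of _ "_ - _ * _"] dvd_diff[of _ "_ * (_ - 1)"] dvd_mult gd)+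
    ultimately show "\<pi> ^ m dvd cj A B C g $ 1 $ 2 - B" "\<pi> ^ m dvd cj A B C g $ 2 $ 1 - C" by (simp_all only:)
    show "\<pi> ^ m dvd cj A B C g $ 2 $ 2" unfolding cj_entries[OF g] by (intro dvd_diff dvd_mult2 gd)
  qed
  have P: "adj22 t ** g \<in> Par A B C n"
    if g: "g \<in> Lev m" and t: "t \<in> Lev m"
     and c: "\<pi> ^ n dvd cj A B C g $ 1 $ 2 - cj A B C t $ 1 $ 2" "\<pi> ^ n dvd cj A B C g $ 2 $ 1 - cj A B C t $ 2 $ 1" for g t
  proof (rule cj_cong_Par[OF g t c])
    define x y z where xyz1: "x = cj A B C g $ 1 $ 2" "y = cj A B C g $ 2 $ 1" "z = cj A B C g $ 2 $ 2"
    define x' y' z' where xyz2: "x' = cj A B C t $ 1 $ 2" "y' = cj A B C t $ 2 $ 1" "z' = cj A B C t $ 2 $ 2"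
    note xyz = xyz1 xyz2
    have e: "(A - z) * z - x * y = (A - z') * z' - x' * y'"
      using cj_entries(5)[OF g, of A B C] cj_entries(5)[OF t, of A B C] unfolding xyz by simp
    have "(A - (z + z')) * (z - z') = ((A - z) * z - x * y) - ((A - z') * z' - x' * y') + (x - x') * y + x' * (y - y')"
      by (simp add: algebra_simps)
    then have "(A - (z + z')) * (z - z') = (x - x') * y + x' * (y - y')" unfolding e by simp
    also have "\<pi> ^ n dvd (x - x') * y + x' * (y - y')" using c unfolding xyz by (intro dvd_add dvd_mult dvd_mult2)
    finally have d: "\<pi> ^ n dvd (A - (z + z')) * (z - z')" .
    have "\<pi> dvd z + z'"
      using v_less_m unfolding xyz by (intro dvd_add pi_dvd[OF f(3)[OF g]] pi_dvd[OF f(3)[OF t]]) auto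
    then have "(A - (z + z')) dvd 1"
      using A dvd_add[of \<pi> "A - (z + z')" "z + z'"] unfolding unit_iff by auto
    from iffD1[OF unit_mult_dvd[OF this] d] show "\<pi> ^ n dvd cj A B C g $ 2 $ 2 - cj A B C t $ 2 $ 2" unfolding xyz .
  qed
  show ?thesis
    unfolding mult_2
    by (rule bounded_cover[where ?f1.0 = "\<lambda>g. cj A B C g $ 1 $ 2" and ?f2.0 = "\<lambda>g. cj A B C g $ 2 $ 1", OF f(1,2) n n P])
qed

text \<open>As \<open>A\<close> is even, conjugation moves the off-diagonal entries only from level
  \<open>m + v\<close> on: linear terms carry a factor 2 and quadratic ones have level
  \<open>2 * m\<close>. The unit off-diagonal entry and the diagonal coordinate determine the other
  off-diagonal entry through the determinant.\<close>

lemma Par_cover_unit_offdiag: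
  assumes A: "A = 2 * a" and BC: "B dvd 1 \<or> C dvd 1" and n: "m + v \<le> n"
  shows "covers (Par A B C n) ((n - (m + v)) + (n - m))"
proof -
  have f: "\<pi> ^ (m + v) dvd cj A B C g $ 1 $ 2 - B" "\<pi> ^ (m + v) dvd cj A B C g $ 2 $ 1 - C" "\<pi> ^ m dvd cj A B C g $ 2 $ 2 - 0"
    if g: "g \<in> Lev m" for g
  proof -
    note gd = LevD[OF g]
    have "cj A B C g $ 1 $ 2 - B = B * (2 * (g $ 1 $ 1 - 1)) + B * ((g $ 1 $ 1 - 1) * (g $ 1 $ 1 - 1)) -
        C * (g $ 1 $ 2 * g $ 1 $ 2) - g $ 1 $ 1 * a * (2 * g $ 1 $ 2)"
      "cj A B C g $ 2 $ 1 - C = C * (2 * (g $ 2 $ 2 - 1)) + C * ((g $ 2 $ 2 - 1) * (g $ 2 $ 2 - 1)) -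
        B * (g $ 2 $ 1 * g $ 2 $ 1) + g $ 2 $ 2 * a * (2 * g $ 2 $ 1)"
      unfolding cj_entries[OF g] A by (simp_all add: algebra_simps)
    moreover have two: "\<pi> ^ (m + v) dvd 2 * x" if "\<pi> ^ m dvd x" for x using two_mult_dvd that by blast
    have sq: "\<pi> ^ (m + v) dvd x * x" if "\<pi> ^ m dvd x" for x
      using v_less_m by (intro pow_mult_dvd[OF that that]) simp
    have "\<pi> ^ (m + v) dvd B * (2 * (g $ 1 $ 1 - 1)) + B * ((g $ 1 $ 1 - 1) * (g $ 1 $ 1 - 1)) -
        C * (g $ 1 $ 2 * g $ 1 $ 2) - g $ 1 $ 1 * a * (2 * g $ 1 $ 2)"
      "\<pi> ^ (m + v) dvd C * (2 * (g $ 2 $ 2 - 1)) + C * ((g $ 2 $ 2 - 1) * (g $ 2 $ 2 - 1)) -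
        B * (g $ 2 $ 1 * g $ 2 $ 1) + g $ 2 $ 2 * a * (2 * g $ 2 $ 1)"
      by (intro dvd_add dvd_diff[of _ "_ - _"] dvd_diff[of _ "_ + _"] dvd_mult[OF two] dvd_mult[OF sq] gd)+
    ultimately show "\<pi> ^ (m + v) dvd cj A B C g $ 1 $ 2 - B" "\<pi> ^ (m + v) dvd cj A B C g $ 2 $ 1 - C" by (simp_all only:)
    show "\<pi> ^ m dvd cj A B C g $ 2 $ 2 - 0" unfolding cj_entries[OF g] diff_zero by (intro dvd_diff dvd_mult2 gd)
  qed
  have n': "m \<le> n" using n by simp
  have mv: "0 < m + v" using v_less_m by simp
  have unit: "y dvd 1" if "x dvd 1" "\<pi> ^ (m + v) dvd y - x" for x y
  proof -
    have "\<pi> dvd y - x" by (rule pi_dvd[OF that(2) mv])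
    then show ?thesis using that(1) dvd_diff[of \<pi> y "y - x"] unfolding unit_iff by auto
  qed
  have P: "\<pi> ^ n dvd y - y'" if e: "(A - z) * z - x * y = (A - z') * z' - x' * y'" and u: "x' dvd 1"
     and c: "\<pi> ^ n dvd x - x'" "\<pi> ^ n dvd z - z'" for x y x' y' z z'
  proof -
    have "x' * (y - y') = (A - (z + z')) * (z - z') - (x - x') * y - (((A - z) * z - x * y) - ((A - z') * z' - x' * y'))"
      by (simp add: algebra_simps)
    then have "x' * (y - y') = (A - (z + z')) * (z - z') - (x - x') * y" unfolding e by simp
    also have "\<pi> ^ n dvd (A - (z + z')) * (z - z') - (x - x') * y"
      by (rule dvd_diff[OF dvd_mult[OF c(2)] dvd_mult2[OF c(1)]])
    finally show ?thesis by (rule iffD1[OF unit_mult_dvd[OF u]])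
  qed
  have e: "(A - cj A B C g $ 2 $ 2) * cj A B C g $ 2 $ 2 - cj A B C g $ 1 $ 2 * cj A B C g $ 2 $ 1 =
      (A - cj A B C t $ 2 $ 2) * cj A B C t $ 2 $ 2 - cj A B C t $ 1 $ 2 * cj A B C t $ 2 $ 1"
    "(A - cj A B C g $ 2 $ 2) * cj A B C g $ 2 $ 2 - cj A B C g $ 2 $ 1 * cj A B C g $ 1 $ 2 =
      (A - cj A B C t $ 2 $ 2) * cj A B C t $ 2 $ 2 - cj A B C t $ 2 $ 1 * cj A B C t $ 1 $ 2"
    if "g \<in> Lev m" "t \<in> Lev m" for g t
    using cj_entries(5)[OF that(1), of A B C] cj_entries(5)[OF that(2), of A B C] by (simp_all add: mult.commute)
  from BC show ?thesis
  proof
    assume B: "B dvd 1"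
    have "adj22 t ** g \<in> Par A B C n" if "g \<in> Lev m" "t \<in> Lev m" "\<pi> ^ n dvd cj A B C g $ 1 $ 2 - cj A B C t $ 1 $ 2"
      "\<pi> ^ n dvd cj A B C g $ 2 $ 2 - cj A B C t $ 2 $ 2" for g t
      using that P[OF e(1)[OF that(1,2)] unit[OF B f(1)[OF that(2)]] that(3,4)] by (intro cj_cong_Par)
    from bounded_cover[OF f(1,3) n n' this] show ?thesis .
  next
    assume C: "C dvd 1"
    have "adj22 t ** g \<in> Par A B C n" if "g \<in> Lev m" "t \<in> Lev m" "\<pi> ^ n dvd cj A B C g $ 2 $ 1 - cj A B C t $ 2 $ 1"
      "\<pi> ^ n dvd cj A B C g $ 2 $ 2 - cj A B C t $ 2 $ 2" for g t
      using that P[OF e(2)[OF that(1,2)] unit[OF C f(2)[OF that(2)]] that(3,4)] by (intro cj_cong_Par)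
    from bounded_cover[OF f(2,3) n n' this] show ?thesis .
  qed
qed

lemma unit_Lev_22:
  assumes "k \<in> Lev m"
  shows "k $ 2 $ 2 * unit_inv (k $ 2 $ 2) = 1"
proof (rule unit_inv)
  have "\<pi> dvd k $ 2 $ 2 - 1" using v_less_m by (intro pi_dvd[OF LevD(5)[OF assms]]) simp
  from one_plus_unit[OF this] show "k $ 2 $ 2 dvd 1" by simp
qed

section \<open>Characters of deep subgroups\<close>

text \<open>\<open>Ker N\<close> ignores scalars, so matrices proportional modulo
  \<open>\<pi> ^ N\<close> define the same coset; this allows normalizing the lower right entry to
  1.\<close>

lemma Ker_mem_of_scaled_cong:
  assumes A: "A \<in> Lev m" and B: "B \<in> Lev m" and a: "a dvd 1"
    and c: "\<And>i j. \<pi> ^ N dvd a * A $ i $ j - b * B $ i $ j"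
  shows "A ** adj22 B \<in> Ker N"
proof -
  have eq: "a * (A ** adj22 B) $ i $ j = (a * A $ i $ 1 - b * B $ i $ 1) * adj22 B $ 1 $ j +
      (a * A $ i $ 2 - b * B $ i $ 2) * adj22 B $ 2 $ j + b * (B ** adj22 B) $ i $ j" for i j
    by (simp add: algebra_simps)
  have d: "\<pi> ^ N dvd (a * A $ i $ 1 - b * B $ i $ 1) * adj22 B $ 1 $ j + (a * A $ i $ 2 - b * B $ i $ 2) * adj22 B $ 2 $ j" for i j
    by (intro dvd_add dvd_mult2 c)
  have 12: "\<pi> ^ N dvd a * (A ** adj22 B) $ 1 $ 2" "\<pi> ^ N dvd a * (A ** adj22 B) $ 2 $ 1"
    unfolding eq adj_mult(1)[OF B] one22_nth mult_zero_right add_0_right by (rule d)+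
  have "a * ((A ** adj22 B) $ 1 $ 1 - (A ** adj22 B) $ 2 $ 2) =
      ((a * A $ 1 $ 1 - b * B $ 1 $ 1) * adj22 B $ 1 $ 1 + (a * A $ 1 $ 2 - b * B $ 1 $ 2) * adj22 B $ 2 $ 1) -
      ((a * A $ 2 $ 1 - b * B $ 2 $ 1) * adj22 B $ 1 $ 2 + (a * A $ 2 $ 2 - b * B $ 2 $ 2) * adj22 B $ 2 $ 2)"
    unfolding right_diff_distrib[of a] eq adj_mult(1)[OF B] one22_nth by simp
  then have "\<pi> ^ N dvd a * ((A ** adj22 B) $ 1 $ 1 - (A ** adj22 B) $ 2 $ 2)"
    using dvd_diff[OF d d] by (simp only:)
  with 12 show ?thesis
    unfolding Ker_def mem_Collect_eq unit_mult_dvd[OF a] using Lev_mult[OF A Lev_adj[OF B]] by blast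
qed

text \<open>Newton's iteration for the square root of \<open>1 + x\<close>. The correction
  \<open>c\<close> solves the linearized equation, losing \<open>v\<close> levels in the division by
  2; its square has level \<open>2 * (l + i - v)\<close>, which is at least \<open>l + i + 1\<close>
  because \<open>l > 2 * v\<close>.\<close>

lemma approx_sqrt:
  assumes l: "2 * v + 1 \<le> l" and x: "\<pi> ^ l dvd x"
  shows "\<exists>d. \<pi> ^ (l - v) dvd d - 1 \<and> \<pi> ^ (l + i) dvd d * d - 1 - x"
proof (induction i)
  case 0
  show ?case using x by (intro exI[of _ 1]) simp
next
  case (Suc i)
  then obtain d where d: "\<pi> ^ (l - v) dvd d - 1" "\<pi> ^ (l + i) dvd d * d - 1 - x" by blast
  obtain r where r: "d * d - 1 - x = \<pi> ^ (l + i) * r" using d(2) by (rule dvdE)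
  have "\<pi> dvd d - 1" using l by (intro pi_dvd[OF d(1)]) simp
  then have du: "d dvd 1" using one_plus_unit[of "d - 1"] by simp
  define w where "w = unit_inv (\<epsilon> * d)"
  have w: "\<epsilon> * d * w = 1" unfolding w_def by (intro unit_inv unit_mult eps du)
  define c where "c = - (\<pi> ^ (l + i - v) * (r * w))"
  have p: "\<pi> ^ v * \<pi> ^ (l + i - v) = \<pi> ^ (l + i)" using l by (simp add: power_add[symmetric])
  have "2 * d * c = - ((\<epsilon> * d * w) * (\<pi> ^ v * \<pi> ^ (l + i - v)) * r)" unfolding c_def two by (simp add: mult_ac)
  then have dc: "2 * d * c = - (\<pi> ^ (l + i) * r)" unfolding w p by simp
  have "(d + c) * (d + c) - 1 - x = (d * d - 1 - x) + 2 * d * c + c * c" by (simp add: algebra_simps)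
  also have "\<dots> = c * c" unfolding r dc by simp
  finally have e: "(d + c) * (d + c) - 1 - x = c * c" .
  have cd: "\<pi> ^ (l + i - v) dvd c" unfolding c_def by simp
  have "\<pi> ^ (l + Suc i) dvd c * c" using l by (intro pow_mult_dvd[OF cd cd]) simp
  moreover have "\<pi> ^ (l - v) dvd (d - 1) + c" using d(1) pow_le_dvd[OF cd, of "l - v"] by (intro dvd_add) simp_all
  then have "\<pi> ^ (l - v) dvd (d + c) - 1" by (simp add: algebra_simps)
  ultimately show ?case using e by (intro exI[of _ "d + c"]) simp
qed

text \<open>Modulo \<open>Ker N\<close>, an element of \<open>Ker l\<close> is up to a scalar a
  product of a diagonal, an upper and a lower unipotent element. On each of these three families
  \<open>\<psi>\<close> is an additive character. One of the three is nontrivial at level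
  \<open>N - 1\<close> and serves as \<open>\<theta>\<close>, and self-duality expresses the others
  through it. So one coefficient equals 1; division by the lower right entry fixes the
  scalar.\<close>

lemma Ker_character_functional:
  fixes \<psi> :: "'o^2^2 \<Rightarrow> complex"
  assumes l: "m + v \<le> l" "l < N" "N \<le> 2 * l"
    and hom: "\<And>k k'. k \<in> Ker l \<Longrightarrow> k' \<in> Ker l \<Longrightarrow> \<psi> (k ** k') = \<psi> k * \<psi> k'"
    and triv: "\<And>k. k \<in> Ker N \<Longrightarrow> \<psi> k = 1" and z0: "z0 \<in> Ker (N - 1)" "\<psi> z0 \<noteq> 1"
  shows "\<exists>(\<theta> :: 'o \<Rightarrow> complex) \<xi>1 \<xi>2 \<xi>3. (\<forall>x. \<pi> ^ N dvd x \<longrightarrow> \<theta> x = 1) \<and> (\<xi>1 = 1 \<or> \<xi>2 = 1 \<or> \<xi>3 = 1) \<and>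
    (\<forall>k\<in>Ker l. \<psi> k = \<theta> ((\<xi>1 * (k $ 1 $ 1 - k $ 2 $ 2) + \<xi>2 * k $ 1 $ 2 + \<xi>3 * k $ 2 $ 1) * unit_inv (k $ 2 $ 2)))"
proof -
  have ml: "m \<le> l" using l by simp
  have cong: "\<psi> A = \<psi> B" if A: "A \<in> Ker l" and B: "B \<in> Ker l" and a: "a dvd 1"
     and c: "\<And>i j. \<pi> ^ N dvd a * A $ i $ j - b * B $ i $ j" for A B a b
  proof -
    have AB: "A ** adj22 B \<in> Ker N" using Ker_mem_of_scaled_cong[OF KerD(1)[OF A] KerD(1)[OF B] a c] .
    then have "A ** adj22 B \<in> Ker l" using Ker_mono[of l N] l by auto
    moreover have "A = (A ** adj22 B) ** B"
      using adj_mult(2)[OF KerD(1)[OF B]] by (simp add: matrix_mul_assoc[symmetric])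
    ultimately show ?thesis using hom[of "A ** adj22 B" B] triv[OF AB] B by simp
  qed
  define Ue Uf :: "'o \<Rightarrow> 'o^2^2" where "Ue y = mat22 1 y 0 1" and "Uf z = mat22 1 0 z 1" for y z
  have Ue: "Ue y \<in> Ker i" if "\<pi> ^ i dvd y" "m \<le> i" for y i
    using that pow_le_dvd[OF that] by (simp add: Ker_def Lev_def Ue_def)
  have Uf: "Uf y \<in> Ker i" if "\<pi> ^ i dvd y" "m \<le> i" for y i
    using that pow_le_dvd[OF that] by (simp add: Ker_def Lev_def Uf_def)
  have "\<exists>d. \<pi> ^ (l - v) dvd d - 1 \<and> \<pi> ^ N dvd d * d - 1 - x" if "\<pi> ^ l dvd x" for x
    using approx_sqrt[of l x "N - l"] that l v_less_m by simp
  then obtain d where d: "\<And>x. \<pi> ^ l dvd x \<Longrightarrow> \<pi> ^ (l - v) dvd d x - 1"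
      "\<And>x. \<pi> ^ l dvd x \<Longrightarrow> \<pi> ^ N dvd d x * d x - 1 - x" by metis
  have du: "d x dvd 1" if "\<pi> ^ l dvd x" for x
  proof -
    have "\<pi> dvd d x - 1" using l v_less_m by (intro pi_dvd[OF d(1)[OF that]]) simp
    from one_plus_unit[OF this] show ?thesis by simp
  qed
  \<comment> \<open>The parameter is the ratio of the diagonal entries minus 1, which is additive up
    to products; with determinant 1 this ratio is a square, whence the root of
    \<open>1 + x\<close>.\<close>
  define D where "D x = mat22 (d x) 0 0 (unit_inv (d x))" for x
  have di: "d x * unit_inv (d x) = 1" if "\<pi> ^ l dvd x" for x using unit_inv[OF du[OF that]] .
  have D: "D x \<in> Ker i" if x: "\<pi> ^ l dvd x" and xi: "\<pi> ^ i dvd x" "i \<le> N" for x i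
  proof -
    have "d x * (d x - unit_inv (d x)) = (d x * d x - 1 - x) + x"
      using di[OF x] by (simp add: right_diff_distrib)
    also have "\<pi> ^ i dvd \<dots>" using pow_le_dvd[OF d(2)[OF x] xi(2)] xi(1) by (rule dvd_add)
    finally have 1: "\<pi> ^ i dvd d x - unit_inv (d x)" using unit_mult_dvd[OF du[OF x]] by blast
    have 2: "\<pi> ^ m dvd d x - 1" using l by (intro pow_le_dvd[OF d(1)[OF x]]) simp
    have "d x * (unit_inv (d x) - 1) = - (d x - 1)" using di[OF x] by (simp add: right_diff_distrib)
    then have "\<pi> ^ m dvd d x * (unit_inv (d x) - 1)" using 2 by (simp only: dvd_minus_iff)
    then have "\<pi> ^ m dvd unit_inv (d x) - 1" using unit_mult_dvd[OF du[OF x]] by blast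
    then show ?thesis using 1 2 di[OF x] by (simp add: Ker_def Lev_def D_def)
  qed
  have Dl: "D x \<in> Ker l" if "\<pi> ^ l dvd x" for x using D[OF that that] l by simp
  define \<phi>e \<phi>f \<phi>h where "\<phi>e y = \<psi> (Ue y)" and "\<phi>f y = \<psi> (Uf y)" and "\<phi>h y = \<psi> (D y)" for y
  have lN: "\<pi> ^ l dvd x" if "\<pi> ^ N dvd x" for x using pow_le_dvd[OF that] l by simp
  have e: "\<phi>e (x + y) = \<phi>e x * \<phi>e y" if "\<pi> ^ l dvd x" "\<pi> ^ l dvd y" for x y
  proof -
    have "Ue (x + y) = Ue x ** Ue y" by (simp add: mat22_eq_iff Ue_def)
    then show ?thesis unfolding \<phi>e_def using hom[OF Ue[OF that(1) ml] Ue[OF that(2) ml]] by simp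
  qed
  have f: "\<phi>f (x + y) = \<phi>f x * \<phi>f y" if "\<pi> ^ l dvd x" "\<pi> ^ l dvd y" for x y
  proof -
    have "Uf (x + y) = Uf x ** Uf y" by (simp add: mat22_eq_iff Uf_def)
    then show ?thesis unfolding \<phi>f_def using hom[OF Uf[OF that(1) ml] Uf[OF that(2) ml]] by simp
  qed
  have h: "\<phi>h (x + y) = \<phi>h x * \<phi>h y" if x: "\<pi> ^ l dvd x" and y: "\<pi> ^ l dvd y" for x y
  proof -
    have xy: "\<pi> ^ l dvd x + y" using x y by (rule dvd_add)
    have "\<psi> (D (x + y)) = \<psi> (D x ** D y)"
    proof (rule cong[OF Dl[OF xy] _ du[OF xy]])
      show "D x ** D y \<in> Ker l" using subgroup.m_closed[OF Ker_subgroup Dl[OF x] Dl[OF y]] by simp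
      \<comment> \<open>The product of \<open>1 + x\<close> and \<open>1 + y\<close> differs from
        \<open>1 + x + y\<close> by \<open>x * y\<close>, of level \<open>2 * l\<close>, at least
        \<open>N\<close>.\<close>
      have eq: "d (x + y) * d (x + y) - (d x * d y) * (d x * d y) =
         (d (x + y) * d (x + y) - 1 - (x + y)) - (d x * d x - 1 - x) * (d y * d y) - (1 + x) * (d y * d y - 1 - y) - x * y"
        by (simp add: algebra_simps)
      have "\<pi> ^ N dvd x * y" using l by (intro pow_mult_dvd[OF x y]) simp
      then have "\<pi> ^ N dvd d (x + y) * d (x + y) - (d x * d y) * (d x * d y)"
        unfolding eq by (intro dvd_diff[of _ "_ - _ - _"] dvd_diff[of _ "_ - _" "(1 + x) * _"] dvd_diff[OF d(2)[OF xy]]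
            dvd_mult2[OF d(2)[OF x]] dvd_mult[OF d(2)[OF y]])
      moreover have "d (x + y) * unit_inv (d (x + y)) - (d x * d y) * (unit_inv (d x) * unit_inv (d y)) = 0"
        using di[OF x] di[OF y] di[OF xy] by (simp add: mult.assoc mult.left_commute[of "d y"])
      ultimately have "\<forall>i j. \<pi> ^ N dvd d (x + y) * D (x + y) $ i $ j - d x * d y * (D x ** D y) $ i $ j"
        unfolding forall_2 by (simp add: D_def)
      then show "\<pi> ^ N dvd d (x + y) * D (x + y) $ i $ j - d x * d y * (D x ** D y) $ i $ j" for i j by blast
    qed
    then show ?thesis unfolding \<phi>h_def using hom[OF Dl[OF x] Dl[OF y]] by simp
  qed
  have t: "\<phi>e x = 1" "\<phi>f x = 1" "\<phi>h x = 1" if "\<pi> ^ N dvd x" for x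
    unfolding \<phi>e_def \<phi>f_def \<phi>h_def using that ml l by (intro triv Ue Uf D[OF lN[OF that] that]; simp)+
  have \<psi>: "\<psi> k = \<phi>h ((k $ 1 $ 1 - k $ 2 $ 2) * unit_inv (k $ 2 $ 2)) * \<phi>e (k $ 1 $ 2 * unit_inv (k $ 2 $ 2)) *
      \<phi>f (k $ 2 $ 1 * unit_inv (k $ 2 $ 2))" if k: "k \<in> Ker l" for k
  proof -
    note kd = KerD[OF k]
    define u where "u = unit_inv (k $ 2 $ 2)"
    have u: "k $ 2 $ 2 * u = 1" unfolding u_def by (rule unit_Lev_22[OF kd(1)])
    have uu: "u dvd 1" using u by (metis dvd_triv_right)
    define x y z where "x = (k $ 1 $ 1 - k $ 2 $ 2) * u" and "y = k $ 1 $ 2 * u" and "z = k $ 2 $ 1 * u"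
    have xyz: "\<pi> ^ l dvd x" "\<pi> ^ l dvd y" "\<pi> ^ l dvd z" unfolding x_def y_def z_def by (intro dvd_mult2 kd)+
    have DU: "D x ** Ue y \<in> Ker l" using subgroup.m_closed[OF Ker_subgroup Dl[OF xyz(1)] Ue[OF xyz(2) ml]] by simp
    have "\<psi> k = \<psi> (D x ** Ue y ** Uf z)"
    proof (rule cong[OF k _ uu])
      show "D x ** Ue y ** Uf z \<in> Ker l"
        using subgroup.m_closed[OF Ker_subgroup DU Uf[OF xyz(3) ml]] by simp
      have p: "\<pi> ^ N dvd a * b" if "\<pi> ^ l dvd a" "\<pi> ^ l dvd b" for a b using l by (intro pow_mult_dvd[OF that]) simp
      \<comment> \<open>Scaled to lower right entry 1, the two matrices agree up to products of two
        entries of level \<open>l\<close> and the error of the approximate root.\<close>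
      have 11: "u * k $ 1 $ 1 - d x * (d x * (1 + y * z)) = - ((d x * d x - 1 - x) * (1 + y * z)) - (1 + x) * (y * z)"
        using u by (simp add: x_def algebra_simps)
      have 12: "u * k $ 1 $ 2 - d x * (d x * y) = - ((d x * d x - 1 - x) * y) - x * y"
        by (simp add: y_def algebra_simps)
      have 21: "u * k $ 2 $ 1 - d x * (unit_inv (d x) * z) = 0" "u * k $ 2 $ 2 - d x * unit_inv (d x) = 0"
      proof -
        have "d x * (unit_inv (d x) * z) = z" by (simp only: mult.assoc[symmetric] di[OF xyz(1)] mult_1_left)
        then show "u * k $ 2 $ 1 - d x * (unit_inv (d x) * z) = 0" by (simp add: z_def mult.commute)
        show "u * k $ 2 $ 2 - d x * unit_inv (d x) = 0" using u unfolding di[OF xyz(1)] by (simp add: mult.commute)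
      qed
      have "\<pi> ^ N dvd - ((d x * d x - 1 - x) * (1 + y * z)) - (1 + x) * (y * z)"
        by (intro dvd_diff[of _ "- _"] iffD2[OF dvd_minus_iff] dvd_mult2[OF d(2)[OF xyz(1)]] dvd_mult[OF p[OF xyz(2,3)]])
      then have "\<pi> ^ N dvd u * k $ 1 $ 1 - d x * (d x * (1 + y * z))" unfolding 11 .
      moreover have "\<pi> ^ N dvd - ((d x * d x - 1 - x) * y) - x * y"
        by (intro dvd_diff[of _ "- _"] iffD2[OF dvd_minus_iff] dvd_mult2[OF d(2)[OF xyz(1)]] p[OF xyz(1,2)])
      then have "\<pi> ^ N dvd u * k $ 1 $ 2 - d x * (d x * y)" unfolding 12 .
      moreover have "D x ** Ue y ** Uf z = mat22 (d x * (1 + y * z)) (d x * y) (unit_inv (d x) * z) (unit_inv (d x))"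
        by (simp add: mat22_eq_iff D_def Ue_def Uf_def algebra_simps)
      ultimately have "\<forall>i j. \<pi> ^ N dvd u * k $ i $ j - d x * (D x ** Ue y ** Uf z) $ i $ j"
        unfolding forall_2 using 21 by simp
      then show "\<pi> ^ N dvd u * k $ i $ j - d x * (D x ** Ue y ** Uf z) $ i $ j" for i j by blast
    qed
    also have "\<dots> = \<phi>h x * \<phi>e y * \<phi>f z"
      unfolding hom[OF DU Uf[OF xyz(3) ml]] hom[OF Dl[OF xyz(1)] Ue[OF xyz(2) ml]] \<phi>e_def \<phi>f_def \<phi>h_def ..
    finally show ?thesis unfolding x_def y_def z_def u_def .
  qed
  have comb: ?thesis if \<theta>: "\<theta> \<in> {\<phi>e, \<phi>f, \<phi>h}" and x1: "\<pi> ^ (N - 1) dvd x1" "\<theta> x1 \<noteq> 1" for \<theta> x1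
  proof -
    have \<theta>1: "\<theta> (x + y) = \<theta> x * \<theta> y" if "\<pi> ^ l dvd x" "\<pi> ^ l dvd y" for x y using \<theta> e[OF that] f[OF that] h[OF that] by auto
    have \<theta>2: "\<theta> x = 1" if "\<pi> ^ N dvd x" for x using \<theta> t[OF that] by auto
    obtain a where a: "\<And>x. \<pi> ^ l dvd x \<Longrightarrow> \<phi>h x = \<theta> (a * x)"
      using character_duality[OF \<theta>1 \<theta>2 h t(3) l(2) x1] by blast
    obtain b where b: "\<And>x. \<pi> ^ l dvd x \<Longrightarrow> \<phi>e x = \<theta> (b * x)"
      using character_duality[OF \<theta>1 \<theta>2 e t(1) l(2) x1] by blast
    obtain c where c: "\<And>x. \<pi> ^ l dvd x \<Longrightarrow> \<phi>f x = \<theta> (c * x)"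
      using character_duality[OF \<theta>1 \<theta>2 f t(2) l(2) x1] by blast
    define \<xi>1 \<xi>2 \<xi>3 where "\<xi>1 = (if \<theta> = \<phi>h then 1 else a)" and "\<xi>2 = (if \<theta> = \<phi>e then 1 else b)"
      and "\<xi>3 = (if \<theta> = \<phi>f then 1 else c)"
    have \<xi>: "\<phi>h x = \<theta> (\<xi>1 * x)" "\<phi>e x = \<theta> (\<xi>2 * x)" "\<phi>f x = \<theta> (\<xi>3 * x)" if "\<pi> ^ l dvd x" for x
      using a[OF that] b[OF that] c[OF that] by (simp_all add: \<xi>1_def \<xi>2_def \<xi>3_def)
    have one: "\<xi>1 = 1 \<or> \<xi>2 = 1 \<or> \<xi>3 = 1" using \<theta> by (auto simp: \<xi>1_def \<xi>2_def \<xi>3_def)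
    show ?thesis
    proof (rule exI[of _ \<theta>], rule exI[of _ \<xi>1], rule exI[of _ \<xi>2], rule exI[of _ \<xi>3], intro conjI allI impI ballI)
      show "\<theta> x = 1" if "\<pi> ^ N dvd x" for x using \<theta>2[OF that] .
      show "\<xi>1 = 1 \<or> \<xi>2 = 1 \<or> \<xi>3 = 1" by (rule one)
      fix k assume k: "k \<in> Ker l"
      note kd = KerD[OF k]
      define u where "u = unit_inv (k $ 2 $ 2)"
      have x: "\<pi> ^ l dvd (k $ 1 $ 1 - k $ 2 $ 2) * u" "\<pi> ^ l dvd k $ 1 $ 2 * u" "\<pi> ^ l dvd k $ 2 $ 1 * u"
        by (intro dvd_mult2 kd)+
      have "\<psi> k = \<theta> (\<xi>1 * ((k $ 1 $ 1 - k $ 2 $ 2) * u)) * \<theta> (\<xi>2 * (k $ 1 $ 2 * u)) * \<theta> (\<xi>3 * (k $ 2 $ 1 * u))"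
        unfolding \<psi>[OF k, folded u_def] \<xi>[OF x(1)] \<xi>[OF x(2)] \<xi>[OF x(3)] ..
      also have "\<dots> = \<theta> (\<xi>1 * ((k $ 1 $ 1 - k $ 2 $ 2) * u) + \<xi>2 * (k $ 1 $ 2 * u) + \<xi>3 * (k $ 2 $ 1 * u))"
        using x by (simp only: \<theta>1 dvd_add dvd_mult)
      also have "\<dots> = \<theta> ((\<xi>1 * (k $ 1 $ 1 - k $ 2 $ 2) + \<xi>2 * k $ 1 $ 2 + \<xi>3 * k $ 2 $ 1) * u)"
        by (simp only: distrib_right mult.assoc)
      finally show "\<psi> k = \<theta> ((\<xi>1 * (k $ 1 $ 1 - k $ 2 $ 2) + \<xi>2 * k $ 1 $ 2 + \<xi>3 * k $ 2 $ 1) * unit_inv (k $ 2 $ 2))"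
        unfolding u_def .
    qed
  qed
  have "l \<le> N - 1" using l by linarith
  then have "z0 \<in> Ker l" using z0(1) Ker_mono by blast
  from \<psi>[OF this] z0(2) have "\<phi>h ((z0 $ 1 $ 1 - z0 $ 2 $ 2) * unit_inv (z0 $ 2 $ 2)) \<noteq> 1 \<or>
     \<phi>e (z0 $ 1 $ 2 * unit_inv (z0 $ 2 $ 2)) \<noteq> 1 \<or> \<phi>f (z0 $ 2 $ 1 * unit_inv (z0 $ 2 $ 2)) \<noteq> 1" by auto
  then show ?thesis using comb dvd_mult2[OF KerD(2)[OF z0(1)]] dvd_mult2[OF KerD(3)[OF z0(1)]] dvd_mult2[OF KerD(4)[OF z0(1)]]
    by blast
qed

text \<open>\<open>Ker l2\<close> is abelian modulo \<open>Ker N\<close>, so it has an eigenvector,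
  whose character is given by a matrix. If \<open>\<pi> ^ j\<close> is removed from that matrix, its
  centralizers at the levels \<open>l1 - j\<close> and \<open>l2\<close> serve as \<open>P1\<close>
  and \<open>P2\<close>: the functional takes their commutators to level
  \<open>(l1 - j) + l2 + j = N\<close>.\<close>

lemma dim_upper_bound:
  assumes \<rho>: "fin_quot_group.irred G (Ker N) n \<rho>" and v: "v \<le> 1" and k: "0 < k" and N: "N = 2 * m + v + k"
    and z0: "z0 \<in> Ker (N - 1)" "\<rho> z0 \<noteq> 1\<^sub>m n"
  shows "n\<^sup>2 \<le> q ^ (2 * k)"
proof -
  define l1 l2 where "l1 = N div 2" and "l2 = N - l1"
  have l: "m + v \<le> l1" "l1 \<le> l2" "l2 \<le> l1 + 1" "N = l1 + l2" "N \<le> 2 * l2" "l2 < N" "m + v \<le> l2"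
    using v k v_less_m unfolding l1_def l2_def N by (auto simp: le_Suc_eq)
  have Q: "fin_quot_group G (Ker N)" using N by (intro fin_quot_group_Ker) simp
  interpret Q: fin_quot_group G "Ker N" by (rule Q)
  note kr = Q.irredD(1)[OF \<rho>]
  note r = Q.krepD[OF kr]
  have Kc: "Ker i \<subseteq> carrier G" for i by (auto simp: Ker_def)
  have fin: "finite (\<rho> ` Ker l2)" using finite_subset[OF image_mono[OF Kc] Q.finite_rep_image[OF kr]] .
  have lc: "lin_closed n (carrier_vec n :: complex Matrix.vec set)" by (auto simp: lin_closed_def)
  have n: "0 < n" using Q.irredD(2)[OF \<rho>] .
  have "unit_vec n 0 \<noteq> (0\<^sub>v n :: complex Matrix.vec)"
  proof
    assume "unit_vec n 0 = (0\<^sub>v n :: complex Matrix.vec)"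
    then have "unit_vec n 0 $v 0 = (0\<^sub>v n :: complex Matrix.vec) $v 0" by simp
    then show False using n by simp
  qed
  then have "(carrier_vec n :: complex Matrix.vec set) \<noteq> {0\<^sub>v n}" using unit_vec_carrier[of n 0] by (metis singletonD)
  have "\<exists>v\<in>carrier_vec n. v \<noteq> 0\<^sub>v n \<and> (\<forall>A\<in>\<rho> ` Ker l2. \<exists>c. A *\<^sub>v v = c \<cdot>\<^sub>v v)"
  proof (rule common_eigenvector[OF fin lc])
    show "(carrier_vec n :: complex Matrix.vec set) \<noteq> {0\<^sub>v n}" by fact
    show A: "A \<in> carrier_mat n n" if AK: "A \<in> \<rho> ` Ker l2" for A
    proof -
      obtain x where x: "A = \<rho> x" "x \<in> Ker l2" using AK by (rule imageE)
      show ?thesis unfolding x by (rule r(1)[OF subsetD[OF Kc x(2)]])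
    qed
    show "A *\<^sub>v w \<in> carrier_vec n" if "A \<in> \<rho> ` Ker l2" "w \<in> carrier_vec n" for A w
      by (rule mult_mat_vec_carrier[OF A[OF that(1)] that(2)])
    show "A *\<^sub>v (B *\<^sub>v w) = B *\<^sub>v (A *\<^sub>v w)" if A: "A \<in> \<rho> ` Ker l2" and B: "B \<in> \<rho> ` Ker l2" and w: "w \<in> carrier_vec n" for A B w
    proof -
      obtain a where a: "A = \<rho> a" "a \<in> Ker l2" using A by (rule imageE)
      obtain b where b: "B = \<rho> b" "b \<in> Ker l2" using B by (rule imageE)
      have am: "a \<in> Lev m" "b \<in> Lev m" using a b KerD(1) by blast+
      have "comm a b \<in> Lev N" using comm_in_Lev_sum[OF a(2) b(2)] Lev_mono[of N "l2 + l2"] l by auto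
      then have "comm a b \<in> Ker N" using Lev_in_Ker N by simp
      then have "\<rho> (comm a b) = 1\<^sub>m n" by (rule r(3))
      from rep_commute[OF kr Q am this] have AB: "A * B = B * A" unfolding a b .
      have c: "A \<in> carrier_mat n n" "B \<in> carrier_mat n n" unfolding a b using r(1) am by simp_all
      show ?thesis using assoc_mult_mat_vec[OF c w] assoc_mult_mat_vec[OF c(2,1) w] AB by simp
    qed
  qed
  then obtain v0 where v0: "v0 \<in> carrier_vec n" "v0 \<noteq> 0\<^sub>v n" "\<forall>z\<in>Ker l2. \<exists>c. \<rho> z *\<^sub>v v0 = c \<cdot>\<^sub>v v0" by blast
  then obtain \<psi> where \<psi>: "\<And>z. z \<in> Ker l2 \<Longrightarrow> \<rho> z *\<^sub>v v0 = \<psi> z \<cdot>\<^sub>v v0" by metis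
  obtain i where i: "i < n" "v0 $v i \<noteq> 0"
  proof (rule ccontr)
    assume no: "\<not> thesis"
    have "v0 = 0\<^sub>v n" using no that v0(1) by (intro eq_vecI) auto
    then show False using v0(2) by simp
  qed
  have inj: "c = c'" if "c \<cdot>\<^sub>v v0 = c' \<cdot>\<^sub>v v0" for c c'
  proof -
    have "(c \<cdot>\<^sub>v v0) $v i = (c' \<cdot>\<^sub>v v0) $v i" using that by simp
    then show ?thesis using i v0(1) by simp
  qed
  have hom: "\<psi> (a ** b) = \<psi> a * \<psi> b" if a: "a \<in> Ker l2" and b: "b \<in> Ker l2" for a b
  proof -
    have ab: "a ** b \<in> Ker l2" using subgroup.m_closed[OF Ker_subgroup a b] by simp
    have c: "a \<in> carrier G" "b \<in> carrier G" using a b KerD(1) by auto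
    have "\<rho> (a ** b) *\<^sub>v v0 = \<rho> a *\<^sub>v (\<rho> b *\<^sub>v v0)" using Q.rep_mult_vec[OF kr c v0(1)] by simp
    also have "\<dots> = \<psi> b \<cdot>\<^sub>v (\<psi> a \<cdot>\<^sub>v v0)" unfolding \<psi>[OF b] mult_mat_vec[OF r(1)[OF c(1)] v0(1)] \<psi>[OF a] ..
    finally show ?thesis unfolding \<psi>[OF ab] smult_smult_assoc by (metis inj mult.commute)
  qed
  have one: "\<psi> z = 1" if "z \<in> Ker l2" "\<rho> z = 1\<^sub>m n" for z
    using \<psi>[OF that(1)] unfolding that(2) using v0(1) inj[of "\<psi> z" 1] by (simp add: one_smult_vec)
  have triv: "\<psi> z = 1" if "z \<in> Ker N" for z
    using one[OF _ r(3)[OF that]] Ker_mono[of l2 N] l that by auto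
  have \<psi>z0: "\<psi> z0 \<noteq> 1"
  proof
    assume \<psi>1: "\<psi> z0 = 1"
    have mN: "m + v \<le> N" using N by simp
    obtain c where c: "\<rho> z0 = c \<cdot>\<^sub>m 1\<^sub>m n" by (rule rep_Ker_scalar[OF \<rho> mN z0(1)])
    have "l2 \<le> N - 1" using l by linarith
    then have zl: "z0 \<in> Ker l2" using z0(1) Ker_mono by blast
    have "(c \<cdot>\<^sub>m 1\<^sub>m n) *\<^sub>v v0 = c \<cdot>\<^sub>v v0"
    proof (intro eq_vecI)
      fix i assume "i < dim_vec (c \<cdot>\<^sub>v v0)"
      then have i: "i < n" using v0(1) by simp
      have "row (c \<cdot>\<^sub>m 1\<^sub>m n) i = c \<cdot>\<^sub>v unit_vec n i" using i by (intro eq_vecI) (auto simp: unit_vec_def)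
      then show "((c \<cdot>\<^sub>m 1\<^sub>m n) *\<^sub>v v0) $v i = (c \<cdot>\<^sub>v v0) $v i"
        using i v0(1) scalar_prod_left_unit[OF v0(1) i] smult_scalar_prod_distrib[OF unit_vec_carrier v0(1), of c i] by simp
    qed (use v0(1) in simp)
    then have "c \<cdot>\<^sub>v v0 = 1 \<cdot>\<^sub>v v0" using \<psi>[OF zl] unfolding \<psi>1 c by simp
    then have "c = 1" by (rule inj)
    moreover have "1 \<cdot>\<^sub>m 1\<^sub>m n = (1\<^sub>m n :: complex mat)" by (intro eq_matI) auto
    ultimately show False using c z0(2) by simp
  qed
  obtain \<theta> :: "'o \<Rightarrow> complex" and \<xi>1 \<xi>2 \<xi>3 where \<theta>: "\<And>x. \<pi> ^ N dvd x \<Longrightarrow> \<theta> x = 1" and \<xi>: "\<xi>1 = 1 \<or> \<xi>2 = 1 \<or> \<xi>3 = 1"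
    and F: "\<And>k. k \<in> Ker l2 \<Longrightarrow> \<psi> k = \<theta> ((\<xi>1 * (k $ 1 $ 1 - k $ 2 $ 2) + \<xi>2 * k $ 1 $ 2 + \<xi>3 * k $ 2 $ 1) * unit_inv (k $ 2 $ 2))"
    using Ker_character_functional[OF l(7,6,5) hom triv z0(1) \<psi>z0] by metis
  have main: "n\<^sup>2 \<le> q ^ (2 * k)"
    if X: "2 * \<xi>1 = \<pi> ^ j * A" "\<xi>3 = \<pi> ^ j * B" "\<xi>2 = \<pi> ^ j * C" and unit: "A dvd 1 \<or> B dvd 1 \<or> C dvd 1"
      and j: "j \<le> v" and cov: "covers (Par A B C (l1 - j)) c1" "covers (Par A B C l2) c2" and c: "c1 + c2 = 2 * k"
    for j A B C c1 c2
  proof -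
    from cov obtain T1 T2 where T: "finite T1" "T1 \<subseteq> Lev m" "card T1 \<le> q ^ c1" "\<And>g. g \<in> Lev m \<Longrightarrow> \<exists>t\<in>T1. \<exists>p\<in>Par A B C (l1 - j). g = t ** p"
      "finite T2" "T2 \<subseteq> Lev m" "card T2 \<le> q ^ c2" "\<And>g. g \<in> Lev m \<Longrightarrow> \<exists>t\<in>T2. \<exists>p\<in>Par A B C l2. g = t ** p"
      unfolding covers_def by metis
    have "n\<^sup>2 \<le> card T1 * card T2"
    proof (rule Q.dim_upper_bound_central_pair[OF \<rho> Par_subgroup Par_subgroup Ker_sub_Par Par_mono v0(1,2) \<psi>])
      show "l1 - j \<le> l2" using l by simp
      fix g h assume g: "g \<in> Par A B C (l1 - j)" and h: "h \<in> Par A B C l2"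
      have gh: "g \<otimes>\<^bsub>G\<^esub> h \<otimes>\<^bsub>G\<^esub> inv\<^bsub>G\<^esub> g \<otimes>\<^bsub>G\<^esub> inv\<^bsub>G\<^esub> h = comm g h"
        using ParD(1)[OF g] ParD(1)[OF h] by (simp add: comm_def)
      have num: "N = (l1 - j) + l2 + j" "l1 - j \<le> l2" "m \<le> l2" "l2 \<le> (l1 - j) + m" "l2 + j \<le> (l1 - j) + 2 * m"
        using l j v_less_m by linarith+
      note fc = functional_comm_dvd[OF g h unit X num]
      have K: "comm g h \<in> Ker l2"
        unfolding Ker_def using comm_Lev[OF ParD(1)[OF g] ParD(1)[OF h]] pow_le_dvd[OF fc(2) num(4)]
          pow_le_dvd[OF fc(3) num(4)] pow_le_dvd[OF fc(4) num(4)] by simp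
      moreover have "\<psi> (comm g h) = 1" unfolding F[OF K] by (intro \<theta> dvd_mult2 fc(1))
      ultimately show "g \<otimes>\<^bsub>G\<^esub> h \<otimes>\<^bsub>G\<^esub> inv\<^bsub>G\<^esub> g \<otimes>\<^bsub>G\<^esub> inv\<^bsub>G\<^esub> h \<in> Ker l2 \<and>
        \<psi> (g \<otimes>\<^bsub>G\<^esub> h \<otimes>\<^bsub>G\<^esub> inv\<^bsub>G\<^esub> g \<otimes>\<^bsub>G\<^esub> inv\<^bsub>G\<^esub> h) = 1" unfolding gh by blast
    qed (use T in auto)
    also have "\<dots> \<le> q ^ c1 * q ^ c2" using T by (intro mult_le_mono)
    also have "\<dots> = q ^ (2 * k)" unfolding power_add[symmetric] c ..
    finally show ?thesis .
  qed
  \<comment> \<open>If an off-diagonal coefficient is a unit, nothing is removed and each cover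
    saves \<open>v\<close> digits. Otherwise \<open>\<xi>1 = 1\<close>, and removing
    \<open>\<pi> ^ v\<close> leaves the unit \<open>\<epsilon>\<close> on the diagonal; the saving
    then lies in the smaller level \<open>l1 - v\<close>. Either way the exponents add up to
    \<open>2 * k\<close>.\<close>
  show ?thesis
  proof (cases "\<xi>2 dvd 1 \<or> \<xi>3 dvd 1")
    case True
    then have BC: "\<xi>3 dvd 1 \<or> \<xi>2 dvd 1" by blast
    show ?thesis
    proof (rule main[of 0 "2 * \<xi>1" \<xi>3 \<xi>2])
      show "covers (Par (2 * \<xi>1) \<xi>3 \<xi>2 (l1 - 0)) ((l1 - (m + v)) + (l1 - m))"
        "covers (Par (2 * \<xi>1) \<xi>3 \<xi>2 l2) ((l2 - (m + v)) + (l2 - m))"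
        using Par_cover_unit_offdiag[OF refl BC] l by simp_all
      show "l1 - (m + v) + (l1 - m) + (l2 - (m + v) + (l2 - m)) = 2 * k" using l N by linarith
    qed (use BC in auto)
  next
    case False
    then have \<xi>1: "\<xi>1 = 1" and nu: "\<pi> dvd \<xi>2" "\<pi> dvd \<xi>3" using \<xi> unit_iff by auto
    \<comment> \<open>Here \<open>v \<le> 1\<close> turns divisibility by \<open>\<pi>\<close> into
      divisibility by \<open>\<pi> ^ v\<close>.\<close>
    have "\<pi> ^ v dvd \<xi>" if "\<pi> dvd \<xi>" for \<xi> using v that by (cases v) auto
    then obtain B C where BC: "\<xi>3 = \<pi> ^ v * B" "\<xi>2 = \<pi> ^ v * C" using nu unfolding dvd_def by metis
    show ?thesis
    proof (rule main[OF _ BC])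
      show "2 * \<xi>1 = \<pi> ^ v * \<epsilon>" using two \<xi>1 by (simp add: mult.commute)
      show "covers (Par \<epsilon> B C (l1 - v)) (2 * (l1 - v - m))" "covers (Par \<epsilon> B C l2) (2 * (l2 - m))"
        using l by (intro Par_cover_unit_diag[OF eps]; linarith)+
      show "2 * (l1 - v - m) + 2 * (l2 - m) = 2 * k" using l N by linarith
    qed (use eps in auto)
  qed
qed

section \<open>Counting irreducible representations\<close>

text \<open>Levels are counted from \<open>2 * m + v\<close>, where the image is abelian; with this
  offset a representation that first occurs at level \<open>k\<close> has dimension
  \<open>q ^ k\<close>.\<close>

definition level_irreps :: "nat \<Rightarrow> nat \<Rightarrow> ('o^2^2 \<Rightarrow> complex mat) set" where
  "level_irreps k n = {\<rho>. fin_quot_group.irred G (Ker (2 * m + v + k)) n \<rho>}"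

definition smooth_irreps :: "nat \<Rightarrow> ('o^2^2 \<Rightarrow> complex mat) set" where
  "smooth_irreps n = (\<Union>k. level_irreps k n)"

definition smooth_iso :: "nat \<Rightarrow> (('o^2^2 \<Rightarrow> complex mat) \<times> ('o^2^2 \<Rightarrow> complex mat)) set" where
  "smooth_iso n = {(\<rho>, \<sigma>). \<rho> \<in> smooth_irreps n \<and> \<sigma> \<in> smooth_irreps n \<and> rep_iso G n \<rho> \<sigma>}"

definition smooth_classes :: "nat \<Rightarrow> ('o^2^2 \<Rightarrow> complex mat) set set" where
  "smooth_classes n = smooth_irreps n // smooth_iso n"

text \<open>The dimension is kept beside the class so that one finite sum ranges over all
  dimensions.\<close>

definition level_classes :: "nat \<Rightarrow> (nat \<times> ('o^2^2 \<Rightarrow> complex mat) set) set" where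
  "level_classes k = (SIGMA n:UNIV. level_irreps k n // smooth_iso n)"

lemma quot_level: "fin_quot_group G (Ker (2 * m + v + k))"
  by (rule fin_quot_group_Ker) simp

lemma level_irreps_iff:
  "\<rho> \<in> level_irreps k n \<longleftrightarrow> (\<forall>g\<in>Lev m. \<rho> g \<in> carrier_mat n n) \<and>
     (\<forall>g\<in>Lev m. \<forall>h\<in>Lev m. \<rho> (g ** h) = \<rho> g * \<rho> h) \<and> (\<forall>g\<in>Ker (2 * m + v + k). \<rho> g = 1\<^sub>m n) \<and> irreducible_rep G n \<rho>"
  unfolding level_irreps_def fin_quot_group.irred_def[OF quot_level] fin_quot_group.krep_def[OF quot_level] by auto

lemma level_irreps_mono: "i \<le> j \<Longrightarrow> level_irreps i n \<subseteq> level_irreps j n"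
proof
  fix \<rho> assume ij: "i \<le> j" and "\<rho> \<in> level_irreps i n"
  moreover have "Ker (2 * m + v + j) \<subseteq> Ker (2 * m + v + i)" using ij by (intro Ker_mono) simp
  ultimately show "\<rho> \<in> level_irreps j n" unfolding level_irreps_iff by blast
qed

lemma level_irreps_iso:
  assumes \<rho>: "\<rho> \<in> level_irreps k n" and \<sigma>: "\<sigma> \<in> smooth_irreps n" and iso: "rep_iso G n \<rho> \<sigma>"
  shows "\<sigma> \<in> level_irreps k n"
proof -
  obtain k' where k': "\<sigma> \<in> level_irreps k' n" using \<sigma> unfolding smooth_irreps_def by blast
  obtain P where P: "P \<in> carrier_mat n n" "invertible_mat P" "\<And>g. g \<in> Lev m \<Longrightarrow> P * \<rho> g = \<sigma> g * P"
    using iso unfolding rep_iso_def by auto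
  obtain Q where Q: "Q \<in> carrier_mat n n" "P * Q = 1\<^sub>m n"
    using fin_quot_group.invertible_matE[OF quot_level P(1,2)] by blast
  have "\<sigma> g = 1\<^sub>m n" if g: "g \<in> Ker (2 * m + v + k)" for g
  proof -
    have gm: "g \<in> Lev m" using KerD(1)[OF g] .
    have c: "\<sigma> g \<in> carrier_mat n n" using k' gm unfolding level_irreps_iff by blast
    have "\<rho> g = 1\<^sub>m n" using \<rho> g unfolding level_irreps_iff by blast
    then have "P = \<sigma> g * P" using P(3)[OF gm] P(1) by simp
    then have "P * Q = \<sigma> g * (P * Q)" using assoc_mult_mat[OF c P(1) Q(1)] by simp
    then show ?thesis using c unfolding Q(2) by simp
  qed
  then show ?thesis using k' unfolding level_irreps_iff by blast
qed

text \<open>Isomorphism preserves triviality on a subgroup, so a class is the same set at every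
  level at which it occurs.\<close>

lemma smooth_class_level:
  assumes \<rho>: "\<rho> \<in> level_irreps k n"
  shows "smooth_iso n `` {\<rho>} = fin_quot_group.iso_rel G (Ker (2 * m + v + k)) n `` {\<rho>}"
proof -
  have "\<sigma> \<in> smooth_irreps n \<and> rep_iso G n \<rho> \<sigma> \<longleftrightarrow> \<sigma> \<in> level_irreps k n \<and> rep_iso G n \<rho> \<sigma>" for \<sigma>
    using level_irreps_iso[OF \<rho>, of \<sigma>] unfolding smooth_irreps_def by blast
  moreover have "\<rho> \<in> smooth_irreps n" using \<rho> unfolding smooth_irreps_def by blast
  ultimately show ?thesis
    using \<rho> unfolding smooth_iso_def fin_quot_group.iso_rel_def[OF quot_level] level_irreps_def by auto
qed

lemma level_classes_eq:
  "level_classes k = (SIGMA n:UNIV. fin_quot_group.iso_classes G (Ker (2 * m + v + k)) n)"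
proof -
  have "level_irreps k n // smooth_iso n = fin_quot_group.iso_classes G (Ker (2 * m + v + k)) n" for n
    unfolding fin_quot_group.iso_classes_def[OF quot_level] quotient_def
    using smooth_class_level[of _ k n] unfolding level_irreps_def by (intro SUP_cong) auto
  then show ?thesis unfolding level_classes_def by simp
qed

lemma finite_level_classes: "finite (level_classes k)"
  unfolding level_classes_eq by (rule fin_quot_group.finite_all_classes[OF quot_level])

lemma level_classes_sum_squares: "(\<Sum>(n, C)\<in>level_classes k. n\<^sup>2) = q ^ (3 * m + 2 * v + 3 * k)"
proof -
  have e: "3 * (2 * m + v + k - m) - v = 3 * m + 2 * v + 3 * k" by simp
  have "card (rcosets\<^bsub>G\<^esub> Ker (2 * m + v + k)) = q ^ (3 * (2 * m + v + k - m) - v)"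
    using card_Ker_cosets(2)[of "2 * m + v + k"] by simp
  then show ?thesis unfolding e level_classes_eq fin_quot_group.class_sum_squares[OF quot_level] .
qed

lemma smooth_iso_refl:
  assumes "\<rho> \<in> smooth_irreps n"
  shows "(\<rho>, \<rho>) \<in> smooth_iso n"
proof -
  obtain k where "\<rho> \<in> level_irreps k n" using assms unfolding smooth_irreps_def by blast
  then have "rep_iso G n \<rho> \<rho>"
    unfolding level_irreps_def
    using fin_quot_group.rep_iso_refl[OF quot_level] fin_quot_group.irredD(1)[OF quot_level] by blast
  then show ?thesis using assms unfolding smooth_iso_def by blast
qed

lemma level_class_iff:
  assumes \<rho>: "\<rho> \<in> smooth_irreps n"
  shows "(n, smooth_iso n `` {\<rho>}) \<in> level_classes k \<longleftrightarrow> \<rho> \<in> level_irreps k n"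
proof
  assume "(n, smooth_iso n `` {\<rho>}) \<in> level_classes k"
  then obtain \<sigma> where \<sigma>: "\<sigma> \<in> level_irreps k n" "smooth_iso n `` {\<rho>} = smooth_iso n `` {\<sigma>}"
    unfolding level_classes_def quotient_def by blast
  then have "(\<sigma>, \<rho>) \<in> smooth_iso n" using smooth_iso_refl[OF \<rho>] by blast
  then show "\<rho> \<in> level_irreps k n" using level_irreps_iso[OF \<sigma>(1)] unfolding smooth_iso_def by blast
qed (auto simp: level_classes_def intro: quotientI)

lemma smooth_class_cases:
  assumes "C \<in> smooth_classes n"
  obtains \<rho> where "C = smooth_iso n `` {\<rho>}" "\<rho> \<in> smooth_irreps n"
  using assms unfolding smooth_classes_def by (rule quotientE)

lemma dim_level_0:
  assumes "\<rho> \<in> level_irreps 0 n"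
  shows "n = 1"
proof (rule fin_quot_group.irred_commuting_dim[OF quot_level])
  show irr: "fin_quot_group.irred G (Ker (2 * m + v + 0)) n \<rho>" using assms by (simp add: level_irreps_def)
  fix g h assume g: "g \<in> carrier G" and h: "h \<in> carrier G"
  have "comm g h \<in> Ker (m + m + v)" using g h by (intro comm_in_Ker) simp_all
  then have "comm g h \<in> Ker (2 * m + v + 0)" by (simp add: mult_2)
  then have "\<rho> (comm g h) = 1\<^sub>m n" using assms unfolding level_irreps_iff by blast
  then show "\<rho> g * \<rho> h = \<rho> h * \<rho> g"
    using rep_commute[OF fin_quot_group.irredD(1)[OF quot_level irr] quot_level] g h by simp
qed

lemma dim_level_Suc:
  assumes v: "v \<le> 1" and \<rho>: "\<rho> \<in> level_irreps (Suc k) n" "\<rho> \<notin> level_irreps k n"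
  shows "n = q ^ Suc k"
proof -
  let ?N = "2 * m + v + Suc k"
  have irr: "fin_quot_group.irred G (Ker ?N) n \<rho>" using \<rho>(1) by (simp add: level_irreps_def)
  obtain z0 where z0: "z0 \<in> Ker (?N - 1)" "\<rho> z0 \<noteq> 1\<^sub>m n" using \<rho> unfolding level_irreps_iff by auto
  have "n\<^sup>2 = q ^ (2 * Suc k)"
    using dim_upper_bound[OF irr v _ refl z0] dim_lower_bound[OF irr _ refl z0] by (intro antisym) simp_all
  then have "n\<^sup>2 = (q ^ Suc k)\<^sup>2" by (simp only: power_mult[symmetric] mult.commute)
  then show ?thesis by (simp only: power2_eq_iff_nonneg zero_le)
qed

text \<open>\<open>min\<close> makes \<open>k\<close> the first level of the class; it is void for
  \<open>k = 0\<close>, where the dimension is 1 since the image is abelian.\<close>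

lemma dim_level:
  assumes v: "v \<le> 1" and C: "(n, C) \<in> level_classes k" and min: "\<And>i. k = Suc i \<Longrightarrow> (n, C) \<notin> level_classes i"
  shows "n = q ^ k"
proof -
  obtain \<rho> where \<rho>: "C = smooth_iso n `` {\<rho>}" "\<rho> \<in> level_irreps k n"
    using C unfolding level_classes_def quotient_def by blast
  have s: "\<rho> \<in> smooth_irreps n" using \<rho>(2) unfolding smooth_irreps_def by blast
  show ?thesis
  proof (cases k)
    case 0
    then show ?thesis using dim_level_0 \<rho>(2) by simp
  next
    case (Suc i)
    then have "\<rho> \<notin> level_irreps i n" using min level_class_iff[OF s] unfolding \<rho>(1) by blast
    then show ?thesis using dim_level_Suc[OF v] \<rho>(2) unfolding Suc by blast
  qed
qed

lemma smooth_class_level_exists: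
  assumes C: "C \<in> smooth_classes n"
  shows "\<exists>k. (n, C) \<in> level_classes k \<and> (\<forall>i. k = Suc i \<longrightarrow> (n, C) \<notin> level_classes i)"
proof -
  obtain \<rho> where \<rho>: "C = smooth_iso n `` {\<rho>}" "\<rho> \<in> smooth_irreps n" by (rule smooth_class_cases[OF C])
  then have ex: "\<exists>k. (n, C) \<in> level_classes k" using level_class_iff[OF \<rho>(2)] unfolding smooth_irreps_def by blast
  define k where "k = (LEAST k. (n, C) \<in> level_classes k)"
  have "(n, C) \<in> level_classes k" unfolding k_def using ex by (rule LeastI_ex)
  moreover have "(n, C) \<notin> level_classes i" if "k = Suc i" for i
    using not_less_Least[of i "\<lambda>k. (n, C) \<in> level_classes k"] that unfolding k_def by simp
  ultimately show ?thesis by blast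
qed

lemma level_classes_smooth: "(n, C) \<in> level_classes k \<Longrightarrow> C \<in> smooth_classes n"
  unfolding level_classes_def smooth_classes_def smooth_irreps_def quotient_def by blast

lemma level_classes_mono: "i \<le> j \<Longrightarrow> level_classes i \<subseteq> level_classes j"
  unfolding level_classes_def quotient_def using level_irreps_mono by blast

lemma power_q_inj: "q ^ i = q ^ j \<longleftrightarrow> i = j"
  using q_ge_2 by (intro power_inject_exp) simp

text \<open>Powers of \<open>q\<close> are distinct, so the dimension reveals the first level; hence
  the classes new at a level are all the classes of the corresponding dimension.\<close>

lemma level_classes_new:
  assumes v: "v \<le> 1"
  shows "level_classes (Suc k) - level_classes k = {q ^ Suc k} \<times> smooth_classes (q ^ Suc k)"
proof (intro equalityI subsetI)
  fix x assume x: "x \<in> level_classes (Suc k) - level_classes k"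
  obtain n C where nC: "x = (n, C)" by (cases x)
  have "n = q ^ Suc k" using x unfolding nC by (intro dim_level[OF v, of _ C]) auto
  then show "x \<in> {q ^ Suc k} \<times> smooth_classes (q ^ Suc k)" using x level_classes_smooth unfolding nC by blast
next
  fix x assume "x \<in> {q ^ Suc k} \<times> smooth_classes (q ^ Suc k)"
  then obtain C where x: "x = (q ^ Suc k, C)" "C \<in> smooth_classes (q ^ Suc k)" by blast
  obtain i where i: "(q ^ Suc k, C) \<in> level_classes i" "\<And>j. i = Suc j \<Longrightarrow> (q ^ Suc k, C) \<notin> level_classes j"
    using smooth_class_level_exists[OF x(2)] by blast
  have "q ^ Suc k = q ^ i" by (rule dim_level[OF v i])
  then have "i = Suc k" unfolding power_q_inj by simp
  then show "x \<in> level_classes (Suc k) - level_classes k" using i x(1) by blast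
qed

lemma level_classes_0:
  assumes v: "v \<le> 1"
  shows "level_classes 0 = {1} \<times> smooth_classes 1"
proof (intro equalityI subsetI)
  fix x assume x: "x \<in> level_classes 0"
  obtain n C where nC: "x = (n, C)" by (cases x)
  have "n = q ^ 0" using x unfolding nC by (intro dim_level[OF v, of _ C]) auto
  then show "x \<in> {1} \<times> smooth_classes 1" using x level_classes_smooth unfolding nC by fastforce
next
  fix x assume "x \<in> {1 :: nat} \<times> smooth_classes 1"
  then obtain C where x: "x = (1, C)" "C \<in> smooth_classes 1" by blast
  obtain i where i: "(1, C) \<in> level_classes i" "\<And>j. i = Suc j \<Longrightarrow> (1, C) \<notin> level_classes j"
    using smooth_class_level_exists[OF x(2)] by blast
  have "1 = q ^ i" by (rule dim_level[OF v i])
  then have "q ^ 0 = q ^ i" by simp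
  then have "i = 0" unfolding power_q_inj by simp
  then show "x \<in> level_classes 0" using i x(1) by blast
qed

lemma smooth_classes_empty:
  assumes v: "v \<le> 1" and n: "n \<notin> range (\<lambda>k. q ^ k)"
  shows "smooth_classes n = {}"
proof (rule ccontr)
  assume "smooth_classes n \<noteq> {}"
  then obtain C where C: "C \<in> smooth_classes n" by blast
  obtain i where i: "(n, C) \<in> level_classes i" "\<And>j. i = Suc j \<Longrightarrow> (n, C) \<notin> level_classes j"
    using smooth_class_level_exists[OF C] by blast
  have "n = q ^ i" by (rule dim_level[OF v i])
  then show False using n by blast
qed

lemma finite_smooth_classes:
  assumes v: "v \<le> 1"
  shows "finite (smooth_classes n)"
proof (cases "n \<in> range (\<lambda>k. q ^ k)")
  case False
  then show ?thesis using smooth_classes_empty[OF v] by simp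
next
  case True
  then obtain k where n: "n = q ^ k" by blast
  have "finite ({n} \<times> smooth_classes n)"
  proof (cases k)
    case 0
    then show ?thesis using level_classes_0[OF v] finite_level_classes[of 0] unfolding n by simp
  next
    case (Suc i)
    have "finite (level_classes (Suc i) - level_classes i)" using finite_level_classes by blast
    then show ?thesis unfolding level_classes_new[OF v] n Suc .
  qed
  then show ?thesis by (auto simp: finite_cartesian_product_iff)
qed

lemma card_smooth_classes_1:
  assumes v: "v \<le> 1"
  shows "card (smooth_classes 1) = q ^ (3 * m + 2 * v)"
proof -
  have "(\<Sum>(n, C)\<in>level_classes 0. n\<^sup>2) = (\<Sum>C\<in>smooth_classes 1. 1)"
    unfolding level_classes_0[OF v] by (subst sum.cartesian_product[symmetric]) simp
  then show ?thesis unfolding level_classes_sum_squares by simp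
qed

text \<open>The difference of the sums of squares at consecutive levels, stated additively to stay
  in \<open>nat\<close>.\<close>

lemma card_smooth_classes_Suc:
  assumes v: "v \<le> 1"
  shows "card (smooth_classes (q ^ Suc k)) * q ^ (2 * Suc k) + q ^ (3 * m + 2 * v + 3 * k) = q ^ (3 * m + 2 * v + 3 * Suc k)"
proof -
  have "(\<Sum>(n, C)\<in>level_classes (Suc k). n\<^sup>2) =
      (\<Sum>(n, C)\<in>level_classes (Suc k) - level_classes k. n\<^sup>2) + (\<Sum>(n, C)\<in>level_classes k. n\<^sup>2)"
    by (rule sum.subset_diff[OF level_classes_mono finite_level_classes]) simp
  also have "(\<Sum>(n, C)\<in>level_classes (Suc k) - level_classes k. n\<^sup>2) = (\<Sum>C\<in>smooth_classes (q ^ Suc k). (q ^ Suc k)\<^sup>2)"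
    unfolding level_classes_new[OF v] by (subst sum.cartesian_product[symmetric]) simp
  also have "\<dots> = card (smooth_classes (q ^ Suc k)) * q ^ (2 * Suc k)"
    by (simp only: sum_constant power_mult[symmetric] mult.commute of_nat_id)
  finally show ?thesis unfolding level_classes_sum_squares by simp
qed

end

section \<open>Continuity\<close>

lemma powers_le_imp_zero:
  fixes c a :: real
  assumes "\<And>t. c \<le> (3/4) ^ t * a"
  shows "c \<le> 0"
proof -
  have "(\<lambda>t. (3/4 :: real) ^ t * a) \<longlonglongrightarrow> 0 * a" by (intro tendsto_mult LIMSEQ_realpow_zero tendsto_const) auto
  then show ?thesis using assms LIMSEQ_le_const[of "\<lambda>t. (3/4 :: real) ^ t * a" 0 c] by simp
qed

text \<open>No small subgroups: if \<open>\<rho> h = 1 + X\<close>, then \<open>\<rho> (h\<^sup>2) = 1 + 2 X + X\<^sup>2\<close>, so a bound \<open>a \<le> 1 / (2n)\<close> on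
  all entries of \<open>X\<close> improves to \<open>(a + n a\<^sup>2) / 2 \<le> 3 a / 4\<close>.\<close>

lemma near_one_trivial:
  fixes \<rho> :: "'g \<Rightarrow> complex mat"
  assumes c: "\<And>h. h \<in> H \<Longrightarrow> \<rho> h \<in> carrier_mat n n"
    and sq: "\<And>h. h \<in> H \<Longrightarrow> sq h \<in> H \<and> \<rho> (sq h) = \<rho> h * \<rho> h"
    and near: "\<And>h i j. h \<in> H \<Longrightarrow> i < n \<Longrightarrow> j < n \<Longrightarrow> cmod (\<rho> h $$ (i,j) - 1\<^sub>m n $$ (i,j)) \<le> 1 / (2 * real n)"
    and h: "h \<in> H"
  shows "\<rho> h = 1\<^sub>m n"
proof -
  let ?a = "1 / (2 * real n)"
  define X where "X h i j = \<rho> h $$ (i,j) - 1\<^sub>m n $$ (i,j)" for h i j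
  have bound: "cmod (X h i j) \<le> (3/4) ^ t * ?a" if "h \<in> H" "i < n" "j < n" for t h i j
    using that
  proof (induction t arbitrary: h i j)
    case 0
    then show ?case using near by (simp add: X_def)
  next
    case (Suc t)
    let ?b = "(3/4) ^ t * ?a"
    have b: "0 \<le> ?b" "real n * ?b \<le> 1/2" using \<open>i < n\<close> power_le_one[of "3/4 :: real" t] by (auto simp: field_simps)
    have "\<rho> (sq h) $$ (i,j) = (\<Sum>l<n. \<rho> h $$ (i,l) * \<rho> h $$ (l,j))"
      using sq[OF Suc.prems(1)] mat_mult_entry[OF c[OF Suc.prems(1)] c[OF Suc.prems(1)] Suc.prems(2,3)] by simp
    also have "\<dots> = (\<Sum>l<n. (X h i l + (if l = i then 1 else 0)) * (X h l j + (if l = j then 1 else 0)))"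
      using Suc.prems by (intro sum.cong) (auto simp: X_def)
    also have "\<dots> = (\<Sum>l<n. X h i l * X h l j + (if l = i then X h l j else 0) + (if l = j then X h i l else 0) +
        (if l = i then (if l = j then 1 else 0) else 0))"
      by (intro sum.cong) (auto simp: algebra_simps)
    also have "\<dots> = (\<Sum>l<n. X h i l * X h l j) + 2 * X h i j + 1\<^sub>m n $$ (i,j)"
      using Suc.prems by (simp add: sum.distrib)
    finally have "2 * X h i j = X (sq h) i j - (\<Sum>l<n. X h i l * X h l j)" by (simp add: X_def)
    then have "2 * cmod (X h i j) = cmod (X (sq h) i j - (\<Sum>l<n. X h i l * X h l j))"
      by (metis norm_mult norm_numeral)
    also have "\<dots> \<le> cmod (X (sq h) i j) + (\<Sum>l<n. cmod (X h i l * X h l j))"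
      by (rule order_trans[OF norm_triangle_ineq4 add_left_mono[OF norm_sum]])
    also have "\<dots> \<le> ?b + (\<Sum>l<n. ?b * ?b)"
      unfolding norm_mult using Suc sq[OF Suc.prems(1)] b(1) by (intro add_mono sum_mono mult_mono) auto
    also have "\<dots> = ?b + (real n * ?b) * ?b" by simp
    also have "\<dots> \<le> ?b + 1/2 * ?b" using b by (intro add_left_mono mult_right_mono)
    finally show ?case by simp
  qed
  have "\<rho> h $$ (i,j) = 1\<^sub>m n $$ (i,j)" if "i < n" "j < n" for i j
    using powers_le_imp_zero[OF bound[OF h that]] by (simp add: X_def)
  then show ?thesis using c[OF h] by (intro eq_matI) auto
qed

locale topological_sl2_congruence = sl2_congruence \<pi> q m v \<epsilon>
  for \<pi> :: "'o::{idom, topological_space}" and q m v \<epsilon> +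
  assumes open_iff: "\<And>U :: 'o set. open U \<longleftrightarrow> (\<forall>x\<in>U. \<exists>k. \<forall>y. \<pi> ^ k dvd y - x \<longrightarrow> y \<in> U)"
begin

lemma open_congruence_class: "open {y. \<pi> ^ k dvd y - x}"
  unfolding open_iff
proof (intro ballI exI[of _ k] allI impI)
  fix z y assume "z \<in> {y. \<pi> ^ k dvd y - x}" "\<pi> ^ k dvd y - z"
  then show "y \<in> {y. \<pi> ^ k dvd y - x}" using dvd_add[of "\<pi> ^ k" "y - z" "z - x"] by simp
qed

lemma open_matrix_congruence_class: "open {B :: 'o^2^2. \<forall>i j. \<pi> ^ k dvd B $ i $ j - A $ i $ j}"
proof -
  have "{B :: 'o^2^2. \<forall>i j. \<pi> ^ k dvd B $ i $ j - A $ i $ j} =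
      (\<Inter>i\<in>UNIV. \<Inter>j\<in>UNIV. (\<lambda>B. B $ i) -` ((\<lambda>r. r $ j) -` {y. \<pi> ^ k dvd y - A $ i $ j}))" by auto
  also have "open \<dots>" by (intro open_INT finite ballI open_vimage_vec_nth open_congruence_class)
  finally show ?thesis .
qed

lemma open_matrix_nhd:
  assumes "open U" "A \<in> U"
  shows "\<exists>k. \<forall>B :: 'o^2^2. (\<forall>i j. \<pi> ^ k dvd B $ i $ j - A $ i $ j) \<longrightarrow> B \<in> U"
proof -
  obtain V where V: "\<And>i. open (V i)" "\<And>i. A $ i \<in> V i" "\<And>B. (\<forall>i. B $ i \<in> V i) \<Longrightarrow> B \<in> U"
    using assms unfolding open_vec_def[of U] by meson
  have "\<exists>W. (\<forall>j. open (W j) \<and> A $ i $ j \<in> W j) \<and> (\<forall>r. (\<forall>j. r $ j \<in> W j) \<longrightarrow> r \<in> V i)" for i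
    using V(1,2)[of i] unfolding open_vec_def[of "V i"] by meson
  then obtain W where W: "\<And>i j. open (W i j)" "\<And>i j. A $ i $ j \<in> W i j" "\<And>i r. (\<forall>j. r $ j \<in> W i j) \<Longrightarrow> r \<in> V i" by metis
  have "\<forall>i j. \<exists>k. \<forall>y. \<pi> ^ k dvd y - A $ i $ j \<longrightarrow> y \<in> W i j" using W(1,2) unfolding open_iff by blast
  then obtain k where k: "\<And>i j y. \<pi> ^ k i j dvd y - A $ i $ j \<Longrightarrow> y \<in> W i j" by metis
  \<comment> \<open>Any common bound of the finitely many exponents serves; their sum is
    one.\<close>
  define K where "K = (\<Sum>i\<in>UNIV. \<Sum>j\<in>UNIV. k i j)"
  have "k i j \<le> (\<Sum>j\<in>UNIV. k i j)" "(\<Sum>j\<in>UNIV. k i j) \<le> K" for i j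
    unfolding K_def by (intro member_le_sum; simp)+
  then have kK: "k i j \<le> K" for i j using order_trans by blast
  show ?thesis
  proof (intro exI[of _ K] allI impI V(3) W(3))
    fix B i j assume "\<forall>i j. \<pi> ^ K dvd B $ i $ j - A $ i $ j"
    then show "B $ i $ j \<in> W i j" using pow_le_dvd[OF _ kK] by (intro k) blast
  qed
qed

text \<open>By the determinant condition an element of the group close to a scalar is close to the
  identity, so the groups \<open>Ker\<close> shrink into every congruence neighbourhood of
  it.\<close>

lemma Ker_sub_Lev: "Ker (2 * m + v + k) \<subseteq> Lev k"
proof
  fix A assume A: "A \<in> Ker (2 * m + v + k)"
  then have Am: "A \<in> Lev m" and d: "\<pi> ^ (2 * m + v + k) dvd A $ 1 $ 2" "\<pi> ^ (2 * m + v + k) dvd A $ 2 $ 1"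
    "\<pi> ^ (2 * m + v + k - v) dvd A $ 2 $ 2 - 1" using Ker_iff[of "2 * m + v + k" A] by simp_all
  have "\<pi> ^ (m + k) dvd A $ 1 $ 2" "\<pi> ^ (m + k) dvd A $ 2 $ 1" "\<pi> ^ (m + k) dvd A $ 2 $ 2 - 1"
    by (rule pow_le_dvd[OF d(1)] pow_le_dvd[OF d(2)] pow_le_dvd[OF d(3)]; simp)+
  then have "A \<in> Lev (m + k)" by (rule Lev_intro[OF Am])
  then show "A \<in> Lev k" using Lev_mono[of k "m + k"] by auto
qed

text \<open>Triviality on some \<open>Ker\<close> makes the representation constant on congruence
  classes, which are open.\<close>

lemma level_irreps_continuous:
  assumes \<rho>: "\<rho> \<in> level_irreps k n"
  shows "\<rho> \<in> irr_reps G n"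
proof -
  let ?N = "2 * m + v + k"
  have c: "\<And>g. g \<in> Lev m \<Longrightarrow> \<rho> g \<in> carrier_mat n n" and hom: "\<And>g h. g \<in> Lev m \<Longrightarrow> h \<in> Lev m \<Longrightarrow> \<rho> (g ** h) = \<rho> g * \<rho> h"
    and triv: "\<And>g. g \<in> Ker ?N \<Longrightarrow> \<rho> g = 1\<^sub>m n" and irr: "irreducible_rep G n \<rho>"
    using \<rho> unfolding level_irreps_iff by blast+
  have "Finite_Cartesian_Product.mat 1 \<in> Ker ?N" by (simp add: Ker_def Lev_one)
  then have one: "\<rho> (Finite_Cartesian_Product.mat 1) = 1\<^sub>m n" by (rule triv)
  have "\<rho> \<in> hom G (units_of (ring_mat TYPE(complex) n ()))"
  proof (rule homI)
    fix g assume g: "g \<in> carrier G"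
    then have "\<rho> g * \<rho> (adj22 g) = 1\<^sub>m n" "\<rho> (adj22 g) * \<rho> g = 1\<^sub>m n"
      using hom[of g "adj22 g"] hom[of "adj22 g" g] adj_mult[of g m] Lev_adj[of g m] one by simp_all
    then show "\<rho> g \<in> carrier (units_of (ring_mat TYPE(complex) n ()))"
      using c[of g] c[of "adj22 g"] g Lev_adj[of g m] unfolding units_of_carrier Units_def by (auto simp: ring_mat_simps)
  qed (simp add: units_of_mult ring_mat_simps hom)
  moreover have "continuous_on (carrier G) (\<lambda>g. \<rho> g $$ (i, j))" for i j
    unfolding continuous_on_topological
  proof (intro ballI allI impI)
    fix g0 B assume g0: "g0 \<in> carrier G" and B: "\<rho> g0 $$ (i, j) \<in> B"
    show "\<exists>A. open A \<and> g0 \<in> A \<and> (\<forall>y\<in>carrier G. y \<in> A \<longrightarrow> \<rho> y $$ (i, j) \<in> B)"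
    proof (intro exI[of _ "{B. \<forall>i j. \<pi> ^ ?N dvd B $ i $ j - g0 $ i $ j}"] conjI ballI impI)
      fix g assume g: "g \<in> carrier G" and cg: "g \<in> {B. \<forall>i j. \<pi> ^ ?N dvd B $ i $ j - g0 $ i $ j}"
      have gm: "g \<in> Lev m" "g0 \<in> Lev m" using g g0 by simp_all
      have K: "g ** adj22 g0 \<in> Ker ?N" using cg by (intro Ker_mem_of_scaled_cong[OF gm, of 1 ?N 1]) simp_all
      have "g = (g ** adj22 g0) ** g0" using adj_mult(2)[OF gm(2)] by (simp add: matrix_mul_assoc[symmetric])
      then have "\<rho> g = \<rho> (g ** adj22 g0) * \<rho> g0" using hom[OF KerD(1)[OF K] gm(2)] by simp
      then have "\<rho> g = \<rho> g0" unfolding triv[OF K] using c[OF gm(2)] by simp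
      then show "\<rho> g $$ (i, j) \<in> B" using B by simp
    qed (use open_matrix_congruence_class in auto)
  qed
  ultimately show ?thesis using irr unfolding irr_reps_def continuous_reps_def by blast
qed

text \<open>By continuity all entries are within \<open>1 / (2 * n)\<close> of the identity on some
  congruence subgroup. This subgroup is closed under squaring, so \<open>near_one_trivial\<close>
  makes the representation trivial on it.\<close>

lemma irr_reps_level:
  assumes \<rho>: "\<rho> \<in> irr_reps G n"
  shows "\<exists>k. \<rho> \<in> level_irreps k n"
proof -
  have h: "\<rho> \<in> hom G (units_of (ring_mat TYPE(complex) n ()))" and irr: "irreducible_rep G n \<rho>"
    and cont: "\<And>i j. i < n \<Longrightarrow> j < n \<Longrightarrow> continuous_on (Lev m) (\<lambda>g. \<rho> g $$ (i, j))"
    using \<rho> unfolding irr_reps_def continuous_reps_def by auto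
  have U: "\<rho> g \<in> Units (ring_mat TYPE(complex) n ())" if "g \<in> Lev m" for g
    using hom_in_carrier[OF h, of g] that by (simp add: units_of_carrier)
  have c: "\<rho> g \<in> carrier_mat n n" if "g \<in> Lev m" for g using U[OF that] by (auto simp: Units_def ring_mat_simps)
  have hom: "\<rho> (g ** h) = \<rho> g * \<rho> h" if "g \<in> Lev m" "h \<in> Lev m" for g h
    using hom_mult[OF h, of g h] that by (simp add: units_of_mult ring_mat_simps)
  let ?I = "Finite_Cartesian_Product.mat 1 :: 'o^2^2"
  have one: "\<rho> ?I = 1\<^sub>m n"
  proof -
    obtain x where x: "x \<in> carrier_mat n n" "x * \<rho> ?I = 1\<^sub>m n" using U[OF Lev_one] by (auto simp: Units_def ring_mat_simps)
    have "x * (\<rho> ?I * \<rho> ?I) = x * \<rho> ?I" using hom[OF Lev_one Lev_one] by simp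
    then have "(x * \<rho> ?I) * \<rho> ?I = x * \<rho> ?I" using assoc_mult_mat[OF x(1) c[OF Lev_one] c[OF Lev_one]] by simp
    then show ?thesis unfolding x(2) using c[OF Lev_one] by simp
  qed
  have n: "0 < n" using irr unfolding irreducible_rep_def by blast
  let ?a = "1 / (2 * real n)"
  have "\<exists>k. \<forall>g\<in>Lev m. (\<forall>a b. \<pi> ^ k dvd g $ a $ b - ?I $ a $ b) \<longrightarrow> cmod (\<rho> g $$ (i,j) - 1\<^sub>m n $$ (i,j)) \<le> ?a"
    if ij: "i < n" "j < n" for i j
  proof -
    have "\<rho> ?I $$ (i,j) \<in> ball (1\<^sub>m n $$ (i,j)) ?a" unfolding one using n by simp
    from cont[OF ij, unfolded continuous_on_topological, rule_format, OF Lev_one open_ball this]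
    obtain A where A: "open A" "?I \<in> A" "\<forall>g\<in>Lev m. g \<in> A \<longrightarrow> \<rho> g $$ (i,j) \<in> ball (1\<^sub>m n $$ (i,j)) ?a"
      by (elim exE conjE)
    obtain k where k: "\<forall>B. (\<forall>a b. \<pi> ^ k dvd B $ a $ b - ?I $ a $ b) \<longrightarrow> B \<in> A" using open_matrix_nhd[OF A(1,2)] by blast
    show ?thesis
    proof (intro exI[of _ k] ballI impI)
      fix g assume "g \<in> Lev m" "\<forall>a b. \<pi> ^ k dvd g $ a $ b - ?I $ a $ b"
      then have "\<rho> g $$ (i,j) \<in> ball (1\<^sub>m n $$ (i,j)) ?a" using A(3) k by blast
      then show "cmod (\<rho> g $$ (i,j) - 1\<^sub>m n $$ (i,j)) \<le> ?a" by (simp add: dist_norm norm_minus_commute)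
    qed
  qed
  then obtain k where k: "\<And>i j g. i < n \<Longrightarrow> j < n \<Longrightarrow> g \<in> Lev m \<Longrightarrow> (\<forall>a b. \<pi> ^ k i j dvd g $ a $ b - ?I $ a $ b) \<Longrightarrow>
      cmod (\<rho> g $$ (i,j) - 1\<^sub>m n $$ (i,j)) \<le> ?a" by metis
  define K where "K = (\<Sum>i<n. \<Sum>j<n. k i j)"
  have kK: "k i j \<le> K" if "i < n" "j < n" for i j
  proof -
    have "k i j \<le> (\<Sum>j<n. k i j)" using that by (intro member_le_sum) auto
    also have "\<dots> \<le> K" unfolding K_def using that(1) by (intro member_le_sum[of i _ "\<lambda>i. \<Sum>j<n. k i j"]) auto
    finally show ?thesis .
  qed
  have "\<rho> g = 1\<^sub>m n" if g: "g \<in> Lev m \<inter> Lev K" for g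
  proof (rule near_one_trivial[of "Lev m \<inter> Lev K" \<rho> n "\<lambda>h. h ** h"])
    show "\<rho> h \<in> carrier_mat n n" if "h \<in> Lev m \<inter> Lev K" for h using that c by simp
    show "h ** h \<in> Lev m \<inter> Lev K \<and> \<rho> (h ** h) = \<rho> h * \<rho> h" if "h \<in> Lev m \<inter> Lev K" for h
      using that hom Lev_mult by simp
    fix h i j assume h: "h \<in> Lev m \<inter> Lev K" and ij: "i < n" "j < n"
    then have "h \<in> Lev K" by simp
    note hd = LevD[OF this]
    have "\<forall>a b. \<pi> ^ K dvd h $ a $ b - ?I $ a $ b" unfolding forall_2 using hd by simp
    then have "\<forall>a b. \<pi> ^ k i j dvd h $ a $ b - ?I $ a $ b" using pow_le_dvd[OF _ kK[OF ij]] by blast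
    then show "cmod (\<rho> h $$ (i,j) - 1\<^sub>m n $$ (i,j)) \<le> ?a" using k[OF ij, of h] h by simp
  qed (rule g)
  then have "\<forall>g\<in>Ker (2 * m + v + K). \<rho> g = 1\<^sub>m n" using Ker_sub_Lev[of K] KerD(1) by blast
  then have "\<rho> \<in> level_irreps K n" unfolding level_irreps_iff using c hom irr by blast
  then show ?thesis ..
qed

lemma irr_classes_eq: "irr_classes G n = smooth_classes n"
proof -
  have "irr_reps G n = smooth_irreps n"
  proof (intro equalityI subsetI)
    fix \<rho> assume "\<rho> \<in> irr_reps G n"
    then obtain k where "\<rho> \<in> level_irreps k n" using irr_reps_level by metis
    then show "\<rho> \<in> smooth_irreps n" unfolding smooth_irreps_def by (rule UN_I[OF UNIV_I])
  next
    fix \<rho> assume "\<rho> \<in> smooth_irreps n"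
    then show "\<rho> \<in> irr_reps G n" unfolding smooth_irreps_def by (elim UN_E level_irreps_continuous)
  qed
  then show ?thesis unfolding irr_classes_def smooth_classes_def smooth_iso_def by simp
qed

end

section \<open>Permissible levels\<close>

lemma span_over_superset: "X \<subseteq> span_over R sc X"
  unfolding span_over_def by blast

lemma lie_product_mem: "a \<in> A \<Longrightarrow> b \<in> B \<Longrightarrow> br a b \<in> lie_product R sc br A B"
  unfolding lie_product_def by (rule subsetD[OF span_over_superset]) blast

lemma congruence_sublattice_mem: "a \<in> max_ideal_pow m \<Longrightarrow> x \<in> L \<Longrightarrow> sc a x \<in> congruence_sublattice sc m L"
  unfolding congruence_sublattice_def by (rule subsetD[OF span_over_superset]) blast

lemma congruence_sublattice_entries:
  fixes \<pi> :: "'o::idom" and L :: "('o^2^2) set"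
  assumes pow: "max_ideal_pow m = {x::'o. \<pi> ^ m dvd x}" and B: "B \<in> congruence_sublattice mat_scale m L"
  shows "\<pi> ^ m dvd B $ i $ j"
proof -
  let ?N = "{B :: 'o^2^2. \<forall>i j. \<pi> ^ m dvd B $ i $ j}"
  have "submodule_over UNIV mat_scale ?N" unfolding submodule_over_def by (auto simp: mat_scale_def intro: dvd_add)
  moreover have "{mat_scale a x |a x. a \<in> max_ideal_pow m \<and> x \<in> L} \<subseteq> ?N" unfolding pow by (auto simp: mat_scale_def)
  ultimately have "congruence_sublattice mat_scale m L \<subseteq> ?N" unfolding congruence_sublattice_def span_over_def by blast
  then show ?thesis using B by blast
qed

lemma sl2_mem: "mat22 a b c (- a) \<in> sl2"
  by (simp add: sl2_def trace_def sum_2)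

text \<open>For \<open>m = 0\<close> potency fails: bracketing the upper nilpotent generator
  \<open>p - 2\<close> times with the diagonal one multiplies it by a power of \<open>- 2\<close>, a
  unit, so the result is not divisible by \<open>p\<close>.\<close>

lemma permissible_pos:
  fixes \<pi>' :: "'o::{idom, ring_char_0, topological_space}"
  assumes "uniformized \<pi>' q'" and p: "residue_char TYPE('o) = p" "p > 2" "\<pi>' dvd of_nat p"
    and two: "2 dvd (1 :: 'o)" and perm: "permissible mat_scale mat_bracket (sl2 :: ('o^2^2) set) m"
  shows "0 < m"
proof (rule ccontr)
  interpret U: uniformized \<pi>' q' by fact
  assume "\<not> 0 < m"
  then have m: "m = 0" by simp
  let ?L = "congruence_sublattice mat_scale m (sl2 :: ('o^2^2) set)"
  have sl: "x \<in> ?L" if "x \<in> sl2" for x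
  proof -
    have "mat_scale 1 x \<in> ?L" using that unfolding m by (intro congruence_sublattice_mem) simp_all
    moreover have "mat_scale 1 x = x" by (simp add: mat22_eq_iff mat_scale_def)
    ultimately show ?thesis by simp
  qed
  have iter: "mat22 0 ((- 2) ^ k) 0 0 \<in> lie_product_iter UNIV mat_scale mat_bracket ?L ?L k" for k
  proof (induction k)
    case 0
    show ?case using sl[OF sl2_mem[of 0 1 0]] by (simp add: lie_product_iter_def)
  next
    case (Suc k)
    have "mat_bracket (mat22 0 ((- 2) ^ k) 0 0) (mat22 1 0 0 (- 1)) \<in>
        lie_product UNIV mat_scale mat_bracket (lie_product_iter UNIV mat_scale mat_bracket ?L ?L k) ?L"
      by (rule lie_product_mem[OF Suc sl[OF sl2_mem]])
    moreover have "mat_bracket (mat22 0 ((- 2) ^ k) 0 0) (mat22 1 0 0 (- 1)) = mat22 0 ((- 2) ^ Suc k) 0 (0 :: 'o)"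
      by (simp add: mat22_eq_iff mat_bracket_def)
    ultimately show ?case by (simp add: lie_product_iter_def)
  qed
  have "lower_central UNIV mat_scale mat_bracket ?L (p - 1) \<subseteq> mat_scale (of_nat p) ` ?L"
    using perm p unfolding permissible_def potent_def by (simp add: Let_def)
  then have "mat22 0 ((- 2) ^ (p - 1 - 1)) 0 0 \<in> mat_scale (of_nat p) ` ?L"
    using iter[of "p - 1 - 1"] unfolding lower_central_def by blast
  then obtain B :: "'o^2^2" where "mat22 0 ((- 2) ^ (p - 1 - 1)) 0 0 = mat_scale (of_nat p) B" by blast
  then have "mat22 0 ((- 2) ^ (p - 1 - 1)) 0 0 $ 1 $ 2 = mat_scale (of_nat p) B $ 1 $ 2" by simp
  then have "(- 2 :: 'o) ^ (p - 1 - 1) = of_nat p * B $ 1 $ 2" by (simp add: mat_scale_def)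
  then have "\<pi>' dvd (- 2 :: 'o) ^ (p - 1 - 1)" using p(3) by simp
  moreover have "(- 2 :: 'o) ^ k dvd 1" for k
    using two dvd_power_same[of "- 2 :: 'o" 1 k] by simp
  ultimately show False using U.pi_nonunit dvd_trans by blast
qed

text \<open>The bracket of \<open>\<pi>' ^ m\<close> times the two nilpotent generators has upper
  left entry \<open>\<pi>' ^ m * \<pi>' ^ m\<close>. Potency makes it 4 times a lattice element,
  whose entries are divisible by \<open>\<pi>' ^ m\<close>, and 4 is a multiple of
  \<open>\<pi>' ^ (2 * v)\<close>.\<close>

lemma permissible_dyadic:
  fixes \<pi>' \<epsilon> :: "'o::{idom, ring_char_0, topological_space}"
  assumes "uniformized \<pi>' q'"
    and pow: "\<And>k. max_ideal_pow k = {x::'o. \<pi>' ^ k dvd x}" and p: "residue_char TYPE('o) = 2"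
    and two: "2 = \<epsilon> * \<pi>' ^ v" and perm: "permissible mat_scale mat_bracket (sl2 :: ('o^2^2) set) m"
  shows "2 * v \<le> m"
proof -
  interpret U: uniformized \<pi>' q' by fact
  let ?L = "congruence_sublattice mat_scale m (sl2 :: ('o^2^2) set)"
  have sl: "mat_scale (\<pi>' ^ m) x \<in> ?L" if "x \<in> sl2" for x
    using that by (intro congruence_sublattice_mem) (simp_all add: pow)
  let ?e = "mat_scale (\<pi>' ^ m) (mat22 0 1 0 (- 0))" and ?f = "mat_scale (\<pi>' ^ m) (mat22 0 0 1 (- 0)) :: 'o^2^2"
  have "mat_bracket ?e ?f \<in> lie_product UNIV mat_scale mat_bracket ?L ?L"
    by (rule lie_product_mem[OF sl[OF sl2_mem] sl[OF sl2_mem]])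
  then have "mat_bracket ?e ?f \<in> lower_central UNIV mat_scale mat_bracket ?L 2"
    by (simp add: lower_central_def lie_product_iter_def)
  then have "mat_bracket ?e ?f \<in> mat_scale 4 ` ?L"
    using perm p unfolding permissible_def potent_def by (auto simp: Let_def)
  then obtain B where B: "B \<in> ?L" "mat_bracket ?e ?f = mat_scale 4 B" by blast
  then have "mat_bracket ?e ?f $ 1 $ 1 = mat_scale 4 B $ 1 $ 1" by simp
  then have e: "\<pi>' ^ m * \<pi>' ^ m = 4 * B $ 1 $ 1" by (simp add: mat_bracket_def mat_scale_def)
  have "\<pi>' ^ m dvd B $ 1 $ 1" by (rule congruence_sublattice_entries[OF pow B(1)])
  then obtain c where c: "B $ 1 $ 1 = \<pi>' ^ m * c" by (rule dvdE)
  have "(4 :: 'o) = 2 * 2" by simp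
  also have "\<dots> = (\<epsilon> * \<pi>' ^ v) * (\<epsilon> * \<pi>' ^ v)" by (simp only: two[symmetric])
  also have "\<dots> = (\<pi>' ^ v * \<pi>' ^ v) * (\<epsilon> * \<epsilon>)" by (simp only: mult_ac)
  also have "\<pi>' ^ v * \<pi>' ^ v = \<pi>' ^ (2 * v)" by (simp only: mult_2 power_add)
  finally have four: "(4 :: 'o) = \<pi>' ^ (2 * v) * (\<epsilon> * \<epsilon>)" .
  have "\<pi>' ^ m * \<pi>' ^ m = \<pi>' ^ m * (\<pi>' ^ (2 * v) * (\<epsilon> * \<epsilon> * c))"
    unfolding e c four by (simp add: mult_ac)
  then have "\<pi>' ^ m = \<pi>' ^ (2 * v) * (\<epsilon> * \<epsilon> * c)" by (rule iffD1[OF mult_left_cancel[OF U.pi_pow_nz]])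
  then have "\<pi>' ^ (2 * v) dvd \<pi>' ^ m" by simp
  then show ?thesis unfolding U.pi_pow_dvd_iff .
qed

section \<open>The Dirichlet series\<close>

text \<open>The recursion gives \<open>r (q ^ k) = c * (1 - 1 / q ^ 3) * q ^ k\<close> for
  \<open>k > 0\<close>, so apart from the first term the series is geometric in \<open>x\<close>.
  Convergence is characterized exactly because the closed form has to hold wherever the series
  converges.\<close>

lemma dirichlet_series_geometric:
  fixes r :: "nat \<Rightarrow> nat" and q c :: nat and s :: complex
  assumes q: "2 \<le> q" and c: "0 < c" and r1: "r 1 = c" and rS: "\<And>k. r (q ^ Suc k) * q ^ (2 * Suc k) + c * q ^ (3 * k) = c * q ^ (3 * Suc k)"
    and r0: "\<And>n. n \<notin> range (\<lambda>k. q ^ k) \<Longrightarrow> r n = 0"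
  defines "f \<equiv> \<lambda>k. of_nat (r (Suc k)) * of_nat (Suc k) powr (- s)" and "x \<equiv> of_nat q powr (1 - s)"
  shows "summable f \<longleftrightarrow> norm x < 1" "summable f \<Longrightarrow> suminf f = of_nat c * ((1 - x / of_nat q ^ 3) / (1 - x))"
    "x = of_nat q * of_nat q powr (- s)" "norm x < 1 \<longleftrightarrow> 1 < Re s"
proof -
  have qc: "(of_nat q :: complex) \<noteq> 0" and q1: "1 < q" using q by auto
  show x: "x = of_nat q * of_nat q powr (- s)"
    unfolding x_def using powr_add[of "of_nat q" 1 "- s"] qc by simp
  have "norm x = real q powr (1 - Re s)"
    unfolding x_def using q by (subst norm_powr_real_powr) auto
  also have "\<dots> < 1 \<longleftrightarrow> 1 < Re s" using q powr_less_cancel_iff[of "real q" "1 - Re s" 0] by simp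
  finally show "norm x < 1 \<longleftrightarrow> 1 < Re s" .
  \<comment> \<open>Term number \<open>k\<close> belongs to dimension \<open>k + 1\<close>, whence
    the subtraction of 1.\<close>
  define g where "g k = q ^ k - 1" for k
  have Sg: "Suc (g k) = q ^ k" for k using q by (simp add: g_def)
  have mono: "strict_mono g"
  proof (rule strict_monoI)
    fix i j :: nat assume "i < j"
    then have "q ^ i < q ^ j" using q1 by (rule power_strict_increasing)
    then show "g i < g j" using Sg[of i] Sg[of j] by simp
  qed
  have out: "f k = 0" if "k \<notin> range g" for k
  proof -
    have "Suc k \<notin> range (\<lambda>k. q ^ k)"
    proof
      assume "Suc k \<in> range (\<lambda>k. q ^ k)"
      then obtain j where "Suc k = q ^ j" by blast
      then have "k = g j" by (simp add: g_def flip: One_nat_def)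
      then show False using that by blast
    qed
    then show ?thesis using r0 by (simp add: f_def)
  qed
  have pw: "of_nat (q ^ k) powr (- s) = (of_nat q powr (- s)) ^ k" for k
    by (induction k) (simp_all add: powr_times_real)
  \<comment> \<open>\<open>b\<close> is the coefficient of the positive powers of \<open>x\<close>;
    the term of dimension 1 has the coefficient \<open>c\<close> instead and is split off.\<close>
  define b where "b = of_nat c * (1 - 1 / of_nat q ^ 3 :: complex)"
  have f0: "f (g 0) = of_nat c" unfolding f_def Sg using r1 by simp
  have fS: "f (g (Suc k)) = b * x * x ^ k" for k
  proof -
    have "of_nat (r (q ^ Suc k) * q ^ (2 * Suc k) + c * q ^ (3 * k)) = (of_nat (c * q ^ (3 * Suc k)) :: complex)"
      unfolding rS ..
    then have e: "of_nat (r (q ^ Suc k)) * of_nat q ^ (2 * Suc k) = (of_nat c * of_nat q ^ (3 * Suc k) - of_nat c * of_nat q ^ (3 * k) :: complex)"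
      by (simp add: algebra_simps)
    have "of_nat c * of_nat q ^ (3 * Suc k) - of_nat c * of_nat q ^ (3 * k) = b * of_nat q ^ Suc k * (of_nat q ^ (2 * Suc k) :: complex)"
    proof -
      have "3 * Suc k = Suc k + 2 * Suc k" by simp
      then have 1: "(of_nat q :: complex) ^ (3 * Suc k) = of_nat q ^ Suc k * of_nat q ^ (2 * Suc k)"
        by (simp only: power_add)
      have "3 * Suc k = 3 + 3 * k" by simp
      then have 2: "(of_nat q :: complex) ^ (3 * k) = 1 / of_nat q ^ 3 * of_nat q ^ (3 * Suc k)"
        using qc by (simp only: power_add) simp
      have "C * (A * B) - C * (z * (A * B)) = C * (1 - z) * A * B" for C z A B :: complex
        by (simp add: algebra_simps)
      then show ?thesis unfolding 2 1 b_def .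
    qed
    with e have "of_nat (r (q ^ Suc k)) = b * (of_nat q :: complex) ^ Suc k" using qc by simp
    then have "f (g (Suc k)) = b * of_nat q ^ Suc k * (of_nat q powr (- s)) ^ Suc k"
      unfolding f_def Sg pw by simp
    also have "\<dots> = b * x ^ Suc k" unfolding x power_mult_distrib by simp
    finally show ?thesis by simp
  qed
  have bnz: "b \<noteq> 0"
  proof
    assume "b = 0"
    then have "(of_nat q :: complex) ^ 3 = 1" using c qc by (simp add: b_def)
    then have "of_nat (q ^ 3) = (of_nat 1 :: complex)" by simp
    then have "q ^ 3 = 1" by (simp only: of_nat_eq_iff)
    then show False using q1 by simp
  qed
  have xnz: "x \<noteq> 0" unfolding x using qc by simp
  have "summable f \<longleftrightarrow> summable (\<lambda>k. f (g k))" by (rule summable_mono_reindex[OF mono out, symmetric])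
  also have "\<dots> \<longleftrightarrow> summable (\<lambda>k. f (g (Suc k)))" by (rule summable_Suc_iff[symmetric])
  also have "\<dots> \<longleftrightarrow> norm x < 1" unfolding fS using bnz xnz by (simp add: summable_cmult_iff summable_geometric_iff)
  finally show sum: "summable f \<longleftrightarrow> norm x < 1" .
  assume "summable f"
  then have nx: "norm x < 1" using sum by simp
  then have "(\<lambda>k. f (g (Suc k))) sums (b * x * (1 / (1 - x)))" unfolding fS by (intro sums_mult geometric_sums)
  then have "(\<lambda>k. f (g k)) sums (b * x * (1 / (1 - x)) + f (g 0))" by (rule iffD1[OF sums_Suc_iff])
  moreover have "(\<lambda>n. f (g n)) sums S \<longleftrightarrow> f sums S" for S by (rule sums_mono_reindex[OF mono]) (rule out)
  ultimately have "f sums (b * x * (1 / (1 - x)) + f (g 0))" by blast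
  then have "f sums (b * x * (1 / (1 - x)) + of_nat c)" unfolding f0 .
  moreover have "b * x * (1 / (1 - x)) + of_nat c = of_nat c * ((1 - x / of_nat q ^ 3) / (1 - x))"
  proof -
    have "1 - x \<noteq> 0" using nx by auto
    then show ?thesis using qc unfolding b_def by (simp add: divide_simps) (simp add: algebra_simps)
  qed
  ultimately show "suminf f = of_nat c * ((1 - x / of_nat q ^ 3) / (1 - x))" by (simp add: sums_iff)
qed

lemma nat_powr_shift:
  assumes "0 < q"
  shows "(of_nat q :: complex) powr (a - of_nat k) = of_nat q powr a / of_nat q ^ k"
proof (induction k)
  case (Suc k)
  have "(of_nat q :: complex) powr (a - of_nat (Suc k)) = of_nat q powr ((a - of_nat k) - 1)" by (simp add: algebra_simps)
  also have "\<dots> = of_nat q powr (a - of_nat k) / of_nat q" using assms by (subst powr_diff) simp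
  finally show ?case unfolding Suc using assms by (simp add: field_simps)
qed simp

context topological_sl2_congruence
begin

lemma G_eq_SL2_congruence:
  assumes "max_ideal_pow m = {x. \<pi> ^ m dvd x}"
  shows "G = SL2_congruence m"
proof -
  have "Lev m = {A. Determinants.det A = 1 \<and> (\<forall>i j. A $ i $ j - Finite_Cartesian_Product.mat 1 $ i $ j \<in> max_ideal_pow m)}"
    unfolding Lev_def assms det_2 forall_2 by (auto simp: diff_diff_eq)
  then show ?thesis unfolding G_def SL2_congruence_def by simp
qed

lemma has_rep_zeta_G:
  assumes v: "v \<le> 1"
  shows "has_rep_zeta G (\<lambda>s. of_nat (q ^ (3 * m + 2 * v)) * ((1 - of_nat q powr (1 - s) / of_nat q ^ 3) / (1 - of_nat q powr (1 - s))))"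
proof -
  let ?c = "q ^ (3 * m + 2 * v)"
  have terms: "rep_zeta_term G s = (\<lambda>k. of_nat (card (smooth_classes (Suc k))) * of_nat (Suc k) powr (- s))" for s
    unfolding rep_zeta_term_def rep_count_def irr_classes_eq ..
  have c: "0 < ?c" using q_ge_2 by simp
  have S: "card (smooth_classes (q ^ Suc k)) * q ^ (2 * Suc k) + ?c * q ^ (3 * k) = ?c * q ^ (3 * Suc k)" for k
    using card_smooth_classes_Suc[OF v, of k] unfolding power_add[of q "3 * m + 2 * v"] .
  have e: "card (smooth_classes n) = 0" if "n \<notin> range (\<lambda>k. q ^ k)" for n
    using smooth_classes_empty[OF v that] by simp
  note series = dirichlet_series_geometric[where r = "\<lambda>n. card (smooth_classes n)",
      OF q_ge_2 c card_smooth_classes_1[OF v] S e, folded terms]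
  have sum: "summable (rep_zeta_term G s)" if "Re s > 1" for s using series(1,4)[of s] that by blast
  show ?thesis
    unfolding has_rep_zeta_def irr_classes_eq rep_zeta_def
    using finite_smooth_classes[OF v] series(2) sum by blast
qed

end

theorem theorem1p2:
  fixes m p q :: nat
  assumes dvr: "compact_dvr TYPE('o::{idom, ring_char_0, topological_space})"
    and q: "q = residue_card TYPE('o)"
    and p: "p = residue_char TYPE('o)"
    and m: "permissible mat_scale mat_bracket (sl2 :: ('o^2^2) set) m"
  shows "(p > 2 \<longrightarrow>
            has_rep_zeta (SL2_congruence m :: ('o^2^2) monoid)
              (\<lambda>s. of_nat q ^ (3 * m) * ((1 - of_nat q powr (- 2 - s)) / (1 - of_nat q powr (1 - s))))) \<and>
         (p = 2 \<and> abs_ramification_index TYPE('o) = 1 \<longrightarrow>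
            has_rep_zeta (SL2_congruence m :: ('o^2^2) monoid)
              (\<lambda>s. of_nat q ^ (3 * m) * ((of_nat q ^ 2 - of_nat q powr (- s)) / (1 - of_nat q powr (1 - s)))))"
proof (rule compact_dvr_uniformized[OF dvr])
  fix \<pi> :: 'o
  assume unif: "uniformized \<pi> (residue_card TYPE('o))" and pow: "\<And>k. max_ideal_pow k = {x::'o. \<pi> ^ k dvd x}"
    and \<pi>p: "\<pi> dvd of_nat (residue_char TYPE('o))"
    and least: "\<And>k. 0 < k \<Longrightarrow> \<pi> dvd of_nat k \<Longrightarrow> residue_char TYPE('o) \<le> k"
    and ram: "\<And>e. residue_char TYPE('o) = 2 \<Longrightarrow> abs_ramification_index TYPE('o) = e \<Longrightarrow> \<exists>u. u dvd 1 \<and> 2 = u * \<pi> ^ e"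
  interpret U: uniformized \<pi> q using unif unfolding q .
  have open_iff: "open U \<longleftrightarrow> (\<forall>x\<in>U. \<exists>k. \<forall>y. \<pi> ^ k dvd y - x \<longrightarrow> y \<in> U)" for U :: "'o set"
    using dvr unfolding compact_dvr_def pow by simp
  have q0: "0 < q" using U.q_ge_2 by simp
  \<comment> \<open>Both powers in the claim are \<open>of_nat q powr (1 - s)\<close>, the ratio of
    the geometric series, divided by a power of \<open>q\<close>.\<close>
  have shift: "of_nat q powr (- 2 - s) = of_nat q powr (1 - s) / of_nat q ^ 3"
    "of_nat q powr (- s) = of_nat q powr (1 - s) / of_nat q" for s :: complex
  proof -
    have e: "- 2 - s = (1 - s) - of_nat 3" "- s = (1 - s) - of_nat 1" by simp_all
    show "of_nat q powr (- 2 - s) = of_nat q powr (1 - s) / of_nat q ^ 3" unfolding e(1) by (rule nat_powr_shift[OF q0])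
    show "of_nat q powr (- s) = of_nat q powr (1 - s) / of_nat q" unfolding e(2) nat_powr_shift[OF q0] by simp
  qed
  have zeta: "has_rep_zeta (SL2_congruence m :: ('o^2^2) monoid)
      (\<lambda>s. of_nat (q ^ (3 * m + 2 * v)) * ((1 - of_nat q powr (1 - s) / of_nat q ^ 3) / (1 - of_nat q powr (1 - s))))"
    if "2 = \<epsilon> * \<pi> ^ v" "\<epsilon> dvd 1" "v < m" "v \<le> 1" for v \<epsilon>
  proof -
    interpret T: topological_sl2_congruence \<pi> q m v \<epsilon> by unfold_locales (use that open_iff in auto)
    show ?thesis using T.has_rep_zeta_G[OF that(4)] unfolding T.G_eq_SL2_congruence[OF pow] .
  qed
  show ?thesis
  proof (intro conjI impI)
    assume p2: "p > 2"
    \<comment> \<open>\<open>p\<close> is the least positive integer divisible by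
      \<open>\<pi>\<close>, so 2 is a unit: the case \<open>v = 0\<close> with
      \<open>\<epsilon> = 2\<close>.\<close>
    have "\<not> \<pi> dvd 2" using least[of 2] p2 p by auto
    then have two: "2 dvd (1 :: 'o)" by (rule U.local)
    have "0 < m" by (rule permissible_pos[OF U.uniformized_axioms p[symmetric] p2 _ two m]) (use \<pi>p p in simp)
    from zeta[OF _ two this] show "has_rep_zeta (SL2_congruence m :: ('o^2^2) monoid)
        (\<lambda>s. of_nat q ^ (3 * m) * ((1 - of_nat q powr (- 2 - s)) / (1 - of_nat q powr (1 - s))))"
      by (simp add: shift)
  next
    assume p2: "p = 2 \<and> abs_ramification_index TYPE('o) = 1"
    then obtain \<epsilon> where \<epsilon>: "\<epsilon> dvd 1" "2 = \<epsilon> * \<pi> ^ 1" using ram[of 1] p by auto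
    \<comment> \<open>With \<open>v = 1\<close>, potency modulo 4 gives \<open>m \<ge> 2\<close>,
      which is the required \<open>v < m\<close>.\<close>
    have "2 * 1 \<le> m" by (rule permissible_dyadic[OF U.uniformized_axioms pow _ \<epsilon>(2) m]) (use p2 p in simp)
    then have "1 < m" by simp
    \<comment> \<open>The extra factor \<open>q ^ 2\<close>, from \<open>2 * v\<close> in the
      exponent, is absorbed into the numerator.\<close>
    have eq: "of_nat (q ^ (3 * m + 2 * 1)) * ((1 - of_nat q powr (1 - s) / of_nat q ^ 3) / (1 - of_nat q powr (1 - s))) =
       of_nat q ^ (3 * m) * ((of_nat q ^ 2 - of_nat q powr (- s)) / (1 - of_nat q powr (1 - s)))" for s :: complex
      unfolding shift using q0 by (simp add: power_add power2_eq_square power3_eq_cube) (simp add: field_simps)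
    show "has_rep_zeta (SL2_congruence m :: ('o^2^2) monoid)
        (\<lambda>s. of_nat q ^ (3 * m) * ((of_nat q ^ 2 - of_nat q powr (- s)) / (1 - of_nat q powr (1 - s))))"
      using zeta[OF \<epsilon>(2,1) \<open>1 < m\<close> order_refl] unfolding eq .
  qed
qed

end
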